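(* Let $F$ be a random variable in $\mathbb{R}^N$ with $\mathbb{E}(F)=0$, identity covariance matrix, and law $\mu_F$ such that $\mu_F\succeq\mathrm{Leb}_N$. Let $r\ge2$ be an integer and $F\in L^{r+1}(\Omega)$. For $n\ge1$ let $\mu_n$ denote the law of $S_n=\frac1{\sqrt n}\sum_{k=1}^nF_k$, where $F_k$, $k\geq 1$, are independent copies of $F$, and let $$\Gamma_{n,r}(dx)=\gamma(x)\Bigl(1+\sum_{m=1}^{[r/3]}\frac1{n^{m/2}}\mathcal{K}_m(x)\Bigr)dx,$$ where $\gamma$ is the standard normal density on $\mathbb{R}^N$ and $$\mathcal{K}_m(x)=\sum_{\substack{3\vee m\le t\le 3m\\ t-m\ \mathrm{even}}}\ \sum_{i=1\vee\frac{t-m}2}^{[t/3]}a_{i,\frac{t-m}2}\,\mathcal{H}^i_t(x),\qquad \mathcal{H}^i_t(x)=\sum_{|\alpha|=t}c^i_\alpha H_\alpha(x),$$ with the coefficients $a_{i,p}$, $c^i_\alpha$ and the Hermite polynomials $H_\alpha$ defined in the context. Then there exists a constant $C>0$, depending on $r$ and $N$ only, such that for every $n\ge1$ $$d_{TV}(\mu_n,\Gamma_{n,r})\le C\bigl(1+\mathbb{E}(|F|^{r+1})\bigr)^{[r/3]\vee1}\Bigl[\sup_{|\alpha|\le r}|\Delta_\alpha|\times\frac1{n^{\frac{[r/3]+1}2}}+\frac1{n^{\frac{r-1}2}}\Bigr].$$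
   Context: $\mu_F\succeq\mathrm{Leb}_N$ means $\mu_F(A)\ge\varepsilon_0\mathrm{Leb}_N(A\cap D_0)$ for all Borel $A$, for some $\varepsilon_0>0$ and some non-empty open $D_0\subset\mathbb{R}^N$, $\mathrm{Leb}_N$ being the Lebesgue measure. $[\cdot]$ is the integer part, $a\vee b=\max(a,b)$, and $d_{TV}(\mu,\nu)=\sup\{|\int f\,d\mu-\int f\,d\nu|: f\text{ measurable},\|f\|_\infty\le1\}$ for (possibly signed) measures. Multiindices are finite tuples $\alpha=(\alpha_1,\dots,\alpha_q)\in\{1,\dots,N\}^q$, $|\alpha|=q$ (the empty one, $|\alpha|=0$, is allowed), and $x^\alpha=\prod_jx^{\alpha_j}$. $G$ is standard normal in $\mathbb{R}^N$. Set $\Delta_\alpha=\mathbb{E}(F^\alpha)-\mathbb{E}(G^\alpha)$ (so $\Delta_\emptyset=0$); $\theta_\alpha=1$ if $|\alpha|$ is even and $\alpha_{2j-1}=\alpha_{2j}$ for all $j=1,\dots,|\alpha|/2$, and $\theta_\alpha=0$ otherwise ($\theta_\emptyset=1$). Coefficients $c^i_\gamma$: with sums over all ways of writing $\gamma$ as a concatenation $(\alpha,\beta)$ of two (possibly empty) multiindices, $$c^1_\gamma=\sum_{(\alpha,\beta)=\gamma}\frac{(-1)^{|\beta|/2}}{2^{|\beta|/2}|\alpha|!(|\beta|/2)!}\Delta_\alpha\theta_\beta,\qquad c^{i+1}_\gamma=\sum_{(\alpha,\beta)=\gamma}c^1_\alpha c^i_\beta,\quad i\ge1$$ (terms with $|\beta|$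 odd in $c^1_\gamma$ are zero). Coefficients $a_{i,p}$: let $B_0=1,B_1=\frac12,B_2=\frac16,B_3=0,B_4=-\frac1{30},\dots$ be the (second) Bernoulli numbers, $\mathcal{S}_l(L)=\sum_{k=1}^Lk^l$, and for $l\ge0$, $0\le q\le l+1$, $$b_{l,q}=\frac1{l+1}\sum_{p=q\vee1}^{l+1}\binom{l+1}{p}B_{l+1-p}\binom pq(-1)^{p-q}.$$ Then $a_{1,0}=0$, $a_{1,1}=1$ and for $i\ge1$: $a_{i+1,0}=\sum_{l=0}^ia_{i,l}b_{l,0}-\sum_{l=0}^ia_{i,l}\mathcal{S}_l(i-1)$ and $a_{i+1,p}=\sum_{l=p-1}^ia_{i,l}b_{l,p}$ for $p=1,\dots,i+1$. Hermite polynomials: $H_m(x)=(-1)^me^{x^2/2}\frac{d^m}{dx^m}e^{-x^2/2}$ on $\mathbb{R}$, and $H_\alpha(x)=\prod_{i=1}^NH_{\beta_i(\alpha)}(x_i)$ with $\beta_i(\alpha)=\mathrm{card}\{j:\alpha_j=i\}$ on $\mathbb{R}^N$.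
   Formalization: C depends on r, N and also on ε₀, D₀ from μ_F ⪰ Leb_N: with r and N only the claim fails for (1-ε)(δ₋₁+δ₁)/2+εN(0,1), ε→0. C is also chosen after the underlying set of Ω, which is harmless since the bound depends only on the law of F, realizable on sequence space. *)

theory Defs
  imports "HOL-Probability.Probability"
begin

section \<open>Total variation distance of (possibly signed) measures\<close>

text \<open>
  A signed measure enters only through the functional \<open>f \<mapsto> \<integral> f d\<mu>\<close> on bounded Borel functions, and is
  represented by it: a finite measure \<open>\<mu>\<close> by \<open>integral\<^sup>L \<mu>\<close>, a signed measure \<open>g dx\<close> with integrable
  density by \<open>\<lambda>f. \<integral>x. f x * g x \<partial>lborel\<close>.  The supremum is taken in \<^typ>\<open>ereal\<close>, so that it is
  meaningful without a boundedness side condition.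
\<close>

definition tv_dist ::
  "(('a::topological_space \<Rightarrow> real) \<Rightarrow> real) \<Rightarrow> (('a \<Rightarrow> real) \<Rightarrow> real) \<Rightarrow> ereal" where
  "tv_dist I J =
     (SUP f \<in> {f \<in> borel_measurable borel. \<forall>x. \<bar>f x\<bar> \<le> 1}. ereal \<bar>I f - J f\<bar>)"

section \<open>Hypotheses on the law\<close>

text \<open>
  The relation \<open>\<mu> \<succeq> Leb\<close> says that \<open>minorized_by_Leb \<epsilon>\<^sub>0 D\<^sub>0 \<mu>\<close> holds for some \<open>\<epsilon>\<^sub>0 > 0\<close> and some
  non-empty open \<open>D\<^sub>0\<close>.  The pair is kept as a parameter because constants in limit theorems for
  such laws cannot be uniform in it: the law \<open>(1 - \<epsilon>) (\<delta>\<^bsub>-1\<^esub> + \<delta>\<^bsub>1\<^esub>)/2 + \<epsilon> N(0,1)\<close> is centered with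
  unit variance and bounded moments, but its \<open>n\<close>-fold convolution has an atomic part of mass
  \<open>(1 - \<epsilon>)^n\<close>.
\<close>

definition minorized_by_Leb ::
  "real \<Rightarrow> 'a::euclidean_space set \<Rightarrow> 'a measure \<Rightarrow> bool" where
  "minorized_by_Leb \<epsilon>\<^sub>0 D\<^sub>0 \<mu> \<longleftrightarrow>
     (\<forall>A \<in> sets borel. emeasure \<mu> A \<ge> ennreal \<epsilon>\<^sub>0 * emeasure lborel (A \<inter> D\<^sub>0))"

definition covariance_matrix :: "'w measure \<Rightarrow> ('w \<Rightarrow> real^'n) \<Rightarrow> real^'n^'n" where
  "covariance_matrix M F =
     (\<chi> i j. \<integral>\<omega>. (F \<omega> $ i - (\<integral>\<omega>. F \<omega> $ i \<partial>M)) * (F \<omega> $ j - (\<integral>\<omega>. F \<omega> $ j \<partial>M)) \<partial>M)"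

section \<open>Multiindices and moments\<close>

text \<open>A multiindex is a list over the finite index type \<open>'n\<close> of \<open>real^'n\<close>.\<close>

definition mpower :: "real^'n \<Rightarrow> 'n list \<Rightarrow> real" where
  "mpower x \<alpha> = prod_list (map (\<lambda>i. x $ i) \<alpha>)"

definition gauss_density :: "real^'n \<Rightarrow> real" where
  "gauss_density x = 1 / sqrt (2 * pi) ^ CARD('n) * exp (- (norm x)\<^sup>2 / 2)"

definition std_gaussian :: "(real^'n) measure" where
  "std_gaussian = density lborel (\<lambda>x. ennreal (gauss_density x))"

definition moment_gap :: "'w measure \<Rightarrow> ('w \<Rightarrow> real^'n) \<Rightarrow> 'n list \<Rightarrow> real" where
  "moment_gap M F \<alpha> = (\<integral>\<omega>. mpower (F \<omega>) \<alpha> \<partial>M) - (\<integral>x. mpower x \<alpha> \<partial>std_gaussian)"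

text \<open>List positions are counted from 0, hence the shift in \<open>\<alpha>\<^bsub>2j-1\<^esub> = \<alpha>\<^bsub>2j\<^esub>\<close>.\<close>

definition paired :: "'n list \<Rightarrow> real" where
  "paired \<alpha> =
     (if even (length \<alpha>) \<and> (\<forall>j < length \<alpha> div 2. \<alpha> ! (2 * j) = \<alpha> ! (2 * j + 1)) then 1 else 0)"

section \<open>The coefficients \<open>c\<^sup>i\<^sub>\<gamma>\<close>\<close>

text \<open>
  The decompositions of \<open>\<gamma>\<close> into a concatenation of two multiindices are the pairs
  \<open>(take k \<gamma>, drop k \<gamma>)\<close> with \<open>k \<le> length \<gamma>\<close>; terms with \<open>length \<beta>\<close> odd vanish as \<open>paired \<beta> = 0\<close>.
\<close>

definition c1_coeff :: "('n list \<Rightarrow> real) \<Rightarrow> 'n list \<Rightarrow> real" where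
  "c1_coeff \<Delta> \<gamma> =
     (\<Sum>k \<le> length \<gamma>. let \<alpha> = take k \<gamma>; \<beta> = drop k \<gamma> in
        (-1) ^ (length \<beta> div 2)
          / (2 ^ (length \<beta> div 2) * fact (length \<alpha>) * fact (length \<beta> div 2))
        * \<Delta> \<alpha> * paired \<beta>)"

text \<open>Only indices \<open>i \<ge> 1\<close> are meaningful.\<close>

fun c_coeff :: "('n list \<Rightarrow> real) \<Rightarrow> nat \<Rightarrow> 'n list \<Rightarrow> real" where
  "c_coeff \<Delta> 0 \<gamma> = 0"
| "c_coeff \<Delta> (Suc 0) \<gamma> = c1_coeff \<Delta> \<gamma>"
| "c_coeff \<Delta> (Suc (Suc i)) \<gamma> =
     (\<Sum>k \<le> length \<gamma>. c1_coeff \<Delta> (take k \<gamma>) * c_coeff \<Delta> (Suc i) (drop k \<gamma>))"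

section \<open>The coefficients \<open>a\<^bsub>i,p\<^esub>\<close>\<close>

text \<open>
  Second Bernoulli numbers (\<open>B\<^sub>1 = 1/2\<close>), by the recursion equivalent to
  \<open>(\<Sum>k\<le>n. (n+1 choose k) * B\<^sub>k) = n + 1\<close>.
\<close>

fun bernoulli2 :: "nat \<Rightarrow> real" where
  "bernoulli2 n = 1 - (\<Sum>k \<in> {..<n}. real (n choose k) * bernoulli2 k / real (n - k + 1))"

declare bernoulli2.simps [simp del]

lemma bernoulli2_values:
  "bernoulli2 0 = 1" "bernoulli2 1 = 1/2" "bernoulli2 2 = 1/6"
  "bernoulli2 3 = 0" "bernoulli2 4 = -1/30"
proof -
  show 0: "bernoulli2 0 = 1"
    by (subst bernoulli2.simps) simp
  show 1: "bernoulli2 1 = 1/2"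
    using 0 by (subst bernoulli2.simps) simp
  show 2: "bernoulli2 2 = 1/6"
    using 0 1 by (subst bernoulli2.simps) (simp add: numeral_eq_Suc)
  show 3: "bernoulli2 3 = 0"
    using 0 1 2 by (subst bernoulli2.simps) (simp add: numeral_eq_Suc)
  show "bernoulli2 4 = -1/30"
    using 0 1 2 3 by (subst bernoulli2.simps) (simp add: numeral_eq_Suc)
qed

definition power_sum :: "nat \<Rightarrow> nat \<Rightarrow> real" where
  "power_sum l L = (\<Sum>k = 1..L. real k ^ l)"

definition b_coeff :: "nat \<Rightarrow> nat \<Rightarrow> real" where
  "b_coeff l q =
     1 / real (l + 1) * (\<Sum>p = max q 1..l + 1.
        real ((l + 1) choose p) * bernoulli2 (l + 1 - p) * real (p choose q) * (-1) ^ (p - q))"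

text \<open>Only \<open>i \<ge> 1\<close> and \<open>p \<le> i\<close> are meaningful.\<close>

fun a_coeff :: "nat \<Rightarrow> nat \<Rightarrow> real" where
  "a_coeff 0 p = 0"
| "a_coeff (Suc 0) p = (if p = 1 then 1 else 0)"
| "a_coeff (Suc (Suc i)) p =
     (if p = 0
      then (\<Sum>l = 0..Suc i. a_coeff (Suc i) l * b_coeff l 0)
           - (\<Sum>l = 0..Suc i. a_coeff (Suc i) l * power_sum l i)
      else (\<Sum>l = p - 1..Suc i. a_coeff (Suc i) l * b_coeff l p))"

section \<open>Hermite polynomials and the expansion\<close>

definition hermite :: "nat \<Rightarrow> real \<Rightarrow> real" where
  "hermite m x = (-1) ^ m * exp (x\<^sup>2 / 2) * (deriv ^^ m) (\<lambda>y. exp (- y\<^sup>2 / 2)) x"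

definition mhermite :: "'n::finite list \<Rightarrow> real^'n \<Rightarrow> real" where
  "mhermite \<alpha> x = (\<Prod>i \<in> UNIV. hermite (count_list \<alpha> i) (x $ i))"

definition hermite_sum :: "('n::finite list \<Rightarrow> real) \<Rightarrow> nat \<Rightarrow> nat \<Rightarrow> real^'n \<Rightarrow> real" where
  "hermite_sum \<Delta> i t x = (\<Sum>\<alpha> \<in> {\<alpha>. length \<alpha> = t}. c_coeff \<Delta> i \<alpha> * mhermite \<alpha> x)"

definition edgeworth_poly :: "('n::finite list \<Rightarrow> real) \<Rightarrow> nat \<Rightarrow> real^'n \<Rightarrow> real" where
  "edgeworth_poly \<Delta> m x =
     (\<Sum>t \<in> {t. max 3 m \<le> t \<and> t \<le> 3 * m \<and> even (t - m)}.
        \<Sum>i = max 1 ((t - m) div 2)..t div 3. a_coeff i ((t - m) div 2) * hermite_sum \<Delta> i t x)"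

definition edgeworth_density :: "('n::finite list \<Rightarrow> real) \<Rightarrow> nat \<Rightarrow> nat \<Rightarrow> real^'n \<Rightarrow> real" where
  "edgeworth_density \<Delta> n r x =
     gauss_density x
       * (1 + (\<Sum>m = 1..r div 3. 1 / real n powr (real m / 2) * edgeworth_poly \<Delta> m x))"

definition normalized_sum :: "(nat \<Rightarrow> 'w \<Rightarrow> real^'n) \<Rightarrow> nat \<Rightarrow> 'w \<Rightarrow> real^'n" where
  "normalized_sum X n \<omega> = (1 / sqrt (real n)) *\<^sub>R (\<Sum>k = 1..n. X k \<omega>)"

end

theory Submission
  imports Defs
begin

text \<open>
  Let \<open>P\<close> and \<open>G\<close> be the averaging operators of the laws of \<open>F / sqrt n\<close> and of a Gaussian vector with
  covariance \<open>1/n\<close>.  Moment expansion of \<open>P\<close> and inversion of the heat semigroup \<open>G\<close> give, up to terms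
  of order \<open>n^(-(r+1)/2)\<close>, the identity \<open>P = G (1 + C)\<close> with \<open>C = (\<Sum>\<gamma>. n^(-|\<gamma>|/2) c\<^sup>1\<^sub>\<gamma> \<partial>\<^sup>\<gamma>)\<close>.
  Hence \<open>P^n\<close> should be close to \<open>(\<Sum>i\<le>[r/3]. (n choose i) C^i) G^n\<close>.  Derivatives of \<open>G^n f\<close> are Hermite
  moments, and \<open>(n choose i) = (\<Sum>p. a\<^bsub>i,p\<^esub> n^p)\<close> turns this operator into \<open>\<Gamma>\<^bsub>n,r\<^esub>\<close> up to terms of higher
  order.  The error is controlled by replacing the factors \<open>P\<close> one at a time, which costs derivatives of
  the test function.  These are created from a merely bounded \<open>f\<close>: the law of \<open>F\<close> dominates \<open>p \<nu>\<close>
  for an explicit \<open>C\<^sup>1\<close> density \<open>\<nu>\<close>, so a block of \<open>b\<close> factors \<open>P\<close> is a smoothing operator at scale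
  \<open>sqrt (b / n)\<close> plus an operator of norm \<open>(1 - p)^b\<close>; one block per derivative suffices, and once half
  of the factors are Gaussian, \<open>G^n\<close> smooths instead.  All this works when
  \<open>E(|F|^(r+1)) \<le> n^((r-1)/2)\<close>, which makes \<open>C\<close> of size \<open>1/n\<close>; otherwise the claimed bound exceeds the
  trivial one.
\<close>

section \<open>Convolution operators on bounded Borel functions\<close>

text \<open>The two error terms have different sources. Replacing one factor leaves a Taylor
  remainder of order n^(-(r+1)/2), and there are n replacements. Cutting the binomial series at
  degree q = [r/3] leaves terms of size n^(q+1) C^(q+1); moments up to order 2 match, so every word
  in C has length at least 3 and carries a moment gap, which makes them of order n^(-(q+1)/2) with q
  + 1 gaps. One gap survives in the estimate, the other q are paid by powers of 1 + E|F|^(r+1). The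
  obstacle is that the derivatives of a bounded f must come from smoothing by the very factors that
  are to be replaced. Since all operators commute, at most half of the factors can be held back as
  smoothing blocks while the others become Gaussian; the blocks are then turned back into factors P,
  up to an exponentially small error, and replaced as well. The smooth minorant is fixed by the
  minorization alone, so all constants are chosen before the law.\<close>

definition bounded_borel :: "real \<Rightarrow> ('a::euclidean_space \<Rightarrow> real) \<Rightarrow> bool" where
  "bounded_borel c f \<longleftrightarrow> f \<in> borel_measurable borel \<and> (\<forall>x. \<bar>f x\<bar> \<le> c)"

abbreviation bdd_borel :: "('a::euclidean_space \<Rightarrow> real) \<Rightarrow> bool" where
  "bdd_borel f \<equiv> \<exists>c. bounded_borel c f"

text \<open>The scale \<open>\<sigma>\<close> is separate from the measure, so that the law, its
  weights and their integrals stay fixed while the scale \<open>1 / sqrt n\<close> varies.\<close>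

definition avg :: "real \<Rightarrow> 'a measure \<Rightarrow> ('a \<Rightarrow> real) \<Rightarrow> ('a::euclidean_space \<Rightarrow> real) \<Rightarrow> 'a \<Rightarrow> real" where
  "avg \<sigma> \<mu> w f x = (\<integral>y. w y * f (x + \<sigma> *\<^sub>R y) \<partial>\<mu>)"

text \<open>
  A class of pairwise commuting, translation invariant operators.  The weight \<open>w\<close> makes room for the
  derivatives of smoothing averages, where \<open>w\<close> is a score function or a Hermite polynomial.
\<close>
inductive conv_op :: "(('a::euclidean_space \<Rightarrow> real) \<Rightarrow> 'a \<Rightarrow> real) \<Rightarrow> bool" where
  avg: "finite_measure \<mu> \<Longrightarrow> sets \<mu> = sets borel \<Longrightarrow> integrable \<mu> w \<Longrightarrow> conv_op (avg \<sigma> \<mu> w)"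
| ident: "conv_op (\<lambda>f. f)"
| comp: "conv_op S \<Longrightarrow> conv_op T \<Longrightarrow> conv_op (\<lambda>f. S (T f))"
| lin: "conv_op S \<Longrightarrow> conv_op T \<Longrightarrow> conv_op (\<lambda>f x. a * S f x + b * T f x)"

definition op_bound :: "real \<Rightarrow> (('a::euclidean_space \<Rightarrow> real) \<Rightarrow> 'a \<Rightarrow> real) \<Rightarrow> bool" where
  "op_bound c T \<longleftrightarrow> (\<forall>b f. bounded_borel b f \<longrightarrow> bounded_borel (c * b) (T f))"

lemma bounded_borel_lin:
  assumes "bounded_borel b f" "bounded_borel c g"
  shows "bounded_borel (\<bar>s\<bar> * b + \<bar>t\<bar> * c) (\<lambda>x. s * f x + t * g x)"
proof -
  have "\<bar>s * f x + t * g x\<bar> \<le> \<bar>s\<bar> * b + \<bar>t\<bar> * c" for x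
  proof -
    have "\<bar>s * f x\<bar> \<le> \<bar>s\<bar> * b" "\<bar>t * g x\<bar> \<le> \<bar>t\<bar> * c"
      using assms by (auto simp: bounded_borel_def abs_mult intro!: mult_left_mono)
    then show ?thesis by linarith
  qed
  then show ?thesis using assms by (auto simp: bounded_borel_def)
qed

lemma bounded_borel_mono: "bounded_borel b f \<Longrightarrow> b \<le> c \<Longrightarrow> bounded_borel c f"
  by (auto simp: bounded_borel_def intro: order_trans)

lemma bounded_borel_nonneg: "bounded_borel b f \<Longrightarrow> 0 \<le> b"
  unfolding bounded_borel_def by (meson abs_ge_zero order_trans)

lemma bounded_borel_sum:
  assumes "finite I" "\<And>i. i \<in> I \<Longrightarrow> bounded_borel (b i) (f i)"
  shows "bounded_borel (\<Sum>i\<in>I. \<bar>a i\<bar> * b i) (\<lambda>x. \<Sum>i\<in>I. a i * f i x)"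
  using assms
proof (induction I rule: finite_induct)
  case empty
  then show ?case by (simp add: bounded_borel_def)
next
  case (insert i I)
  then have "bounded_borel (\<bar>a i\<bar> * b i + \<bar>1\<bar> * (\<Sum>i\<in>I. \<bar>a i\<bar> * b i))
      (\<lambda>x. a i * f i x + 1 * (\<Sum>i\<in>I. a i * f i x))"
    by (intro bounded_borel_lin) auto
  then show ?case using insert by simp
qed

lemma bdd_borel_shift: "bounded_borel c f \<Longrightarrow> bounded_borel c (\<lambda>x. f (x + h))"
  by (auto simp: bounded_borel_def)

lemma avg_integrable:
  assumes "sets \<mu> = sets borel" "integrable \<mu> w" "bounded_borel c f"
  shows "integrable \<mu> (\<lambda>y. w y * f (x + \<sigma> *\<^sub>R y))"
proof (rule Bochner_Integration.integrable_bound)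
  show "integrable \<mu> (\<lambda>y. c * w y)" using assms by simp
  have [measurable]: "f \<in> borel_measurable borel" "w \<in> borel_measurable \<mu>"
    using assms by (auto simp: bounded_borel_def)
  have [measurable_cong]: "sets \<mu> = sets borel" by fact
  show "(\<lambda>y. w y * f (x + \<sigma> *\<^sub>R y)) \<in> borel_measurable \<mu>" by measurable
  have "\<bar>f (x + \<sigma> *\<^sub>R y)\<bar> * \<bar>w y\<bar> \<le> c * \<bar>w y\<bar>" for y
    using assms(3) by (intro mult_right_mono) (auto simp: bounded_borel_def)
  then have "\<bar>w y * f (x + \<sigma> *\<^sub>R y)\<bar> \<le> \<bar>c * w y\<bar>" for y
    using bounded_borel_nonneg[OF assms(3)] by (simp add: abs_mult mult.commute)
  then show "AE y in \<mu>. norm (w y * f (x + \<sigma> *\<^sub>R y)) \<le> norm (c * w y)" by simp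
qed

lemma avg_bounded:
  assumes "finite_measure \<mu>" "sets \<mu> = sets borel" "integrable \<mu> w" "bounded_borel c f"
  shows "bounded_borel ((\<integral>y. \<bar>w y\<bar> \<partial>\<mu>) * c) (avg \<sigma> \<mu> w f)"
proof -
  interpret finite_measure \<mu> by fact
  have [measurable]: "f \<in> borel_measurable borel" "w \<in> borel_measurable \<mu>"
    using assms by (auto simp: bounded_borel_def)
  have [measurable_cong]: "sets \<mu> = sets borel" by fact
  have "\<bar>avg \<sigma> \<mu> w f x\<bar> \<le> (\<integral>y. \<bar>w y\<bar> \<partial>\<mu>) * c" for x
  proof -
    have "\<bar>avg \<sigma> \<mu> w f x\<bar> \<le> (\<integral>y. \<bar>w y * f (x + \<sigma> *\<^sub>R y)\<bar> \<partial>\<mu>)"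
      unfolding avg_def by simp
    also have "\<dots> \<le> (\<integral>y. \<bar>w y\<bar> * c \<partial>\<mu>)"
    proof (rule integral_mono)
      show "integrable \<mu> (\<lambda>y. \<bar>w y * f (x + \<sigma> *\<^sub>R y)\<bar>)"
        by (intro integrable_abs avg_integrable[OF assms(2-4)])
      show "integrable \<mu> (\<lambda>y. \<bar>w y\<bar> * c)" using assms by simp
      show "\<bar>w y * f (x + \<sigma> *\<^sub>R y)\<bar> \<le> \<bar>w y\<bar> * c" for y
        using assms(4) unfolding abs_mult bounded_borel_def by (intro mult_left_mono) auto
    qed
    finally show ?thesis by simp
  qed
  moreover have "avg \<sigma> \<mu> w f \<in> borel_measurable borel"
    unfolding avg_def[abs_def] by measurable
  ultimately show ?thesis by (simp add: bounded_borel_def)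
qed

lemma op_bound_avg:
  assumes "finite_measure \<mu>" "sets \<mu> = sets borel" "integrable \<mu> w"
  shows "op_bound (\<integral>y. \<bar>w y\<bar> \<partial>\<mu>) (avg \<sigma> \<mu> w)"
  using avg_bounded[OF assms] by (simp add: op_bound_def)

lemma op_bound_ident: "op_bound 1 (\<lambda>f. f)"
  by (simp add: op_bound_def)

lemma op_bound_comp: "op_bound c S \<Longrightarrow> op_bound d T \<Longrightarrow> op_bound (c * d) (\<lambda>f. S (T f))"
  by (simp add: op_bound_def mult.assoc)

lemma op_bound_lin:
  fixes S T :: "('a::euclidean_space \<Rightarrow> real) \<Rightarrow> 'a \<Rightarrow> real"
  assumes "op_bound c S" "op_bound d T"
  shows "op_bound (\<bar>a\<bar> * c + \<bar>b\<bar> * d) (\<lambda>f x. a * S f x + b * T f x)"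
  unfolding op_bound_def
proof (intro allI impI)
  fix e and f :: "'a \<Rightarrow> real" assume "bounded_borel e f"
  then have "bounded_borel (\<bar>a\<bar> * (c * e) + \<bar>b\<bar> * (d * e)) (\<lambda>x. a * S f x + b * T f x)"
    using assms by (intro bounded_borel_lin) (auto simp: op_bound_def)
  then show "bounded_borel ((\<bar>a\<bar> * c + \<bar>b\<bar> * d) * e) (\<lambda>x. a * S f x + b * T f x)"
    by (simp add: algebra_simps)
qed

lemma conv_op_bound: "conv_op T \<Longrightarrow> \<exists>c. op_bound c T"
proof (induction rule: conv_op.induct)
  case (avg \<mu> w \<sigma>)
  then show ?case using op_bound_avg by blast
qed (use op_bound_ident op_bound_comp op_bound_lin in blast)+

lemma conv_op_bdd: "conv_op T \<Longrightarrow> bdd_borel f \<Longrightarrow> bdd_borel (T f)"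
  using conv_op_bound unfolding op_bound_def by blast

text \<open>Additivity rests on integrability, which bounded Borel arguments guarantee; on arbitrary
  functions the value 0 assigned to divergent integrals would break it.\<close>

lemma conv_op_lin:
  fixes f g :: "'a::euclidean_space \<Rightarrow> real"
  assumes "conv_op T" "bdd_borel f" "bdd_borel g"
  shows "T (\<lambda>x. a * f x + b * g x) = (\<lambda>x. a * T f x + b * T g x)"
  using assms
proof (induction arbitrary: f g a b rule: conv_op.induct)
  case (avg \<mu> w \<sigma>)
  then obtain c d where cd: "bounded_borel c f" "bounded_borel d g" by blast
  show ?case
  proof
    fix x
    have "avg \<sigma> \<mu> w (\<lambda>x. a * f x + b * g x) x
        = (\<integral>y. a * (w y * f (x + \<sigma> *\<^sub>R y)) + b * (w y * g (x + \<sigma> *\<^sub>R y)) \<partial>\<mu>)"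
      unfolding avg_def by (intro Bochner_Integration.integral_cong) (auto simp: algebra_simps)
    also have "\<dots> = a * avg \<sigma> \<mu> w f x + b * avg \<sigma> \<mu> w g x"
      unfolding avg_def using avg_integrable[OF avg(2,3) cd(1)] avg_integrable[OF avg(2,3) cd(2)]
      by simp
    finally show "avg \<sigma> \<mu> w (\<lambda>x. a * f x + b * g x) x = a * avg \<sigma> \<mu> w f x + b * avg \<sigma> \<mu> w g x" .
  qed
next
  case (comp S T)
  then have "bdd_borel (T f)" "bdd_borel (T g)" using conv_op_bdd by blast+
  then show ?case by (simp only: comp.IH(2)[OF comp.prems] comp.IH(1))
next
  case (lin S T s t)
  show ?case
    by (simp only: lin.IH(1)[OF lin.prems] lin.IH(2)[OF lin.prems]) (simp add: algebra_simps)
qed simp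

lemma conv_op_scale:
  assumes "conv_op T" "bdd_borel f"
  shows "T (\<lambda>x. a * f x) = (\<lambda>x. a * T f x)"
  using conv_op_lin[OF assms assms(2), of a 0] by simp

lemma conv_op_diff:
  assumes "conv_op T" "bdd_borel f" "bdd_borel g"
  shows "T (\<lambda>x. f x - g x) = (\<lambda>x. T f x - T g x)"
  using conv_op_lin[OF assms, of 1 "-1"] by simp

lemma conv_op_sum_arg:
  assumes "conv_op T" "finite I" "\<And>i. i \<in> I \<Longrightarrow> bdd_borel (f i)"
  shows "T (\<lambda>x. \<Sum>i\<in>I. a i * f i x) = (\<lambda>x. \<Sum>i\<in>I. a i * T (f i) x)"
  using assms(2,3)
proof (induction I rule: finite_induct)
  case empty
  have "T (\<lambda>x. 0 * 0) = (\<lambda>x. 0 * T (\<lambda>x. 0) x)"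
    by (rule conv_op_scale[OF assms(1)]) (auto simp: bounded_borel_def intro!: exI[of _ 0])
  then show ?case by simp
next
  case (insert i I)
  have "bdd_borel (\<lambda>x. \<Sum>i\<in>I. a i * f i x)"
  proof -
    obtain b where "\<And>i. i \<in> I \<Longrightarrow> bounded_borel (b i) (f i)"
      using insert.prems by (metis insertCI)
    then show ?thesis using bounded_borel_sum insert.hyps by blast
  qed
  then show ?case
    using insert conv_op_lin[OF assms(1), of "f i" "\<lambda>x. \<Sum>i\<in>I. a i * f i x" "a i" 1]
    by simp
qed

lemma conv_op_sum:
  assumes "finite I" "\<And>i. i \<in> I \<Longrightarrow> conv_op (T i)"
  shows "conv_op (\<lambda>f x. \<Sum>i\<in>I. a i * T i f x)"
  using assms
proof (induction I rule: finite_induct)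
  case empty
  then show ?case using conv_op.lin[OF conv_op.ident conv_op.ident, of 0 0] by simp
next
  case (insert i I)
  then show ?case
    using conv_op.lin[of "T i" "\<lambda>f x. \<Sum>i\<in>I. a i * T i f x" "a i" 1] by simp
qed

lemma conv_op_funpow: "conv_op T \<Longrightarrow> conv_op (T ^^ k)"
proof (induction k)
  case 0
  then show ?case using conv_op.ident by (simp add: id_def)
next
  case (Suc k)
  then show ?case using conv_op.comp[of T "T ^^ k"] by (simp add: comp_def)
qed

lemma op_bound_funpow: "op_bound c T \<Longrightarrow> op_bound (c ^ k) (T ^^ k)"
proof (induction k)
  case 0
  then show ?case by (simp add: op_bound_def)
next
  case (Suc k)
  then show ?case using op_bound_comp[of c T "c ^ k" "T ^^ k"] by (simp add: comp_def)
qed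

lemma op_bound_sum:
  fixes T :: "'i \<Rightarrow> ('a::euclidean_space \<Rightarrow> real) \<Rightarrow> 'a \<Rightarrow> real"
  assumes "finite I" "\<And>i. i \<in> I \<Longrightarrow> op_bound (c i) (T i)"
  shows "op_bound (\<Sum>i\<in>I. \<bar>a i\<bar> * c i) (\<lambda>f x. \<Sum>i\<in>I. a i * T i f x)"
  unfolding op_bound_def
proof (intro allI impI)
  fix e and f :: "'a \<Rightarrow> real" assume "bounded_borel e f"
  then have "bounded_borel (\<Sum>i\<in>I. \<bar>a i\<bar> * (c i * e)) (\<lambda>x. \<Sum>i\<in>I. a i * T i f x)"
    using assms by (intro bounded_borel_sum) (auto simp: op_bound_def)
  then show "bounded_borel ((\<Sum>i\<in>I. \<bar>a i\<bar> * c i) * e) (\<lambda>x. \<Sum>i\<in>I. a i * T i f x)"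
    by (simp add: sum_distrib_right mult.assoc)
qed

lemma op_bound_mono:
  fixes T :: "('a::euclidean_space \<Rightarrow> real) \<Rightarrow> 'a \<Rightarrow> real"
  assumes "op_bound c T" "c \<le> d"
  shows "op_bound d T"
  unfolding op_bound_def
proof (intro allI impI)
  fix e and f :: "'a \<Rightarrow> real" assume f: "bounded_borel e f"
  then show "bounded_borel (d * e) (T f)"
    using bounded_borel_mono[of "c * e" "T f" "d * e"] assms
      mult_right_mono[OF assms(2) bounded_borel_nonneg[OF f]]
    by (simp add: op_bound_def)
qed

section \<open>Translation invariance and commutation\<close>

lemma conv_op_translate: "conv_op T \<Longrightarrow> T (\<lambda>x. f (x + h)) = (\<lambda>x. T f (x + h))"
proof (induction arbitrary: f rule: conv_op.induct)
  case (avg \<mu> w \<sigma>)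
  then show ?case by (simp add: avg_def fun_eq_iff ac_simps)
next
  case (comp S T)
  show ?case by (rule trans[OF arg_cong[where f = S, OF comp.IH(2)] comp.IH(1)])
next
  case (lin S T a b)
  show ?case by (subst lin.IH(1), subst lin.IH(2)) (rule refl)
qed simp

lemma integrable_product_mult:
  fixes u v :: "'a::euclidean_space \<Rightarrow> real"
  assumes "finite_measure \<mu>" "finite_measure \<nu>" "integrable \<mu> u" "integrable \<nu> v"
  shows "integrable (\<mu> \<Otimes>\<^sub>M \<nu>) (\<lambda>(y, z). u y * v z)"
proof -
  interpret M: finite_measure \<mu> by fact
  interpret N: finite_measure \<nu> by fact
  interpret pair_sigma_finite \<mu> \<nu> ..
  have [measurable]: "u \<in> borel_measurable \<mu>" "v \<in> borel_measurable \<nu>" using assms by auto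
  show ?thesis
    by (rule Fubini_integrable) (use assms in \<open>auto simp: abs_mult\<close>)
qed

text \<open>Fubini: the double integrand is dominated by \<open>c * \<bar>w y * v z\<bar>\<close>,
  which is integrable over the product of the two finite measures.\<close>

lemma avg_commute:
  assumes "finite_measure \<mu>" "sets \<mu> = sets borel" "integrable \<mu> w"
    and "finite_measure \<nu>" "sets \<nu> = sets borel" "integrable \<nu> v"
    and "bounded_borel c f"
  shows "avg \<sigma> \<mu> w (avg \<tau> \<nu> v f) = avg \<tau> \<nu> v (avg \<sigma> \<mu> w f)"
proof
  fix x
  interpret M: finite_measure \<mu> by fact
  interpret N: finite_measure \<nu> by fact
  interpret pair_sigma_finite \<mu> \<nu> ..
  have [measurable_cong]: "sets \<mu> = sets borel" "sets \<nu> = sets borel" by fact+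
  have [measurable]: "w \<in> borel_measurable \<mu>" "v \<in> borel_measurable \<nu>" "f \<in> borel_measurable borel"
    using assms by (auto simp: bounded_borel_def)
  let ?g = "\<lambda>(y, z). w y * v z * f (x + \<sigma> *\<^sub>R y + \<tau> *\<^sub>R z)"
  have "integrable (\<mu> \<Otimes>\<^sub>M \<nu>) ?g"
  proof (rule Bochner_Integration.integrable_bound)
    show "integrable (\<mu> \<Otimes>\<^sub>M \<nu>) (\<lambda>p. c * (case p of (y, z) \<Rightarrow> w y * v z))"
      using integrable_product_mult[OF assms(1,4,3,6)] by simp
    show "?g \<in> borel_measurable (\<mu> \<Otimes>\<^sub>M \<nu>)" by measurable
    have "\<bar>w y * v z * f u\<bar> \<le> \<bar>c * (w y * v z)\<bar>" for y z u
      using assms(7) bounded_borel_nonneg[OF assms(7)]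
      by (auto simp: bounded_borel_def abs_mult mult.commute intro!: mult_right_mono mult_left_mono)
    then show "AE p in \<mu> \<Otimes>\<^sub>M \<nu>. norm (?g p) \<le> norm (c * (case p of (y, z) \<Rightarrow> w y * v z))"
      by (auto split: prod.split)
  qed
  then have "(\<integral>z. (\<integral>y. w y * v z * f (x + \<sigma> *\<^sub>R y + \<tau> *\<^sub>R z) \<partial>\<mu>) \<partial>\<nu>)
      = (\<integral>y. (\<integral>z. w y * v z * f (x + \<sigma> *\<^sub>R y + \<tau> *\<^sub>R z) \<partial>\<nu>) \<partial>\<mu>)"
    by (rule Fubini_integral)
  moreover have "avg \<sigma> \<mu> w (avg \<tau> \<nu> v f) x
      = (\<integral>y. (\<integral>z. w y * v z * f (x + \<sigma> *\<^sub>R y + \<tau> *\<^sub>R z) \<partial>\<nu>) \<partial>\<mu>)"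
    unfolding avg_def by (simp only: mult.assoc Bochner_Integration.integral_mult_right_zero)
  moreover have "avg \<tau> \<nu> v (avg \<sigma> \<mu> w f) x
      = (\<integral>z. (\<integral>y. v z * (w y * f (x + \<tau> *\<^sub>R z + \<sigma> *\<^sub>R y)) \<partial>\<mu>) \<partial>\<nu>)"
    unfolding avg_def by (simp only: Bochner_Integration.integral_mult_right_zero)
  moreover have "v z * (w y * f (x + \<tau> *\<^sub>R z + \<sigma> *\<^sub>R y))
      = w y * v z * f (x + \<sigma> *\<^sub>R y + \<tau> *\<^sub>R z)" for y z
    by (simp add: add.assoc add.commute[of "\<tau> *\<^sub>R z"] mult.left_commute)
  ultimately show "avg \<sigma> \<mu> w (avg \<tau> \<nu> v f) x = avg \<tau> \<nu> v (avg \<sigma> \<mu> w f) x"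
    by simp
qed

text \<open>Only a pair of averages requires Fubini; the other cases follow by induction on
  \<open>S\<close> and, once \<open>S\<close> is an average, an inner induction on \<open>T\<close>.
  Commutation is what lets derivatives produced by one block of factors be moved past all the
  others.\<close>

lemma conv_op_commute:
  assumes "conv_op S" "conv_op T" "bdd_borel f"
  shows "S (T f) = T (S f)"
  using assms
proof (induction arbitrary: T f rule: conv_op.induct)
  case (avg \<mu> w \<sigma>)
  note \<mu> = avg(1-3)
  show ?case using avg(4,5)
  proof (induction arbitrary: f rule: conv_op.induct)
    case (avg \<nu> v \<tau>)
    then show ?case using avg_commute[OF \<mu>] by blast
  next
    case (comp S T)
    have "avg \<sigma> \<mu> w (S (T f)) = S (avg \<sigma> \<mu> w (T f))"
      by (rule comp.IH(1)) (rule conv_op_bdd[OF comp.hyps(2) comp.prems])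
    also have "\<dots> = S (T (avg \<sigma> \<mu> w f))" by (simp only: comp.IH(2)[OF comp.prems])
    finally show ?case .
  next
    case (lin S T a b)
    then have "bdd_borel (S f)" "bdd_borel (T f)" using conv_op_bdd by blast+
    note * = conv_op_lin[OF conv_op.avg[OF \<mu>] this]
    show ?case by (simp only: * lin.IH(1)[OF lin.prems] lin.IH(2)[OF lin.prems])
  qed simp
next
  case (comp S T T')
  have "S (T (T' f)) = S (T' (T f))" by (simp only: comp.IH(2)[OF comp.prems])
  also have "\<dots> = T' (S (T f))"
    by (rule comp.IH(1)[OF comp.prems(1)]) (rule conv_op_bdd[OF comp.hyps(2) comp.prems(2)])
  finally show ?case .
next
  case (lin S S' a b)
  then have "bdd_borel (S f)" "bdd_borel (S' f)" using conv_op_bdd by blast+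
  note * = conv_op_lin[OF lin.prems(1) this]
  show ?case by (simp only: * lin.IH(1)[OF lin.prems] lin.IH(2)[OF lin.prems])
qed simp

section \<open>Taylor expansions indexed by multiindices\<close>

lemma finite_lists_length [simp]:
  "finite {\<beta> :: 'n::finite list. length \<beta> = q}"
  "finite {\<beta> :: 'n::finite list. length \<beta> < q}"
  "finite {\<beta> :: 'n::finite list. length \<beta> \<le> q}"
proof -
  show "finite {\<beta> :: 'n::finite list. length \<beta> = q}"
    using finite_lists_length_eq[of "UNIV :: 'n set" q] by simp
  show le: "finite {\<beta> :: 'n::finite list. length \<beta> \<le> q}"
    using finite_lists_length_le[of "UNIV :: 'n set" q] by simp
  show "finite {\<beta> :: 'n::finite list. length \<beta> < q}"
    by (rule finite_subset[OF _ le]) auto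
qed

lemma sum_lists_less:
  fixes f :: "'n::finite list \<Rightarrow> 'b::comm_monoid_add"
  shows "(\<Sum>\<beta> | length \<beta> < q. f \<beta>) = (\<Sum>j<q. \<Sum>\<beta> | length \<beta> = j. f \<beta>)"
proof -
  have "(\<Sum>j<q. \<Sum>\<beta> | \<beta> \<in> {\<beta>. length \<beta> < q} \<and> length \<beta> = j. f \<beta>) = (\<Sum>\<beta> | length \<beta> < q. f \<beta>)"
    by (rule sum.group) auto
  moreover have "{\<beta> :: 'n list. \<beta> \<in> {\<beta>. length \<beta> < q} \<and> length \<beta> = j} = {\<beta>. length \<beta> = j}" if "j < q" for j
    using that by auto
  ultimately show ?thesis by simp
qed

lemma sum_lists_0: "(\<Sum>\<beta> :: 'n::finite list | length \<beta> = 0. f \<beta>) = f []"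
proof -
  have "{\<beta> :: 'n list. length \<beta> = 0} = {[]}" by auto
  then show ?thesis by simp
qed

lemma sum_lists_snoc:
  fixes f :: "'n::finite list \<Rightarrow> 'b::comm_monoid_add"
  shows "(\<Sum>\<beta> | length \<beta> = Suc q. f \<beta>) = (\<Sum>\<beta> | length \<beta> = q. \<Sum>i\<in>UNIV. f (\<beta> @ [i]))"
proof -
  have "(\<Sum>\<beta> | length \<beta> = q. \<Sum>i\<in>UNIV. f (\<beta> @ [i]))
      = (\<Sum>(\<beta>, i) \<in> {\<beta>. length \<beta> = q} \<times> UNIV. f (\<beta> @ [i]))"
    by (subst sum.cartesian_product) auto
  also have "\<dots> = (\<Sum>\<beta> | length \<beta> = Suc q. f \<beta>)"
    by (rule sum.reindex_bij_witness[where j = "\<lambda>(\<beta>, i). \<beta> @ [i]" and i = "\<lambda>\<beta>. (butlast \<beta>, last \<beta>)"])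
      (auto simp: length_Suc_conv_rev)
  finally show ?thesis ..
qed

lemma sum_lists_Cons:
  fixes f :: "'n::finite list \<Rightarrow> 'b::comm_monoid_add"
  shows "(\<Sum>\<beta> | length \<beta> = Suc q. f \<beta>) = (\<Sum>i\<in>UNIV. \<Sum>\<beta> | length \<beta> = q. f (i # \<beta>))"
proof -
  have "(\<Sum>i\<in>UNIV. \<Sum>\<beta> | length \<beta> = q. f (i # \<beta>))
      = (\<Sum>(i, \<beta>) \<in> UNIV \<times> {\<beta>. length \<beta> = q}. f (i # \<beta>))"
    by (subst sum.cartesian_product) auto
  also have "\<dots> = (\<Sum>\<beta> | length \<beta> = Suc q. f \<beta>)"
    by (rule sum.reindex_bij_witness[where j = "\<lambda>(i, \<beta>). i # \<beta>" and i = "\<lambda>\<beta>. (hd \<beta>, tl \<beta>)"])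
      (auto simp: length_Suc_conv)
  finally show ?thesis ..
qed

lemma mpower_simps [simp]:
  "mpower x [] = 1" "mpower x (i # \<beta>) = x $ i * mpower x \<beta>"
  "mpower x (\<alpha> @ \<beta>) = mpower x \<alpha> * mpower x \<beta>"
  by (auto simp: mpower_def)

text \<open>The l1 norm, because the absolute monomials of all words of length \<open>q\<close> add
  up exactly to its \<open>q\<close>-th power.\<close>

definition norm1 :: "real^'n \<Rightarrow> real" where
  "norm1 h = (\<Sum>i\<in>UNIV. \<bar>h $ i\<bar>)"

lemma norm1_nonneg: "0 \<le> norm1 h"
  by (simp add: norm1_def sum_nonneg)

lemma norm1_le: "norm1 (h :: real^'n) \<le> real CARD('n) * norm h"
proof -
  have "norm1 h \<le> (\<Sum>i\<in>(UNIV :: 'n set). norm h)"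
    unfolding norm1_def by (intro sum_mono component_le_norm_cart)
  then show ?thesis by simp
qed

lemma sum_abs_mpower: "(\<Sum>\<beta> | length \<beta> = q. \<bar>mpower h \<beta>\<bar>) = norm1 h ^ q"
proof (induction q)
  case 0
  have "(\<Sum>\<beta> | length \<beta> = 0. \<bar>mpower h \<beta>\<bar>) = 1" by (subst sum_lists_0) simp
  then show ?case by simp
next
  case (Suc q)
  show ?case unfolding sum_lists_Cons
    by (simp add: abs_mult Suc norm1_def flip: sum_distrib_left sum_distrib_right)
qed

lemma abs_mpower_le: "\<bar>mpower x \<beta>\<bar> \<le> norm x ^ length \<beta>"
  by (induction \<beta>) (auto simp: abs_mult intro!: mult_mono component_le_norm_cart)

text \<open>Only degrees below \<open>q\<close> occur, so \<open>q\<close> is the order of the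
  remainder. Words are ordered, hence a mixed derivative is counted once per ordering and
  \<open>1 / fact (length \<beta>)\<close> is the usual Taylor weight.\<close>

definition taylor_poly :: "('n::finite list \<Rightarrow> real^'n \<Rightarrow> real) \<Rightarrow> 'n list \<Rightarrow> nat \<Rightarrow> real^'n \<Rightarrow> real^'n \<Rightarrow> real" where
  "taylor_poly D \<alpha> q x h = (\<Sum>\<beta> | length \<beta> < q. mpower h \<beta> / fact (length \<beta>) * D (\<alpha> @ \<beta>) x)"

lemma taylor_poly_2: "taylor_poly D \<alpha> 2 x h = D \<alpha> x + (\<Sum>i\<in>UNIV. h $ i * D (\<alpha> @ [i]) x)"
proof -
  have "(\<Sum>\<beta> | length \<beta> = Suc 0. mpower h \<beta> / fact (length \<beta>) * D (\<alpha> @ \<beta>) x)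
      = (\<Sum>i\<in>UNIV. h $ i * D (\<alpha> @ [i]) x)"
    by (subst sum_lists_Cons, subst sum_lists_0) simp
  moreover have "(\<Sum>\<beta> | length \<beta> = 0. mpower h \<beta> / fact (length \<beta>) * D (\<alpha> @ \<beta>) x) = D \<alpha> x"
    by (subst sum_lists_0) simp
  ultimately show ?thesis
    unfolding taylor_poly_def sum_lists_less by (simp add: numeral_2_eq_2)
qed

definition grad_rule :: "('n::finite list \<Rightarrow> real^'n \<Rightarrow> real) \<Rightarrow> 'n list \<Rightarrow> real^'n \<Rightarrow> bool" where
  "grad_rule D \<alpha> x \<longleftrightarrow> (D \<alpha> has_derivative (\<lambda>h. \<Sum>i\<in>UNIV. h $ i * D (\<alpha> @ [i]) x)) (at x)"

text \<open>One-dimensional Maclaurin expansion along \<open>t \<mapsto> x + t *\<^sub>R h\<close>: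
  differentiating appends one letter, so the \<open>m\<close>-th derivative is a sum over all words
  of length \<open>m\<close>.\<close>

lemma taylor_lagrange:
  fixes D :: "'n::finite list \<Rightarrow> real^'n \<Rightarrow> real"
  assumes deriv: "\<And>\<beta> y. length \<beta> < q \<Longrightarrow> grad_rule D (\<alpha> @ \<beta>) y"
  shows "\<exists>t\<in>{0..1}. D \<alpha> (x + h) = taylor_poly D \<alpha> q x h
    + (\<Sum>\<beta> | length \<beta> = q. mpower h \<beta> * D (\<alpha> @ \<beta>) (x + t *\<^sub>R h)) / fact q"
proof (cases "q = 0")
  \<comment> \<open>\<open>Maclaurin\<close> asks for positive order; at order 0 the polynomial is
    empty and \<open>t = 1\<close> returns the value itself.\<close>
  case True
  have "(\<Sum>\<beta> | length \<beta> = 0. mpower h \<beta> * D (\<alpha> @ \<beta>) (x + 1 *\<^sub>R h)) = D \<alpha> (x + h)"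
    by (subst sum_lists_0) simp
  then show ?thesis using True by (intro bexI[of _ 1]) (auto simp: taylor_poly_def)
next
  case False
  define diff where "diff m t = (\<Sum>\<beta> | length \<beta> = m. mpower h \<beta> * D (\<alpha> @ \<beta>) (x + t *\<^sub>R h))" for m t
  have "DERIV (diff m) t :> diff (Suc m) t" if "m < q" for m t
  proof -
    have d: "((\<lambda>t. D (\<alpha> @ \<beta>) (x + t *\<^sub>R h)) has_real_derivative
        (\<Sum>i\<in>UNIV. h $ i * D (\<alpha> @ \<beta> @ [i]) (x + t *\<^sub>R h))) (at t)" if "length \<beta> = m" for \<beta>
    proof -
      have "((\<lambda>t. x + t *\<^sub>R h) has_derivative (\<lambda>s. s *\<^sub>R h)) (at t)"
        by (auto intro!: derivative_eq_intros)
      moreover have "(D (\<alpha> @ \<beta>) has_derivative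
          (\<lambda>h'. \<Sum>i\<in>UNIV. h' $ i * D (\<alpha> @ \<beta> @ [i]) (x + t *\<^sub>R h))) (at (x + t *\<^sub>R h))"
        using deriv[of \<beta> "x + t *\<^sub>R h"] that \<open>m < q\<close> by (simp add: grad_rule_def)
      ultimately have "((\<lambda>t. D (\<alpha> @ \<beta>) (x + t *\<^sub>R h)) has_derivative
          (\<lambda>s. \<Sum>i\<in>UNIV. (s *\<^sub>R h) $ i * D (\<alpha> @ \<beta> @ [i]) (x + t *\<^sub>R h))) (at t)"
        by (rule has_derivative_compose)
      then show ?thesis
        by (rule has_derivative_imp_has_field_derivative)
          (simp add: sum_distrib_left mult.assoc mult.commute mult.left_commute)
    qed
    have "DERIV (diff m) t :> (\<Sum>\<beta> | length \<beta> = m. mpower h \<beta> *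
        (\<Sum>i\<in>UNIV. h $ i * D (\<alpha> @ \<beta> @ [i]) (x + t *\<^sub>R h)))"
      unfolding diff_def by (rule DERIV_sum) (auto intro!: DERIV_cmult d)
    then show ?thesis
      unfolding diff_def by (subst sum_lists_snoc) (simp add: sum_distrib_left mult.assoc)
  qed
  then obtain t where t: "0 < t" "t < 1"
    "D \<alpha> (x + 1 *\<^sub>R h) = (\<Sum>m<q. diff m 0 / fact m * 1 ^ m) + diff q t / fact q * 1 ^ q"
  proof -
    have 0: "diff 0 = (\<lambda>t. D \<alpha> (x + t *\<^sub>R h))"
      unfolding diff_def by (rule ext, subst sum_lists_0) simp
    show ?thesis
      using Maclaurin[of 1 q diff "\<lambda>t. D \<alpha> (x + t *\<^sub>R h)"] 0 False that
        \<open>\<And>m t. m < q \<Longrightarrow> DERIV (diff m) t :> diff (Suc m) t\<close> by auto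
  qed
  have "(\<Sum>m<q. diff m 0 / fact m * 1 ^ m) = taylor_poly D \<alpha> q x h"
    unfolding taylor_poly_def sum_lists_less
    by (intro sum.cong refl) (auto simp: diff_def sum_divide_distrib)
  then show ?thesis using t by (intro bexI[of _ t]) (auto simp: diff_def)
qed

text \<open>A quadratic remainder bound is the form in which differentiability is established
  throughout, because such bounds survive integration.\<close>

lemma has_derivative_quadratic:
  fixes f :: "'a::real_normed_vector \<Rightarrow> real"
  assumes "bounded_linear f'" "\<And>h. norm h \<le> 1 \<Longrightarrow> \<bar>f (x + h) - f x - f' h\<bar> \<le> K * (norm h)\<^sup>2"
  shows "(f has_derivative f') (at x)"
proof (rule has_derivativeI_sandwich[where e = 1 and H = "\<lambda>y. K * norm (y - x)"])
  fix y assume y: "y \<noteq> x" "dist y x < 1"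
  then have "\<bar>f (x + (y - x)) - f x - f' (y - x)\<bar> \<le> K * (norm (y - x))\<^sup>2"
    by (intro assms(2)) (simp add: dist_norm)
  then show "norm (f y - f x - f' (y - x)) / norm (y - x) \<le> K * norm (y - x)"
    using y by (simp add: divide_le_eq power2_eq_square mult.assoc)
next
  have "((\<lambda>y. K * norm (y - x)) \<longlongrightarrow> K * norm (x - x)) (at x)" by (intro tendsto_intros)
  then show "((\<lambda>y. K * norm (y - x)) \<longlongrightarrow> 0) (at x)" by simp
qed (use assms in auto)

lemma bounded_linear_coord_sum: "bounded_linear (\<lambda>h :: real^'n. \<Sum>i\<in>UNIV. h $ i * c i)"
  by (intro bounded_linear_sum bounded_linear_mult_const bounded_linear_vec_nth)

lemma coord_sum_unique:
  assumes "(f has_derivative (\<lambda>h :: real^'n. \<Sum>i\<in>UNIV. h $ i * c i)) (at x)"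
    "(f has_derivative (\<lambda>h. \<Sum>i\<in>UNIV. h $ i * d i)) (at x)"
  shows "c j = d j"
proof -
  have "(\<lambda>h :: real^'n. \<Sum>i\<in>UNIV. h $ i * c i) = (\<lambda>h. \<Sum>i\<in>UNIV. h $ i * d i)"
    using assms by (rule has_derivative_unique)
  from fun_cong[OF this, of "axis j 1"] show ?thesis
    by (simp add: axis_def if_distrib[of "\<lambda>u. u * _"] cong: if_cong)
qed

section \<open>Families of derivatives with uniform Taylor estimates\<close>

text \<open>
  \<open>D \<alpha>\<close> plays the role of \<open>\<partial>\<^sup>\<alpha> (D [])\<close>.  Only uniform Taylor estimates are required, because these
  pass through the operators of \<open>conv_op\<close> without any differentiation under the integral.
\<close>
definition jet :: "nat \<Rightarrow> real \<Rightarrow> ('n::finite list \<Rightarrow> real^'n \<Rightarrow> real) \<Rightarrow> bool" where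
  "jet L B D \<longleftrightarrow> (\<forall>\<alpha>. length \<alpha> \<le> L \<longrightarrow> D \<alpha> \<in> borel_measurable borel) \<and>
    (\<forall>\<alpha> q x h. length \<alpha> + q \<le> L \<longrightarrow> \<bar>D \<alpha> (x + h) - taylor_poly D \<alpha> q x h\<bar> \<le> B * norm1 h ^ q)"

lemma jet_taylor:
  assumes "jet L B D" "length \<alpha> + q \<le> L"
  shows "\<bar>D \<alpha> (x + h) - taylor_poly D \<alpha> q x h\<bar> \<le> B * norm1 h ^ q"
  using assms by (simp add: jet_def)

text \<open>At \<open>q = 0\<close> the Taylor polynomial is empty, so the estimate of order 0 is
  the sup bound.\<close>

lemma jet_bounded:
  assumes "jet L B D" "length \<alpha> \<le> L"
  shows "bounded_borel B (D \<alpha>)"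
  unfolding bounded_borel_def
proof (intro conjI allI)
  show "D \<alpha> \<in> borel_measurable borel" using assms by (simp add: jet_def)
  fix x
  have "\<bar>D \<alpha> x - taylor_poly D \<alpha> 0 x 0\<bar> \<le> B"
    using jet_taylor[OF assms(1), of \<alpha> 0 x 0] assms(2) by simp
  then show "\<bar>D \<alpha> x\<bar> \<le> B" by (simp add: taylor_poly_def)
qed

lemma jet_nonneg: "jet L B D \<Longrightarrow> 0 \<le> B"
  using jet_bounded[of L B D "[]"] bounded_borel_nonneg by auto

lemma jet_mono:
  fixes D :: "'n::finite list \<Rightarrow> real^'n \<Rightarrow> real"
  shows "jet L B D \<Longrightarrow> L' \<le> L \<Longrightarrow> B \<le> B' \<Longrightarrow> jet L' B' D"
  unfolding jet_def
proof (intro conjI allI impI)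
  fix \<alpha> :: "'n list" and q and x h :: "real^'n"
  assume *: "(\<forall>\<alpha>. length \<alpha> \<le> L \<longrightarrow> D \<alpha> \<in> borel_measurable borel) \<and>
    (\<forall>\<alpha> q x h. length \<alpha> + q \<le> L \<longrightarrow> \<bar>D \<alpha> (x + h) - taylor_poly D \<alpha> q x h\<bar> \<le> B * norm1 h ^ q)"
    and "L' \<le> L" "B \<le> B'" "length \<alpha> + q \<le> L'"
  then have "\<bar>D \<alpha> (x + h) - taylor_poly D \<alpha> q x h\<bar> \<le> B * norm1 h ^ q" by simp
  also have "\<dots> \<le> B' * norm1 h ^ q"
    by (intro mult_right_mono zero_le_power norm1_nonneg) fact
  finally show "\<bar>D \<alpha> (x + h) - taylor_poly D \<alpha> q x h\<bar> \<le> B' * norm1 h ^ q" .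
qed auto

text \<open>Lagrange remainder: the words of length \<open>q\<close> contribute at most
  \<open>B * norm1 h ^ q\<close>, so the sup bound of the derivatives serves directly as Taylor
  constant.\<close>

lemma jet_derivs:
  fixes D :: "'n::finite list \<Rightarrow> real^'n \<Rightarrow> real"
  assumes "\<And>\<alpha>. length \<alpha> \<le> L \<Longrightarrow> bounded_borel B (D \<alpha>)"
    "\<And>\<alpha> x. length \<alpha> < L \<Longrightarrow> grad_rule D \<alpha> x"
  shows "jet L B D"
  unfolding jet_def
proof (intro conjI allI impI)
  fix \<alpha> :: "'n list" assume "length \<alpha> \<le> L"
  then show "D \<alpha> \<in> borel_measurable borel" using assms(1) by (simp add: bounded_borel_def)
next
  fix \<alpha> :: "'n list" and q and x h :: "real^'n" assume le: "length \<alpha> + q \<le> L"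
  have "\<exists>t\<in>{0..1}. D \<alpha> (x + h) = taylor_poly D \<alpha> q x h
    + (\<Sum>\<beta> | length \<beta> = q. mpower h \<beta> * D (\<alpha> @ \<beta>) (x + t *\<^sub>R h)) / fact q"
    using le by (intro taylor_lagrange assms(2)) auto
  then obtain t where t: "D \<alpha> (x + h) = taylor_poly D \<alpha> q x h
    + (\<Sum>\<beta> | length \<beta> = q. mpower h \<beta> * D (\<alpha> @ \<beta>) (x + t *\<^sub>R h)) / fact q" by blast
  let ?S = "\<Sum>\<beta> | length \<beta> = q. mpower h \<beta> * D (\<alpha> @ \<beta>) (x + t *\<^sub>R h)"
  have "\<bar>?S\<bar> \<le> (\<Sum>\<beta> | length \<beta> = q. \<bar>mpower h \<beta>\<bar> * B)"
    using assms(1) le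
    by (intro order_trans[OF sum_abs] sum_mono) (auto simp: abs_mult bounded_borel_def intro!: mult_left_mono)
  also have "\<dots> = B * norm1 h ^ q"
    unfolding sum_distrib_right[symmetric] sum_abs_mpower by simp
  finally have "\<bar>?S\<bar> \<le> B * norm1 h ^ q" .
  moreover have "\<bar>?S / fact q\<bar> \<le> \<bar>?S\<bar>"
    using fact_ge_1[of q, where ?'a = real] by (simp add: abs_divide divide_le_eq mult_le_cancel_left1)
  ultimately show "\<bar>D \<alpha> (x + h) - taylor_poly D \<alpha> q x h\<bar> \<le> B * norm1 h ^ q" using t by simp
qed

text \<open>The order-2 Taylor estimate is a quadratic remainder bound; this is why two orders
  beyond \<open>\<alpha>\<close> are asked for.\<close>

lemma jet_grad:
  fixes D :: "'n::finite list \<Rightarrow> real^'n \<Rightarrow> real"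
  assumes "jet L B D" "length \<alpha> + 2 \<le> L"
  shows "grad_rule D \<alpha> x"
  unfolding grad_rule_def
proof (rule has_derivative_quadratic[where K = "B * (real CARD('n))\<^sup>2"])
  show "bounded_linear (\<lambda>h. \<Sum>i\<in>UNIV. h $ i * D (\<alpha> @ [i]) x)" by (rule bounded_linear_coord_sum)
  fix h :: "real^'n"
  have "\<bar>D \<alpha> (x + h) - D \<alpha> x - (\<Sum>i\<in>UNIV. h $ i * D (\<alpha> @ [i]) x)\<bar> \<le> B * norm1 h ^ 2"
    using jet_taylor[OF assms, of x h] by (simp add: taylor_poly_2)
  also have "\<dots> \<le> B * (real CARD('n) * norm h) ^ 2"
    by (intro mult_left_mono power_mono norm1_le norm1_nonneg jet_nonneg[OF assms(1)])
  finally show "\<bar>D \<alpha> (x + h) - D \<alpha> x - (\<Sum>i\<in>UNIV. h $ i * D (\<alpha> @ [i]) x)\<bar>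
      \<le> B * (real CARD('n))\<^sup>2 * (norm h)\<^sup>2" by (simp add: power_mult_distrib mult.assoc)
qed

text \<open>The gradient of \<open>D \<alpha>\<close> determines all one-letter extensions, so
  agreement spreads from the empty word to all words below the top order. It serves to identify
  derivatives of one function that were produced in two different ways.\<close>

lemma jet_unique:
  fixes D E :: "'n::finite list \<Rightarrow> real^'n \<Rightarrow> real"
  assumes "jet L B D" "jet L C E" "D [] = E []" "length \<alpha> < L"
  shows "D \<alpha> = E \<alpha>"
  using assms(4)
proof (induction \<alpha> rule: rev_induct)
  case Nil
  then show ?case using assms by simp
next
  case (snoc i \<alpha>)
  show ?case
  proof
    fix x
    have "grad_rule D \<alpha> x" "grad_rule E \<alpha> x"
      using snoc.prems by (auto intro!: jet_grad[OF assms(1)] jet_grad[OF assms(2)])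
    then show "D (\<alpha> @ [i]) x = E (\<alpha> @ [i]) x"
      unfolding grad_rule_def using snoc by (intro coord_sum_unique) auto
  qed
qed

text \<open>For fixed \<open>h\<close> the Taylor remainder is a bounded function of
  \<open>x\<close>; by translation invariance and linearity \<open>T\<close> maps it to the
  remainder of the new family, so its bound is multiplied by \<open>c\<close>.\<close>

lemma jet_conv_op:
  fixes D :: "'n::finite list \<Rightarrow> real^'n \<Rightarrow> real"
  assumes "conv_op T" "op_bound c T" "jet L B D"
  shows "jet L (c * B) (\<lambda>\<alpha>. T (D \<alpha>))"
  unfolding jet_def
proof (intro conjI allI impI)
  fix \<alpha> :: "'n list" assume "length \<alpha> \<le> L"
  then have "bounded_borel (c * B) (T (D \<alpha>))"
    using jet_bounded[OF assms(3)] assms(2) by (simp add: op_bound_def)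
  then show "T (D \<alpha>) \<in> borel_measurable borel" by (simp add: bounded_borel_def)
next
  fix \<alpha> :: "'n list" and q and x h :: "real^'n" assume le: "length \<alpha> + q \<le> L"
  let ?R = "\<lambda>x. D \<alpha> (x + h) - taylor_poly D \<alpha> q x h"
  have bdd: "bdd_borel (D (\<alpha> @ \<beta>))" if "length \<beta> < q" for \<beta>
    using jet_bounded[OF assms(3), of "\<alpha> @ \<beta>"] le that by auto
  have "bounded_borel B (D \<alpha>)" using jet_bounded[OF assms(3)] le by simp
  then have b1: "bdd_borel (\<lambda>x. D \<alpha> (x + h))" using bdd_borel_shift by blast
  obtain b where b: "\<And>\<beta>. length \<beta> < q \<Longrightarrow> bounded_borel (b \<beta>) (D (\<alpha> @ \<beta>))"
    using bdd by metis
  have b2: "bdd_borel (\<lambda>x. taylor_poly D \<alpha> q x h)"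
    unfolding taylor_poly_def
    using bounded_borel_sum[of "{\<beta>. length \<beta> < q}" b "\<lambda>\<beta>. D (\<alpha> @ \<beta>)"
        "\<lambda>\<beta>. mpower h \<beta> / fact (length \<beta>)"] b by auto
  have "T ?R = (\<lambda>x. T (\<lambda>x. D \<alpha> (x + h)) x - T (\<lambda>x. taylor_poly D \<alpha> q x h) x)"
    by (rule conv_op_diff[OF assms(1) b1 b2])
  also have "T (\<lambda>x. taylor_poly D \<alpha> q x h) = (\<lambda>x. taylor_poly (\<lambda>\<alpha>. T (D \<alpha>)) \<alpha> q x h)"
    unfolding taylor_poly_def by (rule conv_op_sum_arg[OF assms(1)]) (use bdd in auto)
  also have "T (\<lambda>x. D \<alpha> (x + h)) = (\<lambda>x. T (D \<alpha>) (x + h))" by (rule conv_op_translate[OF assms(1)])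
  finally have "T (D \<alpha>) (x + h) - taylor_poly (\<lambda>\<alpha>. T (D \<alpha>)) \<alpha> q x h = T ?R x" by simp
  moreover have "bounded_borel (B * norm1 h ^ q) ?R"
  proof -
    have "?R \<in> borel_measurable borel"
      using b1 b2 by (intro borel_measurable_diff) (auto simp: bounded_borel_def)
    then show ?thesis using jet_taylor[OF assms(3) le] by (simp add: bounded_borel_def)
  qed
  then have "bounded_borel (c * (B * norm1 h ^ q)) (T ?R)" using assms(2) by (simp add: op_bound_def)
  ultimately show "\<bar>T (D \<alpha>) (x + h) - taylor_poly (\<lambda>\<alpha>. T (D \<alpha>)) \<alpha> q x h\<bar> \<le> c * B * norm1 h ^ q"
    by (simp add: bounded_borel_def mult.assoc)
qed

text \<open>A differential operator with constant coefficients \<open>u\<close>, acting on the whole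
  family. The word \<open>\<gamma>\<close> goes in front because Taylor polynomials append letters
  at the end; the two operations then do not interfere.\<close>

definition diff_op :: "('n::finite list \<Rightarrow> real) \<Rightarrow> nat \<Rightarrow> ('n list \<Rightarrow> real^'n \<Rightarrow> real) \<Rightarrow> 'n list \<Rightarrow> real^'n \<Rightarrow> real" where
  "diff_op u r D \<alpha> x = (\<Sum>\<gamma> | length \<gamma> \<le> r. u \<gamma> * D (\<gamma> @ \<alpha>) x)"

lemma jet_diff_op:
  fixes D :: "'n::finite list \<Rightarrow> real^'n \<Rightarrow> real"
  assumes "jet L B D" "r \<le> L"
  shows "jet (L - r) ((\<Sum>\<gamma> | length \<gamma> \<le> r. \<bar>u \<gamma>\<bar>) * B) (diff_op u r D)"
  unfolding jet_def
proof (intro conjI allI impI)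
  fix \<alpha> :: "'n list" assume "length \<alpha> \<le> L - r"
  then have "D (\<gamma> @ \<alpha>) \<in> borel_measurable borel" if "length \<gamma> \<le> r" for \<gamma>
    using jet_bounded[OF assms(1), of "\<gamma> @ \<alpha>"] that assms(2) by (auto simp: bounded_borel_def)
  then show "diff_op u r D \<alpha> \<in> borel_measurable borel"
    unfolding diff_op_def[abs_def] by (intro borel_measurable_sum borel_measurable_times) auto
next
  fix \<alpha> :: "'n list" and q and x h :: "real^'n" assume le: "length \<alpha> + q \<le> L - r"
  have "taylor_poly (diff_op u r D) \<alpha> q x h = (\<Sum>\<gamma> | length \<gamma> \<le> r. u \<gamma> * taylor_poly D (\<gamma> @ \<alpha>) q x h)"
    unfolding taylor_poly_def diff_op_def sum_distrib_left
    by (subst sum.swap) (simp add: mult.left_commute)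
  then have "\<bar>diff_op u r D \<alpha> (x + h) - taylor_poly (diff_op u r D) \<alpha> q x h\<bar>
      = \<bar>\<Sum>\<gamma> | length \<gamma> \<le> r. u \<gamma> * (D (\<gamma> @ \<alpha>) (x + h) - taylor_poly D (\<gamma> @ \<alpha>) q x h)\<bar>"
    by (simp add: diff_op_def sum_subtractf algebra_simps)
  also have "\<dots> \<le> (\<Sum>\<gamma> | length \<gamma> \<le> r. \<bar>u \<gamma>\<bar> * (B * norm1 h ^ q))"
    using jet_taylor[OF assms(1)] le assms(2)
    by (intro order_trans[OF sum_abs] sum_mono) (auto simp: abs_mult intro!: mult_left_mono)
  finally show "\<bar>diff_op u r D \<alpha> (x + h) - taylor_poly (diff_op u r D) \<alpha> q x h\<bar>
      \<le> (\<Sum>\<gamma> | length \<gamma> \<le> r. \<bar>u \<gamma>\<bar>) * B * norm1 h ^ q"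
    by (simp add: sum_distrib_right mult.assoc)
qed

section \<open>Binomial coefficients as polynomials in the upper index\<close>

text \<open>The recursion at \<open>m\<close>, multiplied by \<open>m + 1\<close> and rewritten by
  the absorption identity, is this relation at \<open>n = m + 1\<close>; the summand
  \<open>real n\<close> reflects the convention B_1 = 1/2.\<close>

lemma bernoulli2_sum: "(\<Sum>k\<le>n. real (n choose k) * bernoulli2 k) = bernoulli2 n + real n"
proof (cases n)
  case (Suc m)
  have "real (m choose k) / real (m - k + 1) = real (Suc m choose k) / real (Suc m)" if "k < m" for k
  proof -
    have "Suc m * (m choose k) = (Suc m - k) * (Suc m choose k)"
      using binomial_absorb_comp[of "Suc m" k] by simp
    then have "real (Suc m) * real (m choose k) = real (m - k + 1) * real (Suc m choose k)"
      using that by (metis Suc_diff_le Suc_eq_plus1 less_imp_le_nat of_nat_mult)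
    then show ?thesis by (simp add: frac_eq_eq mult.commute del: binomial_Suc_Suc of_nat_Suc)
  qed
  then have "(\<Sum>k<m. real (m choose k) * bernoulli2 k / real (m - k + 1))
      = (\<Sum>k<m. real (Suc m choose k) * bernoulli2 k) / real (Suc m)"
    unfolding sum_divide_distrib
    by (intro sum.cong refl) (metis (no_types, lifting) lessThan_iff times_divide_eq_left)
  then have "real (Suc m) * bernoulli2 m = real (Suc m) - (\<Sum>k<m. real (Suc m choose k) * bernoulli2 k)"
    by (subst bernoulli2.simps) (simp add: right_diff_distrib del: binomial_Suc_Suc of_nat_Suc)
  moreover have "(\<Sum>k\<le>Suc m. real (Suc m choose k) * bernoulli2 k)
      = (\<Sum>k<m. real (Suc m choose k) * bernoulli2 k) + real (Suc m) * bernoulli2 m + bernoulli2 (Suc m)"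
    by (simp only: lessThan_Suc_atMost[symmetric] sum.lessThan_Suc binomial_n_n) (simp del: binomial_Suc_Suc)
  ultimately show ?thesis using Suc by simp
qed simp

text \<open>The classical Bernoulli polynomial B_n at \<open>x + 1\<close>, as the second Bernoulli
  numbers are the values B_n(1).\<close>

definition bernpoly2 :: "nat \<Rightarrow> real \<Rightarrow> real" where
  "bernpoly2 n x = (\<Sum>p\<le>n. real (n choose p) * bernoulli2 (n - p) * x ^ p)"

lemma sum_triangle_swap:
  "(\<Sum>p\<le>n. \<Sum>q\<le>p. f p q) = (\<Sum>q\<le>n. \<Sum>p=q..n. (f p q :: 'a :: comm_monoid_add))" for n :: nat
proof -
  have "(\<Sum>p\<le>n. \<Sum>q\<le>p. f p q) = (\<Sum>(p, q)\<in>(SIGMA p:{..n}. {..p}). f p q)"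
    by (rule sum.Sigma) auto
  also have "\<dots> = (\<Sum>(q, p)\<in>(SIGMA q:{..n}. {q..n}). f p q)"
    by (rule sum.reindex_bij_witness[where i = "\<lambda>(q, p). (p, q)" and j = "\<lambda>(p, q). (q, p)"]) auto
  also have "\<dots> = (\<Sum>q\<le>n. \<Sum>p=q..n. f p q)" by (rule sum.Sigma[symmetric]) auto
  finally show ?thesis .
qed

text \<open>The difference equation of the Bernoulli polynomials: expanding
  \<open>(y + 1) ^ p\<close> and collecting powers \<open>y ^ q\<close> reduces it to
  \<open>bernoulli2_sum\<close> at \<open>n - q\<close>.\<close>

lemma bernpoly2_step: "bernpoly2 n (y + 1) = bernpoly2 n y + real n * (y + 1) ^ (n - 1)"
proof -
  have "bernpoly2 n (y + 1)
      = (\<Sum>p\<le>n. \<Sum>q\<le>p. real (n choose p) * bernoulli2 (n - p) * (real (p choose q) * y ^ q))"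
    unfolding bernpoly2_def by (simp add: binomial_ring sum_distrib_left)
  also have "\<dots> = (\<Sum>q\<le>n. \<Sum>p=q..n. real (n choose p) * bernoulli2 (n - p) * (real (p choose q) * y ^ q))"
    by (rule sum_triangle_swap)
  also have "\<dots> = (\<Sum>q\<le>n. real (n choose q) * y ^ q * (bernoulli2 (n - q) + real (n - q)))"
  proof (intro sum.cong refl)
    fix q assume "q \<in> {..n}"
    then have q: "q \<le> n" by simp
    have "(\<Sum>p=q..n. real (n choose p) * bernoulli2 (n - p) * (real (p choose q) * y ^ q))
        = (\<Sum>k\<le>n - q. real (n choose q) * y ^ q * (real ((n - q) choose k) * bernoulli2 k))"
    proof (rule sum.reindex_bij_witness[where i = "\<lambda>k. n - k" and j = "\<lambda>p. n - p"])
      fix p assume "p \<in> {q..n}"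
      then have p: "q \<le> p" "p \<le> n" by auto
      have "(n choose p) * (p choose q) = (n choose q) * ((n - q) choose (p - q))"
        using p by (rule choose_mult)
      also have "(n - q) choose (p - q) = (n - q) choose (n - p)"
        using p by (subst binomial_symmetric) auto
      finally have "real (n choose p) * real (p choose q) = real (n choose q) * real ((n - q) choose (n - p))"
        by (metis of_nat_mult)
      then show "real (n choose q) * y ^ q * (real ((n - q) choose (n - p)) * bernoulli2 (n - p))
          = real (n choose p) * bernoulli2 (n - p) * (real (p choose q) * y ^ q)"
        by (simp add: algebra_simps)
    qed (use q in auto)
    then show "(\<Sum>p=q..n. real (n choose p) * bernoulli2 (n - p) * (real (p choose q) * y ^ q))
        = real (n choose q) * y ^ q * (bernoulli2 (n - q) + real (n - q))"
      by (simp add: bernoulli2_sum flip: sum_distrib_left)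
  qed
  also have "\<dots> = bernpoly2 n y + (\<Sum>q\<le>n. real (n choose q) * y ^ q * real (n - q))"
    unfolding bernpoly2_def sum.distrib[symmetric] by (intro sum.cong refl) (simp add: algebra_simps)
  also have "(\<Sum>q\<le>n. real (n choose q) * y ^ q * real (n - q)) = real n * (y + 1) ^ (n - 1)"
  proof (cases n)
    case (Suc m)
    have "real (Suc m choose q) * real (Suc m - q) = real (Suc m) * real (m choose q)" for q
      using binomial_absorb_comp[of "Suc m" q] by (metis diff_Suc_1 mult.commute of_nat_mult)
    then have "real (Suc m choose q) * y ^ q * real (Suc m - q) = real (Suc m) * (real (m choose q) * y ^ q)" for q
      by (metis mult.assoc mult.commute)
    then have "(\<Sum>q\<le>n. real (n choose q) * y ^ q * real (n - q))
        = real (Suc m) * (\<Sum>q\<le>Suc m. real (m choose q) * y ^ q)"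
      unfolding Suc by (simp only: sum_distrib_left)
    also have "(\<Sum>q\<le>Suc m. real (m choose q) * y ^ q) = (y + 1) ^ m"
      by (simp add: binomial_ring[of y 1])
    finally show ?thesis using Suc by simp
  qed simp
  finally show ?thesis .
qed

text \<open>Faulhaber's formula, by telescoping the difference equation.\<close>

lemma power_sum_eq: "power_sum l L = (bernpoly2 (l + 1) (real L) - bernoulli2 (l + 1)) / real (l + 1)"
proof (induction L)
  case 0
  have "bernpoly2 (l + 1) 0 = (\<Sum>p\<in>{0}. real ((l + 1) choose p) * bernoulli2 (l + 1 - p) * 0 ^ p)"
    unfolding bernpoly2_def by (rule sum.mono_neutral_right) auto
  then show ?case by (simp add: power_sum_def)
next
  case (Suc L)
  have "power_sum l (Suc L) = power_sum l L + (real L + 1) ^ l"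
    by (simp add: power_sum_def add.commute)
  then show ?case
    using Suc bernpoly2_step[of "l + 1" "real L"] by (simp add: add.commute add_divide_distrib diff_divide_distrib)
qed

text \<open>Faulhaber's formula re-expanded from powers of \<open>n - 1\<close> into powers of
  \<open>n\<close>. The index \<open>p\<close> starts at 1 because the constant term of the
  Bernoulli polynomial cancels.\<close>

lemma power_sum_pred:
  assumes "n \<ge> 1"
  shows "power_sum l (n - 1) = (\<Sum>q\<le>l + 1. b_coeff l q * real n ^ q)"
proof -
  let ?c = "\<lambda>p. real ((l + 1) choose p) * bernoulli2 (l + 1 - p)"
  have "bernpoly2 (l + 1) (real (n - 1)) - bernoulli2 (l + 1) = (\<Sum>p=1..l + 1. ?c p * (real n - 1) ^ p)"
    unfolding bernpoly2_def atMost_atLeast0 using assms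
    by (subst sum.atLeast_Suc_atMost) (auto simp: of_nat_diff)
  also have "\<dots> = (\<Sum>p=1..l + 1. \<Sum>q\<le>p. ?c p * (real (p choose q) * real n ^ q * (-1) ^ (p - q)))"
    by (intro sum.cong refl) (simp add: binomial_ring[of "real n" "-1", simplified] sum_distrib_left)
  also have "\<dots> = (\<Sum>(p, q)\<in>(SIGMA p:{1..l + 1}. {..p}). ?c p * (real (p choose q) * real n ^ q * (-1) ^ (p - q)))"
    by (rule sum.Sigma) auto
  also have "\<dots> = (\<Sum>(q, p)\<in>(SIGMA q:{..l + 1}. {max q 1..l + 1}). ?c p * (real (p choose q) * real n ^ q * (-1) ^ (p - q)))"
    by (rule sum.reindex_bij_witness[where i = "\<lambda>(q, p). (p, q)" and j = "\<lambda>(p, q). (q, p)"]) auto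
  also have "\<dots> = (\<Sum>q\<le>l + 1. \<Sum>p=max q 1..l + 1. ?c p * (real (p choose q) * real n ^ q * (-1) ^ (p - q)))"
    by (rule sum.Sigma[symmetric]) auto
  finally have "bernpoly2 (l + 1) (real (n - 1)) - bernoulli2 (l + 1)
      = (\<Sum>q\<le>l + 1. \<Sum>p=max q 1..l + 1. ?c p * (real (p choose q) * real n ^ q * (-1) ^ (p - q)))" .
  then show ?thesis
    unfolding power_sum_eq b_coeff_def sum_divide_distrib sum_distrib_left sum_distrib_right
    by (simp only: sum_divide_distrib) (intro sum.cong refl, simp add: mult_ac)
qed

text \<open>Hockey-stick summation: \<open>n choose (i + 1)\<close> is the sum of
  \<open>k choose i\<close> over \<open>i \<le> k < n\<close>, that is, a difference of sums up to
  \<open>n - 1\<close> and up to \<open>i - 1\<close>. This is the origin of the two sums in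
  \<open>a_coeff\<close> at \<open>p = 0\<close>.\<close>

theorem binomial_eq_a_coeff:
  assumes "i \<ge> 1" "n \<ge> 1"
  shows "real (n choose i) = (\<Sum>p\<le>i. a_coeff i p * real n ^ p)"
  using assms
proof (induction i arbitrary: n rule: dec_induct)
  case base
  then show ?case by simp
next
  case (step i n)
  then obtain j where i: "i = Suc j" by (cases i) auto
  have zero: "(\<Sum>k=1..j. real (k choose i)) = 0" by (intro sum.neutral) (auto simp: i binomial_eq_0)
  have pow: "(\<Sum>k=1..L. real (k choose i)) = (\<Sum>l\<le>i. a_coeff i l * power_sum l L)" for L
  proof -
    have "(\<Sum>k=1..L. real (k choose i)) = (\<Sum>k=1..L. \<Sum>l\<le>i. a_coeff i l * real k ^ l)"
      by (intro sum.cong refl step.IH) auto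
    also have "\<dots> = (\<Sum>l\<le>i. a_coeff i l * power_sum l L)"
      unfolding power_sum_def sum_distrib_left by (rule sum.swap)
    finally show ?thesis .
  qed
  have "real (n choose Suc i) = (\<Sum>k=1..n - 1. real (k choose i))"
  proof -
    have "(\<Sum>k\<le>n - 1. k choose i) = n choose Suc i"
      using sum_choose_upper[of i "n - 1"] step.prems by simp
    moreover have "(\<Sum>k\<le>n - 1. k choose i) = (\<Sum>k=1..n - 1. k choose i)"
      using i by (intro sum.mono_neutral_right) auto
    ultimately show ?thesis by (metis of_nat_sum)
  qed
  also have "\<dots> = (\<Sum>l\<le>i. a_coeff i l * power_sum l (n - 1)) - (\<Sum>l\<le>i. a_coeff i l * power_sum l j)"
    using zero pow[of j] pow[of "n - 1"] by simp
  also have "(\<Sum>l\<le>i. a_coeff i l * power_sum l (n - 1))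
      = (\<Sum>l\<le>i. \<Sum>q\<le>l + 1. a_coeff i l * b_coeff l q * real n ^ q)"
    using step.prems by (simp only: power_sum_pred sum_distrib_left mult.assoc)
  also have "\<dots> = (\<Sum>(l, q)\<in>(SIGMA l:{..i}. {..l + 1}). a_coeff i l * b_coeff l q * real n ^ q)"
    by (rule sum.Sigma) auto
  also have "\<dots> = (\<Sum>(q, l)\<in>(SIGMA q:{..Suc i}. {q - 1..i}). a_coeff i l * b_coeff l q * real n ^ q)"
    by (rule sum.reindex_bij_witness[where i = "\<lambda>(q, l). (l, q)" and j = "\<lambda>(l, q). (q, l)"]) auto
  also have "\<dots> = (\<Sum>q\<le>Suc i. \<Sum>l=q - 1..i. a_coeff i l * b_coeff l q * real n ^ q)"
    by (rule sum.Sigma[symmetric]) auto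
  also have "\<dots> = (\<Sum>q\<le>Suc i. (\<Sum>l=q - 1..i. a_coeff i l * b_coeff l q) * real n ^ q)"
    by (simp add: sum_distrib_right)
  also have "\<dots> - (\<Sum>l\<le>i. a_coeff i l * power_sum l j) = (\<Sum>q\<le>Suc i. a_coeff (Suc i) q * real n ^ q)"
    unfolding sum.atMost_Suc_shift by (simp add: i atMost_atLeast0)
  finally show ?case .
qed

section \<open>Concatenation products\<close>

text \<open>Convolution on the free monoid of words: the coefficients of a product of two series in
  noncommuting derivative symbols.\<close>

definition concat_mult :: "('n list \<Rightarrow> real) \<Rightarrow> ('n list \<Rightarrow> real) \<Rightarrow> 'n list \<Rightarrow> real" where
  "concat_mult f g \<gamma> = (\<Sum>k\<le>length \<gamma>. f (take k \<gamma>) * g (drop k \<gamma>))"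

fun concat_power :: "('n list \<Rightarrow> real) \<Rightarrow> nat \<Rightarrow> 'n list \<Rightarrow> real" where
  "concat_power f 0 = (\<lambda>\<gamma>. if \<gamma> = [] then 1 else 0)"
| "concat_power f (Suc i) = concat_mult f (concat_power f i)"

lemma concat_mult_assoc: "concat_mult (concat_mult f g) h = concat_mult f (concat_mult g h)"
proof
  fix \<gamma> :: "'a list"
  let ?n = "length \<gamma>"
  have "concat_mult (concat_mult f g) h \<gamma>
      = (\<Sum>k\<le>?n. \<Sum>j\<le>k. f (take j \<gamma>) * g (drop j (take k \<gamma>)) * h (drop k \<gamma>))"
    unfolding concat_mult_def by (simp add: sum_distrib_right min_absorb1)
  also have "\<dots> = (\<Sum>j\<le>?n. \<Sum>k=j..?n. f (take j \<gamma>) * g (drop j (take k \<gamma>)) * h (drop k \<gamma>))"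
    by (rule sum_triangle_swap)
  also have "\<dots> = concat_mult f (concat_mult g h) \<gamma>"
    unfolding concat_mult_def sum_distrib_left
  proof (rule sum.cong[OF refl])
    fix j assume "j \<in> {..?n}"
    then show "(\<Sum>k=j..?n. f (take j \<gamma>) * g (drop j (take k \<gamma>)) * h (drop k \<gamma>))
        = (\<Sum>m\<le>length (drop j \<gamma>). f (take j \<gamma>) * (g (take m (drop j \<gamma>)) * h (drop m (drop j \<gamma>))))"
      by (intro sum.reindex_bij_witness[where i = "\<lambda>m. m + j" and j = "\<lambda>k. k - j"])
        (auto simp: drop_take)
  qed
  finally show "concat_mult (concat_mult f g) h \<gamma> = concat_mult f (concat_mult g h) \<gamma>" .
qed

lemma concat_mult_unit [simp]: "concat_mult f (\<lambda>\<gamma>. if \<gamma> = [] then 1 else 0) = f"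
proof
  fix \<gamma> :: "'a list"
  have "concat_mult f (\<lambda>\<gamma>. if \<gamma> = [] then 1 else 0) \<gamma>
      = (\<Sum>k\<in>{length \<gamma>}. f (take k \<gamma>) * (if drop k \<gamma> = [] then 1 else 0))"
    unfolding concat_mult_def by (rule sum.mono_neutral_right) auto
  then show "concat_mult f (\<lambda>\<gamma>. if \<gamma> = [] then 1 else 0) \<gamma> = f \<gamma>" by simp
qed

lemma c_coeff_eq_concat_power: "c_coeff \<Delta> (Suc i) = concat_power (c1_coeff \<Delta>) (Suc i)"
proof (induction i)
  case 0
  show ?case by (simp add: fun_eq_iff)
next
  case (Suc i)
  then show ?case by (simp add: fun_eq_iff concat_mult_def)
qed

text \<open>A word with a cut position is the same thing as the pair of its two pieces.\<close>

lemma sum_splits: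
  fixes F :: "'n::finite list \<Rightarrow> 'n list \<Rightarrow> real"
  shows "(\<Sum>\<gamma> | length \<gamma> \<le> N. \<Sum>k\<le>length \<gamma>. F (take k \<gamma>) (drop k \<gamma>))
    = (\<Sum>\<beta> | length \<beta> \<le> N. \<Sum>\<delta> | length \<delta> \<le> N - length \<beta>. F \<beta> \<delta>)"
proof -
  have "(\<Sum>\<gamma> | length \<gamma> \<le> N. \<Sum>k\<le>length \<gamma>. F (take k \<gamma>) (drop k \<gamma>))
      = (\<Sum>(\<gamma>, k)\<in>(SIGMA \<gamma>:{\<gamma>. length \<gamma> \<le> N}. {..length \<gamma>}). F (take k \<gamma>) (drop k \<gamma>))"
    by (rule sum.Sigma) auto
  also have "\<dots> = (\<Sum>(\<beta>, \<delta>)\<in>(SIGMA \<beta>:{\<beta>. length \<beta> \<le> N}. {\<delta>. length \<delta> \<le> N - length \<beta>}). F \<beta> \<delta>)"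
    by (rule sum.reindex_bij_witness[where i = "\<lambda>(\<beta>, \<delta>). (\<beta> @ \<delta>, length \<beta>)"
        and j = "\<lambda>(\<gamma>, k). (take k \<gamma>, drop k \<gamma>)"]) auto
  also have "\<dots> = (\<Sum>\<beta> | length \<beta> \<le> N. \<Sum>\<delta> | length \<delta> \<le> N - length \<beta>. F \<beta> \<delta>)"
    by (rule sum.Sigma[symmetric]) auto
  finally show ?thesis .
qed

lemma sum_concat_mult:
  fixes X :: "'n::finite list \<Rightarrow> real"
  shows "(\<Sum>\<gamma> | length \<gamma> \<le> N. concat_mult f g \<gamma> * X \<gamma>)
    = (\<Sum>\<beta> | length \<beta> \<le> N. \<Sum>\<delta> | length \<delta> \<le> N - length \<beta>. f \<beta> * g \<delta> * X (\<beta> @ \<delta>))"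
  unfolding concat_mult_def sum_distrib_right
  using sum_splits[of "\<lambda>\<beta> \<delta>. f \<beta> * g \<delta> * X (\<beta> @ \<delta>)" N] by simp

section \<open>The heat series, its inverse and the coefficients of C\<close>

lemma paired_simps [simp]:
  "paired [] = 1" "paired [x] = 0" "paired (x # y # zs) = (if x = y then paired zs else 0)"
proof -
  have "(\<forall>j<Suc m. P j) \<longleftrightarrow> P 0 \<and> (\<forall>j<m. P (Suc j))" for m P
    using less_Suc_eq_0_disj by auto
  then show "paired (x # y # zs) = (if x = y then paired zs else 0)"
    by (auto simp: paired_def)
qed (auto simp: paired_def)

lemma paired_odd: "odd (length \<alpha>) \<Longrightarrow> paired \<alpha> = 0"
  by (simp add: paired_def)

lemma paired_append: "even (length \<alpha>) \<Longrightarrow> paired (\<alpha> @ \<beta>) = paired \<alpha> * paired \<beta>"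
  by (induction \<alpha> rule: induct_list012) auto

text \<open>The coefficients of \<open>exp (Laplacian / 2)\<close> and, below, of its inverse, as series in \<open>\<partial>\<^sup>\<delta>\<close>.\<close>
definition heat_coeff :: "'n list \<Rightarrow> real" where
  "heat_coeff \<delta> = paired \<delta> / (2 ^ (length \<delta> div 2) * fact (length \<delta> div 2))"

definition inv_heat_coeff :: "'n list \<Rightarrow> real" where
  "inv_heat_coeff \<delta> = (-1) ^ (length \<delta> div 2) * heat_coeff \<delta>"

text \<open>For the moment gaps of F these are the coefficients of (E exp(F \<partial>) - E exp(G
  \<partial>)) exp(-Laplacian / 2), the error of one factor relative to the Gaussian one.\<close>

lemma c1_coeff_eq: "c1_coeff \<Delta> = concat_mult (\<lambda>\<alpha>. \<Delta> \<alpha> / fact (length \<alpha>)) inv_heat_coeff"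
  by (rule ext) (auto simp: c1_coeff_def concat_mult_def inv_heat_coeff_def heat_coeff_def Let_def
      min_absorb1 ac_simps intro!: sum.cong)

text \<open>Only cuts at even positions survive. There \<open>paired\<close> is multiplicative and
  the factorials combine into an alternating sum of binomial coefficients, which vanishes unless the
  word is empty.\<close>

lemma concat_mult_heat: "concat_mult inv_heat_coeff heat_coeff = (\<lambda>\<gamma>. if \<gamma> = [] then 1 else 0)"
proof
  fix \<gamma> :: "'a list"
  show "concat_mult inv_heat_coeff heat_coeff \<gamma> = (if \<gamma> = [] then 1 else 0)"
  proof (cases "even (length \<gamma>)")
    case False
    then have "inv_heat_coeff (take k \<gamma>) * heat_coeff (drop k \<gamma>) = 0" if "k \<le> length \<gamma>" for k
      using that by (cases "even k") (auto simp: inv_heat_coeff_def heat_coeff_def paired_odd)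
    then have "concat_mult inv_heat_coeff heat_coeff \<gamma> = 0"
      unfolding concat_mult_def by (intro sum.neutral) auto
    then show ?thesis using False by auto
  next
    case True
    then obtain K where K: "length \<gamma> = 2 * K" by blast
    let ?F = "\<lambda>k. inv_heat_coeff (take k \<gamma>) * heat_coeff (drop k \<gamma>)"
    have "concat_mult inv_heat_coeff heat_coeff \<gamma> = (\<Sum>k\<in>(*) 2 ` {..K}. ?F k)"
      unfolding concat_mult_def
    proof (rule sum.mono_neutral_right)
      show "\<forall>k\<in>{..length \<gamma>} - (*) 2 ` {..K}. ?F k = 0"
      proof
        fix k assume k: "k \<in> {..length \<gamma>} - (*) 2 ` {..K}"
        then have "odd k" using K by (auto elim!: evenE)
        then show "?F k = 0" using k by (auto simp: inv_heat_coeff_def heat_coeff_def paired_odd)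
      qed
    qed (use K in auto)
    also have "\<dots> = (\<Sum>j\<le>K. ?F (2 * j))"
      by (subst sum.reindex) (auto simp: inj_on_def)
    also have "\<dots> = (\<Sum>j\<le>K. paired \<gamma> / (2 ^ K * fact K) * ((-1) ^ j * real (K choose j)))"
    proof (intro sum.cong refl)
      fix j assume "j \<in> {..K}"
      then have j: "j \<le> K" by simp
      have "paired \<gamma> = paired (take (2 * j) \<gamma>) * paired (drop (2 * j) \<gamma>)"
        using paired_append[of "take (2 * j) \<gamma>" "drop (2 * j) \<gamma>"] j K by simp
      moreover have "length (drop (2 * j) \<gamma>) div 2 = K - j" using K by simp
      moreover have "(2 :: real) ^ K = 2 ^ j * 2 ^ (K - j)" using j by (simp flip: power_add)
      ultimately show "?F (2 * j) = paired \<gamma> / (2 ^ K * fact K) * ((-1) ^ j * real (K choose j))"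
        using j K by (simp add: inv_heat_coeff_def heat_coeff_def min_absorb1 binomial_fact ac_simps)
    qed
    also have "\<dots> = paired \<gamma> / (2 ^ K * fact K) * (\<Sum>j\<le>K. (-1) ^ j * real (K choose j))"
      by (simp only: sum_distrib_left)
    also have "\<dots> = (if \<gamma> = [] then 1 else 0)"
    proof (cases "K = 0")
      case True
      then show ?thesis using K by simp
    next
      case False
      then have "(\<Sum>j\<le>K. (-1) ^ j * real (K choose j)) = 0"
        by (intro choose_alternating_sum) simp
      moreover have "\<gamma> \<noteq> []" using False K by auto
      ultimately show ?thesis by simp
    qed
    finally show ?thesis .
  qed
qed

text \<open>Multiplication by the heat series undoes the inverse and returns the plain moment gaps;
  this is the algebraic content of \<open>P = G (1 + C)\<close>.\<close>

lemma c1_coeff_heat: "concat_mult (c1_coeff \<Delta>) heat_coeff \<gamma> = \<Delta> \<gamma> / fact (length \<gamma>)"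
  unfolding c1_coeff_eq concat_mult_assoc concat_mult_heat by simp

lemma abs_heat_coeff_le: "\<bar>heat_coeff \<delta>\<bar> \<le> 1" "\<bar>inv_heat_coeff \<delta>\<bar> \<le> 1"
proof -
  have "1 \<le> (2 :: real) ^ k * fact k" for k
    using mult_mono[of 1 "(2 :: real) ^ k" 1 "fact k"] by simp
  then show "\<bar>heat_coeff \<delta>\<bar> \<le> 1"
    by (auto simp: heat_coeff_def paired_def abs_mult divide_le_eq)
  then show "\<bar>inv_heat_coeff \<delta>\<bar> \<le> 1"
    by (simp add: inv_heat_coeff_def abs_mult power_abs)
qed

lemma c1_coeff_bound:
  assumes "\<And>k. k \<le> length \<gamma> \<Longrightarrow> \<bar>\<Delta> (take k \<gamma>)\<bar> \<le> d"
  shows "\<bar>c1_coeff \<Delta> \<gamma>\<bar> \<le> (real (length \<gamma>) + 1) * d"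
proof -
  have "\<bar>\<Delta> (take k \<gamma>) / fact (length (take k \<gamma>)) * inv_heat_coeff (drop k \<gamma>)\<bar> \<le> d" if k: "k \<le> length \<gamma>" for k
  proof -
    have "\<bar>\<Delta> (take k \<gamma>)\<bar> / fact (length (take k \<gamma>)) \<le> \<bar>\<Delta> (take k \<gamma>)\<bar>"
      using fact_ge_1[of "length (take k \<gamma>)", where ?'a = real]
      by (simp add: divide_le_eq mult_le_cancel_left1)
    then have "\<bar>\<Delta> (take k \<gamma>)\<bar> / fact (length (take k \<gamma>)) * \<bar>inv_heat_coeff (drop k \<gamma>)\<bar> \<le> d * 1"
      using assms[OF k] abs_heat_coeff_le by (intro mult_mono) auto
    then show ?thesis by (simp add: abs_mult)
  qed
  then have "\<bar>c1_coeff \<Delta> \<gamma>\<bar> \<le> (\<Sum>k\<le>length \<gamma>. d)"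
    unfolding c1_coeff_eq concat_mult_def by (intro order_trans[OF sum_abs] sum_mono) auto
  then show ?thesis by (simp add: add.commute)
qed

lemma c1_coeff_eq_0:
  assumes "\<And>\<alpha>. length \<alpha> \<le> 2 \<Longrightarrow> \<Delta> \<alpha> = 0" "length \<gamma> < 3"
  shows "c1_coeff \<Delta> \<gamma> = 0"
proof -
  have "\<bar>c1_coeff \<Delta> \<gamma>\<bar> \<le> (real (length \<gamma>) + 1) * 0"
    using assms by (intro c1_coeff_bound) auto
  then show ?thesis by simp
qed

text \<open>A nonzero product of \<open>i\<close> factors needs \<open>i\<close> pieces of length at
  least 3.\<close>

lemma concat_power_eq_0:
  assumes "\<And>\<gamma>. length \<gamma> < 3 \<Longrightarrow> f \<gamma> = 0" "length \<gamma> < 3 * i"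
  shows "concat_power f i \<gamma> = 0"
  using assms(2)
proof (induction i arbitrary: \<gamma>)
  case (Suc i)
  have "f (take k \<gamma>) * concat_power f i (drop k \<gamma>) = 0" if "k \<le> length \<gamma>" for k
  proof (cases "k < 3")
    case True
    then have "f (take k \<gamma>) = 0" by (intro assms(1)) auto
    then show ?thesis by simp
  next
    case False
    then have "concat_power f i (drop k \<gamma>) = 0" using Suc.prems that by (intro Suc.IH) auto
    then show ?thesis by simp
  qed
  then show ?case unfolding concat_power.simps concat_mult_def by (intro sum.neutral) auto
qed simp

lemma concat_power_scale:
  "concat_power (\<lambda>\<gamma>. s ^ length \<gamma> * f \<gamma>) i \<gamma> = s ^ length \<gamma> * concat_power f i \<gamma>"
proof (induction i arbitrary: \<gamma>)
  case (Suc i)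
  have "(s ^ length (take k \<gamma>) * f (take k \<gamma>)) * (s ^ length (drop k \<gamma>) * concat_power f i (drop k \<gamma>))
      = s ^ length \<gamma> * (f (take k \<gamma>) * concat_power f i (drop k \<gamma>))" if "k \<le> length \<gamma>" for k
  proof -
    have "s ^ length \<gamma> = s ^ length (take k \<gamma>) * s ^ length (drop k \<gamma>)"
      using that by (simp add: min_absorb1 flip: power_add)
    then show ?thesis by (simp only: mult_ac)
  qed
  then show ?case
    unfolding concat_power.simps concat_mult_def sum_distrib_left Suc.IH by (intro sum.cong refl) simp
qed simp

text \<open>All pieces of a word of length at most \<open>r\<close> are that short themselves, so
  products on such words never see the cut.\<close>

lemma concat_power_truncate:
  assumes "length \<gamma> \<le> r"
  shows "concat_power (\<lambda>\<gamma>. if length \<gamma> \<le> r then f \<gamma> else 0) i \<gamma> = concat_power f i \<gamma>"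
  using assms
proof (induction i arbitrary: \<gamma>)
  case (Suc i)
  have "concat_power (\<lambda>\<gamma>. if length \<gamma> \<le> r then f \<gamma> else 0) i (drop k \<gamma>)
      = concat_power f i (drop k \<gamma>)" for k
    using Suc.prems by (intro Suc.IH) simp
  then show ?case
    using Suc.prems unfolding concat_power.simps concat_mult_def by (intro sum.cong) auto
qed simp

lemma concat_power_long:
  assumes "\<And>\<gamma>. length \<gamma> > r \<Longrightarrow> f \<gamma> = 0" "length \<gamma> > i * r"
  shows "concat_power f i \<gamma> = 0"
  using assms(2)
proof (induction i arbitrary: \<gamma>)
  case (Suc i)
  have "f (take k \<gamma>) * concat_power f i (drop k \<gamma>) = 0" if "k \<le> length \<gamma>" for k
  proof (cases "k > r")
    case True
    then have "f (take k \<gamma>) = 0" using that by (intro assms(1)) auto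
    then show ?thesis by simp
  next
    case False
    then have "concat_power f i (drop k \<gamma>) = 0" using Suc.prems by (intro Suc.IH) auto
    then show ?thesis by simp
  qed
  then show ?case unfolding concat_power.simps concat_mult_def by (intro sum.neutral) auto
qed auto

lemma concat_power_bound:
  assumes "\<And>\<gamma>. \<bar>f \<gamma>\<bar> \<le> a" "length \<gamma> \<le> N"
  shows "\<bar>concat_power f i \<gamma>\<bar> \<le> ((real N + 1) * a) ^ i"
  using assms(2)
proof (induction i arbitrary: \<gamma>)
  case (Suc i)
  have a: "0 \<le> a" using assms(1)[of "[]"] by linarith
  have "\<bar>f (take k \<gamma>) * concat_power f i (drop k \<gamma>)\<bar> \<le> a * ((real N + 1) * a) ^ i" for k
    unfolding abs_mult using Suc a by (intro mult_mono assms(1) Suc.IH) auto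
  then have "\<bar>concat_power f (Suc i) \<gamma>\<bar> \<le> (\<Sum>k\<le>length \<gamma>. a * ((real N + 1) * a) ^ i)"
    unfolding concat_power.simps concat_mult_def by (intro order_trans[OF sum_abs] sum_mono) auto
  also have "\<dots> = (real (length \<gamma>) + 1) * (a * ((real N + 1) * a) ^ i)" by simp
  also have "\<dots> \<le> (real N + 1) * (a * ((real N + 1) * a) ^ i)"
    using Suc.prems a by (intro mult_right_mono) auto
  finally show ?case by (simp add: mult_ac)
qed simp

text \<open>The bound \<open>K ^ (length \<gamma> - 2)\<close> is multiplicative under
  concatenation, each factor losing two powers of \<open>K\<close>. When \<open>K ^ (r - 1)\<close>
  dominates the top moment, this keeps the right power of that moment in every coefficient.\<close>

lemma concat_power_bound_graded:
  assumes f0: "\<And>\<gamma>. length \<gamma> < 3 \<Longrightarrow> f \<gamma> = 0"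
    and f1: "\<And>\<gamma>. 3 \<le> length \<gamma> \<Longrightarrow> length \<gamma> \<le> r \<Longrightarrow> \<bar>f \<gamma>\<bar> \<le> a * K ^ (length \<gamma> - 2)"
    and "0 \<le> a" "0 \<le> K" "length \<gamma> \<le> r"
  shows "\<bar>concat_power f i \<gamma>\<bar> \<le> ((real r + 1) * a) ^ i * K ^ (length \<gamma> - 2 * i)"
  using assms(5)
proof (induction i arbitrary: \<gamma>)
  case (Suc i)
  let ?A = "((real r + 1) * a) ^ i"
  have A: "0 \<le> ?A" using assms by simp
  have "\<bar>f (take k \<gamma>) * concat_power f i (drop k \<gamma>)\<bar> \<le> a * ?A * K ^ (length \<gamma> - 2 * Suc i)"
    if k: "k \<le> length \<gamma>" for k
  \<comment> \<open>Outside the vanishing cases \<open>k \<ge> 3\<close> and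
    \<open>length \<gamma> - k \<ge> 3 * i\<close>, so the natural-number subtractions in the
    exponents are exact and add up.\<close>
  proof (cases "k < 3 \<or> length \<gamma> - k < 3 * i")
    case True
    then have "f (take k \<gamma>) = 0 \<or> concat_power f i (drop k \<gamma>) = 0"
      using f0[of "take k \<gamma>"] concat_power_eq_0[of f "drop k \<gamma>" i] f0 k by auto
    then show ?thesis using assms A by auto
  next
    case False
    then have "\<bar>f (take k \<gamma>)\<bar> \<le> a * K ^ (k - 2)" using f1[of "take k \<gamma>"] k Suc.prems by (simp add: min_absorb1)
    moreover have "\<bar>concat_power f i (drop k \<gamma>)\<bar> \<le> ?A * K ^ (length \<gamma> - k - 2 * i)"
      using Suc.IH[of "drop k \<gamma>"] Suc.prems by simp
    ultimately have "\<bar>f (take k \<gamma>) * concat_power f i (drop k \<gamma>)\<bar> \<le> a * K ^ (k - 2) * (?A * K ^ (length \<gamma> - k - 2 * i))"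
      unfolding abs_mult using assms by (intro mult_mono) auto
    also have "\<dots> = a * ?A * (K ^ (k - 2) * K ^ (length \<gamma> - k - 2 * i))" by (simp add: mult_ac)
    also have "K ^ (k - 2) * K ^ (length \<gamma> - k - 2 * i) = K ^ (length \<gamma> - 2 * Suc i)"
    proof -
      have "(k - 2) + (length \<gamma> - k - 2 * i) = length \<gamma> - 2 * Suc i" using False k by auto
      then show ?thesis by (simp flip: power_add)
    qed
    finally show ?thesis .
  qed
  then have "\<bar>concat_power f (Suc i) \<gamma>\<bar> \<le> (\<Sum>k\<le>length \<gamma>. a * ?A * K ^ (length \<gamma> - 2 * Suc i))"
    unfolding concat_power.simps concat_mult_def by (intro order_trans[OF sum_abs] sum_mono) auto
  also have "\<dots> = (real (length \<gamma>) + 1) * (a * ?A * K ^ (length \<gamma> - 2 * Suc i))" by simp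
  also have "\<dots> \<le> (real r + 1) * (a * ?A * K ^ (length \<gamma> - 2 * Suc i))"
    using Suc.prems assms by (intro mult_right_mono mult_nonneg_nonneg A) auto
  finally show ?case by (simp add: mult_ac)
qed (use assms(4) in simp)

text \<open>Composition of operators concatenates words, so powers of the operator have the
  concatenation powers of \<open>u\<close> as coefficients.\<close>

lemma diff_op_power:
  fixes D :: "'n::finite list \<Rightarrow> real^'n \<Rightarrow> real"
  assumes "\<And>\<gamma>. length \<gamma> > r \<Longrightarrow> u \<gamma> = 0"
  shows "(diff_op u r ^^ i) D \<alpha> x = (\<Sum>\<gamma> | length \<gamma> \<le> i * r. concat_power u i \<gamma> * D (\<gamma> @ \<alpha>) x)"
proof (induction i arbitrary: D)
  case 0
  have "{\<gamma> :: 'n list. length \<gamma> \<le> 0 * r} = {[]}" by auto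
  then show ?case by simp
next
  case (Suc i)
  let ?N = "Suc i * r"
  have "(diff_op u r ^^ Suc i) D \<alpha> x
      = (\<Sum>\<gamma> | length \<gamma> \<le> i * r. \<Sum>\<beta> | length \<beta> \<le> r. u \<beta> * concat_power u i \<gamma> * D (\<beta> @ \<gamma> @ \<alpha>) x)"
    unfolding funpow_Suc_right comp_def Suc diff_op_def by (simp add: sum_distrib_left mult_ac)
  also have "\<dots> = (\<Sum>\<beta> | length \<beta> \<le> r. \<Sum>\<gamma> | length \<gamma> \<le> i * r. u \<beta> * concat_power u i \<gamma> * D (\<beta> @ \<gamma> @ \<alpha>) x)"
    by (rule sum.swap)
  \<comment> \<open>Words longer than \<open>r\<close>, respectively \<open>i * r\<close>, have
    coefficient 0, so both ranges may be enlarged to total length at most \<open>?N\<close>, the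
    shape of \<open>sum_concat_mult\<close>.\<close>
  also have "\<dots> = (\<Sum>\<beta> | length \<beta> \<le> ?N. \<Sum>\<gamma> | length \<gamma> \<le> ?N - length \<beta>. u \<beta> * concat_power u i \<gamma> * D (\<beta> @ \<gamma> @ \<alpha>) x)"
  proof (rule sum.mono_neutral_cong_left)
    fix \<beta> :: "'n list" assume "\<beta> \<in> {\<beta>. length \<beta> \<le> r}"
    then show "(\<Sum>\<gamma> | length \<gamma> \<le> i * r. u \<beta> * concat_power u i \<gamma> * D (\<beta> @ \<gamma> @ \<alpha>) x)
        = (\<Sum>\<gamma> | length \<gamma> \<le> ?N - length \<beta>. u \<beta> * concat_power u i \<gamma> * D (\<beta> @ \<gamma> @ \<alpha>) x)"
      by (intro sum.mono_neutral_left) (auto simp: concat_power_long[OF assms])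
  qed (use assms in auto)
  also have "\<dots> = (\<Sum>\<gamma> | length \<gamma> \<le> ?N. concat_power u (Suc i) \<gamma> * D (\<gamma> @ \<alpha>) x)"
    using sum_concat_mult[of u "concat_power u i" "\<lambda>\<gamma>. D (\<gamma> @ \<alpha>) x" ?N] by simp
  finally show ?case .
qed

section \<open>The standard Gaussian measure\<close>

lemma sum_Basis_vec_nth: "(\<Sum>b\<in>Basis. g b *\<^sub>R b) $ i = g (axis i 1)" for g :: "real^'n \<Rightarrow> real"
proof -
  have "(\<Sum>b\<in>Basis. g b *\<^sub>R b) $ i = (\<Sum>b\<in>Basis. g b *\<^sub>R b) \<bullet> axis i 1"
    by (simp add: inner_axis)
  also have "\<dots> = g (axis i 1)" by (intro inner_sum_left_Basis) (simp add: axis_in_Basis_iff)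
  finally show ?thesis .
qed

text \<open>Lebesgue measure is the image of the product measure indexed by \<open>Basis\<close>;
  \<open>idx\<close> translates basis vectors back into coordinate indices, and Fubini applies to
  the product of lines.\<close>

lemma prod_vec_nth_lborel:
  fixes f :: "'n::finite \<Rightarrow> real \<Rightarrow> real"
  assumes "\<And>i. integrable lborel (f i)"
  shows "integrable lborel (\<lambda>x :: real^'n. \<Prod>i\<in>UNIV. f i (x $ i))"
    and "(\<integral>x. (\<Prod>i\<in>UNIV. f i (x $ i)) \<partial>(lborel :: (real^'n) measure)) = (\<Prod>i\<in>UNIV. \<integral>y. f i y \<partial>lborel)"
proof -
  interpret product_sigma_finite "\<lambda>_ :: real^'n. lborel :: real measure" ..
  define idx where "idx b = (SOME i. b = axis i (1 :: real))" for b :: "real^'n"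
  have idx: "idx (axis i 1) = i" for i
    unfolding idx_def by (rule some_equality) (auto simp: axis_eq_axis)
  have Basis: "(Basis :: (real^'n) set) = (\<lambda>i. axis i 1) ` UNIV"
    by (auto simp: Basis_vec_def)
  have inj: "inj (\<lambda>i :: 'n. axis i (1 :: real))" by (auto simp: inj_def axis_eq_axis)
  have [measurable]: "f i \<in> borel_measurable borel" for i using assms[of i] by auto
  let ?T = "\<lambda>g :: real^'n \<Rightarrow> real. \<Sum>b\<in>Basis. g b *\<^sub>R b"
  have T: "?T \<in> measurable (\<Pi>\<^sub>M b\<in>Basis. lborel) borel" by measurable
  have F: "(\<lambda>x :: real^'n. \<Prod>i\<in>UNIV. f i (x $ i)) \<in> borel_measurable borel" by measurable
  have eq: "(\<Prod>i\<in>UNIV. f i (?T g $ i)) = (\<Prod>b\<in>Basis. f (idx b) (g b))" for g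
    unfolding sum_Basis_vec_nth unfolding Basis by (subst prod.reindex[OF inj]) (simp add: idx)
  have int: "integrable (\<Pi>\<^sub>M b\<in>Basis. lborel) (\<lambda>g. \<Prod>b\<in>Basis. f (idx b) (g b))"
    by (intro product_integrable_prod assms) simp
  show "integrable lborel (\<lambda>x :: real^'n. \<Prod>i\<in>UNIV. f i (x $ i))"
    by (subst lborel_eq, subst integrable_distr_eq[OF T F]) (simp only: eq int)
  have "(\<integral>x. (\<Prod>i\<in>UNIV. f i (x $ i)) \<partial>(lborel :: (real^'n) measure))
      = (\<integral>g. (\<Prod>b\<in>Basis. f (idx b) (g b)) \<partial>(\<Pi>\<^sub>M b\<in>Basis. lborel))"
    by (subst lborel_eq, subst integral_distr[OF T F]) (simp only: eq)
  also have "\<dots> = (\<Prod>b\<in>Basis. \<integral>y. f (idx b) y \<partial>lborel)"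
    by (intro product_integral_prod assms) simp
  also have "\<dots> = (\<Prod>i\<in>UNIV. \<integral>y. f i y \<partial>lborel)"
    unfolding Basis by (subst prod.reindex[OF inj]) (simp add: idx)
  finally show "(\<integral>x. (\<Prod>i\<in>UNIV. f i (x $ i)) \<partial>(lborel :: (real^'n) measure)) = (\<Prod>i\<in>UNIV. \<integral>y. f i y \<partial>lborel)" .
qed

lemma norm_vec_power2: "(norm x)\<^sup>2 = (\<Sum>i\<in>UNIV. (x $ i)\<^sup>2)" for x :: "real^'n"
  unfolding power2_norm_eq_inner inner_vec_def by (simp add: power2_eq_square)

lemma gauss_density_eq_prod: "gauss_density x = (\<Prod>i\<in>UNIV. std_normal_density (x $ i))"
proof -
  have "exp (- (norm x)\<^sup>2 / 2) = (\<Prod>i\<in>UNIV. exp (- (x $ i)\<^sup>2 / 2))"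
    unfolding norm_vec_power2 by (simp add: exp_sum sum_divide_distrib sum_negf flip: exp_sum)
  then show ?thesis
    by (simp add: gauss_density_def std_normal_density_def prod_dividef power_one_over)
qed

lemma gauss_density_pos: "0 < gauss_density x"
  by (simp add: gauss_density_def)

lemma gauss_density_measurable [measurable]: "gauss_density \<in> borel_measurable borel"
  unfolding gauss_density_def[abs_def] by measurable

lemma sets_std_gaussian [simp, measurable_cong]: "sets std_gaussian = sets borel"
  by (simp add: std_gaussian_def)

lemma space_std_gaussian [simp]: "space std_gaussian = UNIV"
  by (simp add: std_gaussian_def)

lemma gauss_density_integral:
  "integrable lborel (gauss_density :: real^'n \<Rightarrow> real)" "(\<integral>x. gauss_density x \<partial>(lborel :: (real^'n) measure)) = 1"
  unfolding gauss_density_eq_prod[abs_def]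
  using prod_vec_nth_lborel[of "\<lambda>_ :: 'n. std_normal_density"] by auto

lemma std_gaussian_integral:
  fixes h :: "real^'n \<Rightarrow> real"
  assumes "h \<in> borel_measurable borel"
  shows "integral\<^sup>L std_gaussian h = (\<integral>x. gauss_density x * h x \<partial>lborel)"
    "integrable std_gaussian h \<longleftrightarrow> integrable lborel (\<lambda>x. gauss_density x * h x)"
proof -
  have "AE x in lborel. 0 \<le> gauss_density (x :: real^'n)"
    using gauss_density_pos by (auto intro: less_imp_le)
  then show "integral\<^sup>L std_gaussian h = (\<integral>x. gauss_density x * h x \<partial>lborel)"
    "integrable std_gaussian h \<longleftrightarrow> integrable lborel (\<lambda>x. gauss_density x * h x)"
    unfolding std_gaussian_def using assms by (auto simp: integral_density integrable_density)
qed

lemma prob_space_std_gaussian: "prob_space (std_gaussian :: (real^'n) measure)"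
proof
  have "emeasure (std_gaussian :: (real^'n) measure) (space std_gaussian) = (\<integral>\<^sup>+x. gauss_density x \<partial>(lborel :: (real^'n) measure))"
    by (simp add: std_gaussian_def emeasure_density)
  also have "\<dots> = ennreal (\<integral>x. gauss_density x \<partial>(lborel :: (real^'n) measure))"
    by (intro nn_integral_eq_integral gauss_density_integral) (simp add: gauss_density_pos less_imp_le)
  finally show "emeasure (std_gaussian :: (real^'n) measure) (space std_gaussian) = 1"
    by (simp add: gauss_density_integral)
qed

interpretation std_gaussian: prob_space "std_gaussian :: (real^'n) measure"
  by (rule prob_space_std_gaussian)

lemma mpower_eq_prod: "mpower x \<alpha> = (\<Prod>i\<in>UNIV. (x $ i) ^ count_list \<alpha> i)" for x :: "real^'n"
proof (induction \<alpha>)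
  case (Cons j \<alpha>)
  have "(\<Prod>i\<in>UNIV. (x $ i) ^ count_list (j # \<alpha>) i)
      = (\<Prod>i\<in>UNIV. (if i = j then x $ j else 1) * (x $ i) ^ count_list \<alpha> i)"
    by (intro prod.cong) auto
  then show ?case by (simp add: prod.distrib Cons)
qed simp

lemma mpower_measurable [measurable]: "(\<lambda>x :: real^'n. mpower x \<alpha>) \<in> borel_measurable borel"
  unfolding mpower_eq_prod by measurable

lemma gaussian_moment: "(\<integral>x. mpower x \<alpha> \<partial>(std_gaussian :: (real^'n) measure))
    = (\<Prod>i\<in>UNIV. \<integral>y. std_normal_density y * y ^ count_list \<alpha> i \<partial>lborel)"
proof -
  have "(\<integral>x. mpower x \<alpha> \<partial>(std_gaussian :: (real^'n) measure))
      = (\<integral>x. (\<Prod>i\<in>UNIV. std_normal_density (x $ i) * (x $ i) ^ count_list \<alpha> i) \<partial>(lborel :: (real^'n) measure))"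
    by (simp add: std_gaussian_integral gauss_density_eq_prod mpower_eq_prod prod.distrib)
  also have "\<dots> = (\<Prod>i\<in>UNIV. \<integral>y. std_normal_density y * y ^ count_list \<alpha> i \<partial>lborel)"
    by (rule prod_vec_nth_lborel) (rule integrable_std_normal_moment)
  finally show ?thesis .
qed

lemma gaussian_moment_1: "(\<integral>x. mpower x [i] \<partial>(std_gaussian :: (real^'n) measure)) = 0"
proof -
  have "(\<integral>y. std_normal_density y * y ^ count_list [i] i \<partial>lborel) = 0"
    using integral_std_normal_moment_odd[of 0] by simp
  then show ?thesis unfolding gaussian_moment by (intro prod_zero) auto
qed

lemma gaussian_moment_2:
  "(\<integral>x. mpower x [i, j] \<partial>(std_gaussian :: (real^'n) measure)) = (if i = j then 1 else 0)"
proof (cases "i = j")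
  case True
  have "(\<integral>y. std_normal_density y * y ^ count_list [i, j] k \<partial>lborel) = 1" for k
    using integral_std_normal_moment_even[of 1] True by (cases "k = i") (auto simp: numeral_2_eq_2)
  then show ?thesis unfolding gaussian_moment using True by simp
next
  case False
  have "(\<integral>y. std_normal_density y * y ^ count_list [i, j] i \<partial>lborel) = 0"
    using integral_std_normal_moment_odd[of 0] False by simp
  then show ?thesis unfolding gaussian_moment using False by (auto intro!: prod_zero)
qed

lemma integrable_exp_norm: "integrable lborel (\<lambda>x :: real^'n. exp (- (norm x)\<^sup>2 / 8))"
proof -
  have "integrable lborel (\<lambda>y. sqrt (8 * pi) * normal_density 0 2 y)" by simp
  then have *: "integrable lborel (\<lambda>y :: real. exp (- y\<^sup>2 / 8))"
    by (simp add: normal_density_def)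
  have "exp (- (norm x)\<^sup>2 / 8) = (\<Prod>i\<in>UNIV. exp (- (x $ i)\<^sup>2 / 8))" for x :: "real^'n"
    unfolding norm_vec_power2 by (simp add: exp_sum sum_divide_distrib sum_negf flip: exp_sum)
  then show ?thesis using prod_vec_nth_lborel(1)[of "\<lambda>_ :: 'n. \<lambda>y. exp (- y\<^sup>2 / 8)"] * by simp
qed

lemma gaussian_norm_power: "integrable std_gaussian (\<lambda>x :: real^'n. norm x ^ q)"
proof -
  have *: "gauss_density x * norm x ^ q \<le> (8 * real q) ^ q * exp (- (norm x)\<^sup>2 / 8) + gauss_density x" for x :: "real^'n"
  proof -
    have g: "gauss_density x \<le> exp (- (norm x)\<^sup>2 / 2)"
    proof -
      have "1 \<le> sqrt (2 * pi) ^ CARD('n)" using pi_gt3 by (intro one_le_power) simp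
      then have "1 / sqrt (2 * pi) ^ CARD('n) \<le> 1" by (simp add: divide_le_eq)
      then show ?thesis unfolding gauss_density_def by (intro mult_left_le_one_le) auto
    qed
    \<comment> \<open>From \<open>t \<le> exp t\<close> at
      \<open>t = (norm x)\<^sup>2 / (8 * q)\<close>, raised to the power \<open>q\<close>; the
      growth \<open>exp ((norm x)\<^sup>2 / 8)\<close> is absorbed by the Gaussian density.\<close>
    have "norm x ^ (2 * q) \<le> (8 * real q) ^ q * exp ((norm x)\<^sup>2 / 8)"
    proof (cases "q = 0")
      case False
      let ?t = "(norm x)\<^sup>2 / (8 * real q)"
      have "?t \<le> exp ?t" using exp_ge_add_one_self[of ?t] by linarith
      then have "?t ^ q \<le> exp ?t ^ q" by (intro power_mono) auto
      also have "exp ?t ^ q = exp ((norm x)\<^sup>2 / 8)" using False by (simp flip: exp_of_nat_mult)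
      finally show ?thesis using False
        by (simp add: power_divide divide_le_eq mult.commute[of _ "exp _"] flip: power_mult)
    qed simp
    then have "gauss_density x * norm x ^ (2 * q) \<le> exp (- (norm x)\<^sup>2 / 2) * ((8 * real q) ^ q * exp ((norm x)\<^sup>2 / 8))"
      by (intro mult_mono g) auto
    also have "\<dots> = (8 * real q) ^ q * (exp (- (norm x)\<^sup>2 / 2) * exp ((norm x)\<^sup>2 / 8))" by simp
    also have "\<dots> \<le> (8 * real q) ^ q * exp (- (norm x)\<^sup>2 / 8)"
      by (intro mult_left_mono) (auto simp flip: exp_add)
    finally have 2: "gauss_density x * norm x ^ (2 * q) \<le> (8 * real q) ^ q * exp (- (norm x)\<^sup>2 / 8)" .
    have "norm x ^ q \<le> norm x ^ (2 * q) + 1"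
    proof (cases "norm x \<le> 1")
      case True
      then have "norm x ^ q \<le> 1" by (intro power_le_one) auto
      then show ?thesis by (simp add: add_increasing)
    next
      case False
      then have "norm x ^ q \<le> norm x ^ (2 * q)" by (intro power_increasing) auto
      then show ?thesis by simp
    qed
    then have "gauss_density x * norm x ^ q \<le> gauss_density x * (norm x ^ (2 * q) + 1)"
      using gauss_density_pos[of x] by (intro mult_left_mono) auto
    then show ?thesis using 2 by (simp add: algebra_simps)
  qed
  have "integrable lborel (\<lambda>x :: real^'n. gauss_density x * norm x ^ q)"
  proof (rule Bochner_Integration.integrable_bound[rotated 2, OF AE_I2])
    show "integrable lborel (\<lambda>x :: real^'n. (8 * real q) ^ q * exp (- (norm x)\<^sup>2 / 8) + gauss_density x)"
      by (intro Bochner_Integration.integrable_add integrable_mult_right integrable_exp_norm gauss_density_integral)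
    fix x :: "real^'n"
    have "0 \<le> gauss_density x * norm x ^ q" using gauss_density_pos[of x] by simp
    with * [of x] show "norm (gauss_density x * norm x ^ q)
        \<le> norm ((8 * real q) ^ q * exp (- (norm x)\<^sup>2 / 8) + gauss_density x)"
      unfolding real_norm_def by linarith
  qed simp
  then show ?thesis by (subst std_gaussian_integral) auto
qed

lemma integrable_mpower:
  fixes \<mu> :: "(real^'n) measure"
  assumes "sets \<mu> = sets borel" "finite_measure \<mu>" "integrable \<mu> (\<lambda>x. norm x ^ q)" "length \<alpha> \<le> q"
  shows "integrable \<mu> (\<lambda>x. mpower x \<alpha>)"
proof (rule Bochner_Integration.integrable_bound)
  interpret finite_measure \<mu> by fact
  show "integrable \<mu> (\<lambda>x. 1 + norm x ^ q)" using assms by simp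
  have [measurable_cong]: "sets \<mu> = sets borel" by fact
  show "(\<lambda>x. mpower x \<alpha>) \<in> borel_measurable \<mu>" by measurable
  have "\<bar>mpower x \<alpha>\<bar> \<le> 1 + norm x ^ q" for x :: "real^'n"
  proof (cases "norm x \<le> 1")
    case True
    then have "norm x ^ length \<alpha> \<le> 1" by (intro power_le_one) auto
    then show ?thesis using abs_mpower_le[of x \<alpha>] zero_le_power[OF norm_ge_zero, of x q]
      by linarith
  next
    case False
    then show ?thesis using abs_mpower_le[of x \<alpha>] power_increasing[of "length \<alpha>" q "norm x"] assms(4)
      by linarith
  qed
  then show "AE x in \<mu>. norm (mpower x \<alpha>) \<le> norm (1 + norm x ^ q)"
    by (auto intro!: AE_I2 order_trans[OF _ abs_ge_self])
qed

section \<open>Hermite polynomials\<close>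

text \<open>The three-term recurrence yields polynomials without iterated derivatives; agreement
  with the derivative formula is \<open>hermite_eq\<close>.\<close>

fun hermite_rec :: "nat \<Rightarrow> real \<Rightarrow> real" where
  "hermite_rec 0 x = 1"
| "hermite_rec (Suc 0) x = x"
| "hermite_rec (Suc (Suc m)) x = x * hermite_rec (Suc m) x - real (Suc m) * hermite_rec m x"

lemma hermite_rec_fun: "hermite_rec 0 = (\<lambda>x. 1)" "hermite_rec (Suc 0) = (\<lambda>x. x)"
  by (simp_all add: fun_eq_iff)

lemma DERIV_hermite_rec: "(hermite_rec (Suc m) has_real_derivative real (Suc m) * hermite_rec m x) (at x)"
proof (induction m rule: less_induct)
  case (less m)
  show ?case
  proof (cases m)
    case 0
    then show ?thesis by (simp add: hermite_rec_fun)
  next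
    case (Suc k)
    have d1: "(hermite_rec (Suc k) has_real_derivative real (Suc k) * hermite_rec k x) (at x)"
      using less[of k] Suc by simp
    have d0: "(hermite_rec k has_real_derivative real k * hermite_rec (k - 1) x) (at x)"
    proof (cases k)
      case 0
      then show ?thesis by (simp add: hermite_rec_fun)
    next
      case (Suc j)
      then show ?thesis using less[of j] \<open>m = Suc k\<close> by simp
    qed
    have "hermite_rec (Suc m) = (\<lambda>x. x * hermite_rec (Suc k) x - real (Suc k) * hermite_rec k x)"
      using Suc by (simp add: fun_eq_iff)
    moreover have "((\<lambda>x. x * hermite_rec (Suc k) x - real (Suc k) * hermite_rec k x) has_real_derivative
        1 * hermite_rec (Suc k) x + (real (Suc k) * hermite_rec k x) * x
          - real (Suc k) * (real k * hermite_rec (k - 1) x)) (at x)"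
      by (intro DERIV_diff DERIV_mult DERIV_cmult d0 d1 DERIV_ident)
    moreover have "1 * hermite_rec (Suc k) x + (real (Suc k) * hermite_rec k x) * x
          - real (Suc k) * (real k * hermite_rec (k - 1) x) = real (Suc m) * hermite_rec m x"
      using Suc by (cases k) (auto simp: algebra_simps)
    ultimately show ?thesis by simp
  qed
qed

lemma DERIV_hermite_exp:
  "((\<lambda>x. hermite_rec m x * exp (- x\<^sup>2 / 2)) has_real_derivative - (hermite_rec (Suc m) x * exp (- x\<^sup>2 / 2))) (at x)"
proof -
  have d: "(hermite_rec m has_real_derivative real m * hermite_rec (m - 1) x) (at x)"
  proof (cases m)
    case 0
    then show ?thesis by (simp add: hermite_rec_fun)
  qed (use DERIV_hermite_rec in simp)
  have e: "((\<lambda>x. exp (- x\<^sup>2 / 2)) has_real_derivative - x * exp (- x\<^sup>2 / 2)) (at x)"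
    by (auto intro!: derivative_eq_intros)
  have "((\<lambda>x. hermite_rec m x * exp (- x\<^sup>2 / 2)) has_real_derivative
      hermite_rec m x * (- x * exp (- x\<^sup>2 / 2)) + real m * hermite_rec (m - 1) x * exp (- x\<^sup>2 / 2)) (at x)"
    by (rule DERIV_mult'[OF d e])
  moreover have "hermite_rec m x * (- x * exp (- x\<^sup>2 / 2)) + real m * hermite_rec (m - 1) x * exp (- x\<^sup>2 / 2)
      = - (hermite_rec (Suc m) x * exp (- x\<^sup>2 / 2))"
    by (cases m) (auto simp: algebra_simps)
  ultimately show ?thesis by simp
qed

lemma hermite_eq: "hermite m = hermite_rec m"
proof -
  have "(deriv ^^ m) (\<lambda>y. exp (- y\<^sup>2 / 2)) = (\<lambda>y. (-1) ^ m * (hermite_rec m y * exp (- y\<^sup>2 / 2)))"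
  proof (induction m)
    case (Suc m)
    have "((\<lambda>y. (-1) ^ m * (hermite_rec m y * exp (- y\<^sup>2 / 2))) has_real_derivative
        (-1) ^ m * - (hermite_rec (Suc m) x * exp (- x\<^sup>2 / 2))) (at x)" for x
      by (intro DERIV_cmult DERIV_hermite_exp)
    then have "deriv (\<lambda>y. (-1) ^ m * (hermite_rec m y * exp (- y\<^sup>2 / 2)))
        = (\<lambda>x. (-1) ^ m * - (hermite_rec (Suc m) x * exp (- x\<^sup>2 / 2)))"
      by (intro ext DERIV_imp_deriv)
    then show ?case unfolding funpow.simps comp_def Suc by simp
  qed simp
  then have "hermite m x = ((-1) * (-1)) ^ m * (exp (x\<^sup>2 / 2) * exp (- x\<^sup>2 / 2)) * hermite_rec m x" for x
    unfolding hermite_def power_mult_distrib by (simp only: mult_ac)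
  then show ?thesis by (simp add: fun_eq_iff flip: exp_add)
qed

lemma hermite_rec_measurable [measurable]: "hermite_rec m \<in> borel_measurable borel"
proof -
  have "continuous_on UNIV (hermite_rec m)"
  proof (cases m)
    case 0
    then show ?thesis by (simp add: hermite_rec_fun)
  next
    case (Suc k)
    then show ?thesis using DERIV_hermite_rec[of k]
      by (auto intro!: continuous_at_imp_continuous_on DERIV_isCont)
  qed
  then show ?thesis by (rule borel_measurable_continuous_onI)
qed

text \<open>An exponential bound is weaker than a polynomial one but passes directly through the
  recurrence, and the Gaussian factor absorbs it.\<close>

lemma hermite_rec_growth: "\<exists>c\<ge>0. \<forall>y. \<bar>hermite_rec m y\<bar> \<le> c * exp (real m * \<bar>y\<bar>)"
proof (induction m rule: induct_nat_012)
  case 0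
  show ?case by (intro exI[of _ 1]) auto
next
  case 1
  have "\<bar>y\<bar> \<le> exp \<bar>y\<bar>" for y :: real using exp_ge_add_one_self[of "\<bar>y\<bar>"] by linarith
  then show ?case by (intro exI[of _ 1]) auto
next
  case (ge2 m)
  obtain c where c: "c \<ge> 0" "\<And>y. \<bar>hermite_rec m y\<bar> \<le> c * exp (real m * \<bar>y\<bar>)" using ge2 by blast
  obtain d where d: "d \<ge> 0" "\<And>y. \<bar>hermite_rec (Suc m) y\<bar> \<le> d * exp (real (Suc m) * \<bar>y\<bar>)" using ge2 by blast
  have "\<bar>hermite_rec (Suc (Suc m)) y\<bar> \<le> (d + real (Suc m) * c) * exp (real (Suc (Suc m)) * \<bar>y\<bar>)" for y
  proof -
    have "\<bar>y\<bar> \<le> exp \<bar>y\<bar>" using exp_ge_add_one_self[of "\<bar>y\<bar>"] by linarith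
    then have "\<bar>y * hermite_rec (Suc m) y\<bar> \<le> exp \<bar>y\<bar> * (d * exp (real (Suc m) * \<bar>y\<bar>))"
      unfolding abs_mult using d by (intro mult_mono) auto
    also have "\<dots> = d * exp (real (Suc (Suc m)) * \<bar>y\<bar>)" by (simp add: algebra_simps flip: exp_add)
    finally have 1: "\<bar>y * hermite_rec (Suc m) y\<bar> \<le> d * exp (real (Suc (Suc m)) * \<bar>y\<bar>)" .
    have "\<bar>real (Suc m) * hermite_rec m y\<bar> \<le> real (Suc m) * (c * exp (real m * \<bar>y\<bar>))"
      unfolding abs_mult using c by (intro mult_mono) auto
    also have "\<dots> \<le> real (Suc m) * (c * exp (real (Suc (Suc m)) * \<bar>y\<bar>))"
      using c by (intro mult_left_mono) (auto intro!: mult_right_mono)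
    finally have 2: "\<bar>real (Suc m) * hermite_rec m y\<bar> \<le> real (Suc m) * (c * exp (real (Suc (Suc m)) * \<bar>y\<bar>))" .
    have "\<bar>hermite_rec (Suc (Suc m)) y\<bar> \<le> \<bar>y * hermite_rec (Suc m) y\<bar> + \<bar>real (Suc m) * hermite_rec m y\<bar>"
      by simp
    also have "\<dots> \<le> d * exp (real (Suc (Suc m)) * \<bar>y\<bar>) + real (Suc m) * (c * exp (real (Suc (Suc m)) * \<bar>y\<bar>))"
      using 1 2 by (rule add_mono)
    finally show ?thesis by (simp only: distrib_right mult.assoc)
  qed
  then show ?case using c d by (intro exI[of _ "d + real (Suc m) * c"]) auto
qed

text \<open>By \<open>0 \<le> (m - \<bar>y\<bar> / 2)\<^sup>2\<close> the growth exponent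
  \<open>m * \<bar>y\<bar>\<close> is at most \<open>m\<^sup>2 + y\<^sup>2 / 4\<close>, which leaves
  half of the Gaussian exponent.\<close>

lemma hermite_normal_bound:
  "\<exists>c\<ge>0. \<forall>y. \<bar>hermite_rec m y * std_normal_density y\<bar> \<le> c * exp (- y\<^sup>2 / 4)"
proof -
  obtain c where c: "c \<ge> 0" "\<And>y. \<bar>hermite_rec m y\<bar> \<le> c * exp (real m * \<bar>y\<bar>)"
    using hermite_rec_growth by blast
  have "\<bar>hermite_rec m y * std_normal_density y\<bar> \<le> c * exp ((real m)\<^sup>2) * exp (- y\<^sup>2 / 4)" for y
  proof -
    have "std_normal_density y \<le> exp (- y\<^sup>2 / 2)"
      unfolding std_normal_density_def using pi_gt3 by (intro mult_left_le_one_le) (simp_all add: divide_le_eq)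
    then have "\<bar>hermite_rec m y * std_normal_density y\<bar> \<le> c * exp (real m * \<bar>y\<bar>) * exp (- y\<^sup>2 / 2)"
      unfolding abs_mult using c by (intro mult_mono) auto
    also have "\<dots> = c * exp (real m * \<bar>y\<bar> - y\<^sup>2 / 2)" by (simp add: mult.assoc flip: exp_add)
    also have "\<dots> \<le> c * exp ((real m)\<^sup>2 - y\<^sup>2 / 4)"
    proof -
      have "0 \<le> (real m - \<bar>y\<bar> / 2)\<^sup>2" by simp
      then have "real m * \<bar>y\<bar> - y\<^sup>2 / 2 \<le> (real m)\<^sup>2 - y\<^sup>2 / 4"
        by (simp add: power2_eq_square algebra_simps)
      then show ?thesis using c by (intro mult_left_mono) auto
    qed
    also have "\<dots> = c * exp ((real m)\<^sup>2) * exp (- y\<^sup>2 / 4)" by (simp add: mult.assoc flip: exp_add)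
    finally show ?thesis .
  qed
  then show ?thesis using c by (intro exI[of _ "c * exp ((real m)\<^sup>2)"]) auto
qed

text \<open>The derivative of the Gaussian density along \<open>\<alpha>\<close>, up to the sign
  \<open>(-1) ^ length \<alpha>\<close>.\<close>

definition hermite_gauss :: "'n::finite list \<Rightarrow> real^'n \<Rightarrow> real" where
  "hermite_gauss \<alpha> x = (\<Prod>i\<in>UNIV. hermite_rec (count_list \<alpha> i) (x $ i) * std_normal_density (x $ i))"

lemma hermite_gauss_eq: "hermite_gauss \<alpha> x = gauss_density x * mhermite \<alpha> x"
  by (simp add: hermite_gauss_def gauss_density_eq_prod mhermite_def hermite_eq prod.distrib mult.commute)

lemma mhermite_measurable [measurable]: "mhermite \<alpha> \<in> borel_measurable borel"
  unfolding mhermite_def[abs_def] hermite_eq by measurable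

lemma hermite_gauss_measurable [measurable]: "hermite_gauss \<alpha> \<in> borel_measurable borel"
  unfolding hermite_gauss_def[abs_def] by measurable

lemma mhermite_Nil: "mhermite [] x = 1"
  by (simp add: mhermite_def hermite_eq)

lemma mhermite_single: "mhermite [i] x = x $ i"
proof -
  have "mhermite [i] x = (\<Prod>j\<in>UNIV. if j = i then x $ i else 1)"
    unfolding mhermite_def hermite_eq by (intro prod.cong) auto
  then show ?thesis by simp
qed

lemma hermite_gauss_bound: "\<exists>c\<ge>0. \<forall>x :: real^'n. \<bar>hermite_gauss \<alpha> x\<bar> \<le> c * exp (- (norm x)\<^sup>2 / 4)"
proof -
  obtain c where c: "\<And>m. c m \<ge> 0" "\<And>m y. \<bar>hermite_rec m y * std_normal_density y\<bar> \<le> c m * exp (- y\<^sup>2 / 4)"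
    using hermite_normal_bound by metis
  have "\<bar>hermite_gauss \<alpha> x\<bar> \<le> (\<Prod>i\<in>UNIV. c (count_list \<alpha> i)) * exp (- (norm x)\<^sup>2 / 4)" for x :: "real^'n"
  proof -
    have "\<bar>hermite_gauss \<alpha> x\<bar> \<le> (\<Prod>i\<in>UNIV. c (count_list \<alpha> i) * exp (- (x $ i)\<^sup>2 / 4))"
      unfolding hermite_gauss_def abs_prod by (intro prod_mono) (use c in auto)
    also have "\<dots> = (\<Prod>i\<in>UNIV. c (count_list \<alpha> i)) * exp (- (norm x)\<^sup>2 / 4)"
      unfolding norm_vec_power2 prod.distrib by (simp add: exp_sum sum_divide_distrib sum_negf flip: exp_sum)
    finally show ?thesis .
  qed
  moreover have "0 \<le> (\<Prod>i\<in>UNIV. c (count_list \<alpha> i))" by (intro prod_nonneg c)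
  ultimately show ?thesis by blast
qed

lemma integrable_hermite_gauss: "integrable lborel (hermite_gauss \<alpha> :: real^'n \<Rightarrow> real)"
proof -
  obtain c where c: "c \<ge> 0" "\<And>x :: real^'n. \<bar>hermite_gauss \<alpha> x\<bar> \<le> c * exp (- (norm x)\<^sup>2 / 4)"
    using hermite_gauss_bound by blast
  have "c * exp (- (norm x)\<^sup>2 / 4) \<le> c * exp (- (norm x)\<^sup>2 / 8)" for x :: "real^'n"
    using c by (intro mult_left_mono) auto
  then have "\<bar>hermite_gauss \<alpha> x\<bar> \<le> \<bar>c * exp (- (norm x)\<^sup>2 / 8)\<bar>" for x :: "real^'n"
    using c(2)[of x] by (metis abs_ge_self order_trans)
  then show ?thesis
    by (intro Bochner_Integration.integrable_bound[OF integrable_mult_right[OF integrable_exp_norm, of c]]) auto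
qed

lemma integrable_mhermite: "integrable std_gaussian (mhermite \<alpha> :: real^'n \<Rightarrow> real)"
  using integrable_hermite_gauss[of \<alpha>] by (simp add: std_gaussian_integral hermite_gauss_eq[abs_def])

lemma grad_hermite_gauss:
  "(hermite_gauss \<alpha> has_derivative (\<lambda>h. \<Sum>i\<in>UNIV. h $ i * - hermite_gauss (\<alpha> @ [i]) x)) (at x)"
proof -
  define \<phi> where "\<phi> m y = hermite_rec m y * std_normal_density y" for m y
  have H: "hermite_gauss \<beta> = (\<lambda>x. \<Prod>i\<in>UNIV. \<phi> (count_list \<beta> i) (x $ i))" for \<beta> :: "'a list"
    by (simp add: fun_eq_iff hermite_gauss_def \<phi>_def)
  have d: "(\<phi> m has_real_derivative - \<phi> (Suc m) y) (at y)" for m y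
    using DERIV_cmult[OF DERIV_hermite_exp[of m y], of "1 / sqrt (2 * pi)"]
    by (simp add: \<phi>_def[abs_def] std_normal_density_def mult_ac)
  have "((\<lambda>x. \<phi> (count_list \<alpha> i) (x $ i)) has_derivative (\<lambda>h. - \<phi> (Suc (count_list \<alpha> i)) (x $ i) * h $ i)) (at x)" for i
  proof -
    have "((\<lambda>x. x $ i) has_derivative (\<lambda>h. h $ i)) (at x)"
      by (intro bounded_linear_imp_has_derivative bounded_linear_vec_nth)
    from has_derivative_compose[OF this d[unfolded has_field_derivative_def]] show ?thesis .
  qed
  from has_derivative_prod[of UNIV, OF this]
  have "(hermite_gauss \<alpha> has_derivative (\<lambda>h. \<Sum>i\<in>UNIV. - \<phi> (Suc (count_list \<alpha> i)) (x $ i) * h $ i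
      * (\<Prod>j\<in>UNIV - {i}. \<phi> (count_list \<alpha> j) (x $ j)))) (at x)"
    unfolding H .
  moreover have "hermite_gauss (\<alpha> @ [i]) x
      = \<phi> (Suc (count_list \<alpha> i)) (x $ i) * (\<Prod>j\<in>UNIV - {i}. \<phi> (count_list \<alpha> j) (x $ j))" for i
    unfolding H by (subst prod.remove[of _ i]) (auto intro!: prod.cong)
  ultimately show ?thesis by (simp add: mult_ac)
qed

section \<open>Gaussian smoothing\<close>

lemma lborel_affine_integral:
  fixes F :: "'a::euclidean_space \<Rightarrow> real"
  assumes "c \<noteq> 0" "F \<in> borel_measurable borel"
  shows "integrable lborel F \<longleftrightarrow> integrable lborel (\<lambda>x. F (t + c *\<^sub>R x))"
    "integral\<^sup>L lborel F = \<bar>c\<bar> ^ DIM('a) * (\<integral>x. F (t + c *\<^sub>R x) \<partial>lborel)"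
proof -
  note [measurable] = assms(2)
  show "integrable lborel F \<longleftrightarrow> integrable lborel (\<lambda>x. F (t + c *\<^sub>R x))"
    by (subst lborel_affine[OF assms(1), of t])
      (use assms in \<open>simp add: integrable_density integrable_distr_eq\<close>)
  show "integral\<^sup>L lborel F = \<bar>c\<bar> ^ DIM('a) * (\<integral>x. F (t + c *\<^sub>R x) \<partial>lborel)"
    by (subst lborel_affine[OF assms(1), of t]) (simp add: integral_density integral_distr)
qed

text \<open>The substitution \<open>z = h + y\<close> moves the increment from \<open>f\<close> onto
  the kernel, so a Taylor bound for the kernel suffices while \<open>f\<close> is merely bounded and
  measurable.\<close>

lemma kernel_derivative:
  fixes f \<psi> K :: "real^'n \<Rightarrow> real" and \<psi>' :: "'n \<Rightarrow> real^'n \<Rightarrow> real"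
  assumes f: "bounded_borel c f" and \<psi>: "integrable lborel \<psi>" and \<psi>': "\<And>i. integrable lborel (\<psi>' i)"
    and K: "integrable lborel K"
    and taylor: "\<And>z h. norm h \<le> 1 \<Longrightarrow> \<bar>\<psi> (z - h) - \<psi> z + (\<Sum>i\<in>UNIV. h $ i * \<psi>' i z)\<bar> \<le> K z * (norm h)\<^sup>2"
  shows "((\<lambda>x. \<integral>y. \<psi> y * f (x + y) \<partial>lborel) has_derivative
    (\<lambda>h. \<Sum>i\<in>UNIV. h $ i * - (\<integral>y. \<psi>' i y * f (x + y) \<partial>lborel))) (at x)"
proof (rule has_derivative_quadratic[where K = "(\<integral>z. K z \<partial>lborel) * c"])
  show "bounded_linear (\<lambda>h. \<Sum>i\<in>UNIV. h $ i * - (\<integral>y. \<psi>' i y * f (x + y) \<partial>lborel))"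
    by (rule bounded_linear_coord_sum)
  fix h :: "real^'n" assume h: "norm h \<le> 1"
  have [measurable]: "f \<in> borel_measurable borel" "\<psi> \<in> borel_measurable borel"
    "\<And>i. \<psi>' i \<in> borel_measurable borel"
    using f \<psi> \<psi>' by (auto simp: bounded_borel_def)
  have int: "integrable lborel (\<lambda>y. g y * f (x + y))" if "integrable lborel g" for g
    using avg_integrable[of lborel g c f x 1] that f by simp
  have shift: "integrable lborel (\<lambda>z. \<psi> (z - h))"
    using lborel_affine_integral(1)[of 1 \<psi> "- h"] \<psi> by (simp add: algebra_simps)
  have "(\<integral>y. \<psi> y * f (x + h + y) \<partial>lborel) = (\<integral>z. \<psi> (z - h) * f (x + z) \<partial>lborel)"
    by (subst lborel_affine_integral(2)[of 1 _ "- h"]) (auto simp: algebra_simps)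
  then have "(\<integral>y. \<psi> y * f (x + h + y) \<partial>lborel) - (\<integral>y. \<psi> y * f (x + y) \<partial>lborel)
        - (\<Sum>i\<in>UNIV. h $ i * - (\<integral>y. \<psi>' i y * f (x + y) \<partial>lborel))
      = (\<integral>z. \<psi> (z - h) * f (x + z) \<partial>lborel) - (\<integral>y. \<psi> y * f (x + y) \<partial>lborel)
        + (\<integral>z. (\<Sum>i\<in>UNIV. h $ i * (\<psi>' i z * f (x + z))) \<partial>lborel)"
    using int[OF \<psi>'] by (simp add: sum_negf)
  also have "\<dots> = (\<integral>z. \<psi> (z - h) * f (x + z) - \<psi> z * f (x + z)
        + (\<Sum>i\<in>UNIV. h $ i * (\<psi>' i z * f (x + z))) \<partial>lborel)"
    using int[OF \<psi>'] int[OF \<psi>] int[OF shift] by simp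
  also have "\<dots> = (\<integral>z. (\<psi> (z - h) - \<psi> z + (\<Sum>i\<in>UNIV. h $ i * \<psi>' i z)) * f (x + z) \<partial>lborel)"
    by (simp add: algebra_simps sum_distrib_left sum_distrib_right)
  also have "\<bar>\<dots>\<bar> \<le> (\<integral>z. (K z * (norm h)\<^sup>2) * c \<partial>lborel)"
  proof (rule order_trans[OF integral_abs_bound integral_mono])
    have "integrable lborel (\<lambda>z. \<psi> (z - h) - \<psi> z + (\<Sum>i\<in>UNIV. h $ i * \<psi>' i z))"
      using shift \<psi> \<psi>' by simp
    from int[OF this] show "integrable lborel (\<lambda>z. \<bar>(\<psi> (z - h) - \<psi> z + (\<Sum>i\<in>UNIV. h $ i * \<psi>' i z)) * f (x + z)\<bar>)"
      by (rule integrable_abs)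
    show "integrable lborel (\<lambda>z. (K z * (norm h)\<^sup>2) * c)" using K by simp
    fix z
    have "0 \<le> K z * (norm h)\<^sup>2" using taylor[OF h, of z] by linarith
    then show "\<bar>(\<psi> (z - h) - \<psi> z + (\<Sum>i\<in>UNIV. h $ i * \<psi>' i z)) * f (x + z)\<bar> \<le> (K z * (norm h)\<^sup>2) * c"
      unfolding abs_mult using taylor[OF h, of z] f by (intro mult_mono) (auto simp: bounded_borel_def)
  qed
  also have "\<dots> = (\<integral>z. K z \<partial>lborel) * c * (norm h)\<^sup>2" by (simp add: mult_ac)
  finally show "\<bar>(\<integral>y. \<psi> y * f (x + h + y) \<partial>lborel) - (\<integral>y. \<psi> y * f (x + y) \<partial>lborel)
        - (\<Sum>i\<in>UNIV. h $ i * - (\<integral>y. \<psi>' i y * f (x + y) \<partial>lborel))\<bar> \<le> (\<integral>z. K z \<partial>lborel) * c * (norm h)\<^sup>2" .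
qed

text \<open>The dominating function has to be integrable in \<open>z\<close> and uniform in
  \<open>norm h \<le> 1\<close>; the Gaussian decay at the intermediate point is therefore traded
  for a slower decay at \<open>z\<close>.\<close>

lemma hermite_gauss_taylor:
  "\<exists>C. \<forall>z h :: real^'n. norm h \<le> 1 \<longrightarrow>
    \<bar>hermite_gauss \<alpha> (z - h) - hermite_gauss \<alpha> z - (\<Sum>i\<in>UNIV. h $ i * hermite_gauss (\<alpha> @ [i]) z)\<bar>
      \<le> C * exp (- (norm z)\<^sup>2 / 8) * (norm h)\<^sup>2"
proof -
  obtain c where c: "\<And>\<beta>. c \<beta> \<ge> 0" "\<And>\<beta> x. \<bar>hermite_gauss (\<alpha> @ \<beta>) (x :: real^'n)\<bar> \<le> c \<beta> * exp (- (norm x)\<^sup>2 / 4)"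
  proof -
    have "\<forall>\<beta>. \<exists>c. 0 \<le> c \<and> (\<forall>x :: real^'n. \<bar>hermite_gauss (\<alpha> @ \<beta>) x\<bar> \<le> c * exp (- (norm x)\<^sup>2 / 4))"
      using hermite_gauss_bound by blast
    from choice[OF this] show ?thesis using that by blast
  qed
  define C where "C = (\<Sum>\<beta> :: 'n list | length \<beta> = 2. c \<beta>)"
  have cC: "c \<beta> \<le> C" if "length \<beta> = 2" for \<beta>
    unfolding C_def using that c by (intro member_le_sum) auto
  have C0: "0 \<le> C" unfolding C_def by (intro sum_nonneg c)
  define D where "D \<beta> x = (-1) ^ length \<beta> * hermite_gauss (\<alpha> @ \<beta>) x" for \<beta> :: "'n list" and x
  have grad: "grad_rule D \<beta> x" for \<beta> x
  proof -
    have "(D \<beta> has_derivative (\<lambda>h. (-1) ^ length \<beta> * (\<Sum>i\<in>UNIV. h $ i * - hermite_gauss ((\<alpha> @ \<beta>) @ [i]) x))) (at x)"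
      unfolding D_def by (intro has_derivative_mult_right grad_hermite_gauss)
    then show ?thesis
      unfolding grad_rule_def by (simp add: D_def sum_distrib_left mult_ac)
  qed
  have "\<bar>hermite_gauss \<alpha> (z - h) - hermite_gauss \<alpha> z - (\<Sum>i\<in>UNIV. h $ i * hermite_gauss (\<alpha> @ [i]) z)\<bar>
      \<le> (C * exp (1/4) * (real CARD('n))\<^sup>2) * exp (- (norm z)\<^sup>2 / 8) * (norm h)\<^sup>2"
    if h: "norm h \<le> 1" for z h
  proof -
    obtain t where t: "t \<in> {0..1}" and eq: "D [] (z + - h) = taylor_poly D [] 2 z (- h)
        + (\<Sum>\<beta> | length \<beta> = 2. mpower (- h) \<beta> * D ([] @ \<beta>) (z + t *\<^sub>R - h)) / fact 2"
      using taylor_lagrange[of 2 D "[]" z "- h"] grad by auto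
    let ?R = "\<Sum>\<beta> | length \<beta> = 2. mpower (- h) \<beta> * D \<beta> (z - t *\<^sub>R h)"
    let ?E = "C * (exp (1/4) * exp (- (norm z)\<^sup>2 / 8))"
    have "hermite_gauss \<alpha> (z - h) - hermite_gauss \<alpha> z - (\<Sum>i\<in>UNIV. h $ i * hermite_gauss (\<alpha> @ [i]) z) = ?R / 2"
      using eq unfolding taylor_poly_2 by (simp add: D_def)
    also have "\<bar>?R / 2\<bar> \<le> \<bar>?R\<bar>" by simp
    also have "\<bar>?R\<bar> \<le> (\<Sum>\<beta> | length \<beta> = 2. \<bar>mpower (- h) \<beta>\<bar> * ?E)"
    proof (intro order_trans[OF sum_abs] sum_mono)
      fix \<beta> :: "'n list" assume "\<beta> \<in> {\<beta>. length \<beta> = 2}"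
      then have len: "length \<beta> = 2" by simp
      have "norm z \<le> norm (z - t *\<^sub>R h) + 1"
      proof -
        have "norm z \<le> norm (z - t *\<^sub>R h) + norm (t *\<^sub>R h)" by (metis diff_add_cancel norm_triangle_ineq)
        moreover have "norm (t *\<^sub>R h) \<le> 1" using t h by (simp add: mult_le_one)
        ultimately show ?thesis by linarith
      qed
      then have "(norm z)\<^sup>2 \<le> (norm (z - t *\<^sub>R h) + 1)\<^sup>2" by (intro power_mono) auto
      \<comment> \<open>Together with the preceding inequality, \<open>(norm z)\<^sup>2 \<le> 2 *
        (norm (z - t *\<^sub>R h))\<^sup>2 + 2\<close>: the decay rate drops from 1/4 to 1/8 at the
        price of the factor \<open>exp (1/4)\<close>.\<close>
      moreover have "0 \<le> (norm (z - t *\<^sub>R h) - 1)\<^sup>2" by simp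
      ultimately have "(norm z)\<^sup>2 / 8 \<le> (norm (z - t *\<^sub>R h))\<^sup>2 / 4 + 1/4"
        by (simp add: power2_eq_square algebra_simps)
      then have "exp (- (norm (z - t *\<^sub>R h))\<^sup>2 / 4) \<le> exp (1/4) * exp (- (norm z)\<^sup>2 / 8)"
        by (simp flip: exp_add)
      then have "c \<beta> * exp (- (norm (z - t *\<^sub>R h))\<^sup>2 / 4) \<le> ?E"
        by (intro mult_mono cC len C0) auto
      then have "\<bar>D \<beta> (z - t *\<^sub>R h)\<bar> \<le> ?E"
        using c(2)[of \<beta> "z - t *\<^sub>R h"] by (simp add: D_def abs_mult power_abs)
      then show "\<bar>mpower (- h) \<beta> * D \<beta> (z - t *\<^sub>R h)\<bar> \<le> \<bar>mpower (- h) \<beta>\<bar> * ?E"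
        unfolding abs_mult by (intro mult_left_mono) auto
    qed
    also have "\<dots> = norm1 (- h) ^ 2 * ?E"
      unfolding sum_distrib_right[symmetric] sum_abs_mpower ..
    also have "\<dots> \<le> (real CARD('n) * norm h) ^ 2 * ?E"
      using norm1_le[of "- h"] C0 by (intro mult_right_mono power_mono norm1_nonneg) auto
    also have "\<dots> = (C * exp (1/4) * (real CARD('n))\<^sup>2) * exp (- (norm z)\<^sup>2 / 8) * (norm h)\<^sup>2"
      by (simp add: power_mult_distrib)
    finally show ?thesis .
  qed
  then show ?thesis by blast
qed

lemma avg_gaussian_eq:
  assumes "f \<in> borel_measurable borel"
  shows "avg \<tau> std_gaussian (mhermite \<alpha>) f x = (\<integral>y. hermite_gauss \<alpha> y * f (x + \<tau> *\<^sub>R y) \<partial>lborel)"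
  unfolding avg_def using assms by (subst std_gaussian_integral) (auto simp: hermite_gauss_eq mult.assoc)

text \<open>Integration by parts: after rescaling to \<open>\<tau> = 1\<close> the derivative falls
  on the kernel, whose gradient is minus the next Hermite kernel, and the two minus signs
  cancel.\<close>

lemma avg_hermite_grad:
  fixes f :: "real^'n \<Rightarrow> real"
  assumes "\<tau> > 0" "bounded_borel c f"
  shows "(avg \<tau> std_gaussian (mhermite \<alpha>) f has_derivative
    (\<lambda>h. \<Sum>i\<in>UNIV. h $ i * (avg \<tau> std_gaussian (mhermite (\<alpha> @ [i])) f x / \<tau>))) (at x)"
proof -
  define g where "g z = f (\<tau> *\<^sub>R z)" for z
  have [measurable]: "f \<in> borel_measurable borel" using assms by (simp add: bounded_borel_def)
  have g: "bounded_borel c g" using assms unfolding g_def[abs_def] bounded_borel_def by simp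
  have avg: "avg \<tau> std_gaussian (mhermite \<beta>) f = (\<lambda>x. \<integral>y. hermite_gauss \<beta> y * g (x /\<^sub>R \<tau> + y) \<partial>lborel)" for \<beta>
    using assms by (auto simp: avg_gaussian_eq g_def scaleR_add_right)
  obtain C where C: "\<And>z h :: real^'n. norm h \<le> 1 \<Longrightarrow>
    \<bar>hermite_gauss \<alpha> (z - h) - hermite_gauss \<alpha> z - (\<Sum>i\<in>UNIV. h $ i * hermite_gauss (\<alpha> @ [i]) z)\<bar>
      \<le> C * exp (- (norm z)\<^sup>2 / 8) * (norm h)\<^sup>2"
    using hermite_gauss_taylor by blast
  have "((\<lambda>x. \<integral>y. hermite_gauss \<alpha> y * g (x + y) \<partial>lborel) has_derivative
    (\<lambda>h. \<Sum>i\<in>UNIV. h $ i * - (\<integral>y. - hermite_gauss (\<alpha> @ [i]) y * g (x /\<^sub>R \<tau> + y) \<partial>lborel))) (at (x /\<^sub>R \<tau>))"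
    using C by (intro kernel_derivative[OF g integrable_hermite_gauss _ integrable_mult_right[OF integrable_exp_norm, of C]])
      (auto simp: sum_negf integrable_hermite_gauss)
  moreover have "((\<lambda>x. x /\<^sub>R \<tau>) has_derivative (\<lambda>h. h /\<^sub>R \<tau>)) (at x)"
    by (auto intro!: derivative_eq_intros)
  ultimately have "((\<lambda>x. \<integral>y. hermite_gauss \<alpha> y * g (x /\<^sub>R \<tau> + y) \<partial>lborel) has_derivative
    (\<lambda>h. \<Sum>i\<in>UNIV. (h /\<^sub>R \<tau>) $ i * - (\<integral>y. - hermite_gauss (\<alpha> @ [i]) y * g (x /\<^sub>R \<tau> + y) \<partial>lborel))) (at x)"
    by (rule has_derivative_compose[rotated])
  then show ?thesis unfolding avg by (simp add: divide_inverse mult_ac)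
qed

text \<open>The derivatives of the average of \<open>f\<close> over \<open>N(x, \<tau>\<^sup>2)\<close>, after integration by parts.\<close>
definition hermite_jet :: "real \<Rightarrow> (real^'n \<Rightarrow> real) \<Rightarrow> 'n::finite list \<Rightarrow> real^'n \<Rightarrow> real" where
  "hermite_jet \<tau> f \<alpha> x = avg \<tau> std_gaussian (mhermite \<alpha>) f x / \<tau> ^ length \<alpha>"

definition hermite_mass :: "'n::finite itself \<Rightarrow> nat \<Rightarrow> real" where
  "hermite_mass _ L = (\<Sum>\<alpha> :: 'n list | length \<alpha> \<le> L. \<integral>y. \<bar>mhermite \<alpha> y\<bar> \<partial>std_gaussian)"

lemma finite_measure_std_gaussian: "finite_measure (std_gaussian :: (real^'n) measure)"
  by unfold_locales

lemma hermite_mass_nonneg: "0 \<le> hermite_mass TYPE('n::finite) L"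
  unfolding hermite_mass_def by (intro sum_nonneg integral_nonneg) auto

lemma avg_hermite_bounded:
  fixes f :: "real^'n \<Rightarrow> real"
  assumes "bounded_borel c f" "length \<alpha> \<le> L"
  shows "bounded_borel (hermite_mass TYPE('n) L * c) (avg \<tau> std_gaussian (mhermite \<alpha>) f)"
proof (rule bounded_borel_mono)
  show "bounded_borel ((\<integral>y. \<bar>mhermite \<alpha> y\<bar> \<partial>std_gaussian) * c) (avg \<tau> std_gaussian (mhermite \<alpha>) f)"
    by (intro avg_bounded finite_measure_std_gaussian integrable_mhermite assms) simp
  have "(\<integral>y. \<bar>mhermite \<alpha> y\<bar> \<partial>std_gaussian) \<le> hermite_mass TYPE('n) L"
    unfolding hermite_mass_def using assms(2) by (intro member_le_sum integral_nonneg) auto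
  then show "(\<integral>y. \<bar>mhermite \<alpha> y\<bar> \<partial>std_gaussian) * c \<le> hermite_mass TYPE('n) L * c"
    using bounded_borel_nonneg[OF assms(1)] by (rule mult_right_mono)
qed

text \<open>Each derivative costs a factor \<open>1 / \<tau>\<close>;
  \<open>\<tau> \<ge> 1 / 2\<close> holds as soon as at least half of the Gaussian factors are
  present.\<close>

lemma jet_hermite:
  fixes f :: "real^'n \<Rightarrow> real"
  assumes "bounded_borel c f" "1 / 2 \<le> \<tau>"
  shows "jet L (2 ^ L * (hermite_mass TYPE('n) L * c)) (hermite_jet \<tau> f)"
proof (rule jet_derivs)
  fix \<alpha> :: "'n list" assume \<alpha>: "length \<alpha> \<le> L"
  have b: "bounded_borel (hermite_mass TYPE('n) L * c) (avg \<tau> std_gaussian (mhermite \<alpha>) f)"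
    by (rule avg_hermite_bounded[OF assms(1) \<alpha>])
  have "1 / \<tau> ^ length \<alpha> \<le> 2 ^ L"
  proof -
    have "1 / \<tau> ^ length \<alpha> = (1 / \<tau>) ^ length \<alpha>" by (simp add: power_one_over)
    also have "\<dots> \<le> 2 ^ length \<alpha>" using assms(2) by (intro power_mono) (auto simp: divide_le_eq)
    also have "\<dots> \<le> 2 ^ L" using \<alpha> by (intro power_increasing) auto
    finally show ?thesis .
  qed
  moreover have "0 < \<tau> ^ length \<alpha>" using assms(2) by (intro zero_less_power) simp
  ultimately have "\<bar>1 / \<tau> ^ length \<alpha>\<bar> * (hermite_mass TYPE('n) L * c) \<le> 2 ^ L * (hermite_mass TYPE('n) L * c)"
    using bounded_borel_nonneg[OF b] by (intro mult_right_mono) auto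
  moreover have "bounded_borel (\<bar>1 / \<tau> ^ length \<alpha>\<bar> * (hermite_mass TYPE('n) L * c)) (hermite_jet \<tau> f \<alpha>)"
    using bounded_borel_lin[OF b b, of "1 / \<tau> ^ length \<alpha>" 0] by (simp add: hermite_jet_def[abs_def])
  ultimately show "bounded_borel (2 ^ L * (hermite_mass TYPE('n) L * c)) (hermite_jet \<tau> f \<alpha>)"
    using bounded_borel_mono by blast
next
  fix \<alpha> :: "'n list" and x
  have "(hermite_jet \<tau> f \<alpha> has_derivative
      (\<lambda>h. (\<Sum>i\<in>UNIV. h $ i * (avg \<tau> std_gaussian (mhermite (\<alpha> @ [i])) f x / \<tau>)) * inverse (\<tau> ^ length \<alpha>))) (at x)"
    unfolding hermite_jet_def[abs_def] divide_inverse[of _ "\<tau> ^ length \<alpha>"]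
    using assms by (intro has_derivative_mult_left avg_hermite_grad) auto
  then show "grad_rule (hermite_jet \<tau> f) \<alpha> x"
    unfolding grad_rule_def hermite_jet_def by (simp add: sum_distrib_left divide_inverse mult_ac)
qed

abbreviation mean :: "real \<Rightarrow> 'a measure \<Rightarrow> ('a::euclidean_space \<Rightarrow> real) \<Rightarrow> 'a \<Rightarrow> real" where
  "mean \<sigma> \<mu> \<equiv> avg \<sigma> \<mu> (\<lambda>_. 1)"

lemma mhermite_Nil_fun: "mhermite [] = (\<lambda>_. 1)"
  by (simp add: fun_eq_iff mhermite_Nil)

lemma hermite_jet_Nil: "hermite_jet \<tau> f [] = mean \<tau> std_gaussian f"
  by (simp add: hermite_jet_def[abs_def] mhermite_Nil_fun)

lemma conv_op_mean: "prob_space \<mu> \<Longrightarrow> sets \<mu> = sets borel \<Longrightarrow> conv_op (mean \<sigma> \<mu>)"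
  by (intro conv_op.avg) (auto simp: prob_space.finite_measure prob_space.axioms
      intro!: finite_measure.integrable_const prob_space.axioms)

lemma op_bound_mean: "prob_space \<mu> \<Longrightarrow> sets \<mu> = sets borel \<Longrightarrow> op_bound 1 (mean \<sigma> \<mu>)"
proof -
  assume p: "prob_space \<mu>" and s: "sets \<mu> = sets borel"
  interpret prob_space \<mu> by fact
  have "op_bound (\<integral>y. \<bar>1\<bar> \<partial>\<mu>) (mean \<sigma> \<mu>)" using s by (intro op_bound_avg) (auto simp: finite_measure_axioms)
  then show "op_bound 1 (mean \<sigma> \<mu>)" by (simp add: prob_space)
qed

text \<open>For independent standard Gaussians U, V and Z = aU + bV both sides are, up to the same
  constant, the joint density of (U, Z): on the left through U and V, on the right through Z and the
  conditional law of U given Z.\<close>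

lemma gauss_density_pair:
  assumes "a > 0" "b > 0"
  defines "c \<equiv> sqrt (a\<^sup>2 + b\<^sup>2)"
  shows "gauss_density u * gauss_density (- (a / b) *\<^sub>R u + (1 / b) *\<^sub>R z)
    = gauss_density ((1 / c) *\<^sub>R z) * gauss_density (- (a / (b * c)) *\<^sub>R z + (c / b) *\<^sub>R u)"
proof -
  have c2: "c\<^sup>2 = a\<^sup>2 + b\<^sup>2" by (simp add: c_def)
  have c: "c > 0" using assms(1,2) by (simp add: c_def add_pos_pos)
  define A B Z where "A = u \<bullet> u" and "B = u \<bullet> z" and "Z = z \<bullet> z"
  have nrm: "(norm (s *\<^sub>R u + t *\<^sub>R z))\<^sup>2 = s\<^sup>2 * A + 2 * (s * t) * B + t\<^sup>2 * Z" for s t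
    unfolding power2_norm_eq_inner A_def B_def Z_def
    by (simp add: inner_add_left inner_add_right inner_commute[of z u] power2_eq_square algebra_simps)
  have "(norm u)\<^sup>2 + (norm (- (a / b) *\<^sub>R u + (1 / b) *\<^sub>R z))\<^sup>2 = A + (a\<^sup>2 * A - 2 * a * B + Z) / b\<^sup>2"
    using nrm[of 1 0] nrm[of "- (a / b)" "1 / b"] assms(1,2)
    by (simp add: field_simps power2_eq_square)
  also have "\<dots> = Z / c\<^sup>2 + (a\<^sup>2 * Z - 2 * a * c\<^sup>2 * B + c\<^sup>2 * c\<^sup>2 * A) / (b\<^sup>2 * c\<^sup>2)"
  proof -
    have "(A + (a\<^sup>2 * A - 2 * a * B + Z) / b\<^sup>2) * (b\<^sup>2 * c\<^sup>2)
        = c\<^sup>2 * (b\<^sup>2 * A) + c\<^sup>2 * (a\<^sup>2 * A - 2 * a * B + Z)"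
      using assms(1,2) c by (simp add: field_simps)
    also have "\<dots> = b\<^sup>2 * Z + (a\<^sup>2 * Z - 2 * a * c\<^sup>2 * B + c\<^sup>2 * c\<^sup>2 * A)"
      unfolding c2 by (simp add: algebra_simps)
    also have "\<dots> = (Z / c\<^sup>2 + (a\<^sup>2 * Z - 2 * a * c\<^sup>2 * B + c\<^sup>2 * c\<^sup>2 * A) / (b\<^sup>2 * c\<^sup>2)) * (b\<^sup>2 * c\<^sup>2)"
      using assms(1,2) c by (simp add: field_simps)
    finally show ?thesis using assms(1,2) c by simp
  qed
  also have "\<dots> = (norm ((1 / c) *\<^sub>R z))\<^sup>2 + (norm (- (a / (b * c)) *\<^sub>R z + (c / b) *\<^sub>R u))\<^sup>2"
  proof -
    have 1: "(norm ((1 / c) *\<^sub>R z))\<^sup>2 = (1 / c)\<^sup>2 * Z" using nrm[of 0 "1 / c"] by simp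
    have "- (a / (b * c)) *\<^sub>R z + (c / b) *\<^sub>R u = (c / b) *\<^sub>R u + (- (a / (b * c))) *\<^sub>R z" by simp
    then have 2: "(norm (- (a / (b * c)) *\<^sub>R z + (c / b) *\<^sub>R u))\<^sup>2
        = (c / b)\<^sup>2 * A + 2 * ((c / b) * - (a / (b * c))) * B + (- (a / (b * c)))\<^sup>2 * Z"
      by (simp only: nrm)
    show ?thesis unfolding 1 2 using assms(1,2) c by (simp add: field_simps power2_eq_square)
  qed
  finally have "exp (- (norm u)\<^sup>2 / 2) * exp (- (norm (- (a / b) *\<^sub>R u + (1 / b) *\<^sub>R z))\<^sup>2 / 2)
      = exp (- (norm ((1 / c) *\<^sub>R z))\<^sup>2 / 2) * exp (- (norm (- (a / (b * c)) *\<^sub>R z + (c / b) *\<^sub>R u))\<^sup>2 / 2)"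
    by (simp flip: exp_add add: field_simps)
  then show ?thesis unfolding gauss_density_def by simp
qed

text \<open>The kernel \<open>k u z\<close> is the joint density of U and Z = aU + bV; integrating
  \<open>u\<close> out through its conditional law leaves the Gaussian density of scale
  \<open>c\<close>.\<close>

lemma mean_gaussian_semigroup:
  fixes f :: "real^'n \<Rightarrow> real"
  assumes a: "a > 0" and b: "b > 0" and f: "bounded_borel B f"
  shows "mean a std_gaussian (mean b std_gaussian f) = mean (sqrt (a\<^sup>2 + b\<^sup>2)) std_gaussian f"
proof
  fix x :: "real^'n"
  define c where "c = sqrt (a\<^sup>2 + b\<^sup>2)"
  have c: "c > 0" using a b by (simp add: c_def add_pos_pos)
  have [measurable]: "f \<in> borel_measurable borel" using f by (simp add: bounded_borel_def)
  let ?N = "CARD('n)"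
  let ?g = "gauss_density :: real^'n \<Rightarrow> real"
  define k where "k u z = ?g u * ((1 / b) ^ ?N * ?g (- (a / b) *\<^sub>R u + (1 / b) *\<^sub>R z))" for u z
  have k0: "0 \<le> k u z" for u z
    using gauss_density_pos[of u] gauss_density_pos[of "- (a / b) *\<^sub>R u + (1 / b) *\<^sub>R z"] b by (simp add: k_def)
  have [measurable]: "(\<lambda>(u, z). k u z) \<in> borel_measurable (borel \<Otimes>\<^sub>M borel)" unfolding k_def by measurable
  have mean: "mean s std_gaussian h y = (\<integral>u. ?g u * h (y + s *\<^sub>R u) \<partial>lborel)"
    if "h \<in> borel_measurable borel" for s h y
    unfolding avg_def using that by (subst std_gaussian_integral) auto
  have inner: "(\<integral>v. ?g v * h (a *\<^sub>R u + b *\<^sub>R v) \<partial>lborel) = (1 / b) ^ ?N * (\<integral>z. ?g (- (a / b) *\<^sub>R u + (1 / b) *\<^sub>R z) * h z \<partial>lborel)"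
    if "h \<in> borel_measurable borel" for h :: "real^'n \<Rightarrow> real" and u
    using b that by (subst lborel_affine_integral(2)[of "1 / b" _ "- (a / b) *\<^sub>R u"]) (auto simp: scaleR_diff_right)
  have int_in: "integrable lborel (\<lambda>z. k u z)" for u
    using lborel_affine_integral(1)[of "1 / b" ?g "- (a / b) *\<^sub>R u"] gauss_density_integral(1)[where ?'n = 'n] b
    unfolding k_def by simp
  have mass: "(\<integral>z. k u z \<partial>lborel) = ?g u" for u
    using inner[of "\<lambda>_. 1" u] gauss_density_integral(2)[where ?'n = 'n] by (simp add: k_def)
  have int_k: "integrable (lborel \<Otimes>\<^sub>M lborel) (\<lambda>(u, z). k u z)"
    using int_in mass gauss_density_integral(1)[where ?'n = 'n] k0
    by (intro lborel_pair.Fubini_integrable) (auto simp: lborel_prod[symmetric])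
  have int: "integrable (lborel \<Otimes>\<^sub>M lborel) (\<lambda>(u, z). k u z * f (x + z))"
  proof (rule Bochner_Integration.integrable_bound)
    show "integrable (lborel \<Otimes>\<^sub>M lborel) (\<lambda>p. B * (case p of (u, z) \<Rightarrow> k u z))" using int_k by simp
    show "(\<lambda>(u, z). k u z * f (x + z)) \<in> borel_measurable (lborel \<Otimes>\<^sub>M lborel)" by measurable
    have "\<bar>k u z * f (x + z)\<bar> \<le> \<bar>B * k u z\<bar>" for u z
      using f bounded_borel_nonneg[OF f] k0[of u z]
      by (simp add: abs_mult mult.commute[of B] bounded_borel_def mult_left_mono)
    then show "AE p in lborel \<Otimes>\<^sub>M lborel. norm (case p of (u, z) \<Rightarrow> k u z * f (x + z)) \<le> norm (B * (case p of (u, z) \<Rightarrow> k u z))"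
      by (auto split: prod.split)
  qed
  have mb: "mean b std_gaussian f \<in> borel_measurable borel"
    using avg_bounded[OF finite_measure_std_gaussian _ _ f, of "\<lambda>_. 1" b] by (simp add: bounded_borel_def)
  have "mean a std_gaussian (mean b std_gaussian f) x
      = (\<integral>u. ?g u * (\<integral>v. ?g v * f (x + (a *\<^sub>R u + b *\<^sub>R v)) \<partial>lborel) \<partial>lborel)"
    by (simp add: mean mb add.assoc)
  also have "\<dots> = (\<integral>u. (\<integral>z. k u z * f (x + z) \<partial>lborel) \<partial>lborel)"
    by (subst inner) (auto simp: k_def mult.assoc)
  also have "\<dots> = (\<integral>z. (\<integral>u. k u z * f (x + z) \<partial>lborel) \<partial>lborel)"
    by (rule lborel_pair.Fubini_integral[OF int, symmetric])
  also have "\<dots> = (\<integral>z. (1 / c) ^ ?N * (?g ((1 / c) *\<^sub>R z) * f (x + z)) \<partial>lborel)"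
  proof (intro Bochner_Integration.integral_cong refl)
    fix z
    have "(\<integral>u. ?g (- (a / (b * c)) *\<^sub>R z + (c / b) *\<^sub>R u) \<partial>lborel) = (b / c) ^ ?N"
      using lborel_affine_integral(2)[of "c / b" ?g "- (a / (b * c)) *\<^sub>R z"] b c
        gauss_density_integral(2)[where ?'n = 'n] by (simp add: power_divide field_simps)
    moreover have "k u z = (1 / b) ^ ?N * ?g ((1 / c) *\<^sub>R z) * ?g (- (a / (b * c)) *\<^sub>R z + (c / b) *\<^sub>R u)" for u
      unfolding k_def using gauss_density_pair[OF a b, of u z] by (simp add: c_def mult_ac)
    ultimately have "(\<integral>u. k u z \<partial>lborel) = (1 / b) ^ ?N * ?g ((1 / c) *\<^sub>R z) * (b / c) ^ ?N" by simp
    also have "\<dots> = (1 / c) ^ ?N * ?g ((1 / c) *\<^sub>R z)" using b by (simp add: power_divide)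
    finally show "(\<integral>u. k u z * f (x + z) \<partial>lborel) = (1 / c) ^ ?N * (?g ((1 / c) *\<^sub>R z) * f (x + z))" by simp
  qed
  also have "\<dots> = (\<integral>w. ?g w * f (x + c *\<^sub>R w) \<partial>lborel)"
    using c by (subst lborel_affine_integral(2)[of "1 / c" "\<lambda>w. ?g w * f (x + c *\<^sub>R w)" 0]) auto
  also have "\<dots> = mean c std_gaussian f x" by (simp add: mean)
  finally show "mean a std_gaussian (mean b std_gaussian f) x = mean (sqrt (a\<^sup>2 + b\<^sup>2)) std_gaussian f x"
    by (simp add: c_def)
qed

lemma mean_gaussian_funpow:
  fixes f :: "real^'n \<Rightarrow> real"
  assumes "\<sigma> > 0" "k \<ge> 1" "bounded_borel B f"
  shows "(mean \<sigma> std_gaussian ^^ k) f = mean (\<sigma> * sqrt (real k)) std_gaussian f"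
  using assms(2)
proof (induction k rule: dec_induct)
  case (step k)
  have "sqrt (\<sigma>\<^sup>2 + (\<sigma> * sqrt (real k))\<^sup>2) = sqrt (\<sigma>\<^sup>2 * real (Suc k))"
    by (simp add: power_mult_distrib algebra_simps)
  also have "\<dots> = \<sigma> * sqrt (real (Suc k))" using assms by (simp add: real_sqrt_mult)
  finally show ?case
    using step assms mean_gaussian_semigroup[of \<sigma> "\<sigma> * sqrt (real k)" B f] by simp
qed simp

section \<open>Taylor expansion of the heat semigroup\<close>

fun iter_laplace :: "nat \<Rightarrow> ('n::finite list \<Rightarrow> real^'n \<Rightarrow> real) \<Rightarrow> 'n list \<Rightarrow> real^'n \<Rightarrow> real" where
  "iter_laplace 0 D \<alpha> x = D \<alpha> x"
| "iter_laplace (Suc k) D \<alpha> x = (\<Sum>j\<in>UNIV. iter_laplace k D (\<alpha> @ [j, j]) x)"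

lemma iter_laplace_eq: "iter_laplace k D \<alpha> x = (\<Sum>\<delta> | length \<delta> = 2 * k. paired \<delta> * D (\<alpha> @ \<delta>) x)"
proof (induction k arbitrary: \<alpha>)
  case 0
  show ?case by (simp add: sum_lists_0[simplified])
next
  case (Suc k)
  have "(\<Sum>\<delta> | length \<delta> = Suc (Suc (2 * k)). paired \<delta> * D (\<alpha> @ \<delta>) x)
      = (\<Sum>i\<in>UNIV. \<Sum>j\<in>UNIV. if i = j then \<Sum>\<delta> | length \<delta> = 2 * k. paired \<delta> * D (\<alpha> @ i # j # \<delta>) x else 0)"
    unfolding sum_lists_Cons by (intro sum.cong refl) auto
  also have "\<dots> = (\<Sum>i\<in>UNIV. \<Sum>\<delta> | length \<delta> = 2 * k. paired \<delta> * D (\<alpha> @ i # i # \<delta>) x)"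
    by simp
  finally show ?case using Suc by simp
qed

text \<open>Stein's identity, read off from two expressions for one gradient: differentiation of the
  Gaussian kernel, and the derivatives already supplied by \<open>D\<close>.\<close>

lemma mean_gaussian_stein:
  fixes D :: "'n::finite list \<Rightarrow> real^'n \<Rightarrow> real"
  assumes "jet L B D" "length \<alpha> + 2 \<le> L" "\<tau> > 0"
  shows "avg \<tau> std_gaussian (\<lambda>y. y $ i) (D \<alpha>) x = \<tau> * mean \<tau> std_gaussian (D (\<alpha> @ [i])) x"
proof -
  have "bounded_borel B (D \<alpha>)" using assms by (intro jet_bounded) auto
  from avg_hermite_grad[OF assms(3) this, of "[]" x]
  have 1: "(mean \<tau> std_gaussian (D \<alpha>) has_derivative
      (\<lambda>h. \<Sum>i\<in>UNIV. h $ i * (avg \<tau> std_gaussian (\<lambda>y. y $ i) (D \<alpha>) x / \<tau>))) (at x)"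
    by (simp add: mhermite_Nil_fun mhermite_single[abs_def])
  have "jet L (1 * B) (\<lambda>\<alpha>. mean \<tau> std_gaussian (D \<alpha>))"
    by (intro jet_conv_op conv_op_mean op_bound_mean assms prob_space_std_gaussian) auto
  from jet_grad[OF this assms(2), of x]
  have 2: "(mean \<tau> std_gaussian (D \<alpha>) has_derivative
      (\<lambda>h. \<Sum>i\<in>UNIV. h $ i * mean \<tau> std_gaussian (D (\<alpha> @ [i])) x)) (at x)"
    by (simp add: grad_rule_def)
  from coord_sum_unique[OF 1 2, of i] assms(3) show ?thesis by (simp add: field_simps)
qed

lemma integrable_std_gaussian_nth: "integrable std_gaussian (\<lambda>y :: real^'n. y $ i)"
  using integrable_mhermite[of "[i]"] by (simp add: mhermite_single[abs_def])

lemma integrable_norm1_power: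
  fixes \<mu> :: "(real^'n) measure"
  assumes "sets \<mu> = sets borel" "integrable \<mu> (\<lambda>x. norm x ^ q)"
  shows "integrable \<mu> (\<lambda>x. norm1 x ^ q)" "(\<integral>x. norm1 x ^ q \<partial>\<mu>) \<le> real CARD('n) ^ q * (\<integral>x. norm x ^ q \<partial>\<mu>)"
proof -
  have le: "norm1 x ^ q \<le> real CARD('n) ^ q * norm x ^ q" for x :: "real^'n"
    using power_mono[OF norm1_le norm1_nonneg] by (simp add: power_mult_distrib)
  have [measurable_cong]: "sets \<mu> = sets borel" by fact
  show int: "integrable \<mu> (\<lambda>x. norm1 x ^ q)"
  proof (rule Bochner_Integration.integrable_bound)
    show "integrable \<mu> (\<lambda>x. real CARD('n) ^ q * norm x ^ q)" using assms(2) by simp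
    show "(\<lambda>x. norm1 x ^ q) \<in> borel_measurable \<mu>" unfolding norm1_def by measurable
    have "\<bar>norm1 x ^ q\<bar> \<le> real CARD('n) ^ q * norm x ^ q" for x :: "real^'n"
      using le[of x] norm1_nonneg[of x] by simp
    then show "AE x in \<mu>. norm (norm1 x ^ q) \<le> norm (real CARD('n) ^ q * norm x ^ q)"
      by (auto intro!: AE_I2 order_trans[OF _ abs_ge_self])
  qed
  have "(\<integral>x. norm1 x ^ q \<partial>\<mu>) \<le> (\<integral>x. real CARD('n) ^ q * norm x ^ q \<partial>\<mu>)"
    using assms(2) by (intro integral_mono int le) auto
  then show "(\<integral>x. norm1 x ^ q \<partial>\<mu>) \<le> real CARD('n) ^ q * (\<integral>x. norm x ^ q \<partial>\<mu>)" by simp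
qed

lemma mean_gaussian_DERIV:
  fixes D :: "'n::finite list \<Rightarrow> real^'n \<Rightarrow> real"
  assumes "jet L B D" "length \<alpha> + 2 \<le> L"
  shows "((\<lambda>\<tau>. mean \<tau> std_gaussian (D \<alpha>) x) has_real_derivative
    (\<Sum>i\<in>UNIV. avg \<tau> std_gaussian (\<lambda>y. y $ i) (D (\<alpha> @ [i])) x)) (at \<tau>)"
proof -
  let ?s = "\<Sum>i\<in>UNIV. avg \<tau> std_gaussian (\<lambda>y. y $ i) (D (\<alpha> @ [i])) x"
  let ?G = "std_gaussian :: (real^'n) measure"
  have b0: "bounded_borel B (D \<alpha>)" using assms by (intro jet_bounded) auto
  have b1: "bounded_borel B (D (\<alpha> @ [i]))" for i using assms by (intro jet_bounded[OF assms(1)]) auto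
  have "((\<lambda>\<tau>. mean \<tau> ?G (D \<alpha>) x) has_derivative (\<lambda>\<epsilon>. \<epsilon> * ?s)) (at \<tau>)"
  proof (rule has_derivative_quadratic[where K = "B * (\<integral>y. norm1 y ^ 2 \<partial>?G)"])
    fix \<epsilon> :: real
    let ?r = "\<lambda>y. D \<alpha> (x + \<tau> *\<^sub>R y + \<epsilon> *\<^sub>R y) - taylor_poly D \<alpha> 2 (x + \<tau> *\<^sub>R y) (\<epsilon> *\<^sub>R y)"
    have int0: "integrable ?G (\<lambda>y. D \<alpha> (x + s *\<^sub>R y))" for s
      using avg_integrable[OF _ _ b0, of ?G "\<lambda>_. 1" x s] by simp
    have int1: "integrable ?G (\<lambda>y. y $ i * D (\<alpha> @ [i]) (x + \<tau> *\<^sub>R y))" for i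
      by (intro avg_integrable[OF _ _ b1] integrable_std_gaussian_nth) simp
    have "mean (\<tau> + \<epsilon>) ?G (D \<alpha>) x - mean \<tau> ?G (D \<alpha>) x - \<epsilon> * ?s
        = (\<integral>y. D \<alpha> (x + (\<tau> + \<epsilon>) *\<^sub>R y) - D \<alpha> (x + \<tau> *\<^sub>R y)
          - \<epsilon> * (\<Sum>i\<in>UNIV. y $ i * D (\<alpha> @ [i]) (x + \<tau> *\<^sub>R y)) \<partial>?G)"
      unfolding avg_def using int0[of \<tau>] int0[of "\<tau> + \<epsilon>"] int1 by simp
    also have "\<dots> = (\<integral>y. ?r y \<partial>?G)"
      by (intro Bochner_Integration.integral_cong) (auto simp: taylor_poly_2 algebra_simps sum_distrib_left)
    also have "\<bar>\<dots>\<bar> \<le> (\<integral>y. B * norm1 y ^ 2 * \<bar>\<epsilon>\<bar>\<^sup>2 \<partial>?G)"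
    proof (rule order_trans[OF integral_abs_bound integral_mono])
      have "integrable ?G (\<lambda>y. D \<alpha> (x + (\<tau> + \<epsilon>) *\<^sub>R y) - D \<alpha> (x + \<tau> *\<^sub>R y)
          - \<epsilon> * (\<Sum>i\<in>UNIV. y $ i * D (\<alpha> @ [i]) (x + \<tau> *\<^sub>R y)))"
        using int0 int1 by simp
      moreover have "(\<lambda>y. D \<alpha> (x + (\<tau> + \<epsilon>) *\<^sub>R y) - D \<alpha> (x + \<tau> *\<^sub>R y)
          - \<epsilon> * (\<Sum>i\<in>UNIV. y $ i * D (\<alpha> @ [i]) (x + \<tau> *\<^sub>R y))) = ?r"
        by (auto simp: taylor_poly_2 algebra_simps sum_distrib_left)
      ultimately show "integrable ?G (\<lambda>y. \<bar>?r y\<bar>)" by simp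
      show "integrable ?G (\<lambda>y. B * norm1 y ^ 2 * \<bar>\<epsilon>\<bar>\<^sup>2)"
        by (intro integrable_mult_left integrable_mult_right integrable_norm1_power gaussian_norm_power) simp
      fix y :: "real^'n"
      have "norm1 (\<epsilon> *\<^sub>R y) = \<bar>\<epsilon>\<bar> * norm1 y" by (simp add: norm1_def abs_mult sum_distrib_left)
      then show "\<bar>?r y\<bar> \<le> B * norm1 y ^ 2 * \<bar>\<epsilon>\<bar>\<^sup>2"
        using jet_taylor[OF assms, of "x + \<tau> *\<^sub>R y" "\<epsilon> *\<^sub>R y"] by (simp add: power_mult_distrib mult_ac)
    qed
    finally show "\<bar>mean (\<tau> + \<epsilon>) ?G (D \<alpha>) x - mean \<tau> ?G (D \<alpha>) x - \<epsilon> * ?s\<bar> \<le> B * (\<integral>y. norm1 y ^ 2 \<partial>?G) * (norm \<epsilon>)\<^sup>2"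
      by simp
  qed (rule bounded_linear_mult_left)
  then show ?thesis by (simp add: has_field_derivative_def mult.commute[of _ ?s])
qed

text \<open>By Stein's identity the derivative of the average in \<open>\<tau>\<close> is
  \<open>\<tau>\<close> times the average of the Laplacian, and the Taylor sum obeys the same rule
  with one term less. The mean value theorem thus passes from \<open>K\<close> to
  \<open>Suc K\<close>, gaining two powers of \<open>\<tau>\<close> and a factor
  \<open>CARD('n)\<close> from the sum over \<open>j\<close>.\<close>

lemma heat_taylor_laplace:
  fixes D :: "'n::finite list \<Rightarrow> real^'n \<Rightarrow> real"
  assumes jet: "jet L B D" and "length \<alpha> + 2 * K + 1 \<le> L" "0 \<le> \<tau>"
  shows "\<bar>mean \<tau> std_gaussian (D \<alpha>) x - (\<Sum>k<K. (\<tau>\<^sup>2 / 2) ^ k / fact k * iter_laplace k D \<alpha> x)\<bar>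
    \<le> real CARD('n) ^ K * B * \<tau> ^ (2 * K)"
  using assms(2,3)
proof (induction K arbitrary: \<alpha> \<tau>)
  case 0
  have "bounded_borel (1 * B) (mean \<tau> std_gaussian (D \<alpha>))"
    using op_bound_mean[OF prob_space_std_gaussian sets_std_gaussian, of \<tau>] jet_bounded[OF jet, of \<alpha>] 0
    by (auto simp: op_bound_def)
  then show ?case by (simp add: bounded_borel_def)
next
  case (Suc K)
  let ?G = "std_gaussian :: (real^'n) measure"
  let ?N = "real CARD('n)"
  have B0: "0 \<le> B" by (rule jet_nonneg[OF jet])
  define w where "w s = mean s ?G (D \<alpha>) x - (\<Sum>k<Suc K. (s\<^sup>2 / 2) ^ k / fact k * iter_laplace k D \<alpha> x)" for s
  define e where "e s j = mean s ?G (D (\<alpha> @ [j, j])) x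
      - (\<Sum>k<K. (s\<^sup>2 / 2) ^ k / fact k * iter_laplace k D (\<alpha> @ [j, j]) x)" for s j
  have w0: "w 0 = 0"
  proof -
    have "(\<Sum>k<Suc K. ((0::real)\<^sup>2 / 2) ^ k / fact k * iter_laplace k D \<alpha> x)
        = (\<Sum>k\<in>{0}. ((0::real)\<^sup>2 / 2) ^ k / fact k * iter_laplace k D \<alpha> x)"
      by (rule sum.mono_neutral_right) auto
    then have "w 0 = mean 0 ?G (D \<alpha>) x - D \<alpha> x" unfolding w_def by simp
    then show ?thesis by (simp add: avg_def prob_space.prob_space[OF prob_space_std_gaussian, simplified])
  qed
  have dsum: "((\<lambda>s. \<Sum>k<Suc K. (s\<^sup>2 / 2) ^ k / fact k * iter_laplace k D \<alpha> x) has_real_derivative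
      s * (\<Sum>k<K. (s\<^sup>2 / 2) ^ k / fact k * iter_laplace (Suc k) D \<alpha> x)) (at s)" for s
  proof -
    have d1: "((\<lambda>s. (s\<^sup>2 / 2) ^ Suc k / fact (Suc k)) has_real_derivative s * ((s\<^sup>2 / 2) ^ k / fact k)) (at s)" for k
    proof -
      have "((\<lambda>s. s\<^sup>2 / 2) has_real_derivative s) (at s)" by (auto intro!: derivative_eq_intros)
      from DERIV_cdivide[OF DERIV_power[OF this, of "Suc k"], of "fact (Suc k)"]
      show ?thesis by (simp add: mult.assoc del: of_nat_Suc)
    qed
    have "((\<lambda>s. D \<alpha> x + (\<Sum>k<K. (s\<^sup>2 / 2) ^ Suc k / fact (Suc k) * iter_laplace (Suc k) D \<alpha> x)) has_real_derivative
        0 + (\<Sum>k<K. (s * ((s\<^sup>2 / 2) ^ k / fact k)) * iter_laplace (Suc k) D \<alpha> x)) (at s)"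
      by (intro DERIV_add DERIV_sum DERIV_cmult_right d1) auto
    then show ?thesis
      unfolding sum.lessThan_Suc_shift by (simp add: sum_distrib_left mult.assoc)
  qed
  have dw: "DERIV w s :> (\<Sum>i\<in>UNIV. avg s ?G (\<lambda>y. y $ i) (D (\<alpha> @ [i])) x)
      - s * (\<Sum>k<K. (s\<^sup>2 / 2) ^ k / fact k * iter_laplace (Suc k) D \<alpha> x)" for s
    unfolding w_def[abs_def] using Suc.prems by (intro DERIV_diff dsum mean_gaussian_DERIV[OF jet]) auto
  show ?case
  proof (cases "\<tau> = 0")
    case True
    then show ?thesis using w0 B0 by (simp add: w_def)
  next
    case False
    then have \<tau>: "0 < \<tau>" using Suc.prems by simp
    have "\<exists>l z. 0 < z \<and> z < \<tau> \<and> DERIV w z :> l \<and> w \<tau> - w 0 = (\<tau> - 0) * l"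
      using dw by (intro MVT[OF \<tau>]) (auto intro!: continuous_at_imp_continuous_on DERIV_isCont
          simp: real_differentiable_def)
    then obtain l s where s: "0 < s" "s < \<tau>" and l: "DERIV w s :> l" and eq: "w \<tau> = \<tau> * l"
      using w0 by auto
    have "l = (\<Sum>i\<in>UNIV. avg s ?G (\<lambda>y. y $ i) (D (\<alpha> @ [i])) x)
        - s * (\<Sum>k<K. (s\<^sup>2 / 2) ^ k / fact k * iter_laplace (Suc k) D \<alpha> x)"
      by (rule DERIV_unique[OF l dw])
    also have "(\<Sum>i\<in>UNIV. avg s ?G (\<lambda>y. y $ i) (D (\<alpha> @ [i])) x) = (\<Sum>i\<in>UNIV. s * mean s ?G (D (\<alpha> @ [i, i])) x)"
    proof (intro sum.cong refl)
      fix i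
      show "avg s ?G (\<lambda>y. y $ i) (D (\<alpha> @ [i])) x = s * mean s ?G (D (\<alpha> @ [i, i])) x"
        using mean_gaussian_stein[OF jet, of "\<alpha> @ [i]" s i x] Suc.prems s by simp
    qed
    also have "s * (\<Sum>k<K. (s\<^sup>2 / 2) ^ k / fact k * iter_laplace (Suc k) D \<alpha> x)
        = (\<Sum>j\<in>UNIV. s * (\<Sum>k<K. (s\<^sup>2 / 2) ^ k / fact k * iter_laplace k D (\<alpha> @ [j, j]) x))"
      unfolding iter_laplace.simps sum_distrib_left by (rule sum.swap)
    also have "(\<Sum>i\<in>UNIV. s * mean s ?G (D (\<alpha> @ [i, i])) x) - \<dots> = s * (\<Sum>j\<in>UNIV. e s j)"
      by (simp add: e_def sum_subtractf sum_distrib_left right_diff_distrib)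
    finally have l': "l = s * (\<Sum>j\<in>UNIV. e s j)" .
    have "\<bar>\<Sum>j\<in>UNIV. e s j\<bar> \<le> (\<Sum>j\<in>(UNIV :: 'n set). ?N ^ K * B * s ^ (2 * K))"
      unfolding e_def using Suc.prems s by (intro order_trans[OF sum_abs] sum_mono Suc.IH) auto
    also have "\<dots> = ?N ^ Suc K * B * s ^ (2 * K)" by simp
    also have "\<dots> \<le> ?N ^ Suc K * B * \<tau> ^ (2 * K)"
      using s B0 by (intro mult_left_mono power_mono) auto
    finally have "\<bar>l\<bar> \<le> \<tau> * (?N ^ Suc K * B * \<tau> ^ (2 * K))"
      unfolding l' abs_mult using s by (intro mult_mono) auto
    then have "\<bar>w \<tau>\<bar> \<le> \<tau> * (\<tau> * (?N ^ Suc K * B * \<tau> ^ (2 * K)))"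
      unfolding eq abs_mult using \<tau> by (intro mult_mono) auto
    then show ?thesis by (simp add: w_def mult_ac power2_eq_square)
  qed
qed

lemma heat_taylor:
  fixes D :: "'n::finite list \<Rightarrow> real^'n \<Rightarrow> real"
  assumes "jet L B D" "length \<alpha> + q + 3 \<le> L" "0 \<le> \<tau>" "\<tau> \<le> 1"
  shows "\<bar>mean \<tau> std_gaussian (D \<alpha>) x - (\<Sum>\<delta> | length \<delta> \<le> q. \<tau> ^ length \<delta> * heat_coeff \<delta> * D (\<alpha> @ \<delta>) x)\<bar>
    \<le> real CARD('n) ^ (q + 1) * B * \<tau> ^ (q + 1)"
proof -
  \<comment> \<open>The number of even orders up to \<open>q\<close>; the first omitted order
    \<open>2 * K\<close> is then at least \<open>q + 1\<close>.\<close>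
  define K where "K = q div 2 + 1"
  let ?N = "real CARD('n)"
  have "(\<Sum>\<delta> | length \<delta> \<le> q. \<tau> ^ length \<delta> * heat_coeff \<delta> * D (\<alpha> @ \<delta>) x)
      = (\<Sum>j<Suc q. \<Sum>\<delta> | length \<delta> = j. \<tau> ^ length \<delta> * heat_coeff \<delta> * D (\<alpha> @ \<delta>) x)"
    using sum_lists_less[of "\<lambda>\<delta>. \<tau> ^ length \<delta> * heat_coeff \<delta> * D (\<alpha> @ \<delta>) x" "Suc q"] by (simp add: less_Suc_eq_le)
  also have "\<dots> = (\<Sum>j\<in>(*) 2 ` {..<K}. \<Sum>\<delta> | length \<delta> = j. \<tau> ^ length \<delta> * heat_coeff \<delta> * D (\<alpha> @ \<delta>) x)"
  proof (rule sum.mono_neutral_right)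
    show "\<forall>j\<in>{..<Suc q} - (*) 2 ` {..<K}. (\<Sum>\<delta> | length \<delta> = j. \<tau> ^ length \<delta> * heat_coeff \<delta> * D (\<alpha> @ \<delta>) x) = 0"
    proof
      fix j assume "j \<in> {..<Suc q} - (*) 2 ` {..<K}"
      then have "odd j" by (auto elim!: evenE simp: K_def)
      then show "(\<Sum>\<delta> | length \<delta> = j. \<tau> ^ length \<delta> * heat_coeff \<delta> * D (\<alpha> @ \<delta>) x) = 0"
        by (intro sum.neutral) (auto simp: heat_coeff_def paired_odd)
    qed
  qed (auto simp: K_def)
  also have "\<dots> = (\<Sum>k<K. \<Sum>\<delta> | length \<delta> = 2 * k. \<tau> ^ length \<delta> * heat_coeff \<delta> * D (\<alpha> @ \<delta>) x)"
    by (subst sum.reindex) (auto simp: inj_on_def)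
  also have "\<dots> = (\<Sum>k<K. (\<tau>\<^sup>2 / 2) ^ k / fact k * iter_laplace k D \<alpha> x)"
    unfolding iter_laplace_eq sum_distrib_left
    by (intro sum.cong refl) (auto simp: heat_coeff_def power_mult power_divide)
  finally have eq: "(\<Sum>\<delta> | length \<delta> \<le> q. \<tau> ^ length \<delta> * heat_coeff \<delta> * D (\<alpha> @ \<delta>) x)
      = (\<Sum>k<K. (\<tau>\<^sup>2 / 2) ^ k / fact k * iter_laplace k D \<alpha> x)" .
  have "\<bar>mean \<tau> std_gaussian (D \<alpha>) x - (\<Sum>k<K. (\<tau>\<^sup>2 / 2) ^ k / fact k * iter_laplace k D \<alpha> x)\<bar>
      \<le> ?N ^ K * B * \<tau> ^ (2 * K)"
    using assms by (intro heat_taylor_laplace[OF assms(1)]) (auto simp: K_def)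
  also have "\<dots> \<le> ?N ^ (q + 1) * B * \<tau> ^ (q + 1)"
    using assms jet_nonneg[OF assms(1)]
    by (intro mult_mono power_increasing power_decreasing) (auto simp: K_def)
  finally show ?thesis unfolding eq .
qed

section \<open>Smoothing by laws minorized by Lebesgue measure\<close>

lemma avg_scale_derivative:
  fixes f :: "real^'n \<Rightarrow> real"
  assumes "\<And>g x. bounded_borel c g \<Longrightarrow>
      (avg 1 \<nu> w g has_derivative (\<lambda>h. \<Sum>i\<in>UNIV. h $ i * avg 1 \<nu> (v i) g x)) (at x)"
    and "\<sigma> > 0" "bounded_borel c f"
  shows "(avg \<sigma> \<nu> w f has_derivative (\<lambda>h. \<Sum>i\<in>UNIV. h $ i * (avg \<sigma> \<nu> (v i) f x / \<sigma>))) (at x)"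
proof -
  define g where "g z = f (\<sigma> *\<^sub>R z)" for z
  have [measurable]: "f \<in> borel_measurable borel" using assms by (simp add: bounded_borel_def)
  have "bounded_borel c g" using assms(3) unfolding g_def[abs_def] bounded_borel_def by simp
  from assms(1)[OF this, of "x /\<^sub>R \<sigma>"]
  have "(avg 1 \<nu> w g has_derivative (\<lambda>h. \<Sum>i\<in>UNIV. h $ i * avg 1 \<nu> (v i) g (x /\<^sub>R \<sigma>))) (at (x /\<^sub>R \<sigma>))" .
  moreover have "((\<lambda>x. x /\<^sub>R \<sigma>) has_derivative (\<lambda>h. h /\<^sub>R \<sigma>)) (at x)"
    by (auto intro!: derivative_eq_intros)
  ultimately have "((\<lambda>x. avg 1 \<nu> w g (x /\<^sub>R \<sigma>)) has_derivative
      (\<lambda>h. \<Sum>i\<in>UNIV. (h /\<^sub>R \<sigma>) $ i * avg 1 \<nu> (v i) g (x /\<^sub>R \<sigma>))) (at x)"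
    by (rule has_derivative_compose[rotated])
  moreover have "avg 1 \<nu> u g (y /\<^sub>R \<sigma>) = avg \<sigma> \<nu> u f y" for u y
    using assms(2) by (simp add: avg_def g_def scaleR_add_right)
  ultimately show ?thesis by (simp add: divide_inverse mult_ac)
qed

text \<open>\<open>s\<close> is the score of \<open>\<nu>\<close>, the negative logarithmic gradient of its density.\<close>
locale smooth_law = prob_space \<nu> for \<nu> :: "(real^'n::finite) measure" +
  fixes s :: "'n \<Rightarrow> real^'n \<Rightarrow> real" and I :: real
  assumes sets_eq: "sets \<nu> = sets borel"
    and score: "integrable \<nu> (s i)"
    and score2: "integrable \<nu> (\<lambda>y. (s i y)\<^sup>2)" "(\<integral>y. (s i y)\<^sup>2 \<partial>\<nu>) \<le> I"
    and I_pos: "0 < I"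
    and unit_derivative: "bounded_borel c f \<Longrightarrow>
      (mean 1 \<nu> f has_derivative (\<lambda>h. \<Sum>i\<in>UNIV. h $ i * avg 1 \<nu> (s i) f x)) (at x)"
begin

lemma mean_derivative:
  assumes "\<sigma> > 0" "bounded_borel c f"
  shows "(mean \<sigma> \<nu> f has_derivative (\<lambda>h. \<Sum>i\<in>UNIV. h $ i * (avg \<sigma> \<nu> (s i) f x / \<sigma>))) (at x)"
  using unit_derivative assms by (rule avg_scale_derivative)

text \<open>The derivative formula applied to the constant function 1, whose average has gradient
  0.\<close>

lemma score_centered: "(\<integral>y. s i y \<partial>\<nu>) = 0"
proof -
  have "bounded_borel 1 (\<lambda>_ :: real^'n. 1)" by (simp add: bounded_borel_def)
  from unit_derivative[OF this, of 0]
  moreover have "mean 1 \<nu> (\<lambda>_. 1) = (\<lambda>_. 1)" "avg 1 \<nu> (s i) (\<lambda>_. 1) 0 = (\<integral>y. s i y \<partial>\<nu>)" for i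
    by (simp_all add: fun_eq_iff avg_def prob_space)
  ultimately have "((\<lambda>_. 1) has_derivative (\<lambda>h. \<Sum>i\<in>UNIV. h $ i * (\<integral>y. s i y \<partial>\<nu>))) (at (0 :: real^'n))"
    by simp
  moreover have "((\<lambda>_. 1 :: real) has_derivative (\<lambda>h. \<Sum>i\<in>UNIV. h $ i * 0)) (at (0 :: real^'n))" by simp
  ultimately show ?thesis by (rule coord_sum_unique)
qed

lemma conv_op_score: "conv_op (avg \<sigma> \<nu> (s i))"
  by (intro conv_op.avg score sets_eq finite_measure_axioms)

lemma conv_op_mean_law: "conv_op (mean \<sigma> \<nu>)"
  by (intro conv_op_mean sets_eq prob_space_axioms)

lemma op_bound_mean_law: "op_bound 1 (mean \<sigma> \<nu>)"
  by (intro op_bound_mean sets_eq prob_space_axioms)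

text \<open>
  The left-hand side is \<open>E[f(x + \<sigma>(Y\<^sub>1 + \<dots> + Y\<^sub>k)) (w + \<Sum>\<^sub>j s i Y\<^sub>j)]\<close>, estimated by AM-GM and the
  variance of the score sum; carrying \<open>w\<close> along lets the induction on \<open>k\<close> avoid product measures.
\<close>
lemma score_sum_bound:
  assumes "bounded_borel 1 f" "\<delta> > 0"
  shows "\<bar>w * (mean \<sigma> \<nu> ^^ k) f x + real k * avg \<sigma> \<nu> (s i) ((mean \<sigma> \<nu> ^^ (k - 1)) f) x\<bar>
    \<le> \<delta> / 2 * (w\<^sup>2 + real k * I) + 1 / (2 * \<delta>)"
proof (induction k arbitrary: w x)
  case 0
  have "\<bar>w * f x\<bar> \<le> \<bar>w\<bar>"
    using assms(1) unfolding abs_mult bounded_borel_def by (intro mult_left_le) auto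
  moreover have "0 \<le> (\<delta> * \<bar>w\<bar> - 1)\<^sup>2 / (2 * \<delta>)" using assms(2) by simp
  then have "\<bar>w\<bar> \<le> \<delta> / 2 * w\<^sup>2 + 1 / (2 * \<delta>)"
    using assms(2) by (simp add: power2_eq_square field_simps)
  ultimately show ?case by simp
next
  case (Suc k)
  let ?V = "mean \<sigma> \<nu>" and ?S = "avg \<sigma> \<nu> (s i)"
  have bV: "bounded_borel 1 ((?V ^^ m) f)" for m
  proof -
    have "op_bound (1 ^ m) (?V ^^ m)" by (intro op_bound_funpow op_bound_mean_law)
    then show ?thesis using assms(1) unfolding op_bound_def by fastforce
  qed
  obtain c where bS: "bounded_borel c (?S ((?V ^^ (k - 1)) f))"
    using conv_op_bdd[OF conv_op_score] bV by blast
  have int1: "integrable \<nu> (\<lambda>y. (?V ^^ k) f (x + \<sigma> *\<^sub>R y))"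
    using avg_integrable[OF sets_eq _ bV, of "\<lambda>_. 1"] by simp
  have int2: "integrable \<nu> (\<lambda>y. s i y * (?V ^^ k) f (x + \<sigma> *\<^sub>R y))"
    by (rule avg_integrable[OF sets_eq score bV])
  have int3: "integrable \<nu> (\<lambda>y. ?S ((?V ^^ (k - 1)) f) (x + \<sigma> *\<^sub>R y))"
    using avg_integrable[OF sets_eq _ bS, of "\<lambda>_. 1"] by simp
  have "real k * ?S ((?V ^^ k) f) x = real k * ?V (?S ((?V ^^ (k - 1)) f)) x"
  proof (cases k)
    case (Suc m)
    have "bdd_borel ((?V ^^ m) f)" using bV by blast
    then have "?S (?V ((?V ^^ m) f)) = ?V (?S ((?V ^^ m) f))"
      by (rule conv_op_commute[OF conv_op_score conv_op_mean_law])
    then show ?thesis using Suc by simp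
  qed simp
  \<comment> \<open>Conditioning on the newly added variable \<open>y\<close> shifts the weight to
    \<open>w + s i y\<close> and the base point to \<open>x + \<sigma> *\<^sub>R y\<close>, where
    the induction hypothesis applies.\<close>
  then have eq: "w * (?V ^^ Suc k) f x + real (Suc k) * ?S ((?V ^^ (Suc k - 1)) f) x
      = (\<integral>y. w * (?V ^^ k) f (x + \<sigma> *\<^sub>R y) + s i y * (?V ^^ k) f (x + \<sigma> *\<^sub>R y)
          + real k * ?S ((?V ^^ (k - 1)) f) (x + \<sigma> *\<^sub>R y) \<partial>\<nu>)"
    using int1 int2 int3 by (simp add: avg_def algebra_simps)
  have "\<bar>\<integral>y. w * (?V ^^ k) f (x + \<sigma> *\<^sub>R y) + s i y * (?V ^^ k) f (x + \<sigma> *\<^sub>R y)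
          + real k * ?S ((?V ^^ (k - 1)) f) (x + \<sigma> *\<^sub>R y) \<partial>\<nu>\<bar> \<le> (\<integral>y. \<delta> / 2 * (w\<^sup>2 + 2 * w * s i y + (s i y)\<^sup>2 + real k * I) + 1 / (2 * \<delta>) \<partial>\<nu>)"
  proof (rule order_trans[OF integral_abs_bound integral_mono])
    show "integrable \<nu> (\<lambda>y. \<bar>w * (?V ^^ k) f (x + \<sigma> *\<^sub>R y) + s i y * (?V ^^ k) f (x + \<sigma> *\<^sub>R y)
        + real k * ?S ((?V ^^ (k - 1)) f) (x + \<sigma> *\<^sub>R y)\<bar>)"
      using int1 int2 int3 by simp
    show "integrable \<nu> (\<lambda>y. \<delta> / 2 * (w\<^sup>2 + 2 * w * s i y + (s i y)\<^sup>2 + real k * I) + 1 / (2 * \<delta>))"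
      using score[of i] score2(1)[of i] by simp
    fix y
    show "\<bar>w * (?V ^^ k) f (x + \<sigma> *\<^sub>R y) + s i y * (?V ^^ k) f (x + \<sigma> *\<^sub>R y)
        + real k * ?S ((?V ^^ (k - 1)) f) (x + \<sigma> *\<^sub>R y)\<bar>
        \<le> \<delta> / 2 * (w\<^sup>2 + 2 * w * s i y + (s i y)\<^sup>2 + real k * I) + 1 / (2 * \<delta>)"
      using Suc.IH[of "w + s i y" "x + \<sigma> *\<^sub>R y"] by (simp add: power2_sum distrib_right add_ac)
  qed
  \<comment> \<open>The cross term \<open>2 * w * s i y\<close> integrates to 0, so the squared
    weight grows only by the variance of one score.\<close>
  also have "\<dots> = \<delta> / 2 * (w\<^sup>2 + (\<integral>y. (s i y)\<^sup>2 \<partial>\<nu>) + real k * I) + 1 / (2 * \<delta>)"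
  proof -
    define e where "e = \<delta> / 2 * (w\<^sup>2 + real k * I) + 1 / (2 * \<delta>)"
    have "(\<integral>y. \<delta> / 2 * (w\<^sup>2 + 2 * w * s i y + (s i y)\<^sup>2 + real k * I) + 1 / (2 * \<delta>) \<partial>\<nu>)
        = (\<integral>y. e + (\<delta> * w) * s i y + (\<delta> / 2) * (s i y)\<^sup>2 \<partial>\<nu>)"
      by (intro Bochner_Integration.integral_cong refl) (simp add: e_def algebra_simps)
    also have "\<dots> = e + \<delta> / 2 * (\<integral>y. (s i y)\<^sup>2 \<partial>\<nu>)"
      using score[of i] score2(1)[of i] by (simp add: score_centered prob_space)
    finally show ?thesis by (simp add: e_def algebra_simps)
  qed
  also have "\<dots> \<le> \<delta> / 2 * (w\<^sup>2 + I + real k * I) + 1 / (2 * \<delta>)"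
    using score2(2)[of i] assms(2) by (intro add_right_mono mult_left_mono) auto
  also have "\<dots> = \<delta> / 2 * (w\<^sup>2 + real (Suc k) * I) + 1 / (2 * \<delta>)"
    by (simp add: distrib_right add_ac)
  finally show ?case unfolding eq .
qed

text \<open>By exchangeability the score of one summand can be replaced by the mean of all
  \<open>k\<close> scores, whose standard deviation is of order \<open>1 / sqrt k\<close>. This gain
  is what makes a block smooth at a scale growing with its length.\<close>

lemma score_mean_bound:
  assumes "k \<ge> 1"
  shows "op_bound (sqrt (I / real k)) (\<lambda>f. avg \<sigma> \<nu> (s i) ((mean \<sigma> \<nu> ^^ (k - 1)) f))"
  unfolding op_bound_def
proof (intro allI impI)
  fix b and f :: "real^'n \<Rightarrow> real" assume f: "bounded_borel b f"
  let ?T = "\<lambda>f. avg \<sigma> \<nu> (s i) ((mean \<sigma> \<nu> ^^ (k - 1)) f)"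
  have T: "conv_op ?T"
    by (intro conv_op.comp[OF conv_op_score] conv_op_funpow conv_op_mean_law)
  have unit: "\<bar>?T g x\<bar> \<le> sqrt (I / real k)" if "bounded_borel 1 g" for g x
  proof -
    \<comment> \<open>\<open>\<delta> = 1 / r\<close> minimizes
      \<open>\<delta> / 2 * r\<^sup>2 + 1 / (2 * \<delta>)\<close>, and the minimum is
      \<open>r\<close>.\<close>
    define r where "r = sqrt (real k * I)"
    have r: "r > 0" "real k * I = r * r" using assms I_pos by (simp_all add: r_def)
    have "\<bar>0 * (mean \<sigma> \<nu> ^^ k) g x + real k * ?T g x\<bar> \<le> (1 / r) / 2 * (0\<^sup>2 + real k * I) + 1 / (2 * (1 / r))"
      using r(1) that by (intro score_sum_bound) auto
    also have "\<dots> = r" unfolding r(2) using r(1) by simp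
    also have "r = real k * sqrt (I / real k)"
      using assms by (simp add: r_def real_sqrt_mult real_sqrt_divide field_simps)
    finally show ?thesis using assms by (simp add: abs_mult)
  qed
  show "bounded_borel (sqrt (I / real k) * b) (?T f)"
  proof (cases "b = 0")
    case True
    then have "f = (\<lambda>_. 0)" using f by (auto simp: bounded_borel_def)
    then have "?T f = (\<lambda>x. 0 * ?T f x)"
      using conv_op_scale[OF T, of f 0] f by auto
    then have "?T f = (\<lambda>x. 0)" by (metis mult_zero_left)
    then show ?thesis using True by (simp add: bounded_borel_def)
  next
    case False
    then have b: "b > 0" using bounded_borel_nonneg[OF f] by simp
    have g: "bounded_borel 1 (\<lambda>x. (1 / b) * f x)"
      using f b by (auto simp: bounded_borel_def abs_mult divide_le_eq)
    have eq: "?T (\<lambda>x. (1 / b) * f x) = (\<lambda>x. (1 / b) * ?T f x)"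
      using f by (intro conv_op_scale[OF T]) auto
    have "\<bar>?T f x\<bar> \<le> sqrt (I / real k) * b" for x
      using unit[OF g, of x] b unfolding eq by (simp add: abs_mult divide_le_eq)
    moreover have "?T f \<in> borel_measurable borel"
      using conv_op_bdd[OF T] f by (auto simp: bounded_borel_def)
    ultimately show ?thesis by (simp add: bounded_borel_def)
  qed
qed

end

text \<open>The mean of \<open>1 / (k + 1)\<close> under a binomial law: absorbing the denominator
  shifts the sum to \<open>b + 1\<close> trials, with the term of no success missing.\<close>

lemma binomial_inverse_sum:
  assumes "0 < p" "p \<le> 1"
  shows "(\<Sum>k\<le>b. real (b choose k) * p ^ k * (1 - p) ^ (b - k) / real (k + 1)) \<le> 1 / (p * real (b + 1))"
proof -
  have *: "real (b choose k) / real (k + 1) = real (Suc b choose Suc k) / real (b + 1)" for k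
  proof -
    have "real (Suc k) * real (Suc b choose Suc k) = real (Suc b) * real (b choose k)"
      using Suc_times_binomial[of k b] by (metis of_nat_mult)
    then show ?thesis by (simp add: field_simps del: binomial_Suc_Suc)
  qed
  have "(\<Sum>k\<le>b. real (b choose k) * p ^ k * (1 - p) ^ (b - k) / real (k + 1))
      = (\<Sum>k\<le>b. real (Suc b choose Suc k) * p ^ Suc k * (1 - p) ^ (Suc b - Suc k)) / (p * real (b + 1))"
    unfolding sum_divide_distrib
  proof (intro sum.cong refl)
    fix k
    have "real (b choose k) * p ^ k * (1 - p) ^ (b - k) / real (k + 1)
        = (real (b choose k) / real (k + 1)) * (p ^ k * (1 - p) ^ (b - k))" by simp
    also have "\<dots> = (real (Suc b choose Suc k) / real (b + 1)) * (p ^ k * (1 - p) ^ (b - k))"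
      by (simp only: *)
    finally show "real (b choose k) * p ^ k * (1 - p) ^ (b - k) / real (k + 1)
        = real (Suc b choose Suc k) * p ^ Suc k * (1 - p) ^ (Suc b - Suc k) / (p * real (b + 1))"
      using assms by (simp del: binomial_Suc_Suc)
  qed
  also have "(\<Sum>k\<le>b. real (Suc b choose Suc k) * p ^ Suc k * (1 - p) ^ (Suc b - Suc k))
      \<le> (\<Sum>k\<le>Suc b. real (Suc b choose k) * p ^ k * (1 - p) ^ (Suc b - k))"
    unfolding sum.atMost_Suc_shift[of _ b] using assms by simp
  also have "\<dots> = (p + (1 - p)) ^ Suc b" by (rule binomial_ring[symmetric])
  finally show ?thesis using assms by (simp add: divide_right_mono)
qed

text \<open>The root is linearized around the target value \<open>d\<close> by AM-GM, so that only
  the mean of \<open>1 / (k + 1)\<close> enters; the factor 2 under the root comes from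
  \<open>k + 1 \<le> 2 * k\<close>.\<close>

lemma binomial_inverse_sqrt_sum:
  assumes "0 < p" "p \<le> 1" "0 < I"
  shows "(\<Sum>k=1..b. real (b choose k) * p ^ k * (1 - p) ^ (b - k) * sqrt (I / real k))
    \<le> sqrt (2 * I / (p * real (b + 1)))"
proof -
  define d where "d = sqrt (2 * I / (p * real (b + 1)))"
  have d: "d > 0" "d\<^sup>2 = 2 * I / (p * real (b + 1))" using assms by (simp_all add: d_def)
  let ?w = "\<lambda>k. real (b choose k) * p ^ k * (1 - p) ^ (b - k)"
  have w0: "0 \<le> ?w k" for k using assms by simp
  have "sqrt (I / real k) \<le> d / 2 + (I / d) * (1 / real (k + 1))" if "k \<ge> 1" for k
  proof -
    let ?r = "sqrt (I / real k)"
    have "0 \<le> (d - ?r)\<^sup>2 / (2 * d)" using d by simp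
    also have "\<dots> = d / 2 - ?r + ?r\<^sup>2 / (2 * d)"
      using d(1) by (simp add: power2_eq_square field_simps)
    also have "?r\<^sup>2 = I / real k" using assms by simp
    finally have "?r \<le> d / 2 + (I / d) * (1 / (2 * real k))" by (simp add: mult_ac)
    also have "(I / d) * (1 / (2 * real k)) \<le> (I / d) * (1 / real (k + 1))"
      using that d assms by (intro mult_left_mono divide_left_mono) auto
    finally show ?thesis by simp
  qed
  then have "(\<Sum>k=1..b. ?w k * sqrt (I / real k)) \<le> (\<Sum>k=1..b. ?w k * (d / 2 + (I / d) * (1 / real (k + 1))))"
    using w0 by (intro sum_mono mult_left_mono) auto
  also have "\<dots> \<le> (\<Sum>k\<le>b. ?w k * (d / 2 + (I / d) * (1 / real (k + 1))))"
    using w0 d assms by (intro sum_mono2) auto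
  also have "\<dots> = (\<Sum>k\<le>b. ?w k) * (d / 2) + (I / d) * (\<Sum>k\<le>b. ?w k / real (k + 1))"
    by (simp add: sum_distrib_left sum_distrib_right distrib_left sum.distrib mult_ac)
  also have "(\<Sum>k\<le>b. ?w k) = 1"
    using binomial_ring[of p "1 - p" b] by simp
  also have "1 * (d / 2) + (I / d) * (\<Sum>k\<le>b. ?w k / real (k + 1)) \<le> d / 2 + (I / d) * (1 / (p * real (b + 1)))"
    using binomial_inverse_sum[OF assms(1,2), of b] d assms by (intro add_mono mult_left_mono) auto
  also have "(I / d) * (1 / (p * real (b + 1))) = d\<^sup>2 / (2 * d)"
  proof -
    have "(I / d) * (1 / X) = (2 * I / X) / (2 * d)" for X by simp
    then show ?thesis unfolding d(2) .
  qed
  also have "d / 2 + d\<^sup>2 / (2 * d) = d" using d(1) by (simp add: power2_eq_square)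
  finally show ?thesis by (simp add: d_def)
qed

text \<open>The binomial theorem for commuting operators; in a block of \<open>b\<close> factors,
  \<open>k\<close> counts those that use the smooth component.\<close>

lemma conv_op_binomial:
  assumes V: "conv_op V" and K: "conv_op K" and f: "bdd_borel f"
  shows "((\<lambda>f x. p * V f x + K f x) ^^ b) f
    = (\<lambda>x. \<Sum>k\<le>b. (real (b choose k) * p ^ k) * (V ^^ k) ((K ^^ (b - k)) f) x)"
proof (induction b)
  case (Suc b)
  define T where "T k m = (V ^^ k) ((K ^^ m) f)" for k m
  define w where "w b k = real (b choose k) * p ^ k" for b k
  have bK: "bdd_borel ((K ^^ m) f)" for m by (rule conv_op_bdd[OF conv_op_funpow[OF K] f])
  have bT: "bdd_borel (T k m)" for k m unfolding T_def by (rule conv_op_bdd[OF conv_op_funpow[OF V] bK])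
  have KT: "K (T k m) = T k (Suc m)" for k m
    using conv_op_commute[OF K conv_op_funpow[OF V] bK] by (simp add: T_def)
  have VT: "V (T k m) = T (Suc k) m" for k m by (simp add: T_def)
  have "((\<lambda>f x. p * V f x + K f x) ^^ Suc b) f
      = (\<lambda>x. p * V (\<lambda>x. \<Sum>k\<le>b. w b k * T k (b - k) x) x + K (\<lambda>x. \<Sum>k\<le>b. w b k * T k (b - k) x) x)"
    using Suc by (simp add: T_def w_def)
  also have "V (\<lambda>x. \<Sum>k\<le>b. w b k * T k (b - k) x) = (\<lambda>x. \<Sum>k\<le>b. w b k * T (Suc k) (b - k) x)"
    by (subst conv_op_sum_arg[OF V]) (auto simp: VT bT)
  also have "K (\<lambda>x. \<Sum>k\<le>b. w b k * T k (b - k) x) = (\<lambda>x. \<Sum>k\<le>b. w b k * T k (Suc (b - k)) x)"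
    by (subst conv_op_sum_arg[OF K]) (auto simp: KT bT)
  also have "(\<lambda>x. p * (\<Sum>k\<le>b. w b k * T (Suc k) (b - k) x) + (\<Sum>k\<le>b. w b k * T k (Suc (b - k)) x))
      = (\<lambda>x. \<Sum>k\<le>Suc b. w (Suc b) k * T k (Suc b - k) x)"
  proof
    fix x
    have "(\<Sum>k\<le>Suc b. w (Suc b) k * T k (Suc b - k) x)
        = T 0 (Suc b) x + (\<Sum>k\<le>b. w (Suc b) (Suc k) * T (Suc k) (b - k) x)"
      unfolding sum.atMost_Suc_shift by (simp add: w_def)
    also have "(\<Sum>k\<le>b. w (Suc b) (Suc k) * T (Suc k) (b - k) x)
        = (\<Sum>k\<le>b. p * (w b k * T (Suc k) (b - k) x)) + (\<Sum>k\<le>b. w b (Suc k) * T (Suc k) (b - k) x)"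
      unfolding sum.distrib[symmetric] by (intro sum.cong refl) (simp add: w_def algebra_simps)
    also have "(\<Sum>k\<le>b. w b (Suc k) * T (Suc k) (b - k) x) = (\<Sum>k<b. w b (Suc k) * T (Suc k) (b - k) x)"
      by (intro sum.mono_neutral_right) (auto simp: w_def not_less)
    also have "T 0 (Suc b) x + ((\<Sum>k\<le>b. p * (w b k * T (Suc k) (b - k) x)) + (\<Sum>k<b. w b (Suc k) * T (Suc k) (b - k) x))
        = (\<Sum>k\<le>b. p * (w b k * T (Suc k) (b - k) x)) + (\<Sum>k\<le>b. w b k * T k (Suc (b - k)) x)"
    proof -
      have "(\<Sum>k\<le>b. w b k * T k (Suc (b - k)) x) = T 0 (Suc b) x + (\<Sum>k<b. w b (Suc k) * T (Suc k) (Suc (b - Suc k)) x)"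
        unfolding lessThan_Suc_atMost[symmetric] sum.lessThan_Suc_shift by (simp add: w_def)
      also have "(\<Sum>k<b. w b (Suc k) * T (Suc k) (Suc (b - Suc k)) x) = (\<Sum>k<b. w b (Suc k) * T (Suc k) (b - k) x)"
        by (intro sum.cong refl) (auto simp: Suc_diff_Suc)
      finally show ?thesis by simp
    qed
    finally show "p * (\<Sum>k\<le>b. w b k * T (Suc k) (b - k) x) + (\<Sum>k\<le>b. w b k * T k (Suc (b - k)) x)
        = (\<Sum>k\<le>Suc b. w (Suc b) k * T k (Suc b - k) x)"
      by (simp add: sum_distrib_left)
  qed
  finally show ?case by (simp only: T_def w_def)
qed simp

section \<open>Blocks of factors: smooth part and remainder\<close>

definition remainder_op :: "real \<Rightarrow> real \<Rightarrow> 'a measure \<Rightarrow> 'a measure \<Rightarrow> ('a::euclidean_space \<Rightarrow> real) \<Rightarrow> 'a \<Rightarrow> real" where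
  "remainder_op p \<sigma> \<mu> \<nu> f x = mean \<sigma> \<mu> f x - p * mean \<sigma> \<nu> f x"

text \<open>With \<open>P = p V + R\<close>, the single term of \<open>P ^^ b\<close> without any
  smooth factor \<open>V\<close> is removed. What remains is differentiable for every bounded
  \<open>f\<close>, and the removed \<open>R ^^ b\<close> has norm at most
  \<open>(1 - p) ^ b\<close>.\<close>

definition smooth_part :: "real \<Rightarrow> real \<Rightarrow> 'a measure \<Rightarrow> 'a measure \<Rightarrow> nat \<Rightarrow> ('a::euclidean_space \<Rightarrow> real) \<Rightarrow> 'a \<Rightarrow> real" where
  "smooth_part p \<sigma> \<mu> \<nu> b f x = (mean \<sigma> \<mu> ^^ b) f x - (remainder_op p \<sigma> \<mu> \<nu> ^^ b) f x"

locale minorized_law = smooth_law \<nu> s I + M: prob_space \<mu>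
  for \<mu> \<nu> :: "(real^'n::finite) measure" and s I +
  fixes p :: real
  assumes sets_M: "sets \<mu> = sets borel"
    and p: "0 < p" "p \<le> 1"
    and minor: "A \<in> sets borel \<Longrightarrow> ennreal p * emeasure \<nu> A \<le> emeasure \<mu> A"
begin

abbreviation "P \<equiv> \<lambda>\<sigma>. mean \<sigma> \<mu>"
abbreviation "R \<equiv> \<lambda>\<sigma>. remainder_op p \<sigma> \<mu> \<nu>"
abbreviation "U \<equiv> \<lambda>\<sigma>. smooth_part p \<sigma> \<mu> \<nu>"

lemma conv_op_P: "conv_op (P \<sigma>)"
  by (intro conv_op_mean sets_M M.prob_space_axioms)

lemma op_bound_P: "op_bound 1 (P \<sigma>)"
  by (intro op_bound_mean sets_M M.prob_space_axioms)

lemma conv_op_R: "conv_op (R \<sigma>)"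
proof -
  have "R \<sigma> = (\<lambda>f x. 1 * P \<sigma> f x + (- p) * mean \<sigma> \<nu> f x)" by (simp add: fun_eq_iff remainder_op_def)
  moreover have "conv_op (\<lambda>f x. 1 * P \<sigma> f x + (- p) * mean \<sigma> \<nu> f x)"
    by (intro conv_op.lin conv_op_P conv_op_mean_law)
  ultimately show ?thesis by simp
qed

lemma minor_integral:
  assumes "bounded_borel c g" "\<And>x. 0 \<le> g x"
  shows "p * (\<integral>y. g y \<partial>\<nu>) \<le> (\<integral>y. g y \<partial>\<mu>)"
proof -
  have g: "g \<in> borel_measurable borel" using assms by (simp add: bounded_borel_def)
  have [measurable_cong]: "sets \<nu> = sets borel" "sets \<mu> = sets borel" by (fact sets_eq sets_M)+
  have spc: "space \<nu> = space \<mu>" using sets_eq_imp_space_eq[of \<nu> \<mu>] sets_eq sets_M by simp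
  have "scale_measure (ennreal p) \<nu> \<le> \<mu>"
  proof -
    have "emeasure (scale_measure (ennreal p) \<nu>) A \<le> emeasure \<mu> A" for A
    proof (cases "A \<in> sets borel")
      case True
      then show ?thesis using minor by simp
    next
      case False
      then show ?thesis using sets_eq by (simp add: emeasure_notin_sets)
    qed
    then show ?thesis unfolding le_measure_iff using sets_eq sets_M spc by (simp add: le_fun_def space_scale_measure)
  qed
  then have "nn_integral (scale_measure (ennreal p) \<nu>) g \<le> nn_integral \<mu> g"
    by (intro nn_integral_mono_measure) (simp_all add: sets_eq sets_M)
  then have "ennreal p * (\<integral>\<^sup>+y. g y \<partial>\<nu>) \<le> (\<integral>\<^sup>+y. g y \<partial>\<mu>)"
    using g by (simp add: nn_integral_scale_measure)
  moreover have "(\<integral>\<^sup>+y. g y \<partial>\<nu>) = ennreal (\<integral>y. g y \<partial>\<nu>)" "(\<integral>\<^sup>+y. g y \<partial>\<mu>) = ennreal (\<integral>y. g y \<partial>\<mu>)"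
    using avg_integrable[OF sets_eq _ assms(1), of "\<lambda>_. 1" 0 1]
      avg_integrable[OF sets_M _ assms(1), of "\<lambda>_. 1" 0 1] assms(2)
    by (auto intro!: nn_integral_eq_integral)
  moreover have "0 \<le> (\<integral>y. g y \<partial>\<nu>)" "0 \<le> (\<integral>y. g y \<partial>\<mu>)" using assms(2) by (auto intro!: Bochner_Integration.integral_nonneg)
  ultimately show ?thesis using p by (simp flip: ennreal_mult)
qed

text \<open>The minorization is applied to the nonnegative functions \<open>b + f\<close> and
  \<open>b - f\<close>, suitably shifted and scaled; both laws have mass 1, so mass
  \<open>1 - p\<close> is left.\<close>

lemma op_bound_R: "op_bound (1 - p) (R \<sigma>)"
  unfolding op_bound_def
proof (intro allI impI)
  fix b and f :: "real^'n \<Rightarrow> real" assume f: "bounded_borel b f"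
  have b0: "0 \<le> b" by (rule bounded_borel_nonneg[OF f])
  have pos: "0 \<le> (1 - p) * b + e * R \<sigma> f x" if e: "\<bar>e\<bar> = 1" for e x
  proof -
    let ?g = "\<lambda>y. b + e * f (x + \<sigma> *\<^sub>R y)"
    have [measurable]: "f \<in> borel_measurable borel" using f by (simp add: bounded_borel_def)
    have ef: "\<bar>e * f y\<bar> \<le> b" for y using f e by (simp add: abs_mult bounded_borel_def)
    then have "0 \<le> ?g y" "\<bar>?g y\<bar> \<le> 2 * b" for y
      using ef[of "x + \<sigma> *\<^sub>R y"] by linarith+
    then have "p * (\<integral>y. ?g y \<partial>\<nu>) \<le> (\<integral>y. ?g y \<partial>\<mu>)"
      by (intro minor_integral[of "2 * b"]) (auto simp: bounded_borel_def)
    moreover have "(\<integral>y. ?g y \<partial>\<nu>) = b + e * mean \<sigma> \<nu> f x" "(\<integral>y. ?g y \<partial>\<mu>) = b + e * mean \<sigma> \<mu> f x"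
      using avg_integrable[OF sets_eq _ f, of "\<lambda>_. 1" x \<sigma>] avg_integrable[OF sets_M _ f, of "\<lambda>_. 1" x \<sigma>]
      by (auto simp: avg_def prob_space M.prob_space)
    ultimately show ?thesis by (simp add: remainder_op_def algebra_simps)
  qed
  have "\<bar>R \<sigma> f x\<bar> \<le> (1 - p) * b" for x using pos[of 1 x] pos[of "-1" x] by linarith
  moreover have "R \<sigma> f \<in> borel_measurable borel"
    using conv_op_bdd[OF conv_op_R] f by (auto simp: bounded_borel_def)
  ultimately show "bounded_borel ((1 - p) * b) (R \<sigma> f)" by (simp add: bounded_borel_def)
qed

lemma conv_op_U: "conv_op (U \<sigma> b)"
proof -
  have "U \<sigma> b = (\<lambda>f x. 1 * (P \<sigma> ^^ b) f x + (- 1) * (R \<sigma> ^^ b) f x)"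
    by (simp add: fun_eq_iff smooth_part_def)
  moreover have "conv_op (\<lambda>f x. 1 * (P \<sigma> ^^ b) f x + (- 1) * (R \<sigma> ^^ b) f x)"
    by (intro conv_op.lin conv_op_funpow conv_op_P conv_op_R)
  ultimately show ?thesis by simp
qed

lemma op_bound_U: "op_bound 2 (U \<sigma> b)"
proof -
  have "U \<sigma> b = (\<lambda>f x. 1 * (P \<sigma> ^^ b) f x + (- 1) * (R \<sigma> ^^ b) f x)"
    by (simp add: fun_eq_iff smooth_part_def)
  moreover have "op_bound (\<bar>1\<bar> * 1 ^ b + \<bar>- 1\<bar> * (1 - p) ^ b) (\<lambda>f x. 1 * (P \<sigma> ^^ b) f x + (- 1) * (R \<sigma> ^^ b) f x)"
    by (intro op_bound_lin op_bound_funpow op_bound_P op_bound_R)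
  ultimately have "op_bound (\<bar>1\<bar> * 1 ^ b + \<bar>- 1\<bar> * (1 - p) ^ b) (U \<sigma> b)" by simp
  then show ?thesis using p power_le_one[of "1 - p" b] by (intro op_bound_mono[of _ "U \<sigma> b" 2]) auto
qed

text \<open>The derivative of the binomial sum for \<open>U\<close>: in each term one of the
  \<open>k\<close> smooth factors is differentiated, which inserts its score and a factor
  \<open>1 / \<sigma>\<close>.\<close>

definition U' :: "real \<Rightarrow> nat \<Rightarrow> 'n \<Rightarrow> (real^'n \<Rightarrow> real) \<Rightarrow> real^'n \<Rightarrow> real" where
  "U' \<sigma> b i f x = (\<Sum>k=1..b. (real (b choose k) * p ^ k / \<sigma>) *
     avg \<sigma> \<nu> (s i) ((mean \<sigma> \<nu> ^^ (k - 1)) ((R \<sigma> ^^ (b - k)) f)) x)"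

lemma conv_op_U': "conv_op (U' \<sigma> b i)"
proof -
  have "conv_op (\<lambda>f x. \<Sum>k=1..b. (real (b choose k) * p ^ k / \<sigma>) *
     (avg \<sigma> \<nu> (s i) ((mean \<sigma> \<nu> ^^ (k - 1)) ((R \<sigma> ^^ (b - k)) f))) x)"
    by (intro conv_op_sum conv_op.comp[OF conv_op_score] conv_op.comp[OF conv_op_funpow]
        conv_op_funpow conv_op_R conv_op_mean_law) auto
  then show ?thesis by (simp add: U'_def[abs_def])
qed

lemma op_bound_U':
  assumes "\<sigma> > 0"
  shows "op_bound (sqrt (2 * I / (p * real (b + 1))) / \<sigma>) (U' \<sigma> b i)"
proof -
  have 1: "op_bound (\<Sum>k=1..b. \<bar>real (b choose k) * p ^ k / \<sigma>\<bar> * (sqrt (I / real k) * (1 - p) ^ (b - k))) (U' \<sigma> b i)"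
    unfolding U'_def[abs_def]
    by (intro op_bound_sum op_bound_comp[OF score_mean_bound] op_bound_funpow op_bound_R) auto
  have "(\<Sum>k=1..b. \<bar>real (b choose k) * p ^ k / \<sigma>\<bar> * (sqrt (I / real k) * (1 - p) ^ (b - k)))
      = (\<Sum>k=1..b. real (b choose k) * p ^ k * (1 - p) ^ (b - k) * sqrt (I / real k)) / \<sigma>"
    unfolding sum_divide_distrib using assms p by (intro sum.cong refl) (simp add: abs_mult)
  also have "\<dots> \<le> sqrt (2 * I / (p * real (b + 1))) / \<sigma>"
    using assms p I_pos by (intro divide_right_mono binomial_inverse_sqrt_sum) auto
  finally show ?thesis by (rule op_bound_mono[OF 1])
qed

lemma U_derivative:
  assumes "\<sigma> > 0" "bdd_borel f"
  shows "(U \<sigma> b f has_derivative (\<lambda>h. \<Sum>i\<in>UNIV. h $ i * U' \<sigma> b i f x)) (at x)"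
proof -
  let ?V = "mean \<sigma> \<nu>"
  have "P \<sigma> = (\<lambda>f x. p * ?V f x + R \<sigma> f x)" by (simp add: fun_eq_iff remainder_op_def)
  then have "(P \<sigma> ^^ b) f = (\<lambda>x. \<Sum>k\<le>b. (real (b choose k) * p ^ k) * (?V ^^ k) ((R \<sigma> ^^ (b - k)) f) x)"
    using conv_op_binomial[OF conv_op_mean_law conv_op_R assms(2)] by simp
  then have U: "U \<sigma> b f = (\<lambda>x. \<Sum>k=1..b. (real (b choose k) * p ^ k) * (?V ^^ k) ((R \<sigma> ^^ (b - k)) f) x)"
    unfolding smooth_part_def[abs_def] atMost_atLeast0 by (simp add: sum.atLeast_Suc_atMost)
  have "((?V ^^ k) ((R \<sigma> ^^ (b - k)) f) has_derivative
      (\<lambda>h. \<Sum>i\<in>UNIV. h $ i * (avg \<sigma> \<nu> (s i) ((?V ^^ (k - 1)) ((R \<sigma> ^^ (b - k)) f)) x / \<sigma>))) (at x)"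
    if k1: "k \<in> {1..b}" for k
  proof -
    obtain m where k: "k = Suc m" using k1 by (cases k) auto
    have "bdd_borel ((?V ^^ m) ((R \<sigma> ^^ (b - k)) f))"
      by (intro conv_op_bdd[OF conv_op_funpow[OF conv_op_mean_law]] conv_op_bdd[OF conv_op_funpow[OF conv_op_R]] assms)
    then obtain c where "bounded_borel c ((?V ^^ m) ((R \<sigma> ^^ (b - k)) f))" by blast
    from mean_derivative[OF assms(1) this] show ?thesis by (simp add: k)
  qed
  then have "(U \<sigma> b f has_derivative (\<lambda>h. \<Sum>k=1..b. (real (b choose k) * p ^ k) *
      (\<Sum>i\<in>UNIV. h $ i * (avg \<sigma> \<nu> (s i) ((?V ^^ (k - 1)) ((R \<sigma> ^^ (b - k)) f)) x / \<sigma>)))) (at x)"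
    unfolding U by (intro has_derivative_sum has_derivative_mult_right)
  moreover have "(\<lambda>h. \<Sum>k=1..b. (real (b choose k) * p ^ k) *
      (\<Sum>i\<in>UNIV. h $ i * (avg \<sigma> \<nu> (s i) ((?V ^^ (k - 1)) ((R \<sigma> ^^ (b - k)) f)) x / \<sigma>)))
      = (\<lambda>h :: real^'n. \<Sum>i\<in>UNIV. h $ i * U' \<sigma> b i f x)"
    unfolding U'_def sum_distrib_left by (subst sum.swap) (simp add: mult_ac)
  ultimately show ?thesis by simp
qed

text \<open>There are \<open>L\<close> blocks in total. Each letter of \<open>\<alpha>\<close> uses
  one of them up by differentiating it, the others stay as they are; the empty word gives
  \<open>U ^^ L\<close> applied to \<open>f\<close>.\<close>

definition smooth_jet :: "real \<Rightarrow> nat \<Rightarrow> nat \<Rightarrow> (real^'n \<Rightarrow> real) \<Rightarrow> 'n list \<Rightarrow> real^'n \<Rightarrow> real" where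
  "smooth_jet \<sigma> b L f \<alpha> = (U \<sigma> b ^^ (L - length \<alpha>)) (fold (U' \<sigma> b) \<alpha> f)"

lemma jet_smooth:
  assumes "\<sigma> > 0" "bounded_borel c f" "sqrt (2 * I / (p * real (b + 1))) / \<sigma> \<le> d" "1 \<le> d"
  shows "jet L ((2 * d) ^ L * c) (smooth_jet \<sigma> b L f)"
proof -
  have fold_bound: "bounded_borel (d ^ length \<alpha> * c) (fold (U' \<sigma> b) \<alpha> f)" for \<alpha>
  proof (induction \<alpha> rule: rev_induct)
    case (snoc i \<alpha>)
    have "op_bound d (U' \<sigma> b i)" by (rule op_bound_mono[OF op_bound_U'[OF assms(1)] assms(3)])
    then show ?case using snoc by (simp add: op_bound_def mult.assoc)
  qed (use assms in simp)
  show ?thesis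
  proof (rule jet_derivs)
    fix \<alpha> :: "'n list" assume \<alpha>: "length \<alpha> \<le> L"
    have c0: "0 \<le> c" by (rule bounded_borel_nonneg[OF assms(2)])
    have "bounded_borel (2 ^ (L - length \<alpha>) * (d ^ length \<alpha> * c)) (smooth_jet \<sigma> b L f \<alpha>)"
      unfolding smooth_jet_def using op_bound_funpow[OF op_bound_U] fold_bound by (simp add: op_bound_def)
    moreover have "2 ^ (L - length \<alpha>) * (d ^ length \<alpha> * c) \<le> 2 ^ L * (d ^ L * c)"
      using \<alpha> assms(4) c0 by (intro mult_mono power_increasing) auto
    ultimately show "bounded_borel ((2 * d) ^ L * c) (smooth_jet \<sigma> b L f \<alpha>)"
      unfolding power_mult_distrib mult.assoc by (rule bounded_borel_mono)
  next
    fix \<alpha> :: "'n list" and x assume \<alpha>: "length \<alpha> < L"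
    define m where "m = L - length \<alpha> - 1"
    have m: "L - length \<alpha> = Suc m" using \<alpha> by (simp add: m_def)
    let ?g = "fold (U' \<sigma> b) \<alpha> f"
    have g: "bdd_borel ?g" using fold_bound by blast
    then have "bdd_borel ((U \<sigma> b ^^ m) ?g)" by (rule conv_op_bdd[OF conv_op_funpow[OF conv_op_U]])
    from U_derivative[OF assms(1) this, of b x]
    have "(smooth_jet \<sigma> b L f \<alpha> has_derivative (\<lambda>h. \<Sum>i\<in>UNIV. h $ i * U' \<sigma> b i ((U \<sigma> b ^^ m) ?g) x)) (at x)"
      by (simp add: smooth_jet_def m)
    moreover have "U' \<sigma> b i ((U \<sigma> b ^^ m) ?g) = smooth_jet \<sigma> b L f (\<alpha> @ [i])" for i
      using conv_op_commute[OF conv_op_U' conv_op_funpow[OF conv_op_U] g] by (simp add: smooth_jet_def m_def)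
    ultimately show "grad_rule (smooth_jet \<sigma> b L f) \<alpha> x" by (simp add: grad_rule_def)
  qed
qed

text \<open>Blocks are exchanged one at a time, each exchange costing \<open>(1 - p) ^ b\<close>
  times the norm of the blocks exchanged before.\<close>

lemma smooth_part_error:
  assumes "bounded_borel c f"
  shows "bounded_borel (2 ^ L * (1 - p) ^ b * c) (\<lambda>x. (P \<sigma> ^^ (b * L)) f x - (U \<sigma> b ^^ L) f x)"
proof -
  \<comment> \<open>The constant \<open>2 ^ L - 1\<close> is the inductive one: the next exchange
    adds \<open>2 ^ L\<close>.\<close>
  have "bounded_borel ((2 ^ L - 1) * (1 - p) ^ b * c) (\<lambda>x. (P \<sigma> ^^ (b * L)) f x - (U \<sigma> b ^^ L) f x)"
  proof (induction L)
    case 0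
    show ?case by (simp add: bounded_borel_def)
  next
    case (Suc L)
    let ?Pf = "(P \<sigma> ^^ (b * L)) f" and ?Uf = "(U \<sigma> b ^^ L) f"
    have bP: "bdd_borel ?Pf" and bU: "bdd_borel ?Uf"
      using assms conv_op_bdd conv_op_funpow conv_op_P conv_op_U by blast+
    have "(P \<sigma> ^^ b) (\<lambda>x. ?Pf x - ?Uf x) = (\<lambda>x. (P \<sigma> ^^ b) ?Pf x - (P \<sigma> ^^ b) ?Uf x)"
      by (rule conv_op_diff[OF conv_op_funpow[OF conv_op_P] bP bU])
    moreover have "(P \<sigma> ^^ (b * Suc L)) f = (P \<sigma> ^^ b) ?Pf" by (simp add: funpow_add)
    ultimately have eq: "(\<lambda>x. (P \<sigma> ^^ (b * Suc L)) f x - (U \<sigma> b ^^ Suc L) f x)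
        = (\<lambda>x. 1 * (P \<sigma> ^^ b) (\<lambda>x. ?Pf x - ?Uf x) x + 1 * (R \<sigma> ^^ b) ?Uf x)"
      by (simp add: fun_eq_iff smooth_part_def)
    have 1: "bounded_borel (1 ^ b * ((2 ^ L - 1) * (1 - p) ^ b * c)) ((P \<sigma> ^^ b) (\<lambda>x. ?Pf x - ?Uf x))"
      using Suc op_bound_funpow[OF op_bound_P] unfolding op_bound_def by blast
    have 2: "bounded_borel ((1 - p) ^ b * (2 ^ L * c)) ((R \<sigma> ^^ b) ?Uf)"
      using assms op_bound_funpow[OF op_bound_U] op_bound_funpow[OF op_bound_R] unfolding op_bound_def by blast
    from bounded_borel_lin[OF 1 2, of 1 1] show ?case unfolding eq by (simp add: algebra_simps)
  qed
  then show ?thesis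
  proof (rule bounded_borel_mono)
    show "(2 ^ L - 1) * (1 - p) ^ b * c \<le> 2 ^ L * (1 - p) ^ b * c"
      using p bounded_borel_nonneg[OF assms] by (intro mult_right_mono) auto
  qed
qed

end

section \<open>An explicit smooth minorant\<close>

text \<open>Squaring the positive part gives a Lipschitz gradient, and keeps the squared gradient
  divided by the function bounded, so that the score has finite variance.\<close>

definition bump :: "'a::euclidean_space \<Rightarrow> real \<Rightarrow> 'a \<Rightarrow> real" where
  "bump a \<rho> y = (max 0 (\<rho>\<^sup>2 - (norm (y - a))\<^sup>2))\<^sup>2"

definition bump_deriv :: "real^'n \<Rightarrow> real \<Rightarrow> 'n \<Rightarrow> real^'n \<Rightarrow> real" where
  "bump_deriv a \<rho> i y = - 4 * max 0 (\<rho>\<^sup>2 - (norm (y - a))\<^sup>2) * (y - a) $ i"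

lemma bump_measurable [measurable]:
  "bump a \<rho> \<in> borel_measurable borel" "bump_deriv b \<rho> i \<in> borel_measurable borel"
  unfolding bump_def[abs_def] bump_deriv_def[abs_def] vector_minus_component by measurable

text \<open>The squared positive part has derivative \<open>2 * max 0 u\<close>, which is Lipschitz
  with constant 2.\<close>

lemma pos_part_square_taylor: "\<bar>(max 0 (u + v))\<^sup>2 - (max 0 u)\<^sup>2 - 2 * max 0 u * v\<bar> \<le> v\<^sup>2" for u v :: real
proof (cases "u \<ge> 0")
  case True
  show ?thesis
  proof (cases "u + v \<ge> 0")
    case True
    then show ?thesis using \<open>u \<ge> 0\<close> by (simp add: power2_eq_square algebra_simps)
  next
    case False
    have "0 \<le> (u + v)\<^sup>2" by simp
    then have "- v\<^sup>2 \<le> u * u + 2 * u * v" by (simp add: power2_eq_square algebra_simps)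
    moreover have "u * (u + 2 * v) \<le> 0" using False \<open>u \<ge> 0\<close> by (intro mult_nonneg_nonpos) auto
    then have "u * u + 2 * u * v \<le> 0" by (simp add: algebra_simps)
    then have "u * u + 2 * u * v \<le> v\<^sup>2" using zero_le_power2[of v] by linarith
    ultimately show ?thesis using False \<open>u \<ge> 0\<close> by (simp add: max_absorb1 max_absorb2 power2_eq_square algebra_simps abs_le_iff)
  qed
next
  case False
  show ?thesis
  proof (cases "u + v \<ge> 0")
    case True
    then have "(u + v)\<^sup>2 \<le> v\<^sup>2" using False by (intro power_mono) auto
    then show ?thesis using False True by (simp add: max_absorb1 max_absorb2)
  qed (use False in simp)
qed

lemma bump_le: "0 \<le> bump a \<rho> y" "bump a \<rho> y \<le> \<rho> ^ 4"
proof -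
  have "(max 0 (\<rho>\<^sup>2 - (norm (y - a))\<^sup>2))\<^sup>2 \<le> (\<rho>\<^sup>2)\<^sup>2" by (intro power_mono) auto
  then show "bump a \<rho> y \<le> \<rho> ^ 4" by (simp add: bump_def flip: power_mult)
qed (simp add: bump_def)

lemma bump_outside:
  assumes "norm (y - a) \<ge> \<rho>" "\<rho> > 0"
  shows "bump a \<rho> y = 0"
proof -
  have "\<rho>\<^sup>2 \<le> (norm (y - a))\<^sup>2" using assms by (intro power_mono) auto
  then show ?thesis by (simp add: bump_def)
qed

lemma integrable_indicator_ball: "integrable lborel (\<lambda>y. c * indicator (ball a r) y :: real)" for a :: "'a::euclidean_space"
  by (intro integrable_mult_right integrable_real_indicator emeasure_lborel_ball_finite) auto

lemma integrable_bump:
  assumes "\<rho> > 0"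
  shows "integrable lborel (bump a \<rho>)" "integrable lborel (bump_deriv b \<rho> i)"
proof -
  have "norm (bump a \<rho> y) \<le> norm (\<rho> ^ 4 * indicator (ball a \<rho>) y :: real)" for y
    using bump_le[of a \<rho> y] bump_outside[of \<rho> y a] assms
    by (cases "norm (y - a) \<ge> \<rho>") (auto simp: indicator_def dist_norm norm_minus_commute)
  then show "integrable lborel (bump a \<rho>)"
    by (intro Bochner_Integration.integrable_bound[OF integrable_indicator_ball[of "\<rho> ^ 4" a \<rho>]] AE_I2) auto
  have "norm (bump_deriv b \<rho> i y) \<le> norm (4 * \<rho>\<^sup>2 * \<rho> * indicator (ball b \<rho>) y :: real)" for y
  proof (cases "norm (y - b) \<ge> \<rho>")
    case True
    then have "\<rho>\<^sup>2 \<le> (norm (y - b))\<^sup>2" using assms by (intro power_mono) auto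
    then show ?thesis by (simp add: bump_deriv_def)
  next
    case False
    then have "4 * \<bar>max 0 (\<rho>\<^sup>2 - (norm (y - b))\<^sup>2)\<bar> * \<bar>(y - b) $ i\<bar> \<le> 4 * \<rho>\<^sup>2 * \<rho>"
      using component_le_norm_cart[of "y - b" i] by (intro mult_mono) auto
    then have "norm (bump_deriv b \<rho> i y) \<le> 4 * \<rho>\<^sup>2 * \<rho>"
      by (simp only: bump_deriv_def real_norm_def abs_mult abs_neg_numeral)
    then show ?thesis using False assms by (simp add: dist_norm norm_minus_commute)
  qed
  then show "integrable lborel (bump_deriv b \<rho> i)"
    by (intro Bochner_Integration.integrable_bound[OF integrable_indicator_ball[of "4 * \<rho>\<^sup>2 * \<rho>" b \<rho>]] AE_I2) auto
qed

text \<open>The increment \<open>v\<close> of the inner quadratic is at most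
  \<open>(2 * \<rho> + 3) * norm h\<close> on the larger ball, and its second-order part accounts
  for \<open>2 * \<rho>\<^sup>2\<close>. The radius is \<open>\<rho> + 1\<close> because a step of
  length 1 from outside that ball gains no positive value of the bump.\<close>

lemma bump_taylor:
  fixes a z h :: "real^'n"
  assumes \<rho>: "\<rho> > 0" and h: "norm h \<le> 1"
  shows "\<bar>bump a \<rho> (z - h) - bump a \<rho> z + (\<Sum>i\<in>UNIV. h $ i * bump_deriv a \<rho> i z)\<bar>
    \<le> (((2 * \<rho> + 3)\<^sup>2 + 2 * \<rho>\<^sup>2) * indicator (ball a (\<rho> + 1)) z) * (norm h)\<^sup>2"
proof -
  define u v where "u = \<rho>\<^sup>2 - (norm (z - a))\<^sup>2" and "v = 2 * ((z - a) \<bullet> h) - (norm h)\<^sup>2"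
  have uv: "\<rho>\<^sup>2 - (norm (z - h - a))\<^sup>2 = u + v"
    unfolding u_def v_def power2_norm_eq_inner by (simp add: inner_diff_left inner_diff_right inner_commute algebra_simps)
  have "(\<Sum>i\<in>UNIV. h $ i * bump_deriv a \<rho> i z) = - 4 * max 0 u * ((z - a) \<bullet> h)"
    unfolding inner_vec_def u_def bump_deriv_def by (simp add: sum_distrib_left sum_distrib_right sum_negf mult_ac)
  then have eq: "bump a \<rho> (z - h) - bump a \<rho> z + (\<Sum>i\<in>UNIV. h $ i * bump_deriv a \<rho> i z)
      = ((max 0 (u + v))\<^sup>2 - (max 0 u)\<^sup>2 - 2 * max 0 u * v) - 2 * max 0 u * (norm h)\<^sup>2"
    unfolding bump_def uv by (simp add: u_def[symmetric] v_def algebra_simps)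
  show ?thesis
  proof (cases "z \<in> ball a (\<rho> + 1)")
    case True
    then have za: "norm (z - a) \<le> \<rho> + 1" by (simp add: dist_norm norm_minus_commute)
    have "\<bar>v\<bar> \<le> 2 * \<bar>(z - a) \<bullet> h\<bar> + norm h * norm h"
      using abs_triangle_ineq4[of "2 * ((z - a) \<bullet> h)" "(norm h)\<^sup>2"]
      by (simp add: v_def power2_eq_square abs_mult)
    also have "\<dots> \<le> 2 * (norm (z - a) * norm h) + norm h * norm h"
      using Cauchy_Schwarz_ineq2[of "z - a" h] by linarith
    also have "\<dots> \<le> 2 * ((\<rho> + 1) * norm h) + 1 * norm h"
      using za h by (intro add_mono mult_left_mono mult_right_mono) auto
    finally have "\<bar>v\<bar> \<le> (2 * \<rho> + 3) * norm h" by (simp add: algebra_simps)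
    then have "\<bar>v\<bar>\<^sup>2 \<le> ((2 * \<rho> + 3) * norm h)\<^sup>2" by (intro power_mono) auto
    then have "v\<^sup>2 \<le> (2 * \<rho> + 3)\<^sup>2 * (norm h)\<^sup>2" by (simp add: power_mult_distrib)
    moreover have "2 * max 0 u * (norm h)\<^sup>2 \<le> 2 * \<rho>\<^sup>2 * (norm h)\<^sup>2"
      by (intro mult_right_mono) (auto simp: u_def)
    moreover have "0 \<le> 2 * max 0 u * (norm h)\<^sup>2" by simp
    ultimately have "\<bar>((max 0 (u + v))\<^sup>2 - (max 0 u)\<^sup>2 - 2 * max 0 u * v) - 2 * max 0 u * (norm h)\<^sup>2\<bar>
        \<le> (2 * \<rho> + 3)\<^sup>2 * (norm h)\<^sup>2 + 2 * \<rho>\<^sup>2 * (norm h)\<^sup>2"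
      using pos_part_square_taylor[of u v] by linarith
    then show ?thesis using True unfolding eq by (simp add: distrib_right)
  next
    case False
    then have za: "\<rho> + 1 \<le> norm (z - a)" by (simp add: dist_norm norm_minus_commute)
    have "norm (z - a) \<le> norm (z - h - a) + norm h"
      using norm_triangle_ineq[of "z - h - a" h] by (simp add: algebra_simps)
    then have "\<rho> \<le> norm (z - h - a)" using za h by linarith
    then have "\<rho>\<^sup>2 \<le> (norm (z - h - a))\<^sup>2" using \<rho> by (intro power_mono) auto
    moreover have "\<rho>\<^sup>2 \<le> (norm (z - a))\<^sup>2" using za \<rho> by (intro power_mono) auto
    ultimately have "u + v \<le> 0" "u \<le> 0" using uv by (auto simp: u_def)
    then show ?thesis using False unfolding eq by (simp add: max_absorb1)
  qed
qed

lemma bump_mass_pos: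
  fixes a :: "'a::euclidean_space"
  assumes "\<rho> > 0"
  shows "0 < (\<integral>y. bump a \<rho> y \<partial>lborel)"
proof -
  have "0 \<le> (\<integral>y. bump a \<rho> y \<partial>lborel)" by (intro Bochner_Integration.integral_nonneg bump_le)
  moreover have "(\<integral>y. bump a \<rho> y \<partial>lborel) \<noteq> 0"
  proof
    assume "(\<integral>y. bump a \<rho> y \<partial>lborel) = 0"
    then have "AE y in lborel. bump a \<rho> y = 0"
      using integral_nonneg_eq_0_iff_AE[OF integrable_bump(1)[OF assms] AE_I2[OF bump_le(1)], of a] by simp
    then have "AE y in lborel. y \<notin> ball a \<rho>"
    proof eventually_elim
      case (elim y)
      then have "max 0 (\<rho>\<^sup>2 - (norm (y - a))\<^sup>2) = 0" by (simp add: bump_def)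
      moreover have "\<rho>\<^sup>2 - (norm (y - a))\<^sup>2 \<le> max 0 (\<rho>\<^sup>2 - (norm (y - a))\<^sup>2)" by (rule max.cobounded2)
      ultimately have "\<rho>\<^sup>2 \<le> (norm (y - a))\<^sup>2" by linarith
      then have "\<rho> \<le> norm (y - a)" by (rule power2_le_imp_le) simp
      then show ?case by (simp add: dist_norm norm_minus_commute)
    qed
    then have "emeasure lborel (ball a \<rho>) = 0"
      using AE_iff_measurable[of "ball a \<rho>" lborel "\<lambda>y. y \<notin> ball a \<rho>"]
      by (simp add: ball_def)
    moreover have "0 < unit_ball_vol (real DIM('a)) * \<rho> ^ DIM('a)" using assms by simp
    ultimately show False using assms by (simp add: emeasure_ball)
  qed
  ultimately show ?thesis by simp
qed

text \<open>The minorant is built from \<open>\<epsilon>\<close> and \<open>D\<^sub>0\<close> before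
  any law is given; this is why one constant serves all laws with the same minorization.\<close>

lemma exists_smooth_minorant:
  fixes D\<^sub>0 :: "(real^'n) set"
  assumes \<epsilon>: "\<epsilon> > 0" and "open D\<^sub>0" "D\<^sub>0 \<noteq> {}"
  obtains \<nu> :: "(real^'n) measure" and s I p where
    "\<And>\<mu>. prob_space \<mu> \<Longrightarrow> sets \<mu> = sets borel \<Longrightarrow> minorized_by_Leb \<epsilon> D\<^sub>0 \<mu> \<Longrightarrow> minorized_law \<mu> \<nu> s I p"
proof -
  obtain a \<rho> where \<rho>: "\<rho> > 0" and ball: "ball a \<rho> \<subseteq> D\<^sub>0"
    using assms(2,3) by (meson ex_in_conv open_contains_ball)
  define Z where "Z = (\<integral>y. bump a \<rho> y \<partial>lborel)"
  have Z: "Z > 0" unfolding Z_def by (rule bump_mass_pos[OF \<rho>])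
  define \<nu> where "\<nu> = density lborel (\<lambda>y. ennreal (bump a \<rho> y / Z))"
  \<comment> \<open>Where the bump vanishes, division by 0 sets the score to 0; this agrees with
    \<open>bump * s = - bump_deriv\<close>, since the gradient vanishes there as well.\<close>
  define s where "s i y = - bump_deriv a \<rho> i y / bump a \<rho> y" for i y
  define I where "I = 1 + (\<Sum>i\<in>UNIV. \<integral>y. (s i y)\<^sup>2 \<partial>\<nu>)"
  \<comment> \<open>As \<open>bump \<le> \<rho> ^ 4\<close>, the density \<open>p * bump / Z\<close>
    stays below \<open>\<epsilon>\<close>; the minimum with 1 keeps \<open>1 - p\<close>
    nonnegative.\<close>
  define p where "p = min 1 (\<epsilon> * Z / \<rho> ^ 4)"
  have [measurable]: "s i \<in> borel_measurable borel" for i unfolding s_def[abs_def] by measurable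
  have sets: "sets \<nu> = sets borel" by (simp add: \<nu>_def)
  have nonneg: "AE y in lborel. 0 \<le> bump a \<rho> y / Z" using bump_le(1)[of a \<rho>] Z by (intro AE_I2) simp
  have dens: "integral\<^sup>L \<nu> h = (\<integral>y. bump a \<rho> y / Z * h y \<partial>lborel)"
    "integrable \<nu> h \<longleftrightarrow> integrable lborel (\<lambda>y. bump a \<rho> y / Z * h y)"
    if "h \<in> borel_measurable borel" for h :: "real^'n \<Rightarrow> real"
    unfolding \<nu>_def using that nonneg by (auto simp: integral_density integrable_density)
  have bs: "bump a \<rho> y * s i y = - bump_deriv a \<rho> i y" for i y
    by (auto simp: s_def bump_def bump_deriv_def)
  have prob: "prob_space \<nu>"
  proof
    have "emeasure \<nu> (space \<nu>) = (\<integral>\<^sup>+y. ennreal (bump a \<rho> y / Z) \<partial>lborel)"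
      by (simp add: \<nu>_def emeasure_density)
    also have "\<dots> = ennreal (\<integral>y. bump a \<rho> y / Z \<partial>lborel)"
      using integrable_bump(1)[OF \<rho>] nonneg by (intro nn_integral_eq_integral) auto
    finally show "emeasure \<nu> (space \<nu>) = 1" using Z by (simp flip: Z_def)
  qed
  have score: "integrable \<nu> (s i)" for i
  proof -
    have "integrable lborel (\<lambda>y. - bump_deriv a \<rho> i y / Z)"
      using integrable_bump(2)[OF \<rho>, of a i] by (intro integrable_divide integrable_minus)
    moreover have "(\<lambda>y. - bump_deriv a \<rho> i y / Z) = (\<lambda>y. bump a \<rho> y / Z * s i y)"
      using bs[of _ i] by (simp add: fun_eq_iff)
    ultimately have "integrable lborel (\<lambda>y. bump a \<rho> y / Z * s i y)" by (simp only:)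
    then show ?thesis by (subst dens) auto
  qed
  have score2: "integrable \<nu> (\<lambda>y. (s i y)\<^sup>2)" for i
  proof -
    have "norm (bump a \<rho> y / Z * (s i y)\<^sup>2) \<le> norm (16 * \<rho>\<^sup>2 / Z * indicator (ball a \<rho>) y :: real)" for y
    proof (cases "norm (y - a) \<ge> \<rho>")
      case True
      then show ?thesis using bump_outside[OF True \<rho>] by simp
    next
      case False
      define u e where "u = \<rho>\<^sup>2 - (norm (y - a))\<^sup>2" and "e = (y - a) $ i"
      have "(norm (y - a))\<^sup>2 < \<rho>\<^sup>2" using False by (intro power_strict_mono) auto
      then have u: "u > 0" by (simp add: u_def)
      have "bump a \<rho> y = u\<^sup>2" "bump_deriv a \<rho> i y = - 4 * u * e"
        using u by (simp_all add: bump_def bump_deriv_def e_def flip: u_def)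
      then have "bump a \<rho> y * (s i y)\<^sup>2 = 16 * e\<^sup>2"
        using u by (simp add: s_def field_simps power2_eq_square)
      also have "16 * e\<^sup>2 = 16 * ((y - a) $ i)\<^sup>2" by (simp add: e_def)
      also have "\<dots> \<le> 16 * \<rho>\<^sup>2"
      proof -
        have "\<bar>(y - a) $ i\<bar> \<le> \<rho>" using component_le_norm_cart[of "y - a" i] False by linarith
        then have "\<bar>(y - a) $ i\<bar>\<^sup>2 \<le> \<rho>\<^sup>2" by (intro power_mono) auto
        then show ?thesis by simp
      qed
      finally have "bump a \<rho> y * (s i y)\<^sup>2 / Z \<le> 16 * \<rho>\<^sup>2 / Z" using Z by (intro divide_right_mono) auto
      moreover have "0 \<le> bump a \<rho> y * (s i y)\<^sup>2" using bump_le(1)[of a \<rho> y] by simp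
      moreover have "y \<in> ball a \<rho>" using False by (simp add: dist_norm norm_minus_commute)
      ultimately show ?thesis using Z by simp
    qed
    then have "integrable lborel (\<lambda>y. bump a \<rho> y / Z * (s i y)\<^sup>2)"
      by (intro Bochner_Integration.integrable_bound[OF integrable_indicator_ball[of "16 * \<rho>\<^sup>2 / Z" a \<rho>]] AE_I2) auto
    then show ?thesis by (subst dens) auto
  qed
  have smooth: "smooth_law \<nu> s I"
  proof (intro smooth_law.intro smooth_law_axioms.intro prob sets score score2)
    fix i
    have "(\<integral>y. (s i y)\<^sup>2 \<partial>\<nu>) \<le> (\<Sum>i\<in>UNIV. \<integral>y. (s i y)\<^sup>2 \<partial>\<nu>)"
      by (intro member_le_sum Bochner_Integration.integral_nonneg) auto
    then show "(\<integral>y. (s i y)\<^sup>2 \<partial>\<nu>) \<le> I" by (simp add: I_def)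
  next
    have "0 \<le> (\<Sum>i\<in>UNIV. \<integral>y. (s i y)\<^sup>2 \<partial>\<nu>)" by (intro sum_nonneg Bochner_Integration.integral_nonneg) auto
    then show "0 < I" by (simp add: I_def)
  next
    fix c and f :: "real^'n \<Rightarrow> real" and x :: "real^'n" assume f: "bounded_borel c f"
    have [measurable]: "f \<in> borel_measurable borel" using f by (simp add: bounded_borel_def)
    have "((\<lambda>x. \<integral>y. bump a \<rho> y * f (x + y) \<partial>lborel) has_derivative
        (\<lambda>h. \<Sum>i\<in>UNIV. h $ i * - (\<integral>y. bump_deriv a \<rho> i y * f (x + y) \<partial>lborel))) (at x)"
      by (intro kernel_derivative[OF f integrable_bump(1) integrable_bump(2) integrable_indicator_ball bump_taylor] \<rho>)
    from has_derivative_mult_right[OF this, of "1 / Z"]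
    have *: "((\<lambda>x. 1 / Z * (\<integral>y. bump a \<rho> y * f (x + y) \<partial>lborel)) has_derivative
        (\<lambda>h. 1 / Z * (\<Sum>i\<in>UNIV. h $ i * - (\<integral>y. bump_deriv a \<rho> i y * f (x + y) \<partial>lborel)))) (at x)" .
    have 1: "(\<lambda>x. 1 / Z * (\<integral>y. bump a \<rho> y * f (x + y) \<partial>lborel)) = mean 1 \<nu> f"
      by (simp add: avg_def dens fun_eq_iff)
    have 2: "avg 1 \<nu> (s i) f x = 1 / Z * - (\<integral>y. bump_deriv a \<rho> i y * f (x + y) \<partial>lborel)" for i
    proof -
      have "avg 1 \<nu> (s i) f x = (\<integral>y. bump a \<rho> y * s i y * f (x + y) / Z \<partial>lborel)"
        by (simp add: avg_def dens mult_ac)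
      then show ?thesis by (simp add: bs)
    qed
    show "(mean 1 \<nu> f has_derivative (\<lambda>h. \<Sum>i\<in>UNIV. h $ i * avg 1 \<nu> (s i) f x)) (at x)"
      using * unfolding 1 2 by (simp add: sum_distrib_left mult_ac sum_negf)
  qed
  have p: "0 < p" "p \<le> 1" using \<epsilon> Z \<rho> by (auto simp: p_def)
  show ?thesis
  proof (rule that[of \<nu> s I p])
    fix \<mu> :: "(real^'n) measure"
    assume \<mu>: "prob_space \<mu>" "sets \<mu> = sets borel" "minorized_by_Leb \<epsilon> D\<^sub>0 \<mu>"
    show "minorized_law \<mu> \<nu> s I p"
    proof (intro minorized_law.intro minorized_law_axioms.intro smooth \<mu>(1,2) p)
      fix A :: "(real^'n) set" assume A: "A \<in> sets borel"
      have D: "D\<^sub>0 \<in> sets borel" using assms(2) by simp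
      have "ennreal p * emeasure \<nu> A = (\<integral>\<^sup>+y. ennreal p * (ennreal (bump a \<rho> y / Z) * indicator A y) \<partial>lborel)"
        unfolding \<nu>_def using A by (subst emeasure_density) (auto simp: nn_integral_cmult)
      also have "\<dots> \<le> (\<integral>\<^sup>+y. ennreal \<epsilon> * indicator (A \<inter> D\<^sub>0) y \<partial>lborel)"
      proof (rule nn_integral_mono)
        fix y
        show "ennreal p * (ennreal (bump a \<rho> y / Z) * indicator A y) \<le> ennreal \<epsilon> * indicator (A \<inter> D\<^sub>0) y"
        proof (cases "y \<in> A \<and> y \<in> ball a \<rho>")
          case True
          have "p * (bump a \<rho> y / Z) \<le> (\<epsilon> * Z / \<rho> ^ 4) * (\<rho> ^ 4 / Z)"
            using bump_le[of a \<rho> y] Z p \<epsilon> \<rho> by (intro mult_mono divide_right_mono) (auto simp: p_def)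
          also have "\<dots> = \<epsilon>" using Z \<rho> by simp
          finally have "ennreal p * ennreal (bump a \<rho> y / Z) \<le> ennreal \<epsilon>"
            using p by (simp flip: ennreal_mult' add: ennreal_leI)
          then show ?thesis using True ball by (auto simp: indicator_def)
        next
          case False
          then have "y \<notin> A \<or> bump a \<rho> y = 0"
            using bump_outside[of \<rho> y a] \<rho> by (auto simp: dist_norm norm_minus_commute)
          then show ?thesis by auto
        qed
      qed
      also have "\<dots> = ennreal \<epsilon> * emeasure lborel (A \<inter> D\<^sub>0)"
        using A D by (simp add: nn_integral_cmult)
      also have "\<dots> \<le> emeasure \<mu> A" using \<mu>(3) A by (simp add: minorized_by_Leb_def)
      finally show "ennreal p * emeasure \<nu> A \<le> emeasure \<mu> A" .
    qed
  qed
qed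

section \<open>One convolution step against the expansion\<close>

lemma mpower_scaleR: "mpower (c *\<^sub>R x) \<alpha> = c ^ length \<alpha> * mpower x \<alpha>"
  by (induction \<alpha>) auto

lemma moment_taylor:
  fixes D :: "'n::finite list \<Rightarrow> real^'n \<Rightarrow> real"
  assumes "prob_space \<mu>" "sets \<mu> = sets borel" "integrable \<mu> (\<lambda>x. norm x ^ (r + 1))"
    and jet: "jet L B D" "length \<alpha> + (r + 1) \<le> L" and "0 \<le> \<sigma>"
  shows "\<bar>mean \<sigma> \<mu> (D \<alpha>) x
      - (\<Sum>\<beta> | length \<beta> \<le> r. \<sigma> ^ length \<beta> / fact (length \<beta>) * (\<integral>y. mpower y \<beta> \<partial>\<mu>) * D (\<alpha> @ \<beta>) x)\<bar>
    \<le> B * \<sigma> ^ (r + 1) * (real CARD('n) ^ (r + 1) * (\<integral>y. norm y ^ (r + 1) \<partial>\<mu>))"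
proof -
  interpret prob_space \<mu> by fact
  have B0: "0 \<le> B" by (rule jet_nonneg[OF jet(1)])
  have "bounded_borel B (D \<alpha>)" using jet by (intro jet_bounded) auto
  from avg_integrable[OF assms(2) _ this, of "\<lambda>_. 1" x \<sigma>]
  have int0: "integrable \<mu> (\<lambda>y. D \<alpha> (x + \<sigma> *\<^sub>R y))" by simp
  have int1: "integrable \<mu> (\<lambda>y. mpower y \<beta>)" if "length \<beta> \<le> r" for \<beta>
    using that by (intro integrable_mpower[OF assms(2) finite_measure_axioms assms(3)]) simp
  have poly: "taylor_poly D \<alpha> (r + 1) x (\<sigma> *\<^sub>R y)
      = (\<Sum>\<beta> | length \<beta> \<le> r. (\<sigma> ^ length \<beta> / fact (length \<beta>) * D (\<alpha> @ \<beta>) x) * mpower y \<beta>)" for y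
  proof -
    have "{\<beta> :: 'n list. length \<beta> < r + 1} = {\<beta>. length \<beta> \<le> r}" by auto
    then show ?thesis unfolding taylor_poly_def by (auto simp: mpower_scaleR mult_ac intro!: sum.cong)
  qed
  have int2: "integrable \<mu> (\<lambda>y. taylor_poly D \<alpha> (r + 1) x (\<sigma> *\<^sub>R y))"
    unfolding poly by (intro Bochner_Integration.integrable_sum integrable_mult_right int1) simp
  have "mean \<sigma> \<mu> (D \<alpha>) x
      - (\<Sum>\<beta> | length \<beta> \<le> r. \<sigma> ^ length \<beta> / fact (length \<beta>) * (\<integral>y. mpower y \<beta> \<partial>\<mu>) * D (\<alpha> @ \<beta>) x)
      = (\<integral>y. D \<alpha> (x + \<sigma> *\<^sub>R y) \<partial>\<mu>) - (\<integral>y. taylor_poly D \<alpha> (r + 1) x (\<sigma> *\<^sub>R y) \<partial>\<mu>)"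
    unfolding poly avg_def using int1 by (simp add: mult_ac)
  also have "\<dots> = (\<integral>y. D \<alpha> (x + \<sigma> *\<^sub>R y) - taylor_poly D \<alpha> (r + 1) x (\<sigma> *\<^sub>R y) \<partial>\<mu>)"
    using int0 int2 by simp
  finally have eq: "mean \<sigma> \<mu> (D \<alpha>) x
      - (\<Sum>\<beta> | length \<beta> \<le> r. \<sigma> ^ length \<beta> / fact (length \<beta>) * (\<integral>y. mpower y \<beta> \<partial>\<mu>) * D (\<alpha> @ \<beta>) x)
      = (\<integral>y. D \<alpha> (x + \<sigma> *\<^sub>R y) - taylor_poly D \<alpha> (r + 1) x (\<sigma> *\<^sub>R y) \<partial>\<mu>)" .
  have "\<bar>\<integral>y. D \<alpha> (x + \<sigma> *\<^sub>R y) - taylor_poly D \<alpha> (r + 1) x (\<sigma> *\<^sub>R y) \<partial>\<mu>\<bar>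
      \<le> (\<integral>y. B * \<sigma> ^ (r + 1) * norm1 y ^ (r + 1) \<partial>\<mu>)"
  proof (rule order_trans[OF integral_abs_bound integral_mono])
    show "integrable \<mu> (\<lambda>y. \<bar>D \<alpha> (x + \<sigma> *\<^sub>R y) - taylor_poly D \<alpha> (r + 1) x (\<sigma> *\<^sub>R y)\<bar>)"
      using int0 int2 by simp
    show "integrable \<mu> (\<lambda>y. B * \<sigma> ^ (r + 1) * norm1 y ^ (r + 1))"
      by (intro integrable_mult_right integrable_norm1_power assms)
    fix y :: "real^'n"
    have "norm1 (\<sigma> *\<^sub>R y) = \<sigma> * norm1 y" using assms(6) by (simp add: norm1_def abs_mult sum_distrib_left)
    then show "\<bar>D \<alpha> (x + \<sigma> *\<^sub>R y) - taylor_poly D \<alpha> (r + 1) x (\<sigma> *\<^sub>R y)\<bar> \<le> B * \<sigma> ^ (r + 1) * norm1 y ^ (r + 1)"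
      using jet_taylor[OF jet, of x "\<sigma> *\<^sub>R y"] by (simp only: power_mult_distrib mult.assoc)
  qed
  also have "\<dots> = B * \<sigma> ^ (r + 1) * (\<integral>y. norm1 y ^ (r + 1) \<partial>\<mu>)" by simp
  also have "\<dots> \<le> B * \<sigma> ^ (r + 1) * (real CARD('n) ^ (r + 1) * (\<integral>y. norm y ^ (r + 1) \<partial>\<mu>))"
    using B0 assms(6) by (intro mult_left_mono integrable_norm1_power assms) auto
  finally show ?thesis unfolding eq .
qed

section \<open>Powers of differential operators on families of derivatives\<close>

lemma jet_lincomb:
  fixes E :: "'i \<Rightarrow> 'n::finite list \<Rightarrow> real^'n \<Rightarrow> real"
  assumes "finite S" "\<And>i. i \<in> S \<Longrightarrow> jet L (b i) (E i)"
  shows "jet L (\<Sum>i\<in>S. \<bar>a i\<bar> * b i) (\<lambda>\<alpha> x. \<Sum>i\<in>S. a i * E i \<alpha> x)"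
  unfolding jet_def
proof (intro conjI allI impI)
  fix \<alpha> :: "'n list" assume "length \<alpha> \<le> L"
  then show "(\<lambda>x. \<Sum>i\<in>S. a i * E i \<alpha> x) \<in> borel_measurable borel"
    using assms by (intro borel_measurable_sum borel_measurable_times) (auto simp: jet_def)
next
  fix \<alpha> :: "'n list" and m and x h :: "real^'n" assume le: "length \<alpha> + m \<le> L"
  have "taylor_poly (\<lambda>\<alpha> x. \<Sum>i\<in>S. a i * E i \<alpha> x) \<alpha> m x h = (\<Sum>i\<in>S. a i * taylor_poly (E i) \<alpha> m x h)"
    unfolding taylor_poly_def sum_distrib_left by (subst sum.swap) (simp add: mult.left_commute)
  then have "\<bar>(\<Sum>i\<in>S. a i * E i \<alpha> (x + h)) - taylor_poly (\<lambda>\<alpha> x. \<Sum>i\<in>S. a i * E i \<alpha> x) \<alpha> m x h\<bar>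
      = \<bar>\<Sum>i\<in>S. a i * (E i \<alpha> (x + h) - taylor_poly (E i) \<alpha> m x h)\<bar>"
    by (simp add: sum_subtractf right_diff_distrib)
  also have "\<dots> \<le> (\<Sum>i\<in>S. \<bar>a i\<bar> * (b i * norm1 h ^ m))"
    using jet_taylor[OF assms(2) le]
    by (intro order_trans[OF sum_abs] sum_mono) (auto simp: abs_mult intro!: mult_left_mono)
  finally show "\<bar>(\<Sum>i\<in>S. a i * E i \<alpha> (x + h)) - taylor_poly (\<lambda>\<alpha> x. \<Sum>i\<in>S. a i * E i \<alpha> x) \<alpha> m x h\<bar>
      \<le> (\<Sum>i\<in>S. \<bar>a i\<bar> * b i) * norm1 h ^ m"
    by (simp add: sum_distrib_right mult.assoc)
qed

lemma jet_diff_op_power: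
  fixes D :: "'n::finite list \<Rightarrow> real^'n \<Rightarrow> real"
  assumes "jet L B D" "i * r \<le> L"
  shows "jet (L - i * r) ((\<Sum>\<gamma> | length \<gamma> \<le> r. \<bar>u \<gamma>\<bar>) ^ i * B) ((diff_op u r ^^ i) D)"
  using assms(2)
proof (induction i)
  case (Suc i)
  have "jet (L - i * r - r) ((\<Sum>\<gamma> | length \<gamma> \<le> r. \<bar>u \<gamma>\<bar>) * ((\<Sum>\<gamma> | length \<gamma> \<le> r. \<bar>u \<gamma>\<bar>) ^ i * B))
      (diff_op u r ((diff_op u r ^^ i) D))"
    using Suc by (intro jet_diff_op) auto
  then show ?case by (simp add: mult.assoc diff_diff_left add.commute)
qed (use assms in simp)

lemma diff_op_conv_op:
  fixes D :: "'n::finite list \<Rightarrow> real^'n \<Rightarrow> real"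
  assumes "conv_op T" "\<And>\<gamma>. length \<gamma> \<le> r \<Longrightarrow> bdd_borel (D (\<gamma> @ \<alpha>))"
  shows "diff_op u r (\<lambda>\<alpha>. T (D \<alpha>)) \<alpha> = T (diff_op u r D \<alpha>)"
  unfolding diff_op_def[abs_def] using assms
  by (subst conv_op_sum_arg) auto

lemma diff_op_power_conv_op:
  fixes D :: "'n::finite list \<Rightarrow> real^'n \<Rightarrow> real"
  assumes "conv_op T" "jet L B D" "length \<alpha> + i * r \<le> L"
  shows "(diff_op u r ^^ i) (\<lambda>\<alpha>. T (D \<alpha>)) \<alpha> = T ((diff_op u r ^^ i) D \<alpha>)"
  using assms(3)
proof (induction i arbitrary: \<alpha>)
  case (Suc i)
  have IH: "(diff_op u r ^^ i) (\<lambda>\<alpha>. T (D \<alpha>)) (\<gamma> @ \<alpha>) = T ((diff_op u r ^^ i) D (\<gamma> @ \<alpha>))" if "length \<gamma> \<le> r" for \<gamma>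
    using that Suc.prems by (intro Suc.IH) auto
  have "(diff_op u r ^^ Suc i) (\<lambda>\<alpha>. T (D \<alpha>)) \<alpha> = diff_op u r (\<lambda>\<alpha>. T ((diff_op u r ^^ i) D \<alpha>)) \<alpha>"
    unfolding funpow.simps comp_def diff_op_def[of u r _ \<alpha>, abs_def] using IH by (intro ext sum.cong) auto
  also have "\<dots> = T (diff_op u r ((diff_op u r ^^ i) D) \<alpha>)"
  proof (rule diff_op_conv_op[OF assms(1)])
    fix \<gamma> :: "'n list" assume "length \<gamma> \<le> r"
    then have "length (\<gamma> @ \<alpha>) \<le> L - i * r" "i * r \<le> L" using Suc.prems by auto
    then show "bdd_borel ((diff_op u r ^^ i) D (\<gamma> @ \<alpha>))"
      using jet_bounded[OF jet_diff_op_power[OF assms(2)]] by blast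
  qed
  finally show ?case by simp
qed simp

lemma choose_le_real_power:
  assumes "k \<le> n"
  shows "real (k choose i) \<le> real n ^ i"
proof -
  have "k choose i \<le> (k choose i) * fact i" by simp
  also have "\<dots> \<le> k ^ i" by (rule binomial_fact_pow)
  also have "\<dots> \<le> n ^ i" using assms by (intro power_mono) auto
  finally show ?thesis by (metis of_nat_le_iff of_nat_power)
qed

section \<open>Replacing factors one at a time\<close>

locale edgeworth_law = minorized_law \<mu> \<nu> s I p
  for \<mu> \<nu> :: "(real^'n::finite) measure" and s I p +
  fixes r q :: nat and \<sigma> :: real
  assumes moment: "integrable \<mu> (\<lambda>x. norm x ^ (r + 1))"
    and \<sigma>: "0 < \<sigma>" "\<sigma> \<le> 1"
begin

abbreviation "G \<equiv> mean \<sigma> (std_gaussian :: (real^'n) measure)"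

definition gap :: "'n list \<Rightarrow> real" where
  "gap \<gamma> = (\<integral>x. mpower x \<gamma> \<partial>\<mu>) - (\<integral>x. mpower x \<gamma> \<partial>std_gaussian)"

definition u :: "'n list \<Rightarrow> real" where
  "u \<gamma> = \<sigma> ^ length \<gamma> * c1_coeff gap \<gamma>"

abbreviation "C \<equiv> diff_op u r"

definition umass :: real where
  "umass = (\<Sum>\<gamma> | length \<gamma> \<le> r. \<bar>u \<gamma>\<bar>)"

text \<open>The binomial expansion of \<open>(1 + C)^k\<close>, truncated at degree \<open>q\<close>.\<close>
definition edge :: "nat \<Rightarrow> ('n list \<Rightarrow> real^'n \<Rightarrow> real) \<Rightarrow> 'n list \<Rightarrow> real^'n \<Rightarrow> real" where
  "edge k D \<alpha> x = (\<Sum>i\<le>q. real (k choose i) * (C ^^ i) D \<alpha> x)"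

text \<open>The three summands come from the Taylor remainders of \<open>P\<close>, of
  \<open>G\<close>, and of the heat semigroup behind each term of \<open>C\<close>.\<close>

definition step_const :: real where
  "step_const = real CARD('n) ^ (r + 1) * ((\<integral>y. norm y ^ (r + 1) \<partial>\<mu>)
     + (\<integral>y. norm y ^ (r + 1) \<partial>(std_gaussian :: (real^'n) measure))
     + (\<Sum>\<gamma> :: 'n list | length \<gamma> \<le> r. \<bar>c1_coeff gap \<gamma>\<bar>))"

lemma conv_op_G: "conv_op G"
  by (intro conv_op_mean prob_space_std_gaussian) simp

lemma op_bound_G: "op_bound 1 G"
  by (intro op_bound_mean prob_space_std_gaussian) simp

lemma umass_nonneg: "0 \<le> umass"
  by (simp add: umass_def sum_nonneg)

lemma step_const_nonneg: "0 \<le> step_const"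
  unfolding step_const_def
  by (intro mult_nonneg_nonneg add_nonneg_nonneg sum_nonneg Bochner_Integration.integral_nonneg) auto

text \<open>Subtracting the moment expansions of \<open>P\<close> and \<open>G\<close> leaves the
  series of moment gaps, which by \<open>c1_coeff_heat\<close> is \<open>C\<close> times the heat
  series. The term of \<open>C\<close> at \<open>\<beta>\<close> carries
  \<open>\<sigma> ^ length \<beta>\<close>, so the heat semigroup is expanded only to order
  \<open>r - length \<beta>\<close> and every remainder has order \<open>r + 1\<close>.\<close>

lemma one_step:
  assumes jet: "jet L B D" "r + 3 \<le> L"
  shows "\<bar>P \<sigma> (D []) x - G (D []) x - G (C D []) x\<bar> \<le> B * \<sigma> ^ (r + 1) * step_const"
proof -
  let ?N = "real CARD('n)"
  let ?M = "\<lambda>\<mu>. \<integral>y. norm y ^ (r + 1) \<partial>\<mu>"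
  let ?S = "\<lambda>\<mu>. \<Sum>\<beta> | length \<beta> \<le> r. \<sigma> ^ length \<beta> / fact (length \<beta>) * (\<integral>y. mpower y \<beta> \<partial>\<mu>) * D ([] @ \<beta>) x"
  let ?H = "\<lambda>\<beta>. \<Sum>\<delta> | length \<delta> \<le> r - length \<beta>. \<sigma> ^ length \<delta> * heat_coeff \<delta> * D (\<beta> @ \<delta>) x"
  have B0: "0 \<le> B" by (rule jet_nonneg[OF jet(1)])
  have P: "\<bar>P \<sigma> (D []) x - ?S \<mu>\<bar> \<le> B * \<sigma> ^ (r + 1) * (?N ^ (r + 1) * ?M \<mu>)"
    using jet \<sigma> by (intro moment_taylor[OF _ sets_M moment]) (auto simp: M.prob_space_axioms)
  have Q: "\<bar>G (D []) x - ?S std_gaussian\<bar> \<le> B * \<sigma> ^ (r + 1) * (?N ^ (r + 1) * ?M (std_gaussian :: (real^'n) measure))"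
    using jet \<sigma> by (intro moment_taylor[OF prob_space_std_gaussian _ gaussian_norm_power]) auto
  have bD: "bdd_borel (D \<beta>)" if "length \<beta> \<le> r" for \<beta>
    using jet_bounded[OF jet(1), of \<beta>] jet(2) that by auto
  have "G (C D []) = (\<lambda>x. \<Sum>\<beta> | length \<beta> \<le> r. u \<beta> * G (D \<beta>) x)"
    unfolding diff_op_def[abs_def] using bD by (subst conv_op_sum_arg[OF conv_op_G]) auto
  then have "\<bar>G (C D []) x - (\<Sum>\<beta> | length \<beta> \<le> r. u \<beta> * ?H \<beta>)\<bar> = \<bar>\<Sum>\<beta> | length \<beta> \<le> r. u \<beta> * (G (D \<beta>) x - ?H \<beta>)\<bar>"
    by (simp add: sum_subtractf right_diff_distrib)
  also have "\<dots> \<le> (\<Sum>\<beta> | length \<beta> \<le> r. B * \<sigma> ^ (r + 1) * ?N ^ (r + 1) * \<bar>c1_coeff gap \<beta>\<bar>)"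
  proof (intro order_trans[OF sum_abs] sum_mono)
    fix \<beta> :: "'n list" assume "\<beta> \<in> {\<beta>. length \<beta> \<le> r}"
    then have \<beta>: "length \<beta> \<le> r" by simp
    have "\<bar>G (D \<beta>) x - ?H \<beta>\<bar> \<le> ?N ^ (r - length \<beta> + 1) * B * \<sigma> ^ (r - length \<beta> + 1)"
      using \<beta> jet \<sigma> by (intro heat_taylor[OF jet(1)]) auto
    also have "\<dots> \<le> ?N ^ (r + 1) * B * \<sigma> ^ (r - length \<beta> + 1)"
      using B0 \<sigma> by (intro mult_right_mono power_increasing) auto
    finally have "\<bar>u \<beta> * (G (D \<beta>) x - ?H \<beta>)\<bar> \<le> \<bar>u \<beta>\<bar> * (?N ^ (r + 1) * B * \<sigma> ^ (r - length \<beta> + 1))"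
      unfolding abs_mult by (intro mult_left_mono) auto
    also have "\<dots> = B * (\<sigma> ^ length \<beta> * \<sigma> ^ (r - length \<beta> + 1)) * ?N ^ (r + 1) * \<bar>c1_coeff gap \<beta>\<bar>"
      using \<sigma> by (simp add: u_def abs_mult)
    also have "\<sigma> ^ length \<beta> * \<sigma> ^ (r - length \<beta> + 1) = \<sigma> ^ (r + 1)"
      using \<beta> by (simp flip: power_add)
    finally show "\<bar>u \<beta> * (G (D \<beta>) x - ?H \<beta>)\<bar> \<le> B * \<sigma> ^ (r + 1) * ?N ^ (r + 1) * \<bar>c1_coeff gap \<beta>\<bar>" .
  qed
  also have "\<dots> = B * \<sigma> ^ (r + 1) * (?N ^ (r + 1) * (\<Sum>\<gamma> :: 'n list | length \<gamma> \<le> r. \<bar>c1_coeff gap \<gamma>\<bar>))"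
    by (simp add: sum_distrib_left mult.assoc)
  finally have GC: "\<bar>G (C D []) x - (\<Sum>\<beta> | length \<beta> \<le> r. u \<beta> * ?H \<beta>)\<bar>
      \<le> B * \<sigma> ^ (r + 1) * (?N ^ (r + 1) * (\<Sum>\<gamma> :: 'n list | length \<gamma> \<le> r. \<bar>c1_coeff gap \<gamma>\<bar>))" .
  have "(\<Sum>\<beta> | length \<beta> \<le> r. u \<beta> * ?H \<beta>)
      = (\<Sum>\<beta> | length \<beta> \<le> r. \<Sum>\<delta> | length \<delta> \<le> r - length \<beta>.
          c1_coeff gap \<beta> * heat_coeff \<delta> * (\<sigma> ^ length (\<beta> @ \<delta>) * D (\<beta> @ \<delta>) x))"
    unfolding sum_distrib_left u_def by (intro sum.cong refl) (simp add: power_add mult_ac)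
  also have "\<dots> = (\<Sum>\<gamma> | length \<gamma> \<le> r. concat_mult (c1_coeff gap) heat_coeff \<gamma> * (\<sigma> ^ length \<gamma> * D \<gamma> x))"
    by (rule sum_concat_mult[symmetric])
  also have "\<dots> = ?S \<mu> - ?S std_gaussian"
    unfolding c1_coeff_heat sum_subtractf[symmetric]
    by (intro sum.cong refl) (simp add: gap_def diff_divide_distrib algebra_simps)
  finally have S: "?S \<mu> - ?S std_gaussian = (\<Sum>\<beta> | length \<beta> \<le> r. u \<beta> * ?H \<beta>)" ..
  have "B * \<sigma> ^ (r + 1) * step_const = B * \<sigma> ^ (r + 1) * (?N ^ (r + 1) * ?M \<mu>)
      + B * \<sigma> ^ (r + 1) * (?N ^ (r + 1) * ?M (std_gaussian :: (real^'n) measure))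
      + B * \<sigma> ^ (r + 1) * (?N ^ (r + 1) * (\<Sum>\<gamma> :: 'n list | length \<gamma> \<le> r. \<bar>c1_coeff gap \<gamma>\<bar>))"
    by (simp only: step_const_def distrib_left)
  then show ?thesis using P Q GC S by linarith
qed

text \<open>Since \<open>k choose i \<le> n ^ i\<close>, the bound depends on \<open>n\<close> only
  through \<open>n * umass\<close>, which stays bounded in the main regime.\<close>

lemma jet_edge:
  assumes "jet L B D" "q * r \<le> L" "k \<le> n"
  shows "jet (L - q * r) ((\<Sum>i\<le>q. (real n * umass) ^ i) * B) (edge k D)"
proof -
  have B0: "0 \<le> B" by (rule jet_nonneg[OF assms(1)])
  have "jet (L - q * r) (umass ^ i * B) ((C ^^ i) D)" if "i \<le> q" for i
  proof (rule jet_mono)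
    have ir: "i * r \<le> q * r" using that by simp
    show "jet (L - i * r) (umass ^ i * B) ((C ^^ i) D)"
      unfolding umass_def by (rule jet_diff_op_power[OF assms(1) order_trans[OF ir assms(2)]])
    show "L - q * r \<le> L - i * r" by (rule diff_le_mono2[OF ir])
  qed simp
  then have "jet (L - q * r) (\<Sum>i\<le>q. \<bar>real (k choose i)\<bar> * (umass ^ i * B)) (edge k D)"
    unfolding edge_def[abs_def] by (intro jet_lincomb) auto
  moreover have "(\<Sum>i\<le>q. \<bar>real (k choose i)\<bar> * (umass ^ i * B)) \<le> (\<Sum>i\<le>q. (real n * umass) ^ i) * B"
    unfolding sum_distrib_right
  proof (rule sum_mono)
    fix i
    have "real (k choose i) \<le> real n ^ i" by (rule choose_le_real_power[OF assms(3)])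
    then show "\<bar>real (k choose i)\<bar> * (umass ^ i * B) \<le> (real n * umass) ^ i * B"
      using B0 umass_nonneg by (simp add: power_mult_distrib mult.assoc mult_right_mono)
  qed
  ultimately show ?thesis by (rule jet_mono[OF _ order_refl])
qed

lemma edge_0: "edge 0 D = D"
proof (intro ext)
  fix \<alpha> x
  have "edge 0 D \<alpha> x = (\<Sum>i\<in>{0}. real (0 choose i) * (C ^^ i) D \<alpha> x)"
    unfolding edge_def by (rule sum.mono_neutral_right) auto
  then show "edge 0 D \<alpha> x = D \<alpha> x" by simp
qed

lemma edge_conv_op:
  assumes "conv_op T" "jet L B D" "q * r \<le> L"
  shows "edge k (\<lambda>\<alpha>. T (D \<alpha>)) [] = T (edge k D [])"
proof -
  have ir: "i * r \<le> L" if "i \<le> q" for i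
    using order_trans[OF mult_le_mono1[OF that] assms(3)] .
  have "bdd_borel ((C ^^ i) D [])" if "i \<le> q" for i
  proof -
    have "bounded_borel ((\<Sum>\<gamma> | length \<gamma> \<le> r. \<bar>u \<gamma>\<bar>) ^ i * B) ((C ^^ i) D [])"
      by (rule jet_bounded[OF jet_diff_op_power[OF assms(2) ir[OF that]]]) simp
    then show ?thesis by blast
  qed
  then have "T (edge k D []) = (\<lambda>x. \<Sum>i\<le>q. real (k choose i) * T ((C ^^ i) D []) x)"
    unfolding edge_def[abs_def] by (intro conv_op_sum_arg assms(1)) auto
  also have "\<dots> = edge k (\<lambda>\<alpha>. T (D \<alpha>)) []"
    unfolding edge_def[abs_def] using ir
    by (intro ext sum.cong refl) (simp add: diff_op_power_conv_op[OF assms(1,2)])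
  finally show ?thesis ..
qed

lemma diff_op_funpow_cong:
  assumes "\<And>\<gamma>. length \<gamma> \<le> i * r + length \<alpha> \<Longrightarrow> D \<gamma> = E \<gamma>"
  shows "(C ^^ i) D \<alpha> = (C ^^ i) E \<alpha>"
  using assms
proof (induction i arbitrary: \<alpha>)
  case (Suc i)
  have "(C ^^ i) D (\<gamma> @ \<alpha>) = (C ^^ i) E (\<gamma> @ \<alpha>)" if "length \<gamma> \<le> r" for \<gamma>
    using that by (intro Suc.IH Suc.prems) simp
  then show ?case by (simp add: diff_op_def[abs_def])
qed simp

lemma edge_cong:
  assumes "\<And>\<gamma>. length \<gamma> \<le> q * r \<Longrightarrow> D \<gamma> = E \<gamma>"
  shows "edge k D [] = edge k E []"
proof -
  have "(C ^^ i) D [] = (C ^^ i) E []" if "i \<le> q" for i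
  proof (rule diff_op_funpow_cong)
    fix \<gamma> :: "'n list" assume "length \<gamma> \<le> i * r + length ([] :: 'n list)"
    then have "length \<gamma> \<le> i * r" by simp
    also have "\<dots> \<le> q * r" using that by (rule mult_le_mono1)
    finally show "D \<gamma> = E \<gamma>" by (rule assms)
  qed
  then show ?thesis by (simp add: edge_def[abs_def])
qed

text \<open>The first summand is the one-step remainder applied to \<open>edge\<close>, the second
  the binomial term lost by truncation at degree \<open>q\<close>.\<close>

definition step_error :: "nat \<Rightarrow> real" where
  "step_error n = (\<Sum>i\<le>q. (real n * umass) ^ i) * \<sigma> ^ (r + 1) * step_const + real n ^ q * umass ^ (q + 1)"

text \<open>Pascal's rule: \<open>edge k\<close> plus \<open>C\<close> applied to it is
  \<open>edge (k + 1)\<close> plus the overflow \<open>(k choose q) C^(q+1)\<close>, while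
  \<open>one_step\<close> accounts for replacing \<open>P\<close> by
  \<open>G (1 + C)\<close>.\<close>

lemma edge_step:
  assumes jet: "jet L B D" "(q + 1) * r + 3 \<le> L" and "k \<le> n"
  shows "bounded_borel (B * step_error n) (\<lambda>x. P \<sigma> (edge k D []) x - edge (k + 1) (\<lambda>\<alpha>. G (D \<alpha>)) [] x)"
proof -
  let ?D = "\<lambda>\<alpha>. G (D \<alpha>)"
  have B0: "0 \<le> B" by (rule jet_nonneg[OF jet(1)])
  have qr: "q * r \<le> L" "(q + 1) * r \<le> L" "r + 3 \<le> L - q * r" using jet(2) by auto
  have je: "jet (L - q * r) ((\<Sum>i\<le>q. (real n * umass) ^ i) * B) (edge k D)"
    by (rule jet_edge[OF jet(1) qr(1) assms(3)])
  have jG: "jet L B ?D" using jet_conv_op[OF conv_op_G op_bound_G jet(1)] by simp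
  have step: "P \<sigma> (edge k D []) x - edge (k + 1) ?D [] x
      = (P \<sigma> (edge k D []) x - G (edge k D []) x - G (C (edge k D) []) x)
        + real (k choose q) * (C ^^ (q + 1)) ?D [] x" for x
  proof -
    define X where "X i = (C ^^ i) ?D [] x" for i
    have 1: "edge (k + 1) ?D [] x = (\<Sum>i\<le>q. real (k choose i) * X i) + (\<Sum>i\<le>q. real (k choose i) * X (Suc i))
        - real (k choose q) * X (q + 1)"
    proof -
      have "edge (k + 1) ?D [] x = X 0 + (\<Sum>i<q. real (Suc k choose Suc i) * X (Suc i))"
        unfolding edge_def X_def lessThan_Suc_atMost[symmetric] sum.lessThan_Suc_shift by simp
      also have "(\<Sum>i<q. real (Suc k choose Suc i) * X (Suc i))
          = (\<Sum>i<q. real (k choose i) * X (Suc i)) + (\<Sum>i<q. real (k choose Suc i) * X (Suc i))"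
        by (simp add: distrib_right sum.distrib)
      also have "(\<Sum>i\<le>q. real (k choose i) * X i) = X 0 + (\<Sum>i<q. real (k choose Suc i) * X (Suc i))"
        unfolding lessThan_Suc_atMost[symmetric] sum.lessThan_Suc_shift by simp
      moreover have "(\<Sum>i\<le>q. real (k choose i) * X (Suc i)) = (\<Sum>i<q. real (k choose i) * X (Suc i)) + real (k choose q) * X (q + 1)"
        unfolding lessThan_Suc_atMost[symmetric] by simp
      ultimately show ?thesis by simp
    qed
    have 2: "G (edge k D []) x = (\<Sum>i\<le>q. real (k choose i) * X i)"
      unfolding edge_conv_op[OF conv_op_G jet(1) qr(1), symmetric] edge_def X_def ..
    have 3: "G (C (edge k D) []) x = (\<Sum>i\<le>q. real (k choose i) * X (Suc i))"
    proof -
      have ir: "i * r + r \<le> L" if "i \<le> q" for i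
        using order_trans[OF mult_le_mono1[of "Suc i" "q + 1" r] qr(2)] that by (simp add: add.commute)
      have "C (edge k D) [] = (\<lambda>x. \<Sum>i\<le>q. real (k choose i) * (C ^^ Suc i) D [] x)"
      proof
        fix x
        show "C (edge k D) [] x = (\<Sum>i\<le>q. real (k choose i) * (C ^^ Suc i) D [] x)"
          unfolding diff_op_def[of u r "edge k D"] edge_def sum_distrib_left
          by (subst sum.swap) (simp add: diff_op_def[of u r "(C ^^ _) D"] sum_distrib_left mult.left_commute)
      qed
      moreover have "bdd_borel ((C ^^ Suc i) D [])" if "i \<le> q" for i
      proof -
        have "Suc i * r \<le> L" using ir[OF that] by (simp add: add.commute)
        then have "bounded_borel ((\<Sum>\<gamma> | length \<gamma> \<le> r. \<bar>u \<gamma>\<bar>) ^ Suc i * B) ((C ^^ Suc i) D [])"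
          by (intro jet_bounded[OF jet_diff_op_power[OF jet(1)]]) simp_all
        then show ?thesis by blast
      qed
      ultimately have "G (C (edge k D) []) = (\<lambda>x. \<Sum>i\<le>q. real (k choose i) * G ((C ^^ Suc i) D []) x)"
        using conv_op_sum_arg[OF conv_op_G, of "{..q}" "\<lambda>i. (C ^^ Suc i) D []" "\<lambda>i. real (k choose i)"] by simp
      then show ?thesis
        using ir by (auto simp: X_def diff_op_power_conv_op[OF conv_op_G jet(1), of "[]" "Suc _" r u, symmetric] add.commute
            simp del: funpow.simps intro!: sum.cong)
    qed
    show ?thesis unfolding 1 2 3 by (simp add: X_def)
  qed
  have "\<bar>P \<sigma> (edge k D []) x - edge (k + 1) ?D [] x\<bar> \<le> B * step_error n" for x
  proof -
    have "\<bar>P \<sigma> (edge k D []) x - G (edge k D []) x - G (C (edge k D) []) x\<bar>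
        \<le> ((\<Sum>i\<le>q. (real n * umass) ^ i) * B) * \<sigma> ^ (r + 1) * step_const"
      by (rule one_step[OF je qr(3)])
    moreover have "\<bar>real (k choose q) * (C ^^ (q + 1)) ?D [] x\<bar> \<le> real n ^ q * (umass ^ (q + 1) * B)"
      unfolding abs_mult
    proof (rule mult_mono)
      show "\<bar>real (k choose q)\<bar> \<le> real n ^ q" using choose_le_real_power[OF assms(3), of q] by simp
      show "\<bar>(C ^^ (q + 1)) ?D [] x\<bar> \<le> umass ^ (q + 1) * B"
        using jet_bounded[OF jet_diff_op_power[OF jG qr(2), of u], of "[]"]
        unfolding bounded_borel_def umass_def by simp
    qed auto
    ultimately show ?thesis unfolding step step_error_def by (simp add: algebra_simps)
  qed
  moreover have "(\<lambda>x. P \<sigma> (edge k D []) x - edge (k + 1) ?D [] x) \<in> borel_measurable borel"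
  proof (intro borel_measurable_diff)
    show "P \<sigma> (edge k D []) \<in> borel_measurable borel"
      using conv_op_bdd[OF conv_op_P, of "edge k D []"] jet_bounded[OF je, of "[]"]
      unfolding bounded_borel_def by (metis le0 list.size(3))
    show "edge (k + 1) ?D [] \<in> borel_measurable borel"
      using jet_edge[OF jG qr(1), of "k + 1" "k + 1"] by (simp add: jet_def)
  qed
  ultimately show ?thesis by (simp add: bounded_borel_def)
qed

text \<open>Telescoping: the factors \<open>P\<close> still to be replaced are contractions in the
  sup norm, so the errors of the single steps simply add up.\<close>

lemma edge_steps:
  assumes "jet L B D" "(q + 1) * r + 3 \<le> L" "k + m \<le> n"
  shows "\<bar>(P \<sigma> ^^ m) (edge k D []) x - edge (k + m) (\<lambda>\<alpha>. (G ^^ m) (D \<alpha>)) [] x\<bar> \<le> real m * (B * step_error n)"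
  using assms(1,3)
proof (induction m arbitrary: k D x)
  case (Suc m)
  let ?D = "\<lambda>\<alpha>. G (D \<alpha>)"
  let ?e = "\<lambda>x. P \<sigma> (edge k D []) x - edge (k + 1) ?D [] x"
  have qr: "q * r \<le> L" using assms(2) by simp
  have jG: "jet L B ?D" using jet_conv_op[OF conv_op_G op_bound_G Suc.prems(1)] by simp
  have e: "bounded_borel (B * step_error n) ?e"
    using Suc.prems by (intro edge_step[OF Suc.prems(1) assms(2)]) simp
  have b1: "bdd_borel (P \<sigma> (edge k D []))"
    using conv_op_bdd[OF conv_op_P, of "edge k D []"] jet_bounded[OF jet_edge[OF Suc.prems(1) qr order_refl], of "[]"] by auto
  have b2: "bdd_borel (edge (k + 1) ?D [])"
    using jet_bounded[OF jet_edge[OF jG qr order_refl], of "[]"] by auto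
  have "(P \<sigma> ^^ m) ?e = (\<lambda>x. (P \<sigma> ^^ m) (P \<sigma> (edge k D [])) x - (P \<sigma> ^^ m) (edge (k + 1) ?D []) x)"
    by (rule conv_op_diff[OF conv_op_funpow[OF conv_op_P] b1 b2])
  then have 1: "(P \<sigma> ^^ Suc m) (edge k D []) x = (P \<sigma> ^^ m) (edge (k + 1) ?D []) x + (P \<sigma> ^^ m) ?e x"
    by (simp add: funpow_swap1)
  have "bounded_borel (1 ^ m * (B * step_error n)) ((P \<sigma> ^^ m) ?e)"
    using op_bound_funpow[OF op_bound_P, of m] e unfolding op_bound_def by blast
  then have 2: "\<bar>(P \<sigma> ^^ m) ?e x\<bar> \<le> B * step_error n" by (simp add: bounded_borel_def)
  have "\<bar>(P \<sigma> ^^ m) (edge (k + 1) ?D []) x - edge (k + 1 + m) (\<lambda>\<alpha>. (G ^^ m) (?D \<alpha>)) [] x\<bar> \<le> real m * (B * step_error n)"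
    using Suc.prems by (intro Suc.IH jG) simp
  then have 3: "\<bar>(P \<sigma> ^^ m) (edge (k + 1) ?D []) x - edge (k + Suc m) (\<lambda>\<alpha>. (G ^^ Suc m) (D \<alpha>)) [] x\<bar> \<le> real m * (B * step_error n)"
    by (simp add: funpow_swap1)
  show ?case using 1 2 3 by (simp add: distrib_right)
qed simp

text \<open>With \<open>U\<close> the product of the smoothing blocks, the chain is
  \<open>P^n f\<close>, \<open>P^n2 (U f)\<close>, \<open>U (edge n2 DG)\<close>,
  \<open>P^n1 (edge n2 DG)\<close>, \<open>edge n\<close>. In the second link derivatives come from
  \<open>U\<close>; commutation then lets \<open>G^n2\<close> supply them while \<open>U\<close> is
  turned back into \<open>P^n1\<close> and replaced in turn.\<close>

lemma comparison:
  assumes n: "\<sigma> = 1 / sqrt (real n)" and L: "L = (q + 1) * r + 4" "2 * L \<le> n"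
    and f: "bounded_borel 1 f"
    and d: "1 \<le> d" "sqrt (4 * I * real L / p) \<le> d"
    and H: "H = 2 ^ L * hermite_mass TYPE('n) L"
    and \<kappa>: "\<kappa> = (\<Sum>i\<le>q. (real n * umass) ^ i)"
  shows "\<bar>(P \<sigma> ^^ n) f x - edge n (hermite_jet 1 f) [] x\<bar>
    \<le> real n * (((2 * d) ^ L + H) * step_error n) + 2 ^ L * (1 - p) ^ (n div (2 * L)) * (1 + \<kappa> * H)"
proof -
  \<comment> \<open>\<open>L\<close> blocks of \<open>b\<close> factors, one for each derivative,
    take up at most half of the \<open>n\<close> factors.\<close>
  define b where "b = n div (2 * L)"
  define n1 where "n1 = b * L"
  define n2 where "n2 = n - n1"
  have L0: "L > 0" and n0: "n > 0" using L by auto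
  have "2 * n1 \<le> n" unfolding n1_def b_def by (metis mult.commute mult.left_commute times_div_less_eq_dividend)
  then have n12: "n = n1 + n2" "2 * n2 \<ge> n" "n2 \<ge> 1" using n0 by (auto simp: n2_def)
  have qL: "q * r \<le> L" "q * r < L" "(q + 1) * r + 3 \<le> L" using L(1) by auto
  let ?U = "U \<sigma> b ^^ L" and ?\<delta> = "2 ^ L * (1 - p) ^ b"
  have p0: "0 \<le> (1 - p) ^ b" using p by simp
  have cU: "conv_op ?U" by (rule conv_op_funpow[OF conv_op_U])
  have cGm: "conv_op (G ^^ m)" for m by (rule conv_op_funpow[OF conv_op_G])
  have cP: "conv_op (P \<sigma> ^^ m)" for m by (rule conv_op_funpow[OF conv_op_P])
  have bf: "bdd_borel f" using f by blast
  define DA where "DA = smooth_jet \<sigma> b L f"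
  \<comment> \<open>The rounding in \<open>b\<close> is harmless as the smoothing bound involves
    \<open>b + 1\<close>: the norm of a differentiated block stays below
    \<open>sqrt (4 * I * L / p)\<close> uniformly in \<open>n\<close>.\<close>
  have "n < 2 * L * (b + 1)" unfolding b_def using L0 dividend_less_times_div[of "2 * L" n] by (simp add: mult.commute)
  then have nb: "real n \<le> 2 * real L * real (b + 1)" by (metis less_imp_le of_nat_le_iff of_nat_mult of_nat_numeral)
  have "sqrt (2 * I / (p * real (b + 1))) / \<sigma> = sqrt (2 * I / (p * real (b + 1)) * real n)"
    unfolding n by (subst real_sqrt_mult) simp
  also have "\<dots> \<le> sqrt (2 * I / (p * real (b + 1)) * (2 * real L * real (b + 1)))"
    using nb I_pos p by (intro real_sqrt_le_mono mult_left_mono) auto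
  also have "2 * I / (p * real (b + 1)) * (2 * real L * real (b + 1)) = 4 * I * real L / p"
  proof -
    have "2 * I / (p * X) * (2 * real L * X) = 4 * I * real L / p" if "X > 0" for X
      using p that by (simp add: field_simps)
    then show ?thesis by simp
  qed
  finally have "sqrt (2 * I / (p * real (b + 1))) / \<sigma> \<le> d" using d(2) by linarith
  then have jA: "jet L ((2 * d) ^ L) DA"
    using jet_smooth[OF \<sigma>(1) f _ d(1), of b L] by (simp add: DA_def)
  have DA0: "DA [] = ?U f" by (simp add: DA_def smooth_jet_def)
  define \<tau> where "\<tau> = \<sigma> * sqrt (real n2)"
  define DG where "DG = hermite_jet \<tau> f"
  have "1 / 2 \<le> \<tau>"
  proof -
    have "(1 / 2)\<^sup>2 \<le> \<tau>\<^sup>2"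
      using n12(2) n0 by (simp add: \<tau>_def n power_mult_distrib power_divide power2_eq_square field_simps)
    then show ?thesis by (rule power2_le_imp_le) (use \<sigma> in \<open>simp add: \<tau>_def\<close>)
  qed
  then have jG: "jet L H DG" unfolding DG_def H using jet_hermite[OF f, of \<tau> L] by simp
  have DG0: "DG [] = (G ^^ n2) f"
    unfolding DG_def hermite_jet_Nil \<tau>_def by (rule mean_gaussian_funpow[OF \<sigma>(1) n12(3) f, symmetric])
  have jH: "jet L H (hermite_jet 1 f)" unfolding H using jet_hermite[OF f, of 1 L] by simp
  have \<sigma>n: "\<sigma> * sqrt (real n) = 1" using n0 by (simp add: n)
  \<comment> \<open>Both families start from \<open>G^n f\<close>, where \<open>G^n\<close> is the
    standard Gaussian average, so uniqueness identifies all derivatives that enter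
    \<open>edge\<close>.\<close>
  have end_jet: "edge n (\<lambda>\<alpha>. (G ^^ n1) (DG \<alpha>)) [] = edge n (hermite_jet 1 f) []"
  proof (rule edge_cong)
    fix \<gamma> :: "'n list" assume "length \<gamma> \<le> q * r"
    then have \<gamma>: "length \<gamma> < L" using qL by simp
    have "(G ^^ n1) (DG []) = (G ^^ (n1 + n2)) f" by (simp only: DG0 funpow_add comp_apply)
    also have "\<dots> = mean (\<sigma> * sqrt (real n)) std_gaussian f"
      unfolding n12(1)[symmetric] using n0 by (intro mean_gaussian_funpow[OF \<sigma>(1) _ f]) simp
    also have "\<dots> = hermite_jet 1 f []" by (simp only: \<sigma>n hermite_jet_Nil)
    finally have "(G ^^ n1) (DG []) = hermite_jet 1 f []" .
    then show "(G ^^ n1) (DG \<gamma>) = hermite_jet 1 f \<gamma>"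
      by (rule jet_unique[OF jet_conv_op[OF cGm op_bound_funpow[OF op_bound_G] jG] jH _ \<gamma>])
  qed
  \<comment> \<open>The handover of smoothing: the same function is differentiated through the
    blocks \<open>U\<close> on the left and through the Gaussian average on the right.\<close>
  have mid_jet: "edge n2 (\<lambda>\<alpha>. (G ^^ n2) (DA \<alpha>)) [] = edge n2 (\<lambda>\<alpha>. ?U (DG \<alpha>)) []"
  proof (rule edge_cong)
    fix \<gamma> :: "'n list" assume "length \<gamma> \<le> q * r"
    then have \<gamma>: "length \<gamma> < L" using qL by simp
    have "(G ^^ n2) (DA []) = ?U (DG [])"
      unfolding DA0 DG0 by (rule conv_op_commute[OF cGm cU bf])
    then show "(G ^^ n2) (DA \<gamma>) = ?U (DG \<gamma>)"
      by (rule jet_unique[OF jet_conv_op[OF cGm op_bound_funpow[OF op_bound_G] jA]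
            jet_conv_op[OF cU op_bound_funpow[OF op_bound_U] jG] _ \<gamma>])
  qed
  let ?E = "edge n2 DG []"
  have "0 \<le> H" by (rule jet_nonneg[OF jG])
  have "n2 \<le> n" by (simp add: n2_def)
  then have bE: "bounded_borel (\<kappa> * H) ?E"
    unfolding \<kappa> using jet_bounded[OF jet_edge[OF jG qL(1)], of n2 n "[]"] by simp
  have 1: "\<bar>(P \<sigma> ^^ n) f x - (P \<sigma> ^^ n2) (?U f) x\<bar> \<le> ?\<delta>"
  proof -
    let ?e = "\<lambda>x. (P \<sigma> ^^ n1) f x - ?U f x"
    have "(P \<sigma> ^^ n2) ?e = (\<lambda>x. (P \<sigma> ^^ n2) ((P \<sigma> ^^ n1) f) x - (P \<sigma> ^^ n2) (?U f) x)"
      by (rule conv_op_diff[OF cP conv_op_bdd[OF cP bf] conv_op_bdd[OF cU bf]])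
    moreover have "(P \<sigma> ^^ n2) ((P \<sigma> ^^ n1) f) = (P \<sigma> ^^ n) f"
    proof -
      have "n = n2 + n1" using n12(1) by simp
      then show ?thesis by (simp only: funpow_add comp_apply)
    qed
    moreover have "bounded_borel (1 ^ n2 * (?\<delta> * 1)) ((P \<sigma> ^^ n2) ?e)"
      using smooth_part_error[OF f, where L = L and \<sigma> = \<sigma> and b = b] op_bound_funpow[OF op_bound_P]
      unfolding op_bound_def n1_def by blast
    ultimately show ?thesis by (simp add: bounded_borel_def)
  qed
  have 2: "\<bar>(P \<sigma> ^^ n2) (?U f) x - ?U ?E x\<bar> \<le> real n2 * ((2 * d) ^ L * step_error n)"
    using edge_steps[OF jA qL(3), of 0 n2 n x] \<open>n2 \<le> n\<close>
    by (simp add: edge_0 DA0 mid_jet edge_conv_op[OF cU jG qL(1)])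
  have 3: "\<bar>(P \<sigma> ^^ n1) ?E x - ?U ?E x\<bar> \<le> ?\<delta> * (\<kappa> * H)"
    using smooth_part_error[OF bE, where L = L and \<sigma> = \<sigma> and b = b] by (simp add: n1_def bounded_borel_def)
  have 4: "\<bar>(P \<sigma> ^^ n1) ?E x - edge n (hermite_jet 1 f) [] x\<bar> \<le> real n1 * (H * step_error n)"
  proof -
    have "n2 + n1 = n" using n12(1) by simp
    then show ?thesis using edge_steps[OF jG qL(3), of n2 n1 n x] by (simp add: end_jet)
  qed
  have se: "0 \<le> step_error n"
    unfolding step_error_def using \<sigma> umass_nonneg step_const_nonneg
    by (intro add_nonneg_nonneg mult_nonneg_nonneg sum_nonneg) auto
  have "real n2 * ((2 * d) ^ L * step_error n) \<le> real n * ((2 * d) ^ L * step_error n)"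
    using se d(1) \<open>n2 \<le> n\<close> by (intro mult_right_mono) auto
  moreover have "real n1 * (H * step_error n) \<le> real n * (H * step_error n)"
    using se \<open>0 \<le> H\<close> n12(1) by (intro mult_right_mono) auto
  moreover have "real n * (((2 * d) ^ L + H) * step_error n) + ?\<delta> * (1 + \<kappa> * H)
      = real n * ((2 * d) ^ L * step_error n) + real n * (H * step_error n) + ?\<delta> + ?\<delta> * (\<kappa> * H)"
    by (simp add: algebra_simps)
  ultimately show ?thesis using 1 2 3 4 unfolding b_def[symmetric] by linarith
qed

text \<open>At the point 0 and scale 1 the derivatives are Hermite moments of \<open>f\<close>, so
  the expansion becomes a finite sum in \<open>n\<close>, \<open>\<sigma>\<close> and these
  moments.\<close>

lemma edge_hermite:
  "edge n (hermite_jet 1 f) [] 0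
    = (\<Sum>i\<le>q. real (n choose i) * (\<Sum>\<gamma> | length \<gamma> \<le> i * r.
        \<sigma> ^ length \<gamma> * concat_power (\<lambda>\<gamma>. if length \<gamma> \<le> r then c1_coeff gap \<gamma> else 0) i \<gamma>
        * (\<integral>y. mhermite \<gamma> y * f y \<partial>std_gaussian)))"
proof -
  let ?v = "\<lambda>\<gamma>. if length \<gamma> \<le> r then c1_coeff gap \<gamma> else 0"
  let ?u = "\<lambda>\<gamma>. \<sigma> ^ length \<gamma> * ?v \<gamma>"
  have C: "C = diff_op ?u r"
    unfolding diff_op_def[abs_def] by (intro ext sum.cong refl) (simp add: u_def)
  have "(C ^^ i) (hermite_jet 1 f) [] 0
      = (\<Sum>\<gamma> | length \<gamma> \<le> i * r. \<sigma> ^ length \<gamma> * concat_power ?v i \<gamma> * (\<integral>y. mhermite \<gamma> y * f y \<partial>std_gaussian))" for i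
    unfolding C by (subst diff_op_power) (simp_all add: concat_power_scale hermite_jet_def avg_def)
  then show ?thesis by (simp add: edge_def)
qed

end

section \<open>Law of the normalized sum\<close>

text \<open>Integrating out one coordinate of the product measure is one application of the
  averaging operator.\<close>

lemma PiM_sum_integral:
  fixes \<mu> :: "'a::euclidean_space measure" and S :: "'i set"
  assumes "prob_space \<mu>" and sets: "sets \<mu> = sets borel" and "finite S" and "bounded_borel c f"
  shows "(\<integral>g. f (x + \<sigma> *\<^sub>R (\<Sum>k\<in>S. g k)) \<partial>(\<Pi>\<^sub>M k\<in>S. \<mu>)) = (mean \<sigma> \<mu> ^^ card S) f x"
  using assms(3,4)
proof (induction S arbitrary: f rule: finite_induct)
  case empty
  interpret prob_space "\<Pi>\<^sub>M k\<in>({} :: 'i set). \<mu>" by (intro prob_space_PiM assms)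
  show ?case using prob_space by simp
next
  case (insert i S)
  interpret product_prob_space "\<lambda>_. \<mu>" by (intro product_prob_spaceI assms)
  interpret PI: prob_space "\<Pi>\<^sub>M k\<in>insert i S. \<mu>" by (intro prob_space_PiM assms)
  have [measurable_cong]: "sets \<mu> = sets borel" by (fact sets)
  have [measurable]: "f \<in> borel_measurable borel" using insert by (simp add: bounded_borel_def)
  have mb: "bounded_borel (1 * c) (mean \<sigma> \<mu> f)"
    using op_bound_mean[OF assms(1) sets] insert.prems unfolding op_bound_def by blast
  have "integrable (\<Pi>\<^sub>M k\<in>insert i S. \<mu>) (\<lambda>g. f (x + \<sigma> *\<^sub>R (\<Sum>k\<in>insert i S. g k)))"
  proof (rule PI.integrable_const_bound[of _ c])
    show "AE g in \<Pi>\<^sub>M k\<in>insert i S. \<mu>. norm (f (x + \<sigma> *\<^sub>R (\<Sum>k\<in>insert i S. g k))) \<le> c"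
      using insert.prems by (auto simp: bounded_borel_def)
    show "(\<lambda>g. f (x + \<sigma> *\<^sub>R (\<Sum>k\<in>insert i S. g k))) \<in> borel_measurable (\<Pi>\<^sub>M k\<in>insert i S. \<mu>)"
      by measurable
  qed
  then have "(\<integral>g. f (x + \<sigma> *\<^sub>R (\<Sum>k\<in>insert i S. g k)) \<partial>(\<Pi>\<^sub>M k\<in>insert i S. \<mu>))
      = (\<integral>g. (\<integral>y. f (x + \<sigma> *\<^sub>R (\<Sum>k\<in>insert i S. (g(i := y)) k)) \<partial>\<mu>) \<partial>(\<Pi>\<^sub>M k\<in>S. \<mu>))"
    by (rule product_integral_insert[OF insert.hyps])
  also have "\<dots> = (\<integral>g. mean \<sigma> \<mu> f (x + \<sigma> *\<^sub>R (\<Sum>k\<in>S. g k)) \<partial>(\<Pi>\<^sub>M k\<in>S. \<mu>))"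
  proof (intro Bochner_Integration.integral_cong refl)
    fix g :: "'i \<Rightarrow> 'a"
    have "(\<Sum>k\<in>S. (g(i := y)) k) = (\<Sum>k\<in>S. g k)" for y
      using insert.hyps by (intro sum.cong) auto
    then have "(\<Sum>k\<in>insert i S. (g(i := y)) k) = y + (\<Sum>k\<in>S. g k)" for y
      using insert.hyps by simp
    then show "(\<integral>y. f (x + \<sigma> *\<^sub>R (\<Sum>k\<in>insert i S. (g(i := y)) k)) \<partial>\<mu>) = mean \<sigma> \<mu> f (x + \<sigma> *\<^sub>R (\<Sum>k\<in>S. g k))"
      by (simp add: avg_def scaleR_add_right add_ac)
  qed
  also have "\<dots> = (mean \<sigma> \<mu> ^^ card S) (mean \<sigma> \<mu> f) x" using mb by (intro insert.IH) simp
  finally show ?case using insert.hyps by (simp add: funpow_swap1)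
qed

lemma normalized_sum_integral:
  fixes X :: "nat \<Rightarrow> 'w \<Rightarrow> real^'n"
  assumes M: "prob_space M" and indep: "prob_space.indep_vars M (\<lambda>_. borel) X {1..}"
    and law: "\<And>k. k \<ge> 1 \<Longrightarrow> distr M borel (X k) = \<mu>" and n: "n \<ge> 1" and f: "bounded_borel c f"
  shows "integral\<^sup>L (distr M borel (normalized_sum X n)) f = (mean (1 / sqrt (real n)) \<mu> ^^ n) f 0"
proof -
  interpret prob_space M by fact
  let ?S = "{1..n}" and ?\<sigma> = "1 / sqrt (real n)"
  have X [measurable]: "random_variable borel (X k)" if "k \<in> ?S" for k
    using indep that by (auto simp: indep_vars_def)
  have \<mu>: "prob_space \<mu>" using prob_space_distr[OF X, of 1] law[of 1] n by simp
  have s\<mu>: "sets \<mu> = sets borel" using law[of 1] by auto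
  have [measurable]: "f \<in> borel_measurable borel" using f by (simp add: bounded_borel_def)
  have "indep_vars (\<lambda>_. borel) X ?S" by (rule indep_vars_subset[OF indep]) auto
  then have distr: "distr M (\<Pi>\<^sub>M k\<in>?S. borel) (\<lambda>\<omega>. \<lambda>k\<in>?S. X k \<omega>) = (\<Pi>\<^sub>M k\<in>?S. distr M borel (X k))"
    using indep_vars_iff_distr_eq_PiM'[where I = ?S and M' = "\<lambda>_. borel" and X = X] X n by auto
  have PiM: "(\<Pi>\<^sub>M k\<in>?S. distr M borel (X k)) = (\<Pi>\<^sub>M k\<in>?S. \<mu>)"
    by (intro PiM_cong refl) (auto intro!: law)
  have [measurable]: "(\<lambda>\<omega>. \<lambda>k\<in>?S. X k \<omega>) \<in> measurable M (\<Pi>\<^sub>M k\<in>?S. borel)"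
    by (intro measurable_restrict X)
  have [measurable]: "normalized_sum X n \<in> borel_measurable M"
    unfolding normalized_sum_def[abs_def] by measurable
  have "integral\<^sup>L (distr M borel (normalized_sum X n)) f = (\<integral>\<omega>. f (normalized_sum X n \<omega>) \<partial>M)"
    by (rule integral_distr) auto
  also have "\<dots> = (\<integral>\<omega>. f (0 + ?\<sigma> *\<^sub>R (\<Sum>k\<in>?S. (\<lambda>k\<in>?S. X k \<omega>) k)) \<partial>M)"
    by (intro Bochner_Integration.integral_cong refl) (simp add: normalized_sum_def)
  also have "\<dots> = (\<integral>g. f (0 + ?\<sigma> *\<^sub>R (\<Sum>k\<in>?S. g k)) \<partial>distr M (\<Pi>\<^sub>M k\<in>?S. borel) (\<lambda>\<omega>. \<lambda>k\<in>?S. X k \<omega>))"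
    by (rule integral_distr[symmetric]) measurable
  also have "\<dots> = (mean ?\<sigma> \<mu> ^^ card ?S) f 0"
    unfolding distr PiM by (rule PiM_sum_integral[OF \<mu> s\<mu> _ f]) simp
  finally show ?thesis by simp
qed

section \<open>Rearrangement into the Edgeworth density\<close>

lemma inverse_powr_half:
  assumes "n \<ge> 1"
  shows "1 / real n powr (real m / 2) = (1 / sqrt (real n)) ^ m"
  using assms by (simp add: powr_half_sqrt[symmetric] powr_powr power_one_over flip: powr_realpow)

definition hermite_moment :: "(real^'n \<Rightarrow> real) \<Rightarrow> 'n::finite list \<Rightarrow> real" where
  "hermite_moment f \<gamma> = (\<integral>y. mhermite \<gamma> y * f y \<partial>std_gaussian)"

lemma hermite_moment_bound:
  fixes f :: "real^'n \<Rightarrow> real"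
  assumes "bounded_borel 1 f" "length \<gamma> \<le> L"
  shows "\<bar>hermite_moment f \<gamma>\<bar> \<le> hermite_mass TYPE('n) L"
proof -
  have "bounded_borel (hermite_mass TYPE('n) L * 1) (avg 1 std_gaussian (mhermite \<gamma>) f)"
    by (rule avg_hermite_bounded[OF assms])
  then have "\<bar>avg 1 std_gaussian (mhermite \<gamma>) f 0\<bar> \<le> hermite_mass TYPE('n) L"
    by (simp add: bounded_borel_def)
  then show ?thesis by (simp add: avg_def hermite_moment_def)
qed

text \<open>The integral of \<open>f\<close> against the Edgeworth density as a function of the
  Hermite moments \<open>h\<close> alone, so that its comparison with the operator expansion is pure
  algebra.\<close>

definition edgeworth_value :: "('n::finite list \<Rightarrow> real) \<Rightarrow> nat \<Rightarrow> nat \<Rightarrow> ('n list \<Rightarrow> real) \<Rightarrow> real" where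
  "edgeworth_value \<Delta> n r h = h [] + (\<Sum>m = 1..r div 3. 1 / real n powr (real m / 2) *
     (\<Sum>t \<in> {t. max 3 m \<le> t \<and> t \<le> 3 * m \<and> even (t - m)}.
        \<Sum>i = max 1 ((t - m) div 2)..t div 3. a_coeff i ((t - m) div 2) *
          (\<Sum>\<gamma> | length \<gamma> = t. c_coeff \<Delta> i \<gamma> * h \<gamma>)))"

lemma finite_index_set: "finite {t :: nat. max 3 m \<le> t \<and> t \<le> 3 * m \<and> even (t - m)}"
  by (rule finite_subset[of _ "{..3 * m}"]) auto

lemma edgeworth_integral:
  fixes f :: "real^'n \<Rightarrow> real"
  assumes f: "bounded_borel c f"
  shows "(\<integral>x. f x * edgeworth_density \<Delta> n r x \<partial>lborel) = edgeworth_value \<Delta> n r (hermite_moment f)"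
proof -
  let ?T = "\<lambda>m. {t. max 3 m \<le> t \<and> t \<le> 3 * m \<and> even (t - m)}"
  let ?p = "\<lambda>x. mhermite [] x + (\<Sum>m = 1..r div 3. 1 / real n powr (real m / 2) *
     (\<Sum>t \<in> ?T m. \<Sum>i = max 1 ((t - m) div 2)..t div 3. a_coeff i ((t - m) div 2) *
          (\<Sum>\<gamma> | length \<gamma> = t. c_coeff \<Delta> i \<gamma> * mhermite \<gamma> x)))"
  have [measurable]: "f \<in> borel_measurable borel" using f by (simp add: bounded_borel_def)
  have int: "integrable std_gaussian (\<lambda>x. mhermite \<gamma> x * f x)" for \<gamma> :: "'n list"
    using avg_integrable[OF _ integrable_mhermite f, of \<gamma> 0 1] by simp
  have "(\<integral>x. f x * edgeworth_density \<Delta> n r x \<partial>lborel) = (\<integral>x. gauss_density x * (?p x * f x) \<partial>lborel)"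
    unfolding edgeworth_density_def edgeworth_poly_def hermite_sum_def mhermite_Nil
    by (intro Bochner_Integration.integral_cong refl) (simp only: mult_ac)
  also have "\<dots> = (\<integral>x. ?p x * f x \<partial>std_gaussian)"
    by (rule std_gaussian_integral(1)[symmetric]) measurable
  also have "\<dots> = (\<integral>x. mhermite [] x * f x + (\<Sum>m = 1..r div 3. 1 / real n powr (real m / 2) *
     (\<Sum>t \<in> ?T m. \<Sum>i = max 1 ((t - m) div 2)..t div 3. a_coeff i ((t - m) div 2) *
          (\<Sum>\<gamma> | length \<gamma> = t. c_coeff \<Delta> i \<gamma> * (mhermite \<gamma> x * f x)))) \<partial>std_gaussian)"
    by (intro Bochner_Integration.integral_cong refl)
      (simp only: distrib_right sum_distrib_right mult.assoc)
  also have "\<dots> = edgeworth_value \<Delta> n r (hermite_moment f)"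
    unfolding edgeworth_value_def hermite_moment_def
    by (simp only: Bochner_Integration.integral_add Bochner_Integration.integral_sum
        integral_mult_right Bochner_Integration.integrable_sum integrable_mult_right
        Bochner_Integration.integrable_add int integral_mult_right_zero)
  finally show ?thesis .
qed

text \<open>Coefficients of the powers of \<open>C\<close>, where every factor drops words longer
  than \<open>r\<close>, whereas \<open>c_coeff\<close> keeps them.\<close>

definition truncated_coeff :: "nat \<Rightarrow> ('n list \<Rightarrow> real) \<Rightarrow> nat \<Rightarrow> 'n list \<Rightarrow> real" where
  "truncated_coeff r \<Delta> = concat_power (\<lambda>\<gamma>. if length \<gamma> \<le> r then c1_coeff \<Delta> \<gamma> else 0)"

text \<open>
  With \<open>m = t - 2 p\<close> the Edgeworth density collects the terms of order \<open>n^(-m/2)\<close>, \<open>m \<le> q\<close>; for those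
  the truncation of \<open>c\<^sup>1\<close> at length \<open>r\<close> is invisible.
\<close>
lemma edgeworth_rearrange:
  fixes \<Delta> h :: "'n::finite list \<Rightarrow> real"
  assumes \<Delta>: "\<And>\<alpha>. length \<alpha> \<le> 2 \<Longrightarrow> \<Delta> \<alpha> = 0" and n: "n \<ge> 1" and \<sigma>: "\<sigma> = 1 / sqrt (real n)" and q: "q = r div 3"
  defines "S \<equiv> \<lambda>i t. \<Sum>\<gamma> | length \<gamma> = t. truncated_coeff r \<Delta> i \<gamma> * h \<gamma>"
  shows "(\<Sum>i\<le>q. real (n choose i) * (\<Sum>\<gamma> | length \<gamma> \<le> i * r. \<sigma> ^ length \<gamma> * truncated_coeff r \<Delta> i \<gamma> * h \<gamma>))
    - edgeworth_value \<Delta> n r h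
    = (\<Sum>i=1..q. \<Sum>p\<le>i. \<Sum>t\<in>{t. t \<le> i * r \<and> q + 2 * p < t}. a_coeff i p * real n ^ p * \<sigma> ^ t * S i t)"
proof -
  define g where "g i p t = a_coeff i p * real n ^ p * \<sigma> ^ t * S i t" for i p t
  have \<sigma>0: "\<sigma> > 0" "real n * \<sigma>\<^sup>2 = 1" using n by (simp_all add: \<sigma> power_divide)
  have S0: "S i t = 0" if "t < 3 * i" for i t
  proof -
    have "truncated_coeff r \<Delta> i \<gamma> = 0" if "length \<gamma> = t" for \<gamma> :: "'n list"
      unfolding truncated_coeff_def using c1_coeff_eq_0[of \<Delta>] \<Delta> that \<open>t < 3 * i\<close>
      by (intro concat_power_eq_0) auto
    then show ?thesis by (simp add: S_def)
  qed
  have Sc: "S i t = (\<Sum>\<gamma> | length \<gamma> = t. c_coeff \<Delta> i \<gamma> * h \<gamma>)" if "t \<le> r" "i \<ge> 1" for i t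
  proof -
    have "truncated_coeff r \<Delta> i \<gamma> = c_coeff \<Delta> i \<gamma>" if "length \<gamma> = t" for \<gamma> :: "'n list"
      using that \<open>t \<le> r\<close> \<open>i \<ge> 1\<close> c_coeff_eq_concat_power[of \<Delta> "i - 1"]
      by (simp add: truncated_coeff_def concat_power_truncate)
    then show ?thesis by (simp add: S_def)
  qed
  have "(\<Sum>i\<le>q. real (n choose i) * (\<Sum>\<gamma> | length \<gamma> \<le> i * r. \<sigma> ^ length \<gamma> * truncated_coeff r \<Delta> i \<gamma> * h \<gamma>))
      = (\<Sum>i\<le>q. real (n choose i) * (\<Sum>t\<le>i * r. \<sigma> ^ t * S i t))"
  proof (intro sum.cong refl arg_cong2[where f = "(*)"])
    fix i
    have "(\<Sum>\<gamma> | length \<gamma> < Suc (i * r). \<sigma> ^ length \<gamma> * truncated_coeff r \<Delta> i \<gamma> * h \<gamma>)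
        = (\<Sum>t<Suc (i * r). \<Sum>\<gamma> | length \<gamma> = t. \<sigma> ^ length \<gamma> * truncated_coeff r \<Delta> i \<gamma> * h \<gamma>)"
      by (rule sum_lists_less)
    also have "\<dots> = (\<Sum>t<Suc (i * r). \<sigma> ^ t * S i t)"
      unfolding S_def sum_distrib_left by (intro sum.cong refl) (auto simp: mult.assoc)
    finally show "(\<Sum>\<gamma> | length \<gamma> \<le> i * r. \<sigma> ^ length \<gamma> * truncated_coeff r \<Delta> i \<gamma> * h \<gamma>) = (\<Sum>t\<le>i * r. \<sigma> ^ t * S i t)"
      by (simp only: less_Suc_eq_le lessThan_Suc_atMost)
  qed
  also have "\<dots> = h [] + (\<Sum>i=1..q. real (n choose i) * (\<Sum>t\<le>i * r. \<sigma> ^ t * S i t))"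
  proof -
    have "S 0 0 = h []" unfolding S_def by (subst sum_lists_0) (simp add: truncated_coeff_def)
    then show ?thesis unfolding atMost_atLeast0[of q] by (subst sum.atLeast_Suc_atMost) auto
  qed
  also have "(\<Sum>i=1..q. real (n choose i) * (\<Sum>t\<le>i * r. \<sigma> ^ t * S i t)) = (\<Sum>i=1..q. \<Sum>p\<le>i. \<Sum>t\<le>i * r. g i p t)"
  proof (intro sum.cong refl)
    fix i assume "i \<in> {1..q}"
    then have "real (n choose i) = (\<Sum>p\<le>i. a_coeff i p * real n ^ p)" using n by (intro binomial_eq_a_coeff) auto
    then show "real (n choose i) * (\<Sum>t\<le>i * r. \<sigma> ^ t * S i t) = (\<Sum>p\<le>i. \<Sum>t\<le>i * r. g i p t)"
      by (simp only: g_def sum_product mult.assoc)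
  qed
  also have "\<dots> = (\<Sum>i=1..q. \<Sum>p\<le>i. (\<Sum>t\<in>{t. t \<le> i * r \<and> t \<le> q + 2 * p \<and> 3 * i \<le> t}. g i p t)
      + (\<Sum>t\<in>{t. t \<le> i * r \<and> q + 2 * p < t}. g i p t))"
  proof (intro sum.cong refl)
    fix i p
    have fin: "finite {t. t \<le> i * r \<and> t \<le> q + 2 * p}" by (rule finite_subset[of _ "{..i * r}"]) auto
    have "(\<Sum>t\<le>i * r. g i p t) = (\<Sum>t\<in>{t. t \<le> i * r \<and> t \<le> q + 2 * p} \<union> {t. t \<le> i * r \<and> q + 2 * p < t}. g i p t)"
      by (intro sum.cong) auto
    also have "\<dots> = (\<Sum>t\<in>{t. t \<le> i * r \<and> t \<le> q + 2 * p}. g i p t) + (\<Sum>t\<in>{t. t \<le> i * r \<and> q + 2 * p < t}. g i p t)"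
      by (rule sum.union_disjoint) auto
    also have "(\<Sum>t\<in>{t. t \<le> i * r \<and> t \<le> q + 2 * p}. g i p t) = (\<Sum>t\<in>{t. t \<le> i * r \<and> t \<le> q + 2 * p \<and> 3 * i \<le> t}. g i p t)"
    proof (rule sum.mono_neutral_right)
      show "\<forall>t\<in>{t. t \<le> i * r \<and> t \<le> q + 2 * p} - {t. t \<le> i * r \<and> t \<le> q + 2 * p \<and> 3 * i \<le> t}. g i p t = 0"
      proof
        fix t assume "t \<in> {t. t \<le> i * r \<and> t \<le> q + 2 * p} - {t. t \<le> i * r \<and> t \<le> q + 2 * p \<and> 3 * i \<le> t}"
        then have "t < 3 * i" by auto
        then show "g i p t = 0" by (simp add: g_def S0)
      qed
    qed (use fin in auto)
    finally show "(\<Sum>t\<le>i * r. g i p t) = (\<Sum>t\<in>{t. t \<le> i * r \<and> t \<le> q + 2 * p \<and> 3 * i \<le> t}. g i p t)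
      + (\<Sum>t\<in>{t. t \<le> i * r \<and> q + 2 * p < t}. g i p t)" .
  qed
  also have "\<dots> = (\<Sum>i=1..q. \<Sum>p\<le>i. \<Sum>t\<in>{t. t \<le> i * r \<and> t \<le> q + 2 * p \<and> 3 * i \<le> t}. g i p t)
      + (\<Sum>i=1..q. \<Sum>p\<le>i. \<Sum>t\<in>{t. t \<le> i * r \<and> q + 2 * p < t}. g i p t)"
    by (simp only: sum.distrib)
  also have "(\<Sum>i=1..q. \<Sum>p\<le>i. \<Sum>t\<in>{t. t \<le> i * r \<and> t \<le> q + 2 * p \<and> 3 * i \<le> t}. g i p t)
      = edgeworth_value \<Delta> n r h - h []"
  proof -
    let ?T = "\<lambda>m. {t. max 3 m \<le> t \<and> t \<le> 3 * m \<and> even (t - m)}"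
    let ?A = "SIGMA i:{1..q}. SIGMA p:{..i}. {t. t \<le> i * r \<and> t \<le> q + 2 * p \<and> 3 * i \<le> t}"
    let ?B = "SIGMA m:{1..q}. SIGMA t:?T m. {max 1 ((t - m) div 2)..t div 3}"
    have finA: "finite {t. t \<le> i * r \<and> t \<le> q + 2 * p \<and> 3 * i \<le> t}" for i p
      by (rule finite_subset[of _ "{..i * r}"]) auto
    have "(\<Sum>i=1..q. \<Sum>p\<le>i. \<Sum>t\<in>{t. t \<le> i * r \<and> t \<le> q + 2 * p \<and> 3 * i \<le> t}. g i p t)
        = (\<Sum>(i, p, t)\<in>?A. g i p t)"
      using finA by (simp add: sum.Sigma)
    also have "\<dots> = (\<Sum>(m, t, i)\<in>?B. g i ((t - m) div 2) t)"
    \<comment> \<open>The ranges match: for \<open>m = t - 2 * p\<close>, the bounds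
      \<open>1 \<le> i\<close>, \<open>p \<le> i\<close> and \<open>3 * i \<le> t\<close> give
      \<open>1 \<le> m\<close> and \<open>t \<le> 3 * m\<close>; conversely
      \<open>t \<le> 3 * m \<le> 3 * q \<le> r\<close> yields \<open>t \<le> i * r\<close> and
      \<open>i \<le> q\<close>.\<close>
    proof (rule sum.reindex_bij_witness[where i = "\<lambda>(m, t, i). (i, (t - m) div 2, t)" and j = "\<lambda>(i, p, t). (t - 2 * p, t, i)"])
      fix x assume "x \<in> ?A"
      then obtain i p t where x: "x = (i, p, t)" "1 \<le> i" "i \<le> q" "p \<le> i" "t \<le> q + 2 * p" "3 * i \<le> t"
        by auto
      then have t: "2 * p \<le> t" "t - (t - 2 * p) = 2 * p" by auto
      show "(case case x of (i, p, t) \<Rightarrow> (t - 2 * p, t, i) of (m, t, i) \<Rightarrow> (i, (t - m) div 2, t)) = x"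
        using x t by simp
      have "i \<le> t div 3" using x by linarith
      then show "(case x of (i, p, t) \<Rightarrow> (t - 2 * p, t, i)) \<in> ?B"
        using x t by auto
      show "(case case x of (i, p, t) \<Rightarrow> (t - 2 * p, t, i) of (m, t, i) \<Rightarrow> g i ((t - m) div 2) t) = (case x of (i, p, t) \<Rightarrow> g i p t)"
        using x t by simp
    next
      fix y assume "y \<in> ?B"
      then obtain m t i where y: "y = (m, t, i)" "1 \<le> m" "m \<le> q" "3 \<le> t" "m \<le> t" "t \<le> 3 * m" "even (t - m)"
        "1 \<le> i" "(t - m) div 2 \<le> i" "i \<le> t div 3" by auto
      then obtain p where p: "t - m = 2 * p" by blast
      show "(case case y of (m, t, i) \<Rightarrow> (i, (t - m) div 2, t) of (i, p, t) \<Rightarrow> (t - 2 * p, t, i)) = y"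
        using y p by auto
      have "3 * i \<le> t" using y(10) by linarith
      moreover have "t \<le> r" using y q by linarith
      then have "t \<le> i * r" using y(8) by (metis le_trans mult_le_mono1 nat_mult_1)
      moreover have "i \<le> q" using y by linarith
      ultimately show "(case y of (m, t, i) \<Rightarrow> (i, (t - m) div 2, t)) \<in> ?A"
        using y p by auto
    qed
    also have "\<dots> = (\<Sum>m=1..q. \<Sum>t\<in>?T m. \<Sum>i = max 1 ((t - m) div 2)..t div 3. g i ((t - m) div 2) t)"
      using finite_index_set by (simp add: sum.Sigma)
    also have "\<dots> = edgeworth_value \<Delta> n r h - h []"
    proof -
      define W where "W i t = (\<Sum>\<gamma> | length \<gamma> = t. c_coeff \<Delta> i \<gamma> * h \<gamma>)" for i t
      have "g i ((t - m) div 2) t = 1 / real n powr (real m / 2) * (a_coeff i ((t - m) div 2) * W i t)"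
        if m: "m \<in> {1..q}" and t: "t \<in> ?T m" and i: "i \<in> {max 1 ((t - m) div 2)..t div 3}" for m t i
      proof -
      obtain p where p: "t - m = 2 * p" using t by blast
      have tm: "t = m + 2 * p" using t p by auto
      have "real n ^ p * \<sigma> ^ t = (real n * \<sigma>\<^sup>2) ^ p * \<sigma> ^ m"
        unfolding tm power_add power_mult power_mult_distrib by (simp only: mult_ac)
      then have "real n ^ p * \<sigma> ^ t = \<sigma> ^ m" using \<sigma>0 by simp
      moreover have "\<sigma> ^ m = 1 / real n powr (real m / 2)"
        unfolding \<sigma> by (rule inverse_powr_half[OF n, symmetric])
      moreover have "t \<le> r" using m t q by auto
      ultimately show ?thesis
        using i by (simp add: g_def p Sc W_def mult_ac)
      qed
      then show ?thesis
        unfolding edgeworth_value_def q[symmetric] add_diff_cancel_left' W_def[symmetric] sum_distrib_left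
        by (intro sum.cong refl)
    qed
    finally show ?thesis .
  qed
  finally show ?thesis by (simp add: g_def)
qed

section \<open>Moment bounds and the two regimes\<close>

definition moment_const :: "'n::finite itself \<Rightarrow> nat \<Rightarrow> real" where
  "moment_const _ r = real CARD('n) + 1 + (\<Sum>t\<le>r + 1. \<integral>y. norm y ^ t \<partial>(std_gaussian :: (real^'n) measure))"

definition index_count :: "'n::finite itself \<Rightarrow> nat \<Rightarrow> real" where
  "index_count _ r = real (card {\<gamma> :: 'n list. length \<gamma> \<le> r})"

definition edgeworth_const :: "'n::finite itself \<Rightarrow> nat \<Rightarrow> real \<Rightarrow> real \<Rightarrow> real" where
  "edgeworth_const _ r a H = H * (1 + (\<Sum>m = 1..r div 3. \<Sum>t \<in> {t. max 3 m \<le> t \<and> t \<le> 3 * m \<and> even (t - m)}.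
     \<Sum>i = max 1 ((t - m) div 2)..t div 3. \<bar>a_coeff i ((t - m) div 2)\<bar> * (real (card {\<gamma> :: 'n list. length \<gamma> = t}) * a ^ i)))"

definition rearrange_const :: "'n::finite itself \<Rightarrow> nat \<Rightarrow> nat \<Rightarrow> real" where
  "rearrange_const T r q = (\<Sum>i=1..q. \<Sum>p\<le>i. \<Sum>t\<in>{t. t \<le> i * r \<and> q + 2 * p < t}. \<bar>a_coeff i p\<bar> *
     (real (card {\<gamma> :: 'n list. length \<gamma> = t}) * (((real (q * r) + 1) * (real r + 1)) ^ i * moment_const T r ^ q * hermite_mass T (q * r))))"

text \<open>The parameter \<open>a\<close> stands for the bound on \<open>n * umass\<close> in the
  main regime.\<close>

definition step_error_const :: "'n::finite itself \<Rightarrow> nat \<Rightarrow> nat \<Rightarrow> real \<Rightarrow> real" where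
  "step_error_const T r q a = (\<Sum>i\<le>q. a ^ i) * (real CARD('n) ^ (r + 1) * (moment_const T r + a + 1))
     + (index_count T r * (real r + 1)) ^ (q + 1) * moment_const T r ^ q"

text \<open>The three summands bound the replacement of factors, the blocks without any smooth
  factor, and the rearrangement into the density.\<close>

definition main_const :: "'n::finite itself \<Rightarrow> nat \<Rightarrow> nat \<Rightarrow> nat \<Rightarrow> real \<Rightarrow> real \<Rightarrow> real" where
  "main_const T r q L p I =
    (let a = index_count T r * ((real r + 1) * moment_const T r);
         H = 2 ^ L * hermite_mass T L
     in ((2 * max 1 (sqrt (4 * I * real L / p))) ^ L + H) * step_error_const T r q a
        + 2 ^ L * ((2 * real L * (real (r - 1) / p)) ^ (r - 1) * exp p) * (1 + (\<Sum>i\<le>q. a ^ i) * H)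
        + rearrange_const T r q)"

definition trivial_const :: "'n::finite itself \<Rightarrow> nat \<Rightarrow> nat \<Rightarrow> real" where
  "trivial_const T r L = (1 + edgeworth_const T r ((real r + 1) * ((real r + 1) * moment_const T r)) (hermite_mass T r))
     * sqrt (2 * real L) ^ (r - 1)"

lemma gaussian_moment_le:
  assumes "t \<le> r + 1"
  shows "(\<integral>y. norm y ^ t \<partial>(std_gaussian :: (real^'n) measure)) \<le> moment_const TYPE('n) r - real CARD('n) - 1"
proof -
  have "(\<integral>y. norm y ^ t \<partial>(std_gaussian :: (real^'n) measure))
      \<le> (\<Sum>t\<le>r + 1. \<integral>y. norm y ^ t \<partial>(std_gaussian :: (real^'n) measure))"
    using assms by (intro member_le_sum Bochner_Integration.integral_nonneg) auto
  then show ?thesis by (simp add: moment_const_def)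
qed

lemma moment_const_ge: "1 \<le> moment_const TYPE('n::finite) r"
proof -
  have "0 \<le> (\<Sum>t\<le>r + 1. \<integral>y. norm y ^ t \<partial>(std_gaussian :: (real^'n) measure))"
    by (intro sum_nonneg Bochner_Integration.integral_nonneg) auto
  then show ?thesis by (simp add: moment_const_def)
qed

lemma integrable_norm_power_le:
  fixes \<mu> :: "(real^'n) measure"
  assumes "sets \<mu> = sets borel" "finite_measure \<mu>" "integrable \<mu> (\<lambda>x. norm x ^ q)" "t \<le> q"
  shows "integrable \<mu> (\<lambda>x. norm x ^ t)"
proof (rule Bochner_Integration.integrable_bound)
  interpret finite_measure \<mu> by fact
  have [measurable_cong]: "sets \<mu> = sets borel" by fact
  show "integrable \<mu> (\<lambda>x. 1 + norm x ^ q)" using assms by simp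
  show "(\<lambda>x. norm x ^ t) \<in> borel_measurable \<mu>" by measurable
  have "norm x ^ t \<le> 1 + norm x ^ q" for x :: "real^'n"
  proof (cases "norm x \<le> 1")
    case True
    then have "norm x ^ t \<le> 1" by (intro power_le_one) auto
    then show ?thesis using zero_le_power[OF norm_ge_zero, of x q] by linarith
  next
    case False
    then have "norm x ^ t \<le> norm x ^ q" using assms(4) by (intro power_increasing) auto
    then show ?thesis by simp
  qed
  then show "AE x in \<mu>. norm (norm x ^ t) \<le> norm (1 + norm x ^ q)"
    by (auto intro!: AE_I2 order_trans[OF _ abs_ge_self])
qed

text \<open>Up to \<open>K\<close> the square dominates, beyond \<open>K\<close> the top power does.
  Integrated, with \<open>K ^ (r - 1)\<close> at least the top moment and the second moment fixed,
  it bounds the moments in between by powers of \<open>K\<close>.\<close>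

lemma power_interpolation:
  fixes y K :: real
  assumes "0 \<le> y" "0 < K" "2 \<le> t" "t \<le> r + 1"
  shows "y ^ t \<le> K ^ (t - 2) * (y\<^sup>2 + y ^ (r + 1) / K ^ (r - 1))"
proof (cases "y \<le> K")
  case True
  have "y ^ t = y ^ (t - 2) * y\<^sup>2" using assms(3) by (metis le_add_diff_inverse2 power_add)
  also have "\<dots> \<le> K ^ (t - 2) * y\<^sup>2" using True assms by (intro mult_right_mono power_mono) auto
  also have "\<dots> \<le> K ^ (t - 2) * (y\<^sup>2 + y ^ (r + 1) / K ^ (r - 1))"
    using assms by (intro mult_left_mono) auto
  finally show ?thesis .
next
  case False
  have r: "K ^ (r - 1) = K ^ (t - 2) * K ^ (r + 1 - t)" "y ^ (r + 1) = y ^ t * y ^ (r + 1 - t)"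
    using assms(3,4) by (simp_all flip: power_add)
  have "y ^ t * K ^ (r + 1 - t) \<le> y ^ t * y ^ (r + 1 - t)"
    using False assms by (intro mult_left_mono power_mono) auto
  then have "y ^ t \<le> K ^ (t - 2) * (y ^ (r + 1) / K ^ (r - 1))"
    unfolding r using assms(2) by (simp add: field_simps)
  also have "\<dots> \<le> K ^ (t - 2) * (y\<^sup>2 + y ^ (r + 1) / K ^ (r - 1))"
    using assms by (intro mult_left_mono) auto
  finally show ?thesis .
qed

text \<open>Here \<open>(1 - p) ^ b \<le> exp (- p * b)\<close>, and \<open>t \<le> exp t\<close> at
  \<open>t = p * (b + 1) / m\<close> controls \<open>(b + 1) ^ m\<close>; the factor
  \<open>exp p\<close> pays for the shift from \<open>b\<close> to \<open>b + 1\<close>.\<close>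

lemma geometric_decay:
  fixes p :: real
  assumes "0 < p" "p \<le> 1" "L > 0" "n \<ge> 1"
  shows "(1 - p) ^ (n div (2 * L)) * sqrt (real n) ^ m \<le> (2 * real L * (real m / p)) ^ m * exp p"
proof -
  define b where "b = n div (2 * L)"
  have "n < 2 * L * (b + 1)" unfolding b_def using assms(3) dividend_less_times_div[of "2 * L" n] by (simp add: mult.commute)
  then have nb: "real n \<le> 2 * real L * real (b + 1)" by (metis less_imp_le of_nat_le_iff of_nat_mult of_nat_numeral)
  have "sqrt (real n) \<le> sqrt ((real n)\<^sup>2)"
    using assms(4) by (intro real_sqrt_le_mono) (simp add: power2_eq_square)
  then have "sqrt (real n) \<le> 2 * real L * real (b + 1)" using nb by simp
  then have 1: "sqrt (real n) ^ m \<le> (2 * real L * real (b + 1)) ^ m" by (intro power_mono) auto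
  have "(1 - p) ^ b \<le> exp (- p) ^ b"
    using assms exp_ge_add_one_self[of "- p"] by (intro power_mono) auto
  then have 2: "(1 - p) ^ b \<le> exp (- (p * real b))" by (simp flip: exp_of_nat_mult add: mult.commute)
  have 3: "real (b + 1) ^ m \<le> (real m / p) ^ m * exp (p * real (b + 1))"
  proof (cases "m = 0")
    case False
    let ?t = "p * real (b + 1) / real m"
    have "real (b + 1) = real m / p * ?t" using assms(1) False by simp
    also have "\<dots> \<le> real m / p * exp ?t"
      using assms(1) exp_ge_add_one_self[of ?t] by (intro mult_left_mono) (linarith, simp)
    finally have "real (b + 1) ^ m \<le> (real m / p * exp ?t) ^ m" by (intro power_mono) auto
    also have "\<dots> = (real m / p) ^ m * exp (p * real (b + 1))"
      using False by (simp only: power_mult_distrib exp_of_nat_mult[symmetric]) (simp del: of_nat_add)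
    finally show ?thesis .
  qed (use assms in simp)
  have "(1 - p) ^ b * sqrt (real n) ^ m \<le> exp (- (p * real b)) * (2 * real L * real (b + 1)) ^ m"
    using 1 2 assms by (intro mult_mono) auto
  also have "\<dots> = (2 * real L) ^ m * (exp (- (p * real b)) * real (b + 1) ^ m)"
    by (simp only: power_mult_distrib mult_ac)
  also have "\<dots> \<le> (2 * real L) ^ m * (exp (- (p * real b)) * ((real m / p) ^ m * exp (p * real (b + 1))))"
    using 3 by (intro mult_left_mono) auto
  also have "\<dots> = (2 * real L * (real m / p)) ^ m * (exp (- (p * real b)) * exp (p * real (b + 1)))"
    by (simp only: power_mult_distrib mult_ac)
  also have "exp (- (p * real b)) * exp (p * real (b + 1)) = exp p" by (simp add: algebra_simps flip: exp_add)
  finally show ?thesis by (simp only: b_def)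
qed

section \<open>Estimates for standardized laws\<close>

locale edgeworth_normalized = edgeworth_law \<mu> \<nu> s I p r q \<sigma>
  for \<mu> \<nu> :: "(real^'n::finite) measure" and s I p r q \<sigma> +
  fixes n :: nat
  assumes gap0: "length \<alpha> \<le> 2 \<Longrightarrow> gap \<alpha> = 0"
    and second: "(\<integral>x. (norm x)\<^sup>2 \<partial>\<mu>) = real CARD('n)"
    and r: "r \<ge> 2" and q: "q = r div 3" and n: "n \<ge> 1" and \<sigma>n: "\<sigma> = 1 / sqrt (real n)"
begin

definition M :: real where
  "M = (\<integral>x. norm x ^ (r + 1) \<partial>\<mu>)"

definition gap_sup :: real where
  "gap_sup = (SUP \<gamma>\<in>{\<gamma>. length \<gamma> \<le> r}. \<bar>gap \<gamma>\<bar>)"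

lemma M_nonneg: "0 \<le> M"
  unfolding M_def by (intro Bochner_Integration.integral_nonneg) auto

lemma c_nonneg: "0 \<le> index_count TYPE('n) r"
  by (simp add: index_count_def)

text \<open>The identity covariance fixes the second moment at the dimension, and the top moment
  adds at most 1 after division by \<open>K ^ (r - 1)\<close>.\<close>

lemma norm_moment_le:
  assumes "0 < K" "M \<le> K ^ (r - 1)" "2 \<le> t" "t \<le> r + 1"
  shows "(\<integral>x. norm x ^ t \<partial>\<mu>) \<le> K ^ (t - 2) * (real CARD('n) + 1)"
proof -
  have int: "integrable \<mu> (\<lambda>x. norm x ^ t)" if "t \<le> r + 1" for t
    by (rule integrable_norm_power_le[OF sets_M M.finite_measure_axioms moment that])
  have "(\<integral>x. norm x ^ t \<partial>\<mu>) \<le> (\<integral>x. K ^ (t - 2) * ((norm x)\<^sup>2 + norm x ^ (r + 1) / K ^ (r - 1)) \<partial>\<mu>)"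
    using int[of 2] r moment
    by (intro integral_mono int assms power_interpolation Bochner_Integration.integrable_mult_right
        Bochner_Integration.integrable_add integrable_divide) auto
  also have "\<dots> = K ^ (t - 2) * (real CARD('n) + M / K ^ (r - 1))"
    using int[of 2] r moment by (simp add: second M_def)
  also have "\<dots> \<le> K ^ (t - 2) * (real CARD('n) + 1)"
    using assms by (intro mult_left_mono add_left_mono) (auto simp: divide_le_eq)
  finally show ?thesis .
qed

lemma mpower_integral_le:
  fixes \<kappa> :: "(real^'n) measure"
  assumes "sets \<kappa> = sets borel" "finite_measure \<kappa>" "integrable \<kappa> (\<lambda>x. norm x ^ (r + 1))" "length \<gamma> \<le> r + 1"
  shows "\<bar>\<integral>x. mpower x \<gamma> \<partial>\<kappa>\<bar> \<le> (\<integral>x. norm x ^ length \<gamma> \<partial>\<kappa>)"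
  by (rule order_trans[OF integral_abs_bound integral_mono])
    (intro integrable_abs integrable_mpower[OF assms] integrable_norm_power_le[OF assms] abs_mpower_le)+

lemma gap_le:
  assumes "length \<gamma> \<le> r + 1"
  shows "\<bar>gap \<gamma>\<bar> \<le> (\<integral>x. norm x ^ length \<gamma> \<partial>\<mu>) + (moment_const TYPE('n) r - real CARD('n) - 1)"
proof -
  have "\<bar>\<integral>x. mpower x \<gamma> \<partial>\<mu>\<bar> \<le> (\<integral>x. norm x ^ length \<gamma> \<partial>\<mu>)"
    by (rule mpower_integral_le[OF sets_M M.finite_measure_axioms moment assms])
  moreover have "\<bar>\<integral>x. mpower x \<gamma> \<partial>(std_gaussian :: (real^'n) measure)\<bar> \<le> moment_const TYPE('n) r - real CARD('n) - 1"
    using mpower_integral_le[OF sets_std_gaussian finite_measure_std_gaussian gaussian_norm_power assms]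
      gaussian_moment_le[OF assms, where ?'n = 'n] by linarith
  ultimately show ?thesis unfolding gap_def by linarith
qed

lemma gap_graded:
  assumes "1 \<le> K" "M \<le> K ^ (r - 1)" "length \<gamma> \<le> r"
  shows "\<bar>gap \<gamma>\<bar> \<le> moment_const TYPE('n) r * K ^ (length \<gamma> - 2)"
proof (cases "length \<gamma> \<le> 2")
  case True
  then show ?thesis using gap0 moment_const_ge[where ?'n = 'n, of r] assms(1) by simp
next
  case False
  have A1: "0 \<le> moment_const TYPE('n) r - real CARD('n) - 1"
    unfolding moment_const_def by (simp, intro sum_nonneg add_nonneg_nonneg Bochner_Integration.integral_nonneg) auto
  have "(\<integral>x. norm x ^ length \<gamma> \<partial>\<mu>) \<le> K ^ (length \<gamma> - 2) * (real CARD('n) + 1)"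
    using assms False by (intro norm_moment_le) auto
  moreover have "(moment_const TYPE('n) r - real CARD('n) - 1) * 1 \<le> (moment_const TYPE('n) r - real CARD('n) - 1) * K ^ (length \<gamma> - 2)"
    using assms(1) A1 by (intro mult_left_mono one_le_power)
  ultimately have "(\<integral>x. norm x ^ length \<gamma> \<partial>\<mu>) + (moment_const TYPE('n) r - real CARD('n) - 1)
      \<le> K ^ (length \<gamma> - 2) * (real CARD('n) + 1) + (moment_const TYPE('n) r - real CARD('n) - 1) * K ^ (length \<gamma> - 2)"
    by (intro add_mono) simp_all
  from order_trans[OF gap_le[OF trans_le_add1[OF assms(3)]] this] show ?thesis by (simp add: algebra_simps)
qed

text \<open>A crude bound, linear in \<open>1 + M\<close>: it converts surplus factors
  \<open>gap_sup\<close> into powers of \<open>1 + M\<close>, whereas \<open>gap_graded\<close>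
  controls single coefficients by powers of \<open>K\<close>.\<close>

lemma gap_total:
  assumes "length \<gamma> \<le> r"
  shows "\<bar>gap \<gamma>\<bar> \<le> moment_const TYPE('n) r * (1 + M)"
proof -
  have "(\<integral>x. norm x ^ length \<gamma> \<partial>\<mu>) \<le> (\<integral>x. 1 + norm x ^ (r + 1) \<partial>\<mu>)"
  proof (rule integral_mono)
    show "integrable \<mu> (\<lambda>x. norm x ^ length \<gamma>)"
      using assms by (intro integrable_norm_power_le[OF sets_M M.finite_measure_axioms moment]) simp
    show "integrable \<mu> (\<lambda>x. 1 + norm x ^ (r + 1))" using moment by simp
    fix x :: "real^'n"
    show "norm x ^ length \<gamma> \<le> 1 + norm x ^ (r + 1)"
    proof (cases "norm x \<le> 1")
      case True
      then have "norm x ^ length \<gamma> \<le> 1" by (intro power_le_one) auto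
      then show ?thesis using zero_le_power[OF norm_ge_zero, of x "r + 1"] by linarith
    next
      case False
      then show ?thesis using power_increasing[of "length \<gamma>" "r + 1" "norm x"] assms by simp
    qed
  qed
  also have "\<dots> = 1 + M" using moment by (simp add: M_def M.prob_space)
  finally have "\<bar>gap \<gamma>\<bar> \<le> moment_const TYPE('n) r + M"
    using gap_le[of \<gamma>] assms by simp
  also have "\<dots> \<le> moment_const TYPE('n) r + moment_const TYPE('n) r * M" using moment_const_ge[where ?'n = 'n, of r] M_nonneg by (simp add: mult_le_cancel_right1)
  finally show ?thesis by (simp add: distrib_left)
qed

lemma gap_le_sup: "length \<gamma> \<le> r \<Longrightarrow> \<bar>gap \<gamma>\<bar> \<le> gap_sup"
  unfolding gap_sup_def by (intro cSUP_upper bdd_above_finite) auto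

lemma gap_sup_nonneg: "0 \<le> gap_sup"
  using gap_le_sup[of "[]"] by simp

lemma gap_sup_le: "gap_sup \<le> moment_const TYPE('n) r * (1 + M)"
  unfolding gap_sup_def using gap_total by (intro cSUP_least) (auto intro: exI[of _ "[]"])

lemma c1_graded:
  assumes "1 \<le> K" "M \<le> K ^ (r - 1)" "length \<gamma> \<le> r"
  shows "\<bar>c1_coeff gap \<gamma>\<bar> \<le> (real r + 1) * moment_const TYPE('n) r * K ^ (length \<gamma> - 2)"
proof -
  have A0: "0 \<le> moment_const TYPE('n) r" using moment_const_ge[where ?'n = 'n, of r] by linarith
  have "\<bar>c1_coeff gap \<gamma>\<bar> \<le> (real (length \<gamma>) + 1) * (moment_const TYPE('n) r * K ^ (length \<gamma> - 2))"
  proof (rule c1_coeff_bound)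
    fix k assume k: "k \<le> length \<gamma>"
    then have "\<bar>gap (take k \<gamma>)\<bar> \<le> moment_const TYPE('n) r * K ^ (k - 2)"
      using gap_graded[OF assms(1,2), of "take k \<gamma>"] assms(3) by (simp add: min_absorb1)
    also have "\<dots> \<le> moment_const TYPE('n) r * K ^ (length \<gamma> - 2)"
      using k A0 assms(1) by (intro mult_left_mono power_increasing) auto
    finally show "\<bar>gap (take k \<gamma>)\<bar> \<le> moment_const TYPE('n) r * K ^ (length \<gamma> - 2)" .
  qed
  also have "\<dots> \<le> (real r + 1) * (moment_const TYPE('n) r * K ^ (length \<gamma> - 2))"
    using assms A0 by (intro mult_right_mono) auto
  finally show ?thesis by (simp add: mult.assoc)
qed

lemma c1_sup:
  assumes "length \<gamma> \<le> r"
  shows "\<bar>c1_coeff gap \<gamma>\<bar> \<le> (real r + 1) * gap_sup"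
proof -
  have "\<bar>c1_coeff gap \<gamma>\<bar> \<le> (real (length \<gamma>) + 1) * gap_sup"
    using assms by (intro c1_coeff_bound gap_le_sup) auto
  also have "\<dots> \<le> (real r + 1) * gap_sup" using assms gap_sup_nonneg by (intro mult_right_mono) auto
  finally show ?thesis .
qed

lemma c1_0: "length \<gamma> < 3 \<Longrightarrow> c1_coeff gap \<gamma> = 0"
  by (rule c1_coeff_eq_0[OF gap0])

lemma n\<sigma>: "real n * \<sigma>\<^sup>2 = 1" "\<sigma> * sqrt (real n) = 1" "1 \<le> sqrt (real n)"
  using n by (simp_all add: \<sigma>n power_divide)

lemma sum_index_bound:
  assumes "\<And>\<gamma> :: 'n list. length \<gamma> \<le> r \<Longrightarrow> g \<gamma> \<le> b"
  shows "(\<Sum>\<gamma> | length \<gamma> \<le> r. g \<gamma>) \<le> index_count TYPE('n) r * b"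
  using sum_bounded_above[of "{\<gamma> :: 'n list. length \<gamma> \<le> r}" g b] assms by (simp add: index_count_def)

text \<open>With \<open>K = sqrt n\<close> a coefficient of a word of length \<open>t\<close> has
  size \<open>\<sigma> ^ t * K ^ (t - 2) = \<sigma>\<^sup>2\<close>, so \<open>C\<close> is of size
  \<open>1 / n\<close>. The assumption on \<open>M\<close> is \<open>M \<le> K ^ (r - 1)\<close> for
  this \<open>K\<close>.\<close>

lemma umass_small:
  assumes "M \<le> sqrt (real n) ^ (r - 1)"
  shows "real n * umass \<le> index_count TYPE('n) r * ((real r + 1) * moment_const TYPE('n) r)"
proof -
  let ?B = "(real r + 1) * moment_const TYPE('n) r"
  have A0: "0 \<le> moment_const TYPE('n) r" using moment_const_ge[where ?'n = 'n, of r] by linarith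
  have "umass \<le> index_count TYPE('n) r * (?B * \<sigma>\<^sup>2)"
    unfolding umass_def
  proof (rule sum_index_bound)
    fix \<gamma> :: "'n list" assume \<gamma>: "length \<gamma> \<le> r"
    show "\<bar>u \<gamma>\<bar> \<le> ?B * \<sigma>\<^sup>2"
    proof (cases "length \<gamma> < 3")
      case True
      then show ?thesis using A0 by (simp add: u_def c1_0)
    next
      case False
      then obtain t where t: "length \<gamma> = t + 2" by (metis add.commute le_Suc_ex less_or_eq_imp_le not_less_eq numeral_2_eq_2 numeral_3_eq_3 not_le)
      have "\<bar>u \<gamma>\<bar> \<le> \<sigma> ^ length \<gamma> * (?B * sqrt (real n) ^ (length \<gamma> - 2))"
        unfolding u_def abs_mult
      proof (rule mult_mono)
        show "\<bar>c1_coeff gap \<gamma>\<bar> \<le> ?B * sqrt (real n) ^ (length \<gamma> - 2)"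
          by (rule c1_graded[OF n\<sigma>(3) assms \<gamma>])
      qed (use \<sigma> in auto)
      also have "\<dots> = ?B * \<sigma>\<^sup>2 * (\<sigma> * sqrt (real n)) ^ t"
        by (simp only: t power_add power_mult_distrib add_diff_cancel_right' mult_ac)
      finally show ?thesis by (simp add: n\<sigma>)
    qed
  qed
  then have "real n * umass \<le> real n * (index_count TYPE('n) r * (?B * \<sigma>\<^sup>2))" by (intro mult_left_mono) auto
  also have "\<dots> = index_count TYPE('n) r * ?B * (real n * \<sigma>\<^sup>2)" by (simp only: mult_ac)
  finally show ?thesis by (simp add: n\<sigma> mult.assoc)
qed

text \<open>The shortest surviving words have length 3, so \<open>\<sigma> ^ 3\<close> bounds all
  scale factors, and the moment gap is retained.\<close>

lemma umass_sup: "umass \<le> index_count TYPE('n) r * (real r + 1) * (\<sigma> ^ 3 * gap_sup)"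
proof -
  have "umass \<le> index_count TYPE('n) r * ((real r + 1) * (\<sigma> ^ 3 * gap_sup))"
    unfolding umass_def
  proof (rule sum_index_bound)
    fix \<gamma> :: "'n list" assume \<gamma>: "length \<gamma> \<le> r"
    show "\<bar>u \<gamma>\<bar> \<le> (real r + 1) * (\<sigma> ^ 3 * gap_sup)"
    proof (cases "length \<gamma> < 3")
      case True
      then show ?thesis using gap_sup_nonneg \<sigma> by (simp add: u_def c1_0)
    next
      case False
      have "\<bar>u \<gamma>\<bar> \<le> \<sigma> ^ 3 * ((real r + 1) * gap_sup)"
        unfolding u_def abs_mult
      proof (rule mult_mono)
        show "\<bar>\<sigma> ^ length \<gamma>\<bar> \<le> \<sigma> ^ 3" using False \<sigma> by (simp add: power_decreasing)
      qed (use c1_sup[OF \<gamma>] \<sigma> in auto)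
      then show ?thesis by (simp only: mult_ac)
    qed
  qed
  then show ?thesis by (simp only: mult.assoc)
qed

lemma step_const_le:
  "step_const \<le> real CARD('n) ^ (r + 1) * (moment_const TYPE('n) r + index_count TYPE('n) r * ((real r + 1) * moment_const TYPE('n) r) + 1) * (1 + M)"
proof -
  have A: "1 \<le> moment_const TYPE('n) r" by (rule moment_const_ge)
  have "(\<Sum>\<gamma> :: 'n list | length \<gamma> \<le> r. \<bar>c1_coeff gap \<gamma>\<bar>) \<le> index_count TYPE('n) r * ((real r + 1) * (moment_const TYPE('n) r * (1 + M)))"
  proof (rule sum_index_bound)
    fix \<gamma> :: "'n list" assume \<gamma>: "length \<gamma> \<le> r"
    have "(real r + 1) * gap_sup \<le> (real r + 1) * (moment_const TYPE('n) r * (1 + M))" using gap_sup_le by (intro mult_left_mono) auto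
    then show "\<bar>c1_coeff gap \<gamma>\<bar> \<le> (real r + 1) * (moment_const TYPE('n) r * (1 + M))" using c1_sup[OF \<gamma>] by linarith
  qed
  moreover have "(\<integral>y. norm y ^ (r + 1) \<partial>(std_gaussian :: (real^'n) measure)) \<le> moment_const TYPE('n) r * (1 + M)"
  proof -
    have "(\<integral>y. norm y ^ (r + 1) \<partial>(std_gaussian :: (real^'n) measure)) \<le> moment_const TYPE('n) r" using gaussian_moment_le[of "r + 1" r, where ?'n = 'n] by simp
    also have "moment_const TYPE('n) r * 1 \<le> moment_const TYPE('n) r * (1 + M)" using A M_nonneg by (intro mult_left_mono) auto
    finally show ?thesis by simp
  qed
  ultimately have "M + (\<integral>y. norm y ^ (r + 1) \<partial>(std_gaussian :: (real^'n) measure))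
      + (\<Sum>\<gamma> :: 'n list | length \<gamma> \<le> r. \<bar>c1_coeff gap \<gamma>\<bar>)
      \<le> (1 + M) + moment_const TYPE('n) r * (1 + M) + index_count TYPE('n) r * ((real r + 1) * (moment_const TYPE('n) r * (1 + M)))" by linarith
  also have "\<dots> = (moment_const TYPE('n) r + index_count TYPE('n) r * ((real r + 1) * moment_const TYPE('n) r) + 1) * (1 + M)" by (simp add: algebra_simps)
  finally have "real CARD('n) ^ (r + 1) * (M + (\<integral>y. norm y ^ (r + 1) \<partial>(std_gaussian :: (real^'n) measure))
      + (\<Sum>\<gamma> :: 'n list | length \<gamma> \<le> r. \<bar>c1_coeff gap \<gamma>\<bar>))
      \<le> real CARD('n) ^ (r + 1) * ((moment_const TYPE('n) r + index_count TYPE('n) r * ((real r + 1) * moment_const TYPE('n) r) + 1) * (1 + M))"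
    by (intro mult_left_mono) auto
  then show ?thesis unfolding step_const_def M_def[symmetric] by (simp only: mult.assoc)
qed

abbreviation "m1 \<equiv> (1 + M) ^ max q 1"

lemma m1_ge: "1 \<le> m1" "1 + M \<le> m1" "i \<le> q \<Longrightarrow> (1 + M) ^ i \<le> m1"
proof -
  show "1 \<le> m1" using M_nonneg by (intro one_le_power) simp
  show "1 + M \<le> m1" using M_nonneg power_increasing[of 1 "max q 1" "1 + M"] by simp
  show "(1 + M) ^ i \<le> m1" if "i \<le> q" using M_nonneg that by (intro power_increasing) auto
qed

abbreviation "rhs \<equiv> m1 * (gap_sup * \<sigma> ^ (q + 1) + \<sigma> ^ (r - 1))"

lemma rhs_ge: "m1 * (gap_sup * \<sigma> ^ (q + 1)) \<le> rhs" "m1 * \<sigma> ^ (r - 1) \<le> rhs" "0 \<le> rhs"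
  using m1_ge(1) gap_sup_nonneg \<sigma> by (auto intro!: mult_left_mono mult_nonneg_nonneg add_nonneg_nonneg)

text \<open>By \<open>n * \<sigma>\<^sup>2 = 1\<close>, the \<open>n\<close> one-step remainders
  have order \<open>\<sigma> ^ (r - 1)\<close> and \<open>(n * \<sigma> ^ 3) ^ (q + 1)\<close> is
  \<open>\<sigma> ^ (q + 1)\<close>. Of the \<open>q + 1\<close> moment gaps one is kept; the
  others, bounded by multiples of \<open>1 + M\<close>, produce the power \<open>m1\<close>.\<close>

lemma step_error_le:
  assumes "M \<le> sqrt (real n) ^ (r - 1)"
  defines "a \<equiv> index_count TYPE('n) r * ((real r + 1) * moment_const TYPE('n) r)"
  shows "real n * step_error n \<le> step_error_const TYPE('n) r q a * rhs"
proof -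
  let ?k = "\<Sum>i\<le>q. (real n * umass) ^ i" and ?b = "real CARD('n) ^ (r + 1) * (moment_const TYPE('n) r + a + 1)"
  let ?e = "index_count TYPE('n) r * (real r + 1)"
  have A: "1 \<le> moment_const TYPE('n) r" by (rule moment_const_ge)
  have a0: "0 \<le> a" using A c_nonneg by (simp add: a_def)
  have k: "?k \<le> (\<Sum>i\<le>q. a ^ i)"
    using umass_small[OF assms(1)] umass_nonneg unfolding a_def by (intro sum_mono power_mono) auto
  have b: "step_const \<le> ?b * (1 + M)" unfolding a_def by (rule step_const_le)
  have n\<sigma>r: "real n * \<sigma> ^ (r + 1) = \<sigma> ^ (r - 1)"
  proof -
    have "\<sigma> ^ (r + 1) = \<sigma>\<^sup>2 * \<sigma> ^ (r - 1)" using r by (simp flip: power_add)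
    then show ?thesis using n\<sigma>(1) by (simp flip: mult.assoc)
  qed
  have "real n * (?k * \<sigma> ^ (r + 1) * step_const) = \<sigma> ^ (r - 1) * (?k * step_const)"
    unfolding n\<sigma>r[symmetric] by (simp only: mult_ac)
  also have "\<dots> \<le> \<sigma> ^ (r - 1) * ((\<Sum>i\<le>q. a ^ i) * (?b * (1 + M)))"
    using \<sigma> k b a0 step_const_nonneg by (intro mult_left_mono mult_mono) (auto intro!: sum_nonneg)
  also have "\<dots> \<le> \<sigma> ^ (r - 1) * ((\<Sum>i\<le>q. a ^ i) * (?b * m1))"
    using \<sigma> a0 A m1_ge(2) by (intro mult_left_mono) (auto intro!: sum_nonneg)
  also have "\<dots> = (\<Sum>i\<le>q. a ^ i) * ?b * (m1 * \<sigma> ^ (r - 1))" by (simp only: mult_ac)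
  also have "\<dots> \<le> (\<Sum>i\<le>q. a ^ i) * ?b * rhs"
    using a0 A by (intro mult_left_mono rhs_ge) (auto intro!: sum_nonneg mult_nonneg_nonneg)
  finally have 1: "real n * (?k * \<sigma> ^ (r + 1) * step_const) \<le> (\<Sum>i\<le>q. a ^ i) * ?b * rhs" .
  have "umass ^ (q + 1) \<le> (?e * (\<sigma> ^ 3 * gap_sup)) ^ (q + 1)"
    by (intro power_mono umass_sup umass_nonneg)
  also have "\<dots> = ?e ^ (q + 1) * (\<sigma> ^ 3) ^ (q + 1) * gap_sup * gap_sup ^ q"
    by (simp add: power_mult_distrib mult_ac)
  also have "\<dots> \<le> ?e ^ (q + 1) * (\<sigma> ^ 3) ^ (q + 1) * gap_sup * (moment_const TYPE('n) r * (1 + M)) ^ q"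
    using gap_sup_le gap_sup_nonneg \<sigma> c_nonneg by (intro mult_left_mono power_mono) auto
  also have "\<dots> \<le> ?e ^ (q + 1) * (\<sigma> ^ 3) ^ (q + 1) * gap_sup * (moment_const TYPE('n) r ^ q * m1)"
    unfolding power_mult_distrib[of "moment_const TYPE('n) r"] using gap_sup_nonneg \<sigma> c_nonneg A m1_ge(3)[of q] by (intro mult_left_mono) auto
  finally have um: "umass ^ (q + 1) \<le> ?e ^ (q + 1) * (\<sigma> ^ 3) ^ (q + 1) * gap_sup * (moment_const TYPE('n) r ^ q * m1)" .
  have "real n * (real n ^ q * umass ^ (q + 1)) = real n ^ (q + 1) * umass ^ (q + 1)" by simp
  also have "\<dots> \<le> real n ^ (q + 1) * (?e ^ (q + 1) * (\<sigma> ^ 3) ^ (q + 1) * gap_sup * (moment_const TYPE('n) r ^ q * m1))"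
    by (intro mult_left_mono um) simp
  also have "\<dots> = ?e ^ (q + 1) * moment_const TYPE('n) r ^ q * (m1 * (gap_sup * (real n * \<sigma> ^ 3) ^ (q + 1)))"
    by (simp only: power_mult_distrib mult_ac)
  also have "real n * \<sigma> ^ 3 = \<sigma>" using n\<sigma>(1) by (simp add: power3_eq_cube power2_eq_square flip: mult.assoc)
  also have "?e ^ (q + 1) * moment_const TYPE('n) r ^ q * (m1 * (gap_sup * \<sigma> ^ (q + 1))) \<le> ?e ^ (q + 1) * moment_const TYPE('n) r ^ q * rhs"
    using c_nonneg A by (intro mult_left_mono rhs_ge) auto
  finally have 2: "real n * (real n ^ q * umass ^ (q + 1)) \<le> ?e ^ (q + 1) * moment_const TYPE('n) r ^ q * rhs" .
  show ?thesis
    unfolding step_error_def step_error_const_def distrib_left[of "real n"]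
    unfolding distrib_right[of _ _ rhs] using 1 2 by (rule add_mono)
qed

text \<open>Terms outside the density have \<open>t > q + 2 * p\<close>, hence
  \<open>n ^ p * \<sigma> ^ t \<le> \<sigma> ^ (q + 1)\<close>; since \<open>i \<ge> 1\<close>, each
  contains a moment gap that can be kept.\<close>

lemma rearrange_bound:
  assumes f: "bounded_borel 1 f"
  shows "\<bar>edge n (hermite_jet 1 f) [] 0 - edgeworth_value gap n r (hermite_moment f)\<bar> \<le> rearrange_const TYPE('n) r q * rhs"
proof -
  let ?H = "hermite_mass TYPE('n) (q * r)"
  let ?B = "(real (q * r) + 1) * (real r + 1)"
  let ?S = "\<lambda>i t. \<Sum>\<gamma> | length \<gamma> = t. truncated_coeff r gap i \<gamma> * hermite_moment f \<gamma>"
  let ?T = "\<lambda>i p. {t. t \<le> i * r \<and> q + 2 * p < t}"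
  let ?R = "m1 * (gap_sup * \<sigma> ^ (q + 1))"
  have A: "1 \<le> moment_const TYPE('n) r" by (rule moment_const_ge)
  have H0: "0 \<le> ?H" by (rule hermite_mass_nonneg)
  have tc: "\<bar>truncated_coeff r gap i \<gamma>\<bar> \<le> ?B ^ i * moment_const TYPE('n) r ^ q * (gap_sup * m1)"
    if i: "1 \<le> i" "i \<le> q" "length \<gamma> \<le> q * r" for i \<gamma>
  proof -
    obtain j where j: "i = Suc j" using i(1) by (cases i) auto
    have "\<bar>truncated_coeff r gap i \<gamma>\<bar> \<le> ((real (q * r) + 1) * ((real r + 1) * gap_sup)) ^ i"
      unfolding truncated_coeff_def using c1_sup gap_sup_nonneg that(3) by (intro concat_power_bound) auto
    also have "\<dots> = ?B ^ i * (gap_sup * gap_sup ^ j)" by (simp only: power_mult_distrib mult_ac j power_Suc)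
    also have "\<dots> \<le> ?B ^ i * (gap_sup * (moment_const TYPE('n) r * (1 + M)) ^ j)"
      using gap_sup_le gap_sup_nonneg by (intro mult_left_mono power_mono) auto
    also have "\<dots> \<le> ?B ^ i * (gap_sup * (moment_const TYPE('n) r ^ q * m1))"
      unfolding power_mult_distrib[of "moment_const TYPE('n) r"]
      using gap_sup_nonneg A m1_ge(3)[of j] M_nonneg that(2) j
      by (intro mult_left_mono mult_mono power_increasing) auto
    finally show ?thesis by (simp only: mult_ac)
  qed
  have eq: "edge n (hermite_jet 1 f) [] 0 - edgeworth_value gap n r (hermite_moment f)
      = (\<Sum>i=1..q. \<Sum>p\<le>i. \<Sum>t\<in>?T i p. a_coeff i p * real n ^ p * \<sigma> ^ t * ?S i t)"
    unfolding edge_hermite truncated_coeff_def[symmetric] hermite_moment_def[symmetric]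
    by (rule edgeworth_rearrange[OF gap0 n \<sigma>n q])
  have "\<bar>edge n (hermite_jet 1 f) [] 0 - edgeworth_value gap n r (hermite_moment f)\<bar>
      \<le> (\<Sum>i=1..q. \<Sum>p\<le>i. \<Sum>t\<in>?T i p. \<bar>a_coeff i p\<bar> *
        (real (card {\<gamma> :: 'n list. length \<gamma> = t}) * (?B ^ i * moment_const TYPE('n) r ^ q * ?H)) * ?R)"
    unfolding eq
  proof (intro order_trans[OF sum_abs] sum_mono)
    fix i p t assume i: "i \<in> {1..q}" and p: "p \<in> {..i}" and t: "t \<in> ?T i p"
    have "i * r \<le> q * r" using i by (intro mult_le_mono1) simp
    then have tqr: "t \<le> q * r" using t by (blast intro: le_trans)
    have "\<bar>?S i t\<bar> \<le> (\<Sum>\<gamma> :: 'n list | length \<gamma> = t. (?B ^ i * moment_const TYPE('n) r ^ q * (gap_sup * m1)) * ?H)"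
    proof (intro order_trans[OF sum_abs] sum_mono)
      fix \<gamma> :: "'n list" assume "\<gamma> \<in> {\<gamma>. length \<gamma> = t}"
      then have \<gamma>: "length \<gamma> \<le> q * r" using tqr by simp
      show "\<bar>truncated_coeff r gap i \<gamma> * hermite_moment f \<gamma>\<bar> \<le> (?B ^ i * moment_const TYPE('n) r ^ q * (gap_sup * m1)) * ?H"
        unfolding abs_mult
      proof (rule mult_mono)
        show t1: "\<bar>truncated_coeff r gap i \<gamma>\<bar> \<le> ?B ^ i * moment_const TYPE('n) r ^ q * (gap_sup * m1)" using i \<gamma> by (intro tc) auto
        show "\<bar>hermite_moment f \<gamma>\<bar> \<le> ?H" by (rule hermite_moment_bound[OF f \<gamma>])
        show "0 \<le> ?B ^ i * moment_const TYPE('n) r ^ q * (gap_sup * m1)" using t1 by linarith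
      qed simp
    qed
    also have "\<dots> = real (card {\<gamma> :: 'n list. length \<gamma> = t}) * (?B ^ i * moment_const TYPE('n) r ^ q * ?H) * (gap_sup * m1)"
      by (simp only: sum_constant mult_ac)
    finally have S: "\<bar>?S i t\<bar> \<le> real (card {\<gamma> :: 'n list. length \<gamma> = t}) * (?B ^ i * moment_const TYPE('n) r ^ q * ?H) * (gap_sup * m1)" .
    have "real n ^ p * \<sigma> ^ t = (real n * \<sigma>\<^sup>2) ^ p * \<sigma> ^ (t - 2 * p)"
    proof -
      have "t = 2 * p + (t - 2 * p)" using t by auto
      then have "\<sigma> ^ t = (\<sigma>\<^sup>2) ^ p * \<sigma> ^ (t - 2 * p)" by (metis power_add power_mult)
      then show ?thesis by (simp only: power_mult_distrib mult.assoc)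
    qed
    also have "\<dots> \<le> \<sigma> ^ (q + 1)" unfolding n\<sigma>(1) power_one mult_1 using t \<sigma> by (intro power_decreasing) auto
    finally have ns: "real n ^ p * \<sigma> ^ t \<le> \<sigma> ^ (q + 1)" .
    have "\<bar>a_coeff i p * real n ^ p * \<sigma> ^ t * ?S i t\<bar> = \<bar>a_coeff i p\<bar> * (real n ^ p * \<sigma> ^ t) * \<bar>?S i t\<bar>"
      using \<sigma> by (simp add: abs_mult)
    also have "\<dots> \<le> \<bar>a_coeff i p\<bar> * \<sigma> ^ (q + 1) * (real (card {\<gamma> :: 'n list. length \<gamma> = t}) * (?B ^ i * moment_const TYPE('n) r ^ q * ?H) * (gap_sup * m1))"
      using S ns \<sigma> by (intro mult_mono mult_left_mono) auto
    also have "\<dots> = \<bar>a_coeff i p\<bar> * (real (card {\<gamma> :: 'n list. length \<gamma> = t}) * (?B ^ i * moment_const TYPE('n) r ^ q * ?H)) * ?R"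
      by (simp only: mult_ac)
    finally show "\<bar>a_coeff i p * real n ^ p * \<sigma> ^ t * ?S i t\<bar>
        \<le> \<bar>a_coeff i p\<bar> * (real (card {\<gamma> :: 'n list. length \<gamma> = t}) * (?B ^ i * moment_const TYPE('n) r ^ q * ?H)) * ?R" .
  qed
  also have "\<dots> = rearrange_const TYPE('n) r q * ?R"
    unfolding rearrange_const_def by (simp only: sum_distrib_right)
  also have "\<dots> \<le> rearrange_const TYPE('n) r q * rhs"
  proof (rule mult_left_mono[OF rhs_ge(1)])
    show "0 \<le> rearrange_const TYPE('n) r q"
      unfolding rearrange_const_def using A H0 by (intro sum_nonneg mult_nonneg_nonneg) auto
  qed
  finally show ?thesis .
qed

text \<open>The term of order \<open>m\<close> has coefficients of size \<open>K ^ m\<close> and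
  contributes \<open>(\<sigma> * K) ^ m\<close>; as \<open>\<sigma> * K \<ge> 1\<close> and
  \<open>m \<le> r div 3 \<le> r - 1\<close>, the power \<open>r - 1\<close> dominates them
  all.\<close>

lemma edgeworth_value_bound:
  assumes f: "bounded_borel 1 f" and K: "1 \<le> K" "M \<le> K ^ (r - 1)" "1 \<le> \<sigma> * K"
  shows "\<bar>edgeworth_value gap n r (hermite_moment f)\<bar>
    \<le> edgeworth_const TYPE('n) r ((real r + 1) * ((real r + 1) * moment_const TYPE('n) r)) (hermite_mass TYPE('n) r) * (\<sigma> * K) ^ (r - 1)"
proof -
  let ?H = "hermite_mass TYPE('n) r" and ?B = "(real r + 1) * ((real r + 1) * moment_const TYPE('n) r)" and ?l = "(\<sigma> * K) ^ (r - 1)"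
  let ?T = "\<lambda>m. {t. max 3 m \<le> t \<and> t \<le> 3 * m \<and> even (t - m)}"
  let ?I = "\<lambda>m t. {max 1 ((t - m) div 2)..t div 3}"
  let ?c = "\<lambda>t. real (card {\<gamma> :: 'n list. length \<gamma> = t})"
  have A: "1 \<le> moment_const TYPE('n) r" by (rule moment_const_ge)
  have H0: "0 \<le> ?H" by (rule hermite_mass_nonneg)
  have l1: "1 \<le> ?l" by (rule one_le_power[OF K(3)])
  have inner: "1 / real n powr (real m / 2) *
      \<bar>\<Sum>t\<in>?T m. \<Sum>i\<in>?I m t. a_coeff i ((t - m) div 2) * (\<Sum>\<gamma> | length \<gamma> = t. c_coeff gap i \<gamma> * hermite_moment f \<gamma>)\<bar>
      \<le> (\<Sum>t\<in>?T m. \<Sum>i\<in>?I m t. \<bar>a_coeff i ((t - m) div 2)\<bar> * (?c t * ?B ^ i)) * (?H * ?l)"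
    if m: "m \<in> {1..r div 3}" for m
  proof -
    have pm: "1 / real n powr (real m / 2) = \<sigma> ^ m"
      unfolding \<sigma>n by (rule inverse_powr_half[OF n])
    have "\<sigma> ^ m * \<bar>\<Sum>t\<in>?T m. \<Sum>i\<in>?I m t. a_coeff i ((t - m) div 2) * (\<Sum>\<gamma> | length \<gamma> = t. c_coeff gap i \<gamma> * hermite_moment f \<gamma>)\<bar>
        \<le> \<sigma> ^ m * (\<Sum>t\<in>?T m. \<Sum>i\<in>?I m t. \<bar>a_coeff i ((t - m) div 2)\<bar> * (?c t * ?B ^ i) * (K ^ m * ?H))"
    proof (intro mult_left_mono order_trans[OF sum_abs] sum_mono)
      fix t i assume t: "t \<in> ?T m" and i: "i \<in> ?I m t"
      have tr: "t \<le> r" using t m by auto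
      obtain j where j: "i = Suc j" using i by (cases i) auto
      have "\<bar>\<Sum>\<gamma> | length \<gamma> = t. c_coeff gap i \<gamma> * hermite_moment f \<gamma>\<bar> \<le> (\<Sum>\<gamma> :: 'n list | length \<gamma> = t. ?B ^ i * K ^ m * ?H)"
      proof (intro order_trans[OF sum_abs] sum_mono)
        fix \<gamma> :: "'n list" assume "\<gamma> \<in> {\<gamma>. length \<gamma> = t}"
        then have \<gamma>: "length \<gamma> = t" "length \<gamma> \<le> r" using tr by auto
        have "\<bar>c_coeff gap i \<gamma>\<bar> \<le> ?B ^ i * K ^ (length \<gamma> - 2 * i)"
          unfolding j c_coeff_eq_concat_power
          using c1_0 c1_graded[OF K(1,2)] A K(1) \<gamma>(2) by (intro concat_power_bound_graded) auto
        also have "\<dots> \<le> ?B ^ i * K ^ m"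
        \<comment> \<open>From \<open>t = m + 2 * p\<close> and \<open>p \<le> i\<close> the
          exponent \<open>t - 2 * i\<close> is at most \<open>m\<close>.\<close>
        proof (intro mult_left_mono power_increasing K(1))
          obtain p where "t - m = 2 * p" using t by blast
          then show "length \<gamma> - 2 * i \<le> m" using i t \<gamma>(1) by auto
        qed (use A in auto)
        finally have c: "\<bar>c_coeff gap i \<gamma>\<bar> \<le> ?B ^ i * K ^ m" .
        show "\<bar>c_coeff gap i \<gamma> * hermite_moment f \<gamma>\<bar> \<le> ?B ^ i * K ^ m * ?H"
          unfolding abs_mult
        proof (rule mult_mono)
          show "0 \<le> ?B ^ i * K ^ m" using c by linarith
        qed (use c hermite_moment_bound[OF f \<gamma>(2)] in auto)
      qed
      also have "\<dots> = ?c t * ?B ^ i * (K ^ m * ?H)" by (simp only: sum_constant mult_ac)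
      finally show "\<bar>a_coeff i ((t - m) div 2) * (\<Sum>\<gamma> | length \<gamma> = t. c_coeff gap i \<gamma> * hermite_moment f \<gamma>)\<bar>
          \<le> \<bar>a_coeff i ((t - m) div 2)\<bar> * (?c t * ?B ^ i) * (K ^ m * ?H)"
        unfolding abs_mult mult.assoc[of "\<bar>a_coeff i ((t - m) div 2)\<bar>"] by (rule mult_left_mono) simp
    qed (use \<sigma> in auto)
    also have "\<dots> = (\<Sum>t\<in>?T m. \<Sum>i\<in>?I m t. \<bar>a_coeff i ((t - m) div 2)\<bar> * (?c t * ?B ^ i)) * (?H * (\<sigma> * K) ^ m)"
      unfolding power_mult_distrib sum_distrib_right[symmetric] by (simp only: mult_ac)
    also have "\<dots> \<le> (\<Sum>t\<in>?T m. \<Sum>i\<in>?I m t. \<bar>a_coeff i ((t - m) div 2)\<bar> * (?c t * ?B ^ i)) * (?H * ?l)"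
      using m r A H0 by (intro mult_left_mono power_increasing K(3)) (auto intro!: sum_nonneg mult_nonneg_nonneg)
    finally show ?thesis unfolding pm .
  qed
  have "\<bar>edgeworth_value gap n r (hermite_moment f)\<bar> \<le> \<bar>hermite_moment f []\<bar>
      + (\<Sum>m=1..r div 3. 1 / real n powr (real m / 2) *
        \<bar>\<Sum>t\<in>?T m. \<Sum>i\<in>?I m t. a_coeff i ((t - m) div 2) * (\<Sum>\<gamma> | length \<gamma> = t. c_coeff gap i \<gamma> * hermite_moment f \<gamma>)\<bar>)"
    unfolding edgeworth_value_def
    by (intro order_trans[OF abs_triangle_ineq] add_left_mono order_trans[OF sum_abs] sum_mono) (simp add: abs_mult)
  also have "\<dots> \<le> ?H * ?l
      + (\<Sum>m=1..r div 3. (\<Sum>t\<in>?T m. \<Sum>i\<in>?I m t. \<bar>a_coeff i ((t - m) div 2)\<bar> * (?c t * ?B ^ i)) * (?H * ?l))"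
  proof (intro add_mono sum_mono inner)
    have "\<bar>hermite_moment f []\<bar> \<le> ?H * 1" using hermite_moment_bound[OF f, of "[]" r] by simp
    also have "\<dots> \<le> ?H * ?l" by (intro mult_left_mono l1 H0)
    finally show "\<bar>hermite_moment f []\<bar> \<le> ?H * ?l" .
  qed
  also have "\<dots> = edgeworth_const TYPE('n) r ?B ?H * ?l"
    unfolding edgeworth_const_def sum_distrib_right[symmetric] by (simp only: distrib_left mult_1_right distrib_right mult_ac)
  finally show ?thesis .
qed

lemma mean_power_bound:
  assumes "bounded_borel 1 f"
  shows "\<bar>(P \<sigma> ^^ n) f 0\<bar> \<le> 1"
proof -
  have "bounded_borel (1 ^ n * 1) ((P \<sigma> ^^ n) f)"
    using op_bound_funpow[OF op_bound_P, of n] assms unfolding op_bound_def by blast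
  then show ?thesis by (simp add: bounded_borel_def)
qed

lemma main_regime:
  assumes f: "bounded_borel 1 f" and L: "L = (q + 1) * r + 4" "2 * L \<le> n" and M: "M \<le> sqrt (real n) ^ (r - 1)"
  shows "\<bar>(P \<sigma> ^^ n) f 0 - edgeworth_value gap n r (hermite_moment f)\<bar> \<le> main_const TYPE('n) r q L p I * rhs"
proof -
  define a where "a = index_count TYPE('n) r * ((real r + 1) * moment_const TYPE('n) r)"
  define H where "H = 2 ^ L * hermite_mass TYPE('n) L"
  define d where "d = max 1 (sqrt (4 * I * real L / p))"
  define \<kappa> where "\<kappa> = (\<Sum>i\<le>q. (real n * umass) ^ i)"
  define \<delta> where "\<delta> = (1 - p) ^ (n div (2 * L))"
  define E where "E = (2 * real L * (real (r - 1) / p)) ^ (r - 1) * exp p"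
  have H0: "0 \<le> H" using hermite_mass_nonneg[where ?'n = 'n] by (simp add: H_def)
  have d1: "1 \<le> d" by (simp add: d_def)
  have A: "1 \<le> moment_const TYPE('n) r" by (rule moment_const_ge)
  have a0: "0 \<le> a" using A c_nonneg by (simp add: a_def)
  have \<kappa>: "\<kappa> \<le> (\<Sum>i\<le>q. a ^ i)"
    using umass_small[OF M] umass_nonneg unfolding a_def \<kappa>_def by (intro sum_mono power_mono) auto
  have "\<bar>(P \<sigma> ^^ n) f 0 - edge n (hermite_jet 1 f) [] 0\<bar>
      \<le> real n * (((2 * d) ^ L + H) * step_error n) + 2 ^ L * \<delta> * (1 + \<kappa> * H)"
    unfolding \<delta>_def by (rule comparison[OF \<sigma>n L f d1 _ H_def \<kappa>_def]) (simp add: d_def)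
  moreover have "real n * (((2 * d) ^ L + H) * step_error n) \<le> ((2 * d) ^ L + H) * step_error_const TYPE('n) r q a * rhs"
  proof -
    have "((2 * d) ^ L + H) * (real n * step_error n) \<le> ((2 * d) ^ L + H) * (step_error_const TYPE('n) r q a * rhs)"
      using step_error_le[OF M] d1 H0 unfolding a_def by (intro mult_left_mono) auto
    then show ?thesis by (simp only: mult_ac)
  qed
  moreover have "2 ^ L * \<delta> * (1 + \<kappa> * H) \<le> 2 ^ L * E * (1 + (\<Sum>i\<le>q. a ^ i) * H) * rhs"
  proof -
    \<comment> \<open>Exponential decay in \<open>n\<close> absorbs any fixed power, here the one
      that makes the block error comparable with the second error term.\<close>
    have "\<delta> * sqrt (real n) ^ (r - 1) \<le> E"
      unfolding \<delta>_def E_def using p n L by (intro geometric_decay) auto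
    then have "\<delta> * sqrt (real n) ^ (r - 1) * \<sigma> ^ (r - 1) \<le> E * \<sigma> ^ (r - 1)"
      using \<sigma> by (intro mult_right_mono) auto
    moreover have "\<delta> * sqrt (real n) ^ (r - 1) * \<sigma> ^ (r - 1) = \<delta>"
      using n\<sigma>(2) by (simp add: mult.assoc mult.commute[of _ \<sigma>] flip: power_mult_distrib)
    ultimately have \<delta>: "\<delta> \<le> E * \<sigma> ^ (r - 1)" by (simp only:)
    have E0: "0 \<le> E" using p by (simp add: E_def)
    have "\<sigma> ^ (r - 1) \<le> rhs" using rhs_ge(2) m1_ge(1) \<sigma> by (smt (verit) mult_le_cancel_right1 zero_le_power)
    then have "E * \<sigma> ^ (r - 1) \<le> E * rhs" using E0 by (rule mult_left_mono)
    then have "\<delta> \<le> E * rhs" using \<delta> by linarith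
    moreover have "0 \<le> \<delta>" using p by (simp add: \<delta>_def)
    moreover have "0 \<le> \<kappa>" unfolding \<kappa>_def using umass_nonneg by (intro sum_nonneg) auto
    ultimately have "2 ^ L * \<delta> * (1 + \<kappa> * H) \<le> 2 ^ L * (E * rhs) * (1 + (\<Sum>i\<le>q. a ^ i) * H)"
      using \<kappa> H0 E0 rhs_ge(3) by (intro mult_mono add_mono mult_right_mono) auto
    then show ?thesis by (simp only: mult_ac)
  qed
  moreover have "main_const TYPE('n) r q L p I * rhs = ((2 * d) ^ L + H) * step_error_const TYPE('n) r q a * rhs
      + 2 ^ L * E * (1 + (\<Sum>i\<le>q. a ^ i) * H) * rhs + rearrange_const TYPE('n) r q * rhs"
    by (simp only: main_const_def Let_def a_def H_def d_def E_def distrib_right)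
  ultimately show ?thesis using rearrange_bound[OF f] by linarith
qed

text \<open>Both quantities are bounded separately: the expectation of \<open>f\<close> by 1, the
  Edgeworth functional by a multiple of \<open>(\<sigma> * K) ^ (r - 1)\<close>, with
  \<open>K\<close> chosen such that \<open>\<sigma> * K \<ge> 1\<close> and
  \<open>M \<le> K ^ (r - 1)\<close>.\<close>

lemma trivial_regime:
  assumes f: "bounded_borel 1 f" and L: "L \<ge> 1" and nM: "n < 2 * L \<or> sqrt (real n) ^ (r - 1) < M"
  shows "\<bar>(P \<sigma> ^^ n) f 0 - edgeworth_value gap n r (hermite_moment f)\<bar> \<le> trivial_const TYPE('n) r L * rhs"
proof -
  define E where "E = edgeworth_const TYPE('n) r ((real r + 1) * ((real r + 1) * moment_const TYPE('n) r)) (hermite_mass TYPE('n) r)"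
  \<comment> \<open>Large moments make \<open>1 + M\<close> the maximum; for small \<open>n\<close>
    the other entry is bounded by a constant. In both cases \<open>\<sigma> ^ (r - 1) * X\<close> is
    controlled by the second error term.\<close>
  define X where "X = max (sqrt (real n) ^ (r - 1)) (1 + M)"
  define K where "K = root (r - 1) X"
  have X: "1 \<le> X" "sqrt (real n) ^ (r - 1) \<le> X" "M \<le> X"
    using M_nonneg by (auto simp: X_def le_max_iff_disj)
  have KX: "K ^ (r - 1) = X" unfolding K_def using r X by (intro real_root_pow_pos2) auto
  have K1: "1 \<le> K" unfolding K_def using X r by (subst real_root_ge_1_iff) auto
  have nK: "sqrt (real n) \<le> K"
    using X(2) K1 r unfolding KX[symmetric] by (subst (asm) power_mono_iff) auto
  have \<sigma>K: "1 \<le> \<sigma> * K" using mult_left_mono[OF nK, of \<sigma>] \<sigma> n\<sigma>(2) by simp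
  have A: "1 \<le> moment_const TYPE('n) r" by (rule moment_const_ge)
  have E0: "0 \<le> E"
    unfolding E_def edgeworth_const_def using A hermite_mass_nonneg
    by (intro mult_nonneg_nonneg add_nonneg_nonneg sum_nonneg) auto
  have l: "(\<sigma> * K) ^ (r - 1) = \<sigma> ^ (r - 1) * X" by (simp only: power_mult_distrib KX)
  have s2L: "1 \<le> sqrt (2 * real L) ^ (r - 1)" using L by (intro one_le_power) simp
  have sX: "\<sigma> ^ (r - 1) * X \<le> sqrt (2 * real L) ^ (r - 1) * (\<sigma> ^ (r - 1) * (1 + M))"
  proof (cases "sqrt (real n) ^ (r - 1) \<le> 1 + M")
    case True
    then have "1 * (\<sigma> ^ (r - 1) * X) \<le> sqrt (2 * real L) ^ (r - 1) * (\<sigma> ^ (r - 1) * (1 + M))"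
      using s2L \<sigma> M_nonneg by (intro mult_mono) (auto simp: X_def)
    then show ?thesis by simp
  next
    case False
    then have "n < 2 * L" using nM by auto
    then have "real n \<le> 2 * real L" by (metis less_imp_le of_nat_le_iff of_nat_mult of_nat_numeral)
    then have "sqrt (real n) ^ (r - 1) \<le> sqrt (2 * real L) ^ (r - 1)" by (intro power_mono) auto
    moreover have "X = sqrt (real n) ^ (r - 1)" using False by (simp add: X_def)
    ultimately have "\<sigma> ^ (r - 1) * X \<le> \<sigma> ^ (r - 1) * sqrt (2 * real L) ^ (r - 1)"
      using \<sigma> by (intro mult_left_mono) auto
    also have "\<dots> = sqrt (2 * real L) ^ (r - 1) * (\<sigma> ^ (r - 1) * 1)" by simp
    also have "\<dots> \<le> sqrt (2 * real L) ^ (r - 1) * (\<sigma> ^ (r - 1) * (1 + M))"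
      using \<sigma> M_nonneg s2L by (intro mult_left_mono) auto
    finally show ?thesis .
  qed
  have "\<sigma> ^ (r - 1) * (1 + M) \<le> m1 * \<sigma> ^ (r - 1)"
    using m1_ge(2) \<sigma> by (simp add: mult.commute)
  also have "\<dots> \<le> rhs" by (rule rhs_ge(2))
  finally have "sqrt (2 * real L) ^ (r - 1) * (\<sigma> ^ (r - 1) * (1 + M)) \<le> sqrt (2 * real L) ^ (r - 1) * rhs"
    using s2L by (intro mult_left_mono) auto
  then have lam: "(\<sigma> * K) ^ (r - 1) \<le> sqrt (2 * real L) ^ (r - 1) * rhs" unfolding l using sX by linarith
  have "\<bar>(P \<sigma> ^^ n) f 0 - edgeworth_value gap n r (hermite_moment f)\<bar> \<le> 1 + E * (\<sigma> * K) ^ (r - 1)"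
  proof -
    have "M \<le> K ^ (r - 1)" using X(3) by (simp only: KX)
    from mean_power_bound[OF f] edgeworth_value_bound[OF f K1 this \<sigma>K] show ?thesis
      unfolding E_def by linarith
  qed
  also have "\<dots> \<le> 1 * (\<sigma> * K) ^ (r - 1) + E * (\<sigma> * K) ^ (r - 1)"
    using one_le_power[OF \<sigma>K, of "r - 1"] by simp
  also have "\<dots> = (1 + E) * (\<sigma> * K) ^ (r - 1)" by (simp only: distrib_right)
  also have "\<dots> \<le> (1 + E) * (sqrt (2 * real L) ^ (r - 1) * rhs)"
    using E0 by (intro mult_left_mono lam) simp
  finally show ?thesis by (simp only: trivial_const_def E_def mult.assoc)
qed

end

section \<open>Standardized random vectors and the final estimate\<close>

lemma moments_standardized:
  fixes F :: "'w \<Rightarrow> real^'n"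
  assumes M: "prob_space M" and F [measurable]: "F \<in> borel_measurable M" and r: "r \<ge> 2"
    and moment: "integrable M (\<lambda>\<omega>. norm (F \<omega>) ^ (r + 1))"
    and mean: "(\<integral>\<omega>. F \<omega> \<partial>M) = 0" and cov: "covariance_matrix M F = mat 1"
  shows "length \<alpha> \<le> 2 \<Longrightarrow> (\<integral>\<omega>. mpower (F \<omega>) \<alpha> \<partial>M) = (\<integral>x. mpower x \<alpha> \<partial>std_gaussian)"
    and "(\<integral>\<omega>. (norm (F \<omega>))\<^sup>2 \<partial>M) = real CARD('n)"
proof -
  interpret prob_space M by fact
  interpret D: prob_space "distr M borel F" by (rule prob_space_distr[OF F])
  have moment': "integrable (distr M borel F) (\<lambda>x. norm x ^ (r + 1))"
    using moment by (simp add: integrable_distr_eq)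
  have int: "integrable M (\<lambda>\<omega>. mpower (F \<omega>) \<alpha>)" if "length \<alpha> \<le> r + 1" for \<alpha>
    using integrable_mpower[OF _ D.finite_measure_axioms moment' that] by (simp add: integrable_distr_eq)
  have "integrable (distr M borel F) (\<lambda>x. norm x ^ 1)"
    by (rule integrable_norm_power_le[OF _ D.finite_measure_axioms moment']) simp_all
  then have "integrable M F" by (simp add: integrable_distr_eq integrable_norm_iff)
  then have 1: "(\<integral>\<omega>. F \<omega> $ i \<partial>M) = 0" for i
    using integral_bounded_linear[OF bounded_linear_vec_nth, of M F i] mean by simp
  have 2: "(\<integral>\<omega>. F \<omega> $ i * F \<omega> $ j \<partial>M) = (if i = j then 1 else 0)" for i j
    using arg_cong[OF cov, of "\<lambda>A. A $ i $ j"] by (simp add: covariance_matrix_def 1 mat_def)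
  show "(\<integral>\<omega>. mpower (F \<omega>) \<alpha> \<partial>M) = (\<integral>x. mpower x \<alpha> \<partial>std_gaussian)" if \<alpha>: "length \<alpha> \<le> 2"
  proof -
    consider "\<alpha> = []" | i where "\<alpha> = [i]" | i j where "\<alpha> = [i, j]"
      using \<alpha> by (cases \<alpha> rule: remdups_adj.cases) auto
    moreover have "(\<integral>x. x $ i \<partial>(std_gaussian :: (real^'n) measure)) = 0" for i
      using gaussian_moment_1[of i] by simp
    moreover have "(\<integral>x. x $ i * x $ j \<partial>(std_gaussian :: (real^'n) measure)) = (if i = j then 1 else 0)" for i j
      using gaussian_moment_2[of i j] by simp
    ultimately show ?thesis
      by cases (simp_all only: mpower_simps mult_1_right 1 2 lebesgue_integral_const scaleR_one
          prob_space std_gaussian.prob_space)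
  qed
  have "(\<integral>\<omega>. (norm (F \<omega>))\<^sup>2 \<partial>M) = (\<integral>\<omega>. (\<Sum>i\<in>UNIV. F \<omega> $ i * F \<omega> $ i) \<partial>M)"
    by (simp only: norm_vec_power2 power2_eq_square[of "F _ $ _"])
  also have "\<dots> = (\<Sum>i\<in>UNIV. \<integral>\<omega>. F \<omega> $ i * F \<omega> $ i \<partial>M)"
    using int[of "[i, i]" for i] r by (intro Bochner_Integration.integral_sum) simp
  finally show "(\<integral>\<omega>. (norm (F \<omega>))\<^sup>2 \<partial>M) = real CARD('n)" by (simp add: 2)
qed

lemma edgeworth_normalizedI:
  fixes F :: "'w \<Rightarrow> real^'n"
  assumes M: "prob_space M" and F [measurable]: "F \<in> borel_measurable M"
    and F_moment: "integrable M (\<lambda>\<omega>. norm (F \<omega>) ^ (r + 1))"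
    and mean: "(\<integral>\<omega>. F \<omega> \<partial>M) = 0" and cov: "covariance_matrix M F = mat 1"
    and minor: "minorized_law (distr M borel F) \<nu> s I p" and r: "r \<ge> 2" and n: "n \<ge> 1"
  shows "edgeworth_normalized (distr M borel F) \<nu> s I p r (r div 3) (1 / sqrt (real n)) n"
proof -
  interpret minorized_law "distr M borel F" \<nu> s I p by fact
  interpret edgeworth_law "distr M borel F" \<nu> s I p r "r div 3" "1 / sqrt (real n)"
    using F_moment n by unfold_locales (simp_all add: integrable_distr_eq)
  note * = moments_standardized[OF M F r F_moment mean cov]
  show ?thesis
    using * r n by unfold_locales (simp_all add: gap_def integral_distr)
qed

theorem theorem4p13:
  fixes r :: nat and \<epsilon>\<^sub>0 :: real and D\<^sub>0 :: "(real^'n) set"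
  assumes "r \<ge> 2"
    and "\<epsilon>\<^sub>0 > 0" and "open D\<^sub>0" and "D\<^sub>0 \<noteq> {}"
  shows "\<exists>C>0. \<forall>(M :: 'w measure) (F :: 'w \<Rightarrow> real^'n) (X :: nat \<Rightarrow> 'w \<Rightarrow> real^'n).
    prob_space M \<longrightarrow>
    F \<in> borel_measurable M \<longrightarrow>
    integrable M (\<lambda>\<omega>. norm (F \<omega>) ^ (r + 1)) \<longrightarrow>
    (\<integral>\<omega>. F \<omega> \<partial>M) = 0 \<longrightarrow>
    covariance_matrix M F = mat 1 \<longrightarrow>
    minorized_by_Leb \<epsilon>\<^sub>0 D\<^sub>0 (distr M borel F) \<longrightarrow>
    prob_space.indep_vars M (\<lambda>_. borel) X {1..} \<longrightarrow>
    (\<forall>k\<ge>1. distr M borel (X k) = distr M borel F) \<longrightarrow>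
    (\<forall>n\<ge>1.
      tv_dist (integral\<^sup>L (distr M borel (normalized_sum X n)))
              (\<lambda>f. \<integral>x. f x * edgeworth_density (moment_gap M F) n r x \<partial>lborel)
      \<le> ereal (C * (1 + (\<integral>\<omega>. norm (F \<omega>) ^ (r + 1) \<partial>M)) ^ max (r div 3) 1
              * ((SUP \<alpha>\<in>{\<alpha>. length \<alpha> \<le> r}. \<bar>moment_gap M F \<alpha>\<bar>)
                    * (1 / real n powr (real (r div 3 + 1) / 2))
                 + 1 / real n powr (real (r - 1) / 2))))"
proof -
  obtain \<nu> :: "(real^'n) measure" and s I p where minorant:
    "\<And>\<mu>. prob_space \<mu> \<Longrightarrow> sets \<mu> = sets borel \<Longrightarrow> minorized_by_Leb \<epsilon>\<^sub>0 D\<^sub>0 \<mu> \<Longrightarrow> minorized_law \<mu> \<nu> s I p"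
    using exists_smooth_minorant[OF assms(2-4)] by metis
  define q where "q = r div 3"
  \<comment> \<open>Up to \<open>q * r\<close> derivatives are consumed by \<open>edge\<close>, and
    a replacement step asks for \<open>r + 3\<close> further ones.\<close>
  define L where "L = (q + 1) * r + 4"
  \<comment> \<open>Chosen before the law and \<open>n\<close> are introduced; it dominates the
    constants of both regimes whatever their signs, and \<open>rhs\<close> is nonnegative.\<close>
  define C where "C = 1 + \<bar>main_const TYPE('n) r q L p I\<bar> + \<bar>trivial_const TYPE('n) r L\<bar>"
  show ?thesis
  proof (intro exI[of _ C] conjI allI impI)
    show "0 < C" by (simp add: C_def)
    fix M :: "'w measure" and F :: "'w \<Rightarrow> real^'n" and X :: "nat \<Rightarrow> 'w \<Rightarrow> real^'n" and n :: nat
    assume M: "prob_space M" and F: "F \<in> borel_measurable M"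
      and moment: "integrable M (\<lambda>\<omega>. norm (F \<omega>) ^ (r + 1))"
      and mean: "(\<integral>\<omega>. F \<omega> \<partial>M) = 0" and cov: "covariance_matrix M F = mat 1"
      and minor: "minorized_by_Leb \<epsilon>\<^sub>0 D\<^sub>0 (distr M borel F)"
      and indep: "prob_space.indep_vars M (\<lambda>_. borel) X {1..}"
      and law: "\<forall>k\<ge>1. distr M borel (X k) = distr M borel F" and n: "1 \<le> n"
    define \<mu> where "\<mu> = distr M borel F"
    have "edgeworth_normalized \<mu> \<nu> s I p r q (1 / sqrt (real n)) n"
      unfolding \<mu>_def q_def using prob_space.prob_space_distr[OF M F] minor assms(1) n
      by (intro edgeworth_normalizedI[OF M F moment mean cov] minorant) auto
    then interpret edgeworth_normalized \<mu> \<nu> s I p r q "1 / sqrt (real n)" n .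
    have gap: "moment_gap M F = gap"
      unfolding moment_gap_def gap_def using F by (intro ext) (simp add: \<mu>_def integral_distr)
    have M_eq: "(\<integral>\<omega>. norm (F \<omega>) ^ (r + 1) \<partial>M) = edgeworth_normalized.M \<mu> r"
      unfolding M_def using F by (simp add: \<mu>_def integral_distr)
    show "tv_dist (integral\<^sup>L (distr M borel (normalized_sum X n)))
              (\<lambda>f. \<integral>x. f x * edgeworth_density (moment_gap M F) n r x \<partial>lborel)
      \<le> ereal (C * (1 + (\<integral>\<omega>. norm (F \<omega>) ^ (r + 1) \<partial>M)) ^ max (r div 3) 1
              * ((SUP \<alpha>\<in>{\<alpha>. length \<alpha> \<le> r}. \<bar>moment_gap M F \<alpha>\<bar>)
                    * (1 / real n powr (real (r div 3 + 1) / 2))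
                 + 1 / real n powr (real (r - 1) / 2)))"
      unfolding tv_dist_def inverse_powr_half[OF n] gap M_eq gap_sup_def[symmetric] q_def[symmetric] mult.assoc[of C]
    proof (rule SUP_least)
      fix f :: "real^'n \<Rightarrow> real" assume "f \<in> {f \<in> borel_measurable borel. \<forall>x. \<bar>f x\<bar> \<le> 1}"
      then have f: "bounded_borel 1 f" by (simp add: bounded_borel_def)
      have "\<bar>(P (1 / sqrt (real n)) ^^ n) f 0 - edgeworth_value gap n r (hermite_moment f)\<bar> \<le> C * rhs"
      proof (cases "2 * L \<le> n \<and> edgeworth_normalized.M \<mu> r \<le> sqrt (real n) ^ (r - 1)")
        case True
        then have "\<bar>(P (1 / sqrt (real n)) ^^ n) f 0 - edgeworth_value gap n r (hermite_moment f)\<bar>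
            \<le> main_const TYPE('n) r q L p I * rhs"
          by (intro main_regime[OF f L_def]) auto
        also have "\<dots> \<le> C * rhs" by (rule mult_right_mono[OF _ rhs_ge(3)]) (simp add: C_def)
        finally show ?thesis .
      next
        case False
        then have "\<bar>(P (1 / sqrt (real n)) ^^ n) f 0 - edgeworth_value gap n r (hermite_moment f)\<bar>
            \<le> trivial_const TYPE('n) r L * rhs"
          by (intro trivial_regime[OF f]) (auto simp: L_def)
        also have "\<dots> \<le> C * rhs" by (rule mult_right_mono[OF _ rhs_ge(3)]) (simp add: C_def)
        finally show ?thesis .
      qed
      moreover have "integral\<^sup>L (distr M borel (normalized_sum X n)) f = (P (1 / sqrt (real n)) ^^ n) f 0"
        using law by (intro normalized_sum_integral[OF M indep _ n f]) (simp add: \<mu>_def)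
      ultimately show "ereal \<bar>integral\<^sup>L (distr M borel (normalized_sum X n)) f
          - (\<integral>x. f x * edgeworth_density gap n r x \<partial>lborel)\<bar> \<le> ereal (C * rhs)"
        by (simp only: edgeworth_integral[OF f] ereal_less_eq)
    qed
  qed
qed

end
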